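(* Let $\mathcal{F}$ be a foliation of degree $5$ on $\mathbb{P}^2_{\mathbb{C}}$. The following assertions are equivalent: (1) $\mathcal{F}$ is linearly conjugated to the Hilbert modular foliation $\mathcal{F}_H^5$; (2) $\mathcal{F}$ is reduced convex and $\mathcal{CS}(\mathcal{F})=\{-\frac32+\frac{\sqrt5}{2},\,-\frac32-\frac{\sqrt5}{2}\}$; (3) $\mathcal{F}$ possesses three (distinct) radial singularities $m_1,m_2,m_3$ of order $3$ (necessarily non-aligned) and two radial singularities of order $1$ on each invariant line $(m_jm_l)$, $1\leq j<l\leq3$.
   Context: Foliations on $\mathbb{P}^2_{\mathbb{C}}$ are holomorphic, with isolated singularities. The degree of a foliation is the number of tangencies (with multiplicity) with a generic line. Linearly conjugated means conjugated by an element of $\mathrm{Aut}(\mathbb{P}^2_{\mathbb{C}})$. $(m_jm_l)$ denotes the line through $m_j$ and $m_l$; in (3), "necessarily non-aligned" means that three radial singularities of order $3$ of a degree $5$ foliation are automatically not collinear, and the lines $(m_jm_l)$ are automatically invariant. The Hilbert modular foliation $\mathcal{F}_H^5$ is the foliation of degree $5$ on $\mathbb{P}^2_{\mathbb{C}}$ defined in an affine chart by $$(y^2-1)(y^2-(\sqrt5-2)^2)(y+\sqrt5x)\,\mathrm{d}x-(x^2-1)(x^2-(\sqrt5-2)^2)(x+\sqrt5y)\,\mathrm{d}y.$$ Convexity: a foliation on $\mathbb{P}^2_{\mathbb{C}}$ is convex if its leaves other than straight lines have no inflection points. A foliation of degree $d\ge1$ has at most $3d$ distinct invariant lines, and if this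 bound is reached it is convex; a foliation of degree $d$ having exactly $3d$ distinct invariant lines is called reduced convex. Singularities: let $s$ be a singular point and $X$ a local vector field (with isolated zero) defining the foliation near $s$. The algebraic multiplicity $\nu(\mathcal{F},s)$ is the vanishing order of $X$ at $s$; the tangency order $\tau(\mathcal{F},s)$ of $\mathcal{F}$ with a generic line through $s$ is $\min\{k\ge\nu(\mathcal{F},s): \det(J^k_sX,R_s)\neq0\}$, where $J^k_sX$ is the $k$-jet of $X$ at $s$ in affine coordinates and $R_s$ is the radial vector field centered at $s$. The point $s$ is a radial singularity of order $k\ge1$ if $\nu(\mathcal{F},s)=1$ and $\tau(\mathcal{F},s)=k+1$. The point $s$ is non-degenerate if the linear part of $X$ at $s$ is invertible. If $\ell$ is an invariant line through $s$, choose local coordinates $(u,v)$ centered at $s$ with $\ell=\{v=0\}$ and write $X=P(u,v)\partial_u+vQ(u,v)\partial_v$; the Camacho–Sad index is $\mathrm{CS}(\mathcal{F},\ell,s)=\mathrm{Res}_{u=0}\frac{Q(u,0)}{P(u,0)}\,\mathrm{d}u$. $\mathcal{CS}(\mathcal{F})$ is the set of $\lambda\in\mathbb{C}\setminus\{0,1\}$ for which there is a line $\ell$ invariant by $\mathcal{F}$ and a non-degenerate singular point $s\in\ell$ of $\mathcal{F}$ such that $\mathrm{CS}(\mathcal{F},\ell,s)=\lambda$. *)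

theory Defs
  imports "HOL-Complex_Analysis.Complex_Analysis"
begin

no_notation fps_nth (infixl \<open>$\<close> 75)

section \<open>The projective plane\<close>

text \<open>Points and lines of the complex projective plane are the linear subspaces of \<open>\<complex>\<^sup>3\<close> of
  dimension 1 and 2; incidence is inclusion.\<close>

definition proj_point :: "(complex^3) set \<Rightarrow> bool" where
  "proj_point s \<longleftrightarrow> vec.subspace s \<and> vec.dim s = 1"

definition proj_line :: "(complex^3) set \<Rightarrow> bool" where
  "proj_line l \<longleftrightarrow> vec.subspace l \<and> vec.dim l = 2"

definition line_through :: "(complex^3) set \<Rightarrow> (complex^3) set \<Rightarrow> (complex^3) set" where
  "line_through p q = vec.span (p \<union> q)"

text \<open>The line with equation \<open>a\<^sub>1 x + a\<^sub>2 y + a\<^sub>3 z = 0\<close> (for \<open>a \<noteq> 0\<close>).\<close>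

definition line_of_equation :: "complex^3 \<Rightarrow> (complex^3) set" where
  "line_of_equation a = {v. scalar_product a v = 0}"

definition homogeneous_poly :: "nat \<Rightarrow> (complex^3 \<Rightarrow> complex) \<Rightarrow> bool" where
  "homogeneous_poly n f \<longleftrightarrow>
     (\<exists>c :: nat \<Rightarrow> nat \<Rightarrow> complex. \<forall>v.
        f v = (\<Sum>i\<le>n. \<Sum>j\<le>n - i. c i j * (v$1)^i * (v$2)^j * (v$3)^(n - i - j)))"

section \<open>Foliations\<close>

text \<open>A holomorphic foliation of the projective plane is given in homogeneous coordinates by a
  1-form \<open>A dx + B dy + C dz\<close> with homogeneous polynomial coefficients of the same degree that
  satisfies the Euler condition \<open>x A + y B + z C = 0\<close>, unique up to multiplication by a nonzero
  constant once its singularities are isolated.  We represent it by the coefficient map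
  \<open>F v = (A v, B v, C v)\<close>.  As the singular set is a closed analytic subset of a compact
  surface, its points are isolated iff it is finite.\<close>

definition singular_point :: "(complex^3 \<Rightarrow> complex^3) \<Rightarrow> (complex^3) set \<Rightarrow> bool" where
  "singular_point F s \<longleftrightarrow> proj_point s \<and> (\<forall>v\<in>s. F v = 0)"

definition foliation :: "(complex^3 \<Rightarrow> complex^3) \<Rightarrow> bool" where
  "foliation F \<longleftrightarrow>
     (\<exists>n\<ge>1. \<forall>i. homogeneous_poly n (\<lambda>v. F v $ i)) \<and>
     (\<forall>v. scalar_product (F v) v = 0) \<and>
     finite {s. singular_point F s}"

definition same_foliation :: "(complex^3 \<Rightarrow> complex^3) \<Rightarrow> (complex^3 \<Rightarrow> complex^3) \<Rightarrow> bool" where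
  "same_foliation F G \<longleftrightarrow> (\<exists>c. c \<noteq> 0 \<and> (\<forall>v. F v = c *s G v))"

text \<open>The pullback of the 1-form \<open>F\<close> by the linear map \<open>v \<mapsto> M v\<close>.\<close>

definition pullback :: "complex^3^3 \<Rightarrow> (complex^3 \<Rightarrow> complex^3) \<Rightarrow> complex^3 \<Rightarrow> complex^3" where
  "pullback M F v = F (M *v v) v* M"

definition linearly_conjugated ::
    "(complex^3 \<Rightarrow> complex^3) \<Rightarrow> (complex^3 \<Rightarrow> complex^3) \<Rightarrow> bool" where
  "linearly_conjugated F G \<longleftrightarrow> (\<exists>M. invertible M \<and> same_foliation (pullback M F) G)"

text \<open>The line \<open>l\<close> is invariant iff the 1-form restricts to zero on \<open>l\<close>, i.e. iff the tangent
  direction of the foliation at each of its nonsingular points on \<open>l\<close> is that of \<open>l\<close>.\<close>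

definition invariant_line :: "(complex^3 \<Rightarrow> complex^3) \<Rightarrow> (complex^3) set \<Rightarrow> bool" where
  "invariant_line F l \<longleftrightarrow> proj_line l \<and> (\<forall>v\<in>l. \<forall>w\<in>l. scalar_product (F v) w = 0)"

section \<open>Local vector fields\<close>

text \<open>An invertible matrix \<open>M\<close> gives affine coordinates \<open>(u, v)\<close>, the point with coordinates
  \<open>(u, v)\<close> being spanned by \<open>M (u, v, 1)\<close>.  They are centered at \<open>s\<close> if \<open>(0, 0)\<close> is \<open>s\<close>, and
  adapted to the line \<open>l\<close> if moreover \<open>l\<close> is \<open>{v = 0}\<close>.\<close>

definition centered_at :: "complex^3^3 \<Rightarrow> (complex^3) set \<Rightarrow> bool" where
  "centered_at M s \<longleftrightarrow> invertible M \<and> s = vec.span {M *v axis 3 1}"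

definition adapted_to :: "complex^3^3 \<Rightarrow> (complex^3) set \<Rightarrow> (complex^3) set \<Rightarrow> bool" where
  "adapted_to M s l \<longleftrightarrow> centered_at M s \<and> l = vec.span {M *v axis 1 1, M *v axis 3 1}"

text \<open>In these coordinates the foliation is defined by a 1-form \<open>a du + b dv\<close>, hence by the
  vector field \<open>b \<partial>\<^sub>u - a \<partial>\<^sub>v\<close>, which spans its kernel.\<close>

definition local_field ::
    "(complex^3 \<Rightarrow> complex^3) \<Rightarrow> complex^3^3 \<Rightarrow> complex^2 \<Rightarrow> complex^2" where
  "local_field F M w =
     (let \<omega> = pullback M F (vector [w$1, w$2, 1]) in vector [\<omega>$2, - \<omega>$1])"

text \<open>The homogeneous part of degree \<open>m\<close> of the Taylor expansion of \<open>X\<close> at the origin.\<close>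

definition taylor_part :: "(complex^2 \<Rightarrow> complex^2) \<Rightarrow> nat \<Rightarrow> complex^2 \<Rightarrow> complex^2" where
  "taylor_part X m w = (\<chi> i. (deriv ^^ m) (\<lambda>t. X (t *s w) $ i) 0 / fact m)"

definition jet :: "nat \<Rightarrow> (complex^2 \<Rightarrow> complex^2) \<Rightarrow> complex^2 \<Rightarrow> complex^2" where
  "jet k X w = (\<Sum>m\<le>k. taylor_part X m w)"

definition algebraic_multiplicity :: "(complex^2 \<Rightarrow> complex^2) \<Rightarrow> nat" where
  "algebraic_multiplicity X = (LEAST m. \<exists>w. taylor_part X m w \<noteq> 0)"

text \<open>The determinant of \<open>X\<close> and of the radial vector field \<open>u \<partial>\<^sub>u + v \<partial>\<^sub>v\<close>.\<close>

definition det_radial :: "(complex^2 \<Rightarrow> complex^2) \<Rightarrow> complex^2 \<Rightarrow> complex" where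
  "det_radial X w = X w $ 1 * w $ 2 - X w $ 2 * w $ 1"

definition tangency_order :: "(complex^2 \<Rightarrow> complex^2) \<Rightarrow> nat" where
  "tangency_order X =
     (LEAST k. k \<ge> algebraic_multiplicity X \<and> (\<exists>w. det_radial (jet k X) w \<noteq> 0))"

text \<open>The following notions do not depend on the choice of the coordinates \<open>M\<close>.\<close>

definition radial_singularity ::
    "(complex^3 \<Rightarrow> complex^3) \<Rightarrow> (complex^3) set \<Rightarrow> nat \<Rightarrow> bool" where
  "radial_singularity F s k \<longleftrightarrow> k \<ge> 1 \<and> singular_point F s \<and>
     (\<exists>M. centered_at M s \<and>
          algebraic_multiplicity (local_field F M) = 1 \<and>
          tangency_order (local_field F M) = k + 1)"

definition nondegenerate_singularity ::
    "(complex^3 \<Rightarrow> complex^3) \<Rightarrow> (complex^3) set \<Rightarrow> bool" where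
  "nondegenerate_singularity F s \<longleftrightarrow> singular_point F s \<and>
     (\<exists>M. centered_at M s \<and> bij (taylor_part (local_field F M) 1))"

text \<open>\<open>camacho_sad_index F l s c\<close> says that \<open>CS(F, l, s) = c\<close>.  In coordinates adapted to the
  invariant line \<open>l\<close> the field is \<open>P \<partial>\<^sub>u + v Q \<partial>\<^sub>v\<close>, and continuity determines \<open>Q\<close> on \<open>l\<close>.\<close>

definition camacho_sad_index ::
    "(complex^3 \<Rightarrow> complex^3) \<Rightarrow> (complex^3) set \<Rightarrow> (complex^3) set \<Rightarrow> complex \<Rightarrow> bool" where
  "camacho_sad_index F l s c \<longleftrightarrow>
     (\<exists>M P Q. adapted_to M s l \<and>
        (\<forall>w. local_field F M w = vector [P w, w$2 * Q w]) \<and> continuous_on UNIV Q \<and>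
        c = residue (\<lambda>u. Q (vector [u, 0]) / P (vector [u, 0])) 0)"

definition CS_set :: "(complex^3 \<Rightarrow> complex^3) \<Rightarrow> complex set" where
  "CS_set F = {c. c \<noteq> 0 \<and> c \<noteq> 1 \<and>
     (\<exists>l s. invariant_line F l \<and> s \<subseteq> l \<and> nondegenerate_singularity F s \<and>
            camacho_sad_index F l s c)}"

section \<open>Degree and reduced convexity\<close>

text \<open>The multiplicity of the tangency of the foliation with a non-invariant line \<open>l\<close> at a
  point \<open>s\<close> of \<open>l\<close>: the order of contact of \<open>X(v) = 0\<close> with \<open>l = {v = 0}\<close>.\<close>

definition line_tangency ::
    "(complex^3 \<Rightarrow> complex^3) \<Rightarrow> (complex^3) set \<Rightarrow> (complex^3) set \<Rightarrow> nat" where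
  "line_tangency F l s =
     (let M = (SOME M. adapted_to M s l)
      in nat (zorder (\<lambda>u. local_field F M (vector [u, 0]) $ 2) 0))"

text \<open>Generic means: outside of a proper algebraic subset \<open>{G = 0}\<close> of the dual plane.\<close>

definition has_degree :: "(complex^3 \<Rightarrow> complex^3) \<Rightarrow> nat \<Rightarrow> bool" where
  "has_degree F d \<longleftrightarrow>
     (\<exists>n G. homogeneous_poly n G \<and> (\<exists>a. G a \<noteq> 0) \<and>
        (\<forall>a. a \<noteq> 0 \<and> G a \<noteq> 0 \<longrightarrow>
           (let l = line_of_equation a;
                T = {s. proj_point s \<and> s \<subseteq> l \<and> line_tangency F l s > 0}
            in \<not> invariant_line F l \<and> finite T \<and> (\<Sum>s\<in>T. line_tangency F l s) = d)))"

definition reduced_convex :: "(complex^3 \<Rightarrow> complex^3) \<Rightarrow> bool" where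
  "reduced_convex F \<longleftrightarrow> (\<exists>d\<ge>1. has_degree F d \<and> card {l. invariant_line F l} = 3 * d)"

section \<open>The Hilbert modular foliation\<close>

definition hilbert_modular5 :: "complex^3 \<Rightarrow> complex^3" where
  "hilbert_modular5 v =
     (let x = v$1; y = v$2; z = v$3; r = complex_of_real (sqrt 5);
          P = (y^2 - z^2) * (y^2 - (r - 2)^2 * z^2) * (y + r * x);
          Q = (x^2 - z^2) * (x^2 - (r - 2)^2 * z^2) * (x + r * y)
      in vector [z * P, - (z * Q), y * Q - x * P])"

text \<open>Its restriction to the affine chart \<open>z = 1\<close> is the usual affine 1-form.\<close>

lemma hilbert_modular5_affine:
  fixes x y :: complex
  defines "r \<equiv> complex_of_real (sqrt 5)"
  defines "\<omega> \<equiv> hilbert_modular5 (vector [x, y, 1])"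
  shows "\<omega>$1 = (y^2 - 1) * (y^2 - (r - 2)^2) * (y + r * x)"
    and "\<omega>$2 = - ((x^2 - 1) * (x^2 - (r - 2)^2) * (x + r * y))"
  unfolding r_def \<omega>_def hilbert_modular5_def Let_def vector_3 by simp_all

lemma hilbert_modular5_euler: "scalar_product (hilbert_modular5 v) v = 0"
  unfolding hilbert_modular5_def Let_def scalar_product_def sum_3 vector_3
  by (simp add: algebra_simps)

end

theory Submission
  imports Defs "HOL-Computational_Algebra.Fundamental_Theorem_Algebra"
begin

text \<open>The foliation is given by a homogeneous 1-form \<open>F\<close> with coefficients of degree 6. The Jacobian
  determinant of \<open>F\<close> has degree 15 and vanishes on every invariant line. If there are 15 such lines, it
  is the product of their equations; comparing orders at a singular point shows that a point of \<open>k + 2\<close>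
  invariant lines is a radial singularity of order \<open>k\<close> if \<open>k \<ge> 1\<close> and is non-degenerate if \<open>k = 0\<close>. The
  Camacho--Sad indices on a line add up to 1; with index 1 at radial singularities and the two prescribed
  values elsewhere, every line carries four radial and two other singularities, and double counting
  yields the three radial singularities of order 3.

  Conversely, three radial singularities of order 3 are not aligned and can be placed at the coordinate
  points. The order 1 singularities on the three sides then determine the form up to a diagonal change of
  coordinates and the choice of a square root of 5, and both choices are conjugate to the Hilbert modular
  foliation. For the normal form, the 15 lines are explicit and the indices at all singular points on
  them can be computed.\<close>

section \<open>Homogeneous polynomials\<close>

text \<open>Everything local is read off from one-variable polynomials
  \<open>F (p + t u) \<odot> a\<close> in \<open>t\<close>. The Euler condition ties them together:
  along a line through \<open>p\<close> the polar \<open>F v \<odot> p\<close> is \<open>- t\<close>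
  times \<open>F v \<odot> u\<close>. Hence one number per point, the order \<open>kap\<close> of
  its polar there, encodes the order of a radial singularity and bounds the number of invariant
  lines through the point. A priori the Jacobian determinant has order at least \<open>kap\<close>
  at a singular point; only when 15 lines exhaust its degree is there no room left, which excludes
  zero or degenerate linear parts. In (2) => (3), the irrationality of sqrt 5 acts through the index
  sum: if a and b points carry the two indices, then (a - b)^2 = 5 (a + b - 2)^2, whence a + b = 2.
  Five lines through a vertex is the only solution of N (N - 3 + N (7 - N)) = 60 with N between 4
  and 7. In (3) => (1), each side admits two root patterns, and closing up the triangle eliminates
  all combinations but one. The normal form is handled in Z[g] with g^2 + g = 1, where all its lines
  are defined.\<close>

lemma sum_single:
  assumes "finite A" "a \<in> A" "\<And>x. x \<in> A \<Longrightarrow> x \<noteq> a \<Longrightarrow> f x = 0"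
  shows "sum f A = f a"
  using assms by (simp add: sum.remove[of A a] sum.neutral)

lemma homogeneous_poly_monomial:
  assumes "i + j + k = n"
  shows "homogeneous_poly n (\<lambda>v. c * (v$1)^i * (v$2)^j * (v$3)^k)"
proof -
  have k: "k = n - i - j" "j \<le> n - i" "i \<le> n" using assms by auto
  have "c * (v$1)^i * (v$2)^j * (v$3)^k =
     (\<Sum>i'\<le>n. \<Sum>j'\<le>n-i'. (if i' = i \<and> j' = j then c else 0) *
        (v$1)^i' * (v$2)^j' * (v$3)^(n-i'-j'))" for v
    using k by (subst sum_single[of _ i], simp, simp, simp, subst sum_single[of _ j]) auto
  then show ?thesis unfolding homogeneous_poly_def by (intro exI allI)
qed

lemma homogeneous_poly_add:
  assumes "homogeneous_poly n f" "homogeneous_poly n g"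
  shows "homogeneous_poly n (\<lambda>v. f v + g v)"
proof -
  obtain c d where c: "\<And>v. f v = (\<Sum>i\<le>n. \<Sum>j\<le>n - i. c i j * (v$1)^i * (v$2)^j * (v$3)^(n - i - j))"
    and d: "\<And>v. g v = (\<Sum>i\<le>n. \<Sum>j\<le>n - i. d i j * (v$1)^i * (v$2)^j * (v$3)^(n - i - j))"
    using assms unfolding homogeneous_poly_def by blast
  show ?thesis unfolding homogeneous_poly_def
    by (rule exI[of _ "\<lambda>i j. c i j + d i j"]) (simp add: c d sum.distrib ring_distribs)
qed

lemma homogeneous_poly_0: "homogeneous_poly n (\<lambda>_. 0)"
  unfolding homogeneous_poly_def by (rule exI[of _ "\<lambda>_ _. 0"]) simp

lemma homogeneous_poly_sum:
  "finite A \<Longrightarrow> (\<And>a. a \<in> A \<Longrightarrow> homogeneous_poly n (f a)) \<Longrightarrow>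
    homogeneous_poly n (\<lambda>v. \<Sum>a\<in>A. f a v)"
  by (induction A rule: finite_induct) (auto simp: homogeneous_poly_0 intro: homogeneous_poly_add)

lemma homogeneous_poly_const: "homogeneous_poly 0 (\<lambda>_. c)"
  using homogeneous_poly_monomial[of 0 0 0 0 c] by simp

lemma homogeneous_poly_coord: "homogeneous_poly 1 (\<lambda>v. v$k)"
  using homogeneous_poly_monomial[of 1 0 0 1 1] homogeneous_poly_monomial[of 0 1 0 1 1]
    homogeneous_poly_monomial[of 0 0 1 1 1] exhaust_3[of k] by auto

lemma homogeneous_poly_mult:
  assumes "homogeneous_poly m f" "homogeneous_poly n g"
  shows "homogeneous_poly (m + n) (\<lambda>v. f v * g v)"
proof -
  obtain c d where c: "\<And>v. f v = (\<Sum>i\<le>m. \<Sum>j\<le>m - i. c i j * (v$1)^i * (v$2)^j * (v$3)^(m - i - j))"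
    and d: "\<And>v. g v = (\<Sum>i\<le>n. \<Sum>j\<le>n - i. d i j * (v$1)^i * (v$2)^j * (v$3)^(n - i - j))"
    using assms unfolding homogeneous_poly_def by blast
  have "(\<lambda>v. f v * g v) = (\<lambda>v. \<Sum>i\<le>m. \<Sum>i'\<le>n. \<Sum>j\<le>m-i. \<Sum>j'\<le>n-i'.
      (c i j * d i' j') * (v$1)^(i+i') * (v$2)^(j+j') * (v$3)^((m-i-j)+(n-i'-j')))"
    unfolding c d sum_product
    by (intro ext sum.cong refl) (simp only: power_add mult_ac)
  moreover have "homogeneous_poly (m + n) \<dots>"
    by (intro homogeneous_poly_sum homogeneous_poly_monomial) auto
  ultimately show ?thesis by simp
qed

lemma homogeneous_poly_power: "homogeneous_poly n f \<Longrightarrow> homogeneous_poly (n * k) (\<lambda>v. f v ^ k)"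
  by (induction k) (use homogeneous_poly_mult in \<open>auto simp: homogeneous_poly_const\<close>)

lemma homogeneous_poly_cmult: "homogeneous_poly n f \<Longrightarrow> homogeneous_poly n (\<lambda>v. c * f v)"
  using homogeneous_poly_mult[OF homogeneous_poly_const[of c]] by simp

lemma homogeneous_poly_cmult': "homogeneous_poly n f \<Longrightarrow> homogeneous_poly n (\<lambda>v. f v * c)"
  using homogeneous_poly_mult[OF _ homogeneous_poly_const[of c]] by simp

lemma homogeneous_poly_uminus: "homogeneous_poly n f \<Longrightarrow> homogeneous_poly n (\<lambda>v. - f v)"
  using homogeneous_poly_cmult[of n f "-1"] by simp

lemma homogeneous_poly_diff:
  "homogeneous_poly n f \<Longrightarrow> homogeneous_poly n g \<Longrightarrow> homogeneous_poly n (\<lambda>v. f v - g v)"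
  using homogeneous_poly_add[of n f "\<lambda>v. - g v"] homogeneous_poly_uminus by auto

text \<open>Lets later facts be proved by closure under sums and products instead of manipulating
  the double sum. The steps also provide homogeneity of both parts, because the rules for
  \<open>lpoly\<close> and \<open>ddir\<close> ask for it.\<close>

lemma homogeneous_poly_induct [consumes 1, case_names const coord add mult]:
  assumes "homogeneous_poly n f"
    and const: "\<And>c. P 0 (\<lambda>_. c)"
    and coord: "\<And>k. P 1 (\<lambda>v. v$k)"
    and add: "\<And>n f g. homogeneous_poly n f \<Longrightarrow> homogeneous_poly n g \<Longrightarrow> P n f \<Longrightarrow> P n g \<Longrightarrow> P n (\<lambda>v. f v + g v)"
    and mult: "\<And>m n f g. homogeneous_poly m f \<Longrightarrow> homogeneous_poly n g \<Longrightarrow> P m f \<Longrightarrow> P n g \<Longrightarrow> P (m+n) (\<lambda>v. f v * g v)"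
  shows "P n f"
proof -
  obtain c where c: "\<And>v. f v = (\<Sum>i\<le>n. \<Sum>j\<le>n - i. c i j * (v$1)^i * (v$2)^j * (v$3)^(n - i - j))"
    using assms(1) unfolding homogeneous_poly_def by blast
  have pow: "P k (\<lambda>v. (v$l)^k)" for k l
  proof (induction k)
    case (Suc k)
    have h: "homogeneous_poly k (\<lambda>v. (v$l)^k)"
      using homogeneous_poly_power[OF homogeneous_poly_coord, of k l] by simp
    show ?case using mult[OF homogeneous_poly_coord h coord Suc.IH] by simp
  qed (simp add: const)
  have hpow: "homogeneous_poly k (\<lambda>v. (v$l)^k)" for k l
    using homogeneous_poly_power[OF homogeneous_poly_coord, of k l] by simp
  have mono: "P (i + j + k) (\<lambda>v. a * (v$1)^i * (v$2)^j * (v$3)^k)" for i j k a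
  proof -
    have 1: "P (0 + i) (\<lambda>v. a * (v$1)^i)"
      by (rule mult[OF homogeneous_poly_const hpow const pow])
    have h1: "homogeneous_poly (0 + i) (\<lambda>v. a * (v$1)^i)"
      by (rule homogeneous_poly_mult[OF homogeneous_poly_const hpow])
    have 2: "P (0 + i + j) (\<lambda>v. a * (v$1)^i * (v$2)^j)"
      by (rule mult[OF h1 hpow 1 pow])
    have h2: "homogeneous_poly (0 + i + j) (\<lambda>v. a * (v$1)^i * (v$2)^j)"
      by (rule homogeneous_poly_mult[OF h1 hpow])
    show ?thesis using mult[OF h2 hpow 2 pow[of k 3]] by simp
  qed
  \<comment> \<open>Sums start from the zero function in degree \<open>n\<close>, whereas
    \<open>const\<close> gives it in degree 0 only; a monomial with coefficient 0 has the right
    degree.\<close>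
  have zero: "P n (\<lambda>_. 0)"
    using mono[of 0 0 n 0] by simp
  have sum: "P n (\<lambda>v. \<Sum>a\<in>A. h a v)"
    if "finite A" "\<And>a. a \<in> A \<Longrightarrow> P n (h a)" "\<And>a. a \<in> A \<Longrightarrow> homogeneous_poly n (h a)"
    for A :: "'b set" and h
    using that
    by (induction A rule: finite_induct) (auto simp: zero intro!: add homogeneous_poly_sum)
  have P1: "P n (\<lambda>v. c i j * (v$1)^i * (v$2)^j * (v$3)^(n - i - j))" if "i \<le> n" "j \<le> n - i" for i j
  proof -
    have e: "i + j + (n - i - j) = n" using that by auto
    show ?thesis using mono[of i j "n - i - j" "c i j", unfolded e] .
  qed
  have "P n (\<lambda>v. \<Sum>i\<le>n. \<Sum>j\<le>n - i. c i j * (v$1)^i * (v$2)^j * (v$3)^(n - i - j))"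
  proof (intro sum)
    fix i j assume "i \<in> {..n}" "j \<in> {..n-i}"
    then show "P n (\<lambda>v. c i j * (v$1)^i * (v$2)^j * (v$3)^(n - i - j))" using P1 by simp
  next
    fix i j assume "i \<in> {..n}" "j \<in> {..n-i}"
    then show "homogeneous_poly n (\<lambda>v. c i j * (v$1)^i * (v$2)^j * (v$3)^(n - i - j))"
      by (intro homogeneous_poly_monomial) auto
  next
    fix i assume "i \<in> {..n}"
    then show "homogeneous_poly n (\<lambda>v. \<Sum>j\<le>n - i. c i j * (v$1)^i * (v$2)^j * (v$3)^(n - i - j))"
      by (intro homogeneous_poly_sum homogeneous_poly_monomial) auto
  qed auto
  then show ?thesis using c by presburger
qed

lemma homogeneous_poly_scale: "homogeneous_poly n f \<Longrightarrow> f (c *s v) = c ^ n * f v"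
proof (induction rule: homogeneous_poly_induct)
  case (add n f g) then show ?case by (simp add: distrib_left)
next
  case (mult m n f g) then show ?case by (simp add: power_add)
qed auto

lemma homogeneous_poly_1_linear:
  assumes "homogeneous_poly 1 f"
  shows "f (a *s v + b *s w) = a * f v + b * f w"
proof -
  obtain c where c: "\<And>v. f v = (\<Sum>i\<le>1. \<Sum>j\<le>1 - i. c i j * (v$1)^i * (v$2)^j * (v$3)^(1 - i - j))"
    using assms unfolding homogeneous_poly_def by blast
  show ?thesis unfolding c by (simp add: algebra_simps)
qed

section \<open>Restriction to parametrised lines\<close>

text \<open>The coefficient of \<open>t ^ j\<close> is the part of degree \<open>j\<close>, as a
  function of the direction \<open>u\<close>, of the Taylor expansion of \<open>f\<close> at
  \<open>p\<close>. Local statements thus become statements on coefficients.\<close>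

definition lpoly :: "(complex^3 \<Rightarrow> complex) \<Rightarrow> complex^3 \<Rightarrow> complex^3 \<Rightarrow> complex poly" where
  "lpoly f p u = (THE q. \<forall>t. poly q t = f (p + t *s u))"

lemma lpoly_eqI: "(\<And>t. poly q t = f (p + t *s u)) \<Longrightarrow> lpoly f p u = q"
  unfolding lpoly_def by (rule the_equality) (auto simp flip: poly_eq_poly_eq_iff)

lemma coeff_mult_top:
  fixes p q :: "'a::comm_semiring_0 poly"
  assumes "degree p \<le> m" "degree q \<le> n"
  shows "coeff (p * q) (m + n) = coeff p m * coeff q n"
proof -
  have "coeff (p * q) (m + n) = (\<Sum>i\<le>m+n. coeff p i * coeff q (m + n - i))"
    by (rule coeff_mult)
  also have "\<dots> = (\<Sum>i\<le>m+n. if i = m then coeff p m * coeff q n else 0)"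
  proof (rule sum.cong)
    fix i assume "i \<in> {..m+n}"
    then consider "i = m" | "i < m" | "i > m" by linarith
    then show "coeff p i * coeff q (m + n - i) = (if i = m then coeff p m * coeff q n else 0)"
    proof cases
      case 2 then have "degree q < m + n - i" using assms by linarith
      then show ?thesis using 2 by (simp add: coeff_eq_0)
    next
      case 3 then have "degree p < i" using assms by linarith
      then show ?thesis using 3 by (simp add: coeff_eq_0)
    qed simp
  qed simp
  finally show ?thesis by simp
qed

text \<open>The polynomial is chosen for all directions at once, since the last clause treats each
  coefficient as a function of \<open>u\<close>. Coefficients of products are convolutions, so
  homogeneity in degree \<open>j\<close> survives multiplication.\<close>

lemma lpoly_aux:
  assumes "homogeneous_poly n f"
  shows "\<exists>q. \<forall>u. (\<forall>t. poly (q u) t = f (p + t *s u)) \<and> degree (q u) \<le> n \<and> coeff (q u) n = f u \<and>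
    (\<forall>j. homogeneous_poly j (\<lambda>u. coeff (q u) j))"
  using assms
proof (induction rule: homogeneous_poly_induct)
  case (const c)
  have "homogeneous_poly j (\<lambda>u. coeff [:c:] j)" for j
    by (cases j) (auto simp: homogeneous_poly_const homogeneous_poly_0)
  then show ?case by (intro exI[of _ "\<lambda>u. [:c:]"]) auto
next
  case (coord k)
  have "homogeneous_poly j (\<lambda>u. coeff [:p$k, u$k:] j)" for j
  proof -
    consider "j = 0" | "j = 1" | "j \<ge> 2" by linarith
    then show ?thesis
    proof cases
      case 3
      then obtain i where "j = Suc (Suc i)" by (metis add_2_eq_Suc le_Suc_ex)
      then show ?thesis by (simp add: homogeneous_poly_0)
    qed (use homogeneous_poly_coord in \<open>auto simp: homogeneous_poly_const\<close>)
  qed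
  then show ?case by (intro exI[of _ "\<lambda>u. [:p$k, u$k:]"]) (auto simp: mult.commute)
next
  case (add n f g)
  then obtain q r where "\<forall>u. (\<forall>t. poly (q u) t = f (p + t *s u)) \<and> degree (q u) \<le> n \<and> coeff (q u) n = f u \<and>
    (\<forall>j. homogeneous_poly j (\<lambda>u. coeff (q u) j))" "\<forall>u. (\<forall>t. poly (r u) t = g (p + t *s u)) \<and> degree (r u) \<le> n \<and> coeff (r u) n = g u \<and>
    (\<forall>j. homogeneous_poly j (\<lambda>u. coeff (r u) j))" by blast
  then show ?case
    by (intro exI[of _ "\<lambda>u. q u + r u"]) (auto intro: degree_add_le homogeneous_poly_add)
next
  case (mult m n f g)
  then obtain q r where q: "\<forall>u. (\<forall>t. poly (q u) t = f (p + t *s u)) \<and> degree (q u) \<le> m \<and> coeff (q u) m = f u \<and>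
    (\<forall>j. homogeneous_poly j (\<lambda>u. coeff (q u) j))" and r: "\<forall>u. (\<forall>t. poly (r u) t = g (p + t *s u)) \<and> degree (r u) \<le> n \<and> coeff (r u) n = g u \<and>
    (\<forall>j. homogeneous_poly j (\<lambda>u. coeff (r u) j))" by blast
  have h: "homogeneous_poly j (\<lambda>u. coeff (q u * r u) j)" for j
    unfolding coeff_mult
  proof (rule homogeneous_poly_sum)
    fix i assume "i \<in> {..j}"
    then have e: "i + (j - i) = j" by auto
    show "homogeneous_poly j (\<lambda>u. coeff (q u) i * coeff (r u) (j - i))"
      using homogeneous_poly_mult[of i "\<lambda>u. coeff (q u) i" "j - i" "\<lambda>u. coeff (r u) (j - i)"] q r
      unfolding e by blast
  qed simp
  have d: "degree (q u * r u) \<le> m + n" for u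
    using degree_mult_le[of "q u" "r u"] q r by (meson add_mono le_trans)
  show ?case
    by (rule exI[of _ "\<lambda>u. q u * r u"]) (use q r h d in \<open>auto simp: coeff_mult_top\<close>)
qed

lemma
  assumes "homogeneous_poly n f"
  shows poly_lpoly: "poly (lpoly f p u) t = f (p + t *s u)"
    and degree_lpoly: "degree (lpoly f p u) \<le> n"
    and coeff_lpoly_top: "coeff (lpoly f p u) n = f u"
    and homogeneous_poly_coeff_lpoly: "homogeneous_poly j (\<lambda>u. coeff (lpoly f p u) j)"
proof -
  obtain q where q: "\<forall>u. (\<forall>t. poly (q u) t = f (p + t *s u)) \<and> degree (q u) \<le> n \<and> coeff (q u) n = f u \<and>
    (\<forall>j. homogeneous_poly j (\<lambda>u. coeff (q u) j))"
    using lpoly_aux[OF assms] by blast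
  have e: "lpoly f p u = q u" for u
    by (rule lpoly_eqI) (use q in auto)
  show "poly (lpoly f p u) t = f (p + t *s u)" "degree (lpoly f p u) \<le> n"
    "coeff (lpoly f p u) n = f u" "homogeneous_poly j (\<lambda>u. coeff (lpoly f p u) j)"
    using q by (auto simp: e)
qed

lemma coeff_lpoly_0: "homogeneous_poly n f \<Longrightarrow> coeff (lpoly f p u) 0 = f p"
  using poly_lpoly[of n f p u 0] by (simp add: poly_0_coeff_0)

lemma lpoly_add:
  "homogeneous_poly m f \<Longrightarrow> homogeneous_poly n g \<Longrightarrow> lpoly (\<lambda>v. f v + g v) p u = lpoly f p u + lpoly g p u"
  by (rule lpoly_eqI) (simp add: poly_lpoly)

lemma lpoly_mult:
  "homogeneous_poly m f \<Longrightarrow> homogeneous_poly n g \<Longrightarrow> lpoly (\<lambda>v. f v * g v) p u = lpoly f p u * lpoly g p u"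
  by (rule lpoly_eqI) (simp add: poly_lpoly)

lemma lpoly_const: "lpoly (\<lambda>_. c) p u = [:c:]"
  by (rule lpoly_eqI) simp

lemma lpoly_coord: "lpoly (\<lambda>v. v$k) p u = [:p$k, u$k:]"
  by (rule lpoly_eqI) (simp add: mult.commute)

lemma poly_eq_0_on_line:
  assumes "homogeneous_poly n f" "lpoly f p u = 0"
  shows "f (p + t *s u) = 0"
  using poly_lpoly[OF assms(1), of p u t] assms(2) by simp

lemma higher_deriv_poly: "(deriv ^^ m) (poly q) = poly ((pderiv ^^ m) (q :: complex poly))"
proof (induction m)
  case (Suc m)
  have "deriv (poly ((pderiv ^^ m) q)) = poly ((pderiv ^^ Suc m) q)"
    by (rule ext) (auto intro!: DERIV_imp_deriv poly_DERIV)
  then show ?case using Suc.IH by simp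
qed simp

text \<open>Turns the iterated derivatives in \<open>taylor_part\<close> into coefficients of
  restrictions to lines.\<close>

lemma higher_deriv_poly_0: "(deriv ^^ m) (poly q) 0 / fact m = coeff (q :: complex poly) m"
  by (simp add: higher_deriv_poly poly_0_coeff_0 coeff_higher_pderiv pochhammer_fact[symmetric])

text \<open>Join a point that suits the earlier functions to one that suits the new function. On
  this line each function is a nonzero polynomial, so only finitely many parameters are bad.\<close>

lemma common_nonzero:
  assumes "finite A" "\<And>f. f \<in> A \<Longrightarrow> \<exists>n. homogeneous_poly n f" "\<And>f. f \<in> A \<Longrightarrow> \<exists>v. f v \<noteq> 0"
  shows "\<exists>v. \<forall>f\<in>A. f v \<noteq> 0"
  using assms
proof (induction A rule: finite_induct)
  case (insert g A)
  obtain v where v: "\<forall>f\<in>A. f v \<noteq> 0" using insert.IH insert.prems by (metis insertI2)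
  obtain w where w: "g w \<noteq> 0" using insert.prems by blast
  have deg: "\<exists>n. homogeneous_poly n f" if "f \<in> insert g A" for f using insert.prems(1)[OF that] .
  have nz: "lpoly f v (w - v) \<noteq> 0" if f: "f \<in> insert g A" for f
  proof -
    obtain n where n: "homogeneous_poly n f" using deg[OF f] by (elim exE)
    have "poly (lpoly f v (w - v)) 0 = f v" "poly (lpoly f v (w - v)) 1 = f w"
      by (simp_all add: poly_lpoly[OF n])
    moreover have "f v \<noteq> 0 \<or> f w \<noteq> 0" using f v w by auto
    ultimately show ?thesis by auto
  qed
  have "finite (\<Union>f\<in>insert g A. {t. poly (lpoly f v (w - v)) t = 0})"
    using insert.hyps nz by (intro finite_UN_I) (auto intro: poly_roots_finite)
  then obtain t where t: "t \<notin> (\<Union>f\<in>insert g A. {t. poly (lpoly f v (w - v)) t = 0})"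
    using ex_new_if_finite infinite_UNIV_char_0 by blast
  have "f (v + t *s (w - v)) \<noteq> 0" if f: "f \<in> insert g A" for f
  proof -
    obtain n where n: "homogeneous_poly n f" using deg[OF f] by (elim exE)
    have "poly (lpoly f v (w - v)) t \<noteq> 0" using t f by auto
    then show ?thesis using poly_lpoly[OF n, of v "w - v" t] by simp
  qed
  then show ?case by blast
qed auto

section \<open>Directional derivatives\<close>

definition ddir :: "(complex^3 \<Rightarrow> complex) \<Rightarrow> complex^3 \<Rightarrow> complex^3 \<Rightarrow> complex" where
  "ddir f w v = coeff (lpoly f v w) 1"

lemma ddir_const: "ddir (\<lambda>_. c) w v = 0"
  by (simp add: ddir_def lpoly_const)

lemma ddir_coord: "ddir (\<lambda>v. v$k) w v = w$k"
  by (simp add: ddir_def lpoly_coord)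

lemma ddir_add:
  "homogeneous_poly m f \<Longrightarrow> homogeneous_poly n g \<Longrightarrow> ddir (\<lambda>v. f v + g v) w v = ddir f w v + ddir g w v"
  by (simp add: ddir_def lpoly_add)

lemma ddir_mult:
  assumes "homogeneous_poly m f" "homogeneous_poly n g"
  shows "ddir (\<lambda>v. f v * g v) w v = f v * ddir g w v + ddir f w v * g v"
  using assms by (simp add: ddir_def lpoly_mult coeff_mult coeff_lpoly_0)

text \<open>The clause for \<open>n = 0\<close> deals with truncated subtraction: in the product
  rule a factor of degree 0 contributes the zero function, which is homogeneous of every
  degree.\<close>

lemma homogeneous_poly_ddir_aux:
  assumes "homogeneous_poly n f"
  shows "homogeneous_poly (n - 1) (ddir f w) \<and> (n = 0 \<longrightarrow> ddir f w = (\<lambda>_. 0))"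
  using assms
proof (induction rule: homogeneous_poly_induct)
  case (const c)
  then show ?case using homogeneous_poly_0 by (simp add: ddir_const[abs_def])
next
  case (coord k)
  then show ?case using homogeneous_poly_const by (simp add: ddir_coord[abs_def])
next
  case (add n f g)
  have "ddir (\<lambda>v. f v + g v) w = (\<lambda>v. ddir f w v + ddir g w v)"
    using add by (auto simp: ddir_add)
  then show ?case using add by (auto intro: homogeneous_poly_add)
next
  case (mult m n f g)
  have e: "ddir (\<lambda>v. f v * g v) w = (\<lambda>v. f v * ddir g w v + ddir f w v * g v)"
    using mult by (auto simp: ddir_mult)
  have 1: "homogeneous_poly (m + n - 1) (\<lambda>v. f v * ddir g w v)"
    using homogeneous_poly_mult[of m f "n - 1" "ddir g w"] mult homogeneous_poly_0 by (cases n) auto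
  have 2: "homogeneous_poly (m + n - 1) (\<lambda>v. ddir f w v * g v)"
    using homogeneous_poly_mult[of "m - 1" "ddir f w" n g] mult homogeneous_poly_0 by (cases m) auto
  show ?case unfolding e using homogeneous_poly_add[OF 1 2] mult by auto
qed

lemma homogeneous_poly_ddir: "homogeneous_poly n f \<Longrightarrow> homogeneous_poly (n - 1) (ddir f w)"
  using homogeneous_poly_ddir_aux by blast

lemma ddir_linear:
  "homogeneous_poly n f \<Longrightarrow> ddir f (a *s w + b *s w') v = a * ddir f w v + b * ddir f w' v"
  unfolding ddir_def by (rule homogeneous_poly_1_linear, rule homogeneous_poly_coeff_lpoly)

text \<open>Along its own ray \<open>f\<close> is multiplied by \<open>(1 + t) ^ n\<close>, whose
  linear coefficient is \<open>n\<close>.\<close>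

lemma ddir_euler:
  assumes "homogeneous_poly n f"
  shows "ddir f v v = of_nat n * f v"
proof -
  have "lpoly f v v = smult (f v) ([:1, 1:] ^ n)"
  proof (rule lpoly_eqI)
    fix t
    have e: "v + t *s v = (1 + t) *s v" by (simp add: vec_eq_iff algebra_simps)
    show "poly (smult (f v) ([:1, 1:] ^ n)) t = f (v + t *s v)"
      unfolding e homogeneous_poly_scale[OF assms] by simp
  qed
  moreover have "coeff ([:1, 1:] ^ n) 1 = (of_nat n :: complex)"
    by (cases n) (simp_all add: coeff_linear_poly_power del: power_Suc)
  ultimately show ?thesis by (simp add: ddir_def)
qed

text \<open>Moving the base point along the line is composition with
  \<open>[:t, 1:]\<close>.\<close>

lemma poly_pderiv_lpoly:
  assumes "homogeneous_poly n f"
  shows "poly (pderiv (lpoly f p u)) t = ddir f u (p + t *s u)"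
proof -
  have "lpoly f (p + t *s u) u = pcompose (lpoly f p u) [:t, 1:]"
    by (rule lpoly_eqI) (simp add: poly_pcompose poly_lpoly[OF assms] algebra_simps)
  moreover have "coeff (pcompose q [:t, 1:]) 1 = poly (pderiv q) t" for q :: "complex poly"
  proof -
    have "coeff (pcompose q [:t, 1:]) 1 = poly (pderiv (pcompose q [:t, 1:])) 0"
      by (simp add: poly_0_coeff_0 coeff_pderiv)
    then show ?thesis by (simp add: pderiv_pcompose poly_pcompose pderiv_pCons)
  qed
  ultimately show ?thesis by (simp add: ddir_def)
qed

section \<open>Linear algebra in dimension three\<close>

notation scalar_product (infixl "\<odot>" 70)

lemma dot_3: "a \<odot> b = a$1 * b$1 + a$2 * b$2 + a$3 * b$3" for a b :: "'a::semiring_1 ^ 3"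
  by (simp add: scalar_product_def sum_3)

lemma dot_algebra [simp]:
  fixes a b c :: "complex^3"
  shows "(a + b) \<odot> c = a \<odot> c + b \<odot> c" "c \<odot> (a + b) = c \<odot> a + c \<odot> b"
    "(a - b) \<odot> c = a \<odot> c - b \<odot> c" "c \<odot> (a - b) = c \<odot> a - c \<odot> b"
    "(x *s a) \<odot> b = x * (a \<odot> b)" "a \<odot> (x *s b) = x * (a \<odot> b)"
    "(0::complex^3) \<odot> a = 0" "a \<odot> 0 = 0" "(- a) \<odot> b = - (a \<odot> b)" "a \<odot> (- b) = - (a \<odot> b)"
  by (simp_all add: dot_3 algebra_simps)

lemma dot_commute: "a \<odot> b = b \<odot> a" for a b :: "complex^3"
  by (simp add: dot_3 mult.commute)

lemma dot_axis [simp]: "a \<odot> axis k 1 = a$k" "axis k 1 \<odot> a = a$k" for a :: "complex^3"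
  using exhaust_3[of k] by (auto simp: dot_3 axis_def)

lemma vec3_eq_iff: "v = w \<longleftrightarrow> v$1 = w$1 \<and> v$2 = w$2 \<and> v$3 = w$3" for v w :: "'a^3"
  by (simp add: vec_eq_iff forall_3)

definition ccross :: "complex^3 \<Rightarrow> complex^3 \<Rightarrow> complex^3" where
  "ccross a b = vector [a$2 * b$3 - a$3 * b$2, a$3 * b$1 - a$1 * b$3, a$1 * b$2 - a$2 * b$1]"

definition det3 :: "complex^3 \<Rightarrow> complex^3 \<Rightarrow> complex^3 \<Rightarrow> complex" where
  "det3 a b c = a \<odot> ccross b c"

lemma ccross_nth [simp]:
  "ccross a b $ 1 = a$2 * b$3 - a$3 * b$2" "ccross a b $ 2 = a$3 * b$1 - a$1 * b$3"
  "ccross a b $ 3 = a$1 * b$2 - a$2 * b$1"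
  by (simp_all add: ccross_def)

lemma det3_eq: "det3 a b c = a$1 * (b$2 * c$3 - b$3 * c$2) + a$2 * (b$3 * c$1 - b$1 * c$3)
    + a$3 * (b$1 * c$2 - b$2 * c$1)"
  by (simp add: det3_def dot_3)

lemma det3_algebra [simp]:
  "det3 (a + a') b c = det3 a b c + det3 a' b c" "det3 a (b + b') c = det3 a b c + det3 a b' c"
  "det3 a b (c + c') = det3 a b c + det3 a b c'"
  "det3 (x *s a) b c = x * det3 a b c" "det3 a (x *s b) c = x * det3 a b c" "det3 a b (x *s c) = x * det3 a b c"
  "det3 a a c = 0" "det3 a b a = 0" "det3 a b b = 0"
  "det3 0 b c = 0" "det3 a 0 c = 0" "det3 a b 0 = 0"
  by (simp_all add: det3_eq algebra_simps)

lemma det3_rotate: "det3 a b c = det3 b c a"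
  by (simp add: det3_eq algebra_simps)

lemma det3_swap: "det3 a b c = - det3 a c b" "det3 a b c = - det3 b a c"
  by (simp_all add: det3_eq algebra_simps)

lemma det3_cramer: "det3 b p e *s v = det3 v p e *s b + det3 b v e *s p + det3 b p v *s e"
  by (simp add: vec3_eq_iff det3_eq algebra_simps)

lemma det3_basis:
  assumes "det3 a b c \<noteq> 0"
  obtains x y z where "v = x *s a + y *s b + z *s c"
proof -
  let ?d = "det3 a b c"
  have "v = (1 / ?d) *s (?d *s v)" using assms by (simp add: vector_smult_assoc)
  also have "\<dots> = (det3 v b c / ?d) *s a + (det3 a v c / ?d) *s b + (det3 a b v / ?d) *s c"
    unfolding det3_cramer[of a b c v] by (simp add: vec.scale_right_distrib vector_smult_assoc)
  finally show ?thesis by (rule that)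
qed

lemma det3_dot_eq_0:
  assumes "det3 a b c \<noteq> 0" "w \<odot> a = 0" "w \<odot> b = 0" "w \<odot> c = 0"
  shows "w = 0"
proof -
  have "w \<odot> v = 0" for v
    by (rule det3_basis[OF assms(1), of v]) (simp add: assms)
  from this[of "axis _ 1"] show ?thesis by (simp add: vec_eq_iff)
qed

lemma ccross_eq_0_right: "ccross b p = 0 \<Longrightarrow> p \<noteq> 0 \<Longrightarrow> \<exists>c. b = c *s p"
proof -
  assume "ccross b p = 0" "p \<noteq> 0"
  then have e: "b$2 * p$3 = b$3 * p$2" "b$3 * p$1 = b$1 * p$3" "b$1 * p$2 = b$2 * p$1"
    by (simp_all add: vec3_eq_iff)
  from \<open>p \<noteq> 0\<close> consider "p$1 \<noteq> 0" | "p$2 \<noteq> 0" | "p$3 \<noteq> 0" by (auto simp: vec3_eq_iff)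
  then show ?thesis
  proof cases
    case 1 then show ?thesis using e by (intro exI[of _ "b$1 / p$1"]) (auto simp: vec3_eq_iff field_simps)
  next
    case 2 then show ?thesis using e by (intro exI[of _ "b$2 / p$2"]) (auto simp: vec3_eq_iff field_simps)
  next
    case 3 then show ?thesis using e by (intro exI[of _ "b$3 / p$3"]) (auto simp: vec3_eq_iff field_simps)
  qed
qed

lemma ccross_simps [simp]: "ccross (x *s p) p = 0" "ccross p (x *s p) = 0" "ccross p p = 0" "ccross 0 p = 0" "ccross p 0 = 0"
  by (simp_all add: vec3_eq_iff)

lemma ccross_antisym: "ccross a b = - ccross b a"
  by (simp add: vec3_eq_iff)

lemma ccross_nonzeroD: "ccross b p \<noteq> 0 \<Longrightarrow> b \<noteq> 0 \<and> p \<noteq> 0"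
  by auto

lemma dot_nondegenerate: "n \<noteq> 0 \<Longrightarrow> \<exists>e. e \<odot> n \<noteq> 0" for n :: "complex^3"
  by (metis det3_algebra(10) det3_dot_eq_0 dot_axis(2) vec3_eq_iff zero_index)

lemma complete_basis:
  assumes "ccross b p \<noteq> 0"
  obtains e where "det3 e b p \<noteq> 0"
  using dot_nondegenerate[OF assms] by (auto simp: det3_def)

lemma complete_basis1:
  assumes "p \<noteq> 0"
  obtains a b where "det3 a b p \<noteq> 0"
proof -
  obtain e where e: "e \<odot> p \<noteq> 0" using dot_nondegenerate[OF assms] by blast
  have "\<exists>b. ccross b p \<noteq> 0"
  proof (rule ccontr)
    assume "\<not> (\<exists>b. ccross b p \<noteq> 0)"
    then have "ccross (axis 1 1) p = 0" "ccross (axis 2 1) p = 0" "ccross (axis 3 1) p = 0" by blast+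
    then show False using assms by (auto simp: vec3_eq_iff axis_def)
  qed
  then show ?thesis using complete_basis that by metis
qed

lemma span1: "vec.span {p :: complex^3} = range (\<lambda>c. c *s p)"
  by (rule vec.span_singleton)

lemma in_span1: "v \<in> vec.span {p :: complex^3} \<longleftrightarrow> (\<exists>c. v = c *s p)"
  by (auto simp: span1)

lemma in_span2: "v \<in> vec.span {b, p :: complex^3} \<longleftrightarrow> (\<exists>x y. v = x *s b + y *s p)"
  by (auto simp: vec.span_insert[of b] in_span1) (metis add.commute diff_add_cancel, metis add_diff_cancel_left')

lemma in_span2_det3:
  assumes "ccross b p \<noteq> 0"
  shows "v \<in> vec.span {b, p} \<longleftrightarrow> det3 v b p = 0"
proof
  assume "v \<in> vec.span {b, p}"
  then show "det3 v b p = 0" by (auto simp: in_span2)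
next
  assume v: "det3 v b p = 0"
  obtain e where e: "det3 e b p \<noteq> 0" using complete_basis[OF assms] .
  obtain x y z where xyz: "v = x *s e + y *s b + z *s p" using det3_basis[OF e] .
  then have "x = 0" using v e by simp
  then show "v \<in> vec.span {b, p}" using xyz by (auto simp: in_span2)
qed

lemma proj_point_span: "p \<noteq> 0 \<Longrightarrow> proj_point (vec.span {p})"
  by (simp add: proj_point_def)

lemma proj_pointE:
  assumes "proj_point s"
  obtains p where "p \<noteq> 0" "s = vec.span {p}"
proof -
  have "vec.subspace s" "vec.dim s = 1" using assms by (auto simp: proj_point_def)
  obtain B where B: "B \<subseteq> s" "vec.independent B" "s \<subseteq> vec.span B" "card B = vec.dim s"
    using vec.basis_exists by blast
  then obtain p where p: "B = {p}" using \<open>vec.dim s = 1\<close> by (metis card_1_singletonE)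
  have "p \<noteq> 0" using B(2) p vec.dependent_zero by blast
  moreover have "s = vec.span {p}"
    using B p \<open>vec.subspace s\<close> by (metis subset_antisym vec.span_minimal)
  ultimately show ?thesis by (rule that)
qed

lemma span1_eq_iff:
  assumes "p \<noteq> 0" "q \<noteq> 0"
  shows "vec.span {p} = vec.span {q :: complex^3} \<longleftrightarrow> ccross p q = 0"
proof
  assume "vec.span {p} = vec.span {q}"
  then have "p \<in> vec.span {q}" using vec.span_base by blast
  then show "ccross p q = 0" by (auto simp: in_span1)
next
  assume "ccross p q = 0"
  then obtain c where c: "p = c *s q" using ccross_eq_0_right assms by blast
  then have "c \<noteq> 0" using assms by auto
  have "vec.span {c *s q} \<subseteq> vec.span {q}" by (auto simp: in_span1 vector_smult_assoc)
  moreover have "q = (1 / c) *s (c *s q)" using \<open>c \<noteq> 0\<close> by (simp add: vector_smult_assoc)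
  then have "vec.span {q} \<subseteq> vec.span {c *s q}" by (metis in_span1 insert_subset empty_subsetI vec.span_minimal vec.subspace_span)
  ultimately show "vec.span {p} = vec.span {q}" using c by blast
qed

lemma span1_smult: "c \<noteq> 0 \<Longrightarrow> p \<noteq> 0 \<Longrightarrow> vec.span {c *s p} = vec.span {p :: complex^3}"
  by (subst span1_eq_iff) auto

lemma span1_subset: "vec.span {p} \<subseteq> vec.span S \<longleftrightarrow> p \<in> vec.span (S :: (complex^3) set)"
proof
  assume "vec.span {p} \<subseteq> vec.span S"
  then show "p \<in> vec.span S" using vec.span_base[of p "{p}"] by blast
next
  assume "p \<in> vec.span S"
  then show "vec.span {p} \<subseteq> vec.span S" by (intro vec.span_minimal) auto
qed

lemma proj_line_span:
  assumes "ccross b p \<noteq> 0"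
  shows "proj_line (vec.span {b, p})"
proof -
  have "b \<noteq> p" using assms by auto
  have "b \<notin> vec.span {p}" using assms by (auto simp: in_span1)
  moreover have "vec.independent {p}" using ccross_nonzeroD[OF assms] by simp
  ultimately have "vec.independent {b, p}" by (simp add: vec.independent_insertI)
  then show ?thesis using \<open>b \<noteq> p\<close> by (simp add: proj_line_def vec.dim_eq_card_independent)
qed

lemma proj_lineE:
  assumes "proj_line l"
  obtains b p where "ccross b p \<noteq> 0" "l = vec.span {b, p}"
proof -
  have l: "vec.subspace l" "vec.dim l = 2" using assms by (auto simp: proj_line_def)
  obtain B where B: "B \<subseteq> l" "vec.independent B" "l \<subseteq> vec.span B" "card B = vec.dim l"
    using vec.basis_exists by blast
  then obtain b p where bp: "B = {b, p}" "b \<noteq> p" using l by (metis card_2_iff)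
  have "ccross b p \<noteq> 0"
  proof
    assume "ccross b p = 0"
    moreover have "p \<noteq> 0" using B(2) bp vec.dependent_zero by blast
    ultimately have "b \<in> vec.span {p}" using ccross_eq_0_right by (auto simp: in_span1)
    then show False using B(2) bp by (metis insert_Diff_if insert_absorb singletonI vec.dependent_def insertCI singletonD insert_Diff_single Diff_insert_absorb empty_iff)
  qed
  moreover have "l = vec.span {b, p}"
    using B bp l by (metis subset_antisym vec.span_minimal)
  ultimately show ?thesis by (rule that)
qed

lemma span2_eqI:
  assumes "ccross b p \<noteq> 0" "ccross b' p' \<noteq> 0" "b' \<in> vec.span {b, p}" "p' \<in> vec.span {b, p}"
  shows "vec.span {b', p'} = vec.span {b, p :: complex^3}"
proof (rule vec.subspace_dim_equal)
  show "vec.span {b', p'} \<subseteq> vec.span {b, p}"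
    using assms by (simp add: vec.span_minimal)
  show "vec.dim (vec.span {b, p}) \<le> vec.dim (vec.span {b', p'})"
    using proj_line_span[OF assms(1)] proj_line_span[OF assms(2)] by (simp add: proj_line_def)
qed auto

lemma span2_commute: "vec.span {b, p} = vec.span {p, b :: complex^3}"
  by (simp add: insert_commute)

lemma proj_line_through:
  assumes "proj_line l" "p \<in> l" "q \<in> l" "ccross p q \<noteq> 0"
  shows "l = vec.span {p, q}"
proof -
  obtain a b where "ccross a b \<noteq> 0" "l = vec.span {a, b}" using proj_lineE[OF assms(1)] .
  then show ?thesis using span2_eqI[of a b p q] assms by simp
qed

lemma proj_lineE1:
  assumes "proj_line l" "p \<in> l" "p \<noteq> 0"
  obtains b where "ccross b p \<noteq> 0" "l = vec.span {b, p}"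
proof -
  obtain a c where ac: "ccross a c \<noteq> 0" "l = vec.span {a, c}" using proj_lineE[OF assms(1)] .
  have ac_in: "a \<in> l" "c \<in> l" using ac by (auto intro: vec.span_base)
  have "ccross a p \<noteq> 0 \<or> ccross c p \<noteq> 0"
  proof (rule ccontr)
    assume "\<not> ?thesis"
    then obtain x y where "a = x *s p" "c = y *s p" using ccross_eq_0_right assms by meson
    then show False using ac(1) by (simp add: vec3_eq_iff)
  qed
  then show ?thesis using that proj_line_through[OF assms(1) _ assms(2)] ac_in by blast
qed

lemma proj_line_subset_eq:
  assumes "proj_line l" "proj_line l'" "p \<in> l" "q \<in> l" "p \<in> l'" "q \<in> l'" "ccross p q \<noteq> 0"
  shows "l = l'"
  using assms proj_line_through by metis

lemma line_through_span: "line_through (vec.span {p}) (vec.span {q}) = vec.span {p, q}"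
proof -
  have "vec.span (vec.span {p} \<union> vec.span {q}) \<subseteq> vec.span {p, q}"
    by (intro vec.span_minimal Un_least vec.span_mono) auto
  moreover have "vec.span {p, q} \<subseteq> vec.span (vec.span {p} \<union> vec.span {q})"
    by (intro vec.span_mono) (auto intro: vec.span_base)
  ultimately show ?thesis unfolding line_through_def by blast
qed

lemma proj_line_normal:
  assumes "proj_line l"
  obtains a where "a \<noteq> 0" "l = {v. a \<odot> v = 0}"
proof -
  obtain b p where bp: "ccross b p \<noteq> 0" "l = vec.span {b, p}" using proj_lineE[OF assms] .
  have "l = {v. ccross b p \<odot> v = 0}"
    using in_span2_det3[OF bp(1)] bp(2) by (auto simp: det3_def dot_commute)
  with bp(1) show ?thesis by (rule that)
qed

text \<open>If \<open>b, c, a\<close> is a basis, \<open>ccross a b\<close> and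
  \<open>ccross a c\<close> lie in the plane, and their cross product is the nonzero multiple
  \<open>det3 b c a *s a\<close>, so they span it.\<close>

lemma proj_line_of_normal:
  assumes "a \<noteq> 0"
  shows "proj_line {v. a \<odot> v = 0}"
proof -
  obtain b c where d: "det3 b c a \<noteq> 0" using complete_basis1[OF assms] .
  let ?p = "ccross a b" and ?q = "ccross a c"
  have 1: "ccross ?p ?q = det3 b c a *s a"
    by (simp add: vec3_eq_iff det3_eq algebra_simps)
  then have 2: "ccross ?p ?q \<noteq> 0" using d assms by (auto simp: vec3_eq_iff)
  have "{v. a \<odot> v = 0} = vec.span {?p, ?q}"
    using in_span2_det3[OF 2] d by (auto simp: det3_def 1 dot_commute)
  then show ?thesis using proj_line_span[OF 2] by simp
qed

lemma normal_unique:
  assumes "a \<noteq> 0" "b \<noteq> 0" "{v. a \<odot> v = 0} = {v. b \<odot> v = 0}"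
  shows "ccross a b = 0"
proof -
  have "ccross a e \<odot> b = 0" for e
  proof -
    have "a \<odot> ccross a e = 0" by (simp add: dot_3 algebra_simps)
    then have "b \<odot> ccross a e = 0" using assms(3) by blast
    then show ?thesis by (simp add: dot_commute)
  qed
  from this[of "axis 1 1"] this[of "axis 2 1"] this[of "axis 3 1"]
  show ?thesis by (auto simp: vec3_eq_iff dot_3 axis_def algebra_simps)
qed

text \<open>The cross product of the two normals is a common point, unless the normals are
  proportional and the lines coincide.\<close>

lemma lines_meet:
  assumes "proj_line l" "proj_line l'"
  obtains p where "p \<noteq> 0" "p \<in> l" "p \<in> l'"
proof -
  obtain a where a: "a \<noteq> 0" "l = {v. a \<odot> v = 0}" using proj_line_normal[OF assms(1)] .
  obtain b where b: "b \<noteq> 0" "l' = {v. b \<odot> v = 0}" using proj_line_normal[OF assms(2)] .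
  show ?thesis
  proof (cases "ccross a b = 0")
    case True
    then obtain c where c: "a = c *s b" using ccross_eq_0_right b by blast
    obtain x y where xy: "ccross x y \<noteq> 0" "l' = vec.span {x, y}" using proj_lineE[OF assms(2)] .
    then have "x \<in> l'" "x \<noteq> 0" using ccross_nonzeroD[OF xy(1)] by (simp_all add: vec.span_base)
    then show ?thesis using that a b c by auto
  next
    case False
    show ?thesis by (rule that[OF False]) (auto simp: a b dot_3 algebra_simps)
  qed
qed

section \<open>Matrices with given columns\<close>

definition mat3 :: "complex^3 \<Rightarrow> complex^3 \<Rightarrow> complex^3 \<Rightarrow> complex^3^3" where
  "mat3 a b c = (\<chi> i. vector [a$i, b$i, c$i])"

lemma mat3_mult: "mat3 a b c *v v = v$1 *s a + v$2 *s b + v$3 *s c"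
  by (simp add: mat3_def vec_eq_iff matrix_vector_mult_def sum_3 mult.commute)

lemma mat3_axis [simp]: "mat3 a b c *v axis 1 1 = a" "mat3 a b c *v axis 2 1 = b" "mat3 a b c *v axis 3 1 = c"
  by (simp_all add: mat3_mult vec3_eq_iff axis_def)

lemma matrix_columns: "M *v v = v$1 *s (M *v axis 1 1) + v$2 *s (M *v axis 2 1) + v$3 *s (M *v axis 3 1)" for M :: "complex^3^3"
  by (simp add: vec3_eq_iff matrix_vector_mult_def sum_3 axis_def mult.commute)

lemma matrix_eq_mat3: "M = mat3 (M *v axis 1 1) (M *v axis 2 1) (M *v axis 3 1)"
  by (simp add: matrix_eq mat3_mult flip: matrix_columns)

lemma det_mat3: "det (mat3 a b c) = det3 a b c"
  by (simp add: mat3_def det_3 det3_eq algebra_simps)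

lemma det_eq_det3: "det M = det3 (M *v axis 1 1) (M *v axis 2 1) (M *v axis 3 1)"
  by (metis det_mat3 matrix_eq_mat3)

lemma invertible_mat3: "invertible (mat3 a b c) \<longleftrightarrow> det3 a b c \<noteq> 0"
  by (simp add: invertible_det_nz det_mat3)

lemma invertible_inv:
  fixes M :: "complex^3^3"
  assumes "invertible M"
  obtains N where "invertible N" "M ** N = mat 1" "N ** M = mat 1" "\<And>v. M *v (N *v v) = v" "\<And>v. N *v (M *v v) = v"
proof -
  obtain N where N: "M ** N = mat 1" "N ** M = mat 1" using assms unfolding invertible_def by blast
  then have "invertible N" unfolding invertible_def by blast
  then show ?thesis using that N by (simp add: matrix_vector_mul_assoc)
qed

lemma matrix_smult: "M *v (c *s v) = c *s (M *v v)" for M :: "complex^3^3"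
  by (simp add: vector_scalar_commute)

lemma invertible_mult_eq_0: "invertible M \<Longrightarrow> M *v v = 0 \<longleftrightarrow> v = 0" for M :: "complex^3^3"
  by (metis invertible_inv matrix_vector_mult_0_right)

lemma image_span1: "(*v) M ` vec.span {p} = vec.span {M *v p}" for M :: "complex^3^3"
  by (simp add: span1 image_image matrix_smult)

lemma image_span2: "(*v) M ` vec.span {b, p} = vec.span {M *v b, M *v p}" for M :: "complex^3^3"
proof -
  have "M *v (x *s b + y *s p) = x *s (M *v b) + y *s (M *v p)" for x y
    by (simp add: matrix_vector_right_distrib matrix_smult)
  then show ?thesis unfolding set_eq_iff image_iff Bex_def in_span2 by metis
qed

lemma ccross_invertible:
  fixes M :: "complex^3^3"
  assumes "invertible M" "ccross a b \<noteq> 0"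
  shows "ccross (M *v a) (M *v b) \<noteq> 0"
proof
  assume "ccross (M *v a) (M *v b) = 0"
  moreover have "M *v b \<noteq> 0" using assms ccross_nonzeroD invertible_mult_eq_0 by blast
  ultimately obtain c where "M *v a = c *s (M *v b)" using ccross_eq_0_right by blast
  then have "M *v (a - c *s b) = 0" by (simp add: matrix_vector_mult_diff_distrib matrix_smult)
  then have "a = c *s b" using assms invertible_mult_eq_0 by force
  then show False using assms by simp
qed

lemma proj_line_image:
  assumes "invertible M" "proj_line l"
  shows "proj_line ((*v) M ` l)"
  using assms by (metis ccross_invertible image_span2 proj_lineE proj_line_span)

lemma proj_point_image:
  assumes "invertible M" "proj_point s"
  shows "proj_point ((*v) M ` s)"
  using assms by (metis image_span1 invertible_mult_eq_0 proj_pointE proj_point_span)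

section \<open>Homogeneous one-forms and changes of coordinates\<close>

definition hform :: "nat \<Rightarrow> (complex^3 \<Rightarrow> complex^3) \<Rightarrow> bool" where
  "hform n F \<longleftrightarrow> (\<forall>i. homogeneous_poly n (\<lambda>v. F v $ i)) \<and> (\<forall>v. F v \<odot> v = 0)"

abbreviation pair :: "(complex^3 \<Rightarrow> complex^3) \<Rightarrow> complex^3 \<Rightarrow> complex^3 \<Rightarrow> complex" where
  "pair F a \<equiv> \<lambda>v. F v \<odot> a"

text \<open>At a singular point \<open>p\<close> the bilinear form \<open>jf F p\<close> descends to the quotient by \<open>p\<close>; up to a
  rotation it is there the linear part of a local vector field.\<close>

definition jf :: "(complex^3 \<Rightarrow> complex^3) \<Rightarrow> complex^3 \<Rightarrow> complex^3 \<Rightarrow> complex^3 \<Rightarrow> complex" where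
  "jf F p a w = ddir (pair F a) w p"

lemma hform_pair: "hform n F \<Longrightarrow> homogeneous_poly n (pair F a)"
  unfolding hform_def dot_3
  by (intro homogeneous_poly_add homogeneous_poly_cmult') auto

lemma hform_euler: "hform n F \<Longrightarrow> F v \<odot> v = 0"
  by (simp add: hform_def)

lemma hform_scale:
  assumes "hform n F"
  shows "F (c *s v) = c ^ n *s F v"
proof -
  have "F (c *s v) $ i = c ^ n * F v $ i" for i
    using homogeneous_poly_scale[of n "\<lambda>v. F v $ i"] assms by (simp add: hform_def)
  then show ?thesis by (simp add: vec_eq_iff)
qed

lemma foliation_hform: "foliation F \<longleftrightarrow> (\<exists>n\<ge>1. hform n F) \<and> finite {s. singular_point F s}"
  by (auto simp: foliation_def hform_def)

lemma lpoly_pair_linear: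
  assumes "hform n F"
  shows "lpoly (pair F (x *s a + y *s b)) p u = smult x (lpoly (pair F a) p u) + smult y (lpoly (pair F b) p u)"
  by (rule lpoly_eqI) (simp add: poly_lpoly[OF hform_pair[OF assms]])

text \<open>Expand the Euler condition at \<open>p + t u\<close>. The factor \<open>t\<close>
  obtained here is the source of every later shift by one between orders of polars and degrees of
  local fields.\<close>

lemma lpoly_pair_self:
  assumes "hform n F"
  shows "lpoly (pair F p) p u = - pCons 0 (lpoly (pair F u) p u)"
proof (rule lpoly_eqI)
  fix t
  have "F (p + t *s u) \<odot> p + t * (F (p + t *s u) \<odot> u) = 0"
    using hform_euler[OF assms, of "p + t *s u"] by simp
  then show "poly (- pCons 0 (lpoly (pair F u) p u)) t = pair F p (p + t *s u)"
    by (simp add: poly_lpoly[OF hform_pair[OF assms]] add_eq_0_iff)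
qed

lemma jf_linear1: "hform n F \<Longrightarrow> jf F p (x *s a + y *s b) w = x * jf F p a w + y * jf F p b w"
  unfolding jf_def ddir_def by (subst lpoly_pair_linear) simp_all

lemma jf_linear2: "hform n F \<Longrightarrow> jf F p a (x *s w + y *s w') = x * jf F p a w + y * jf F p a w'"
  unfolding jf_def by (rule ddir_linear, rule hform_pair)

lemma
  assumes "hform n F"
  shows jf_add1: "jf F p (a + b) w = jf F p a w + jf F p b w"
    and jf_add2: "jf F p a (w + w') = jf F p a w + jf F p a w'"
    and jf_smult1: "jf F p (x *s a) w = x * jf F p a w"
    and jf_smult2: "jf F p a (x *s w) = x * jf F p a w"
  using jf_linear1[OF assms, of p 1 a 1 b w] jf_linear2[OF assms, of p a 1 w 1 w']
    jf_linear1[OF assms, of p x a 0 0 w] jf_linear2[OF assms, of p a x w 0 0] by simp_all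

lemma jf_radial: "hform n F \<Longrightarrow> jf F p a p = of_nat n * (F p \<odot> a)"
  unfolding jf_def by (rule ddir_euler, rule hform_pair)

lemma jf_radial': "hform n F \<Longrightarrow> jf F p p w = - (F p \<odot> w)"
  by (simp add: jf_def ddir_def lpoly_pair_self coeff_lpoly_0[OF hform_pair] coeff_pCons)

lemma homogeneous_poly_jf: "hform n F \<Longrightarrow> homogeneous_poly (n - 1) (\<lambda>v. jf F v a w)"
  unfolding jf_def by (intro homogeneous_poly_ddir hform_pair)

lemma jf_scale: "hform n F \<Longrightarrow> jf F (c *s p) a w = c ^ (n - 1) * jf F p a w"
  using homogeneous_poly_scale[OF homogeneous_poly_jf[of n F a w], of c p] by simp

lemma pullback_nth: "pullback M F v $ k = F (M *v v) \<odot> (M *v axis k 1)"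
  using exhaust_3[of k]
  by (auto simp: pullback_def vector_matrix_mult_def dot_3 matrix_vector_mult_def sum_3 axis_def mult.commute)

lemma dot_pullback: "pullback M F v \<odot> w = F (M *v v) \<odot> (M *v w)"
  by (subst (2) matrix_columns) (simp add: dot_3 pullback_nth algebra_simps)

lemma pullback_pullback: "pullback N (pullback M F) = pullback (M ** N) F"
proof
  fix v
  show "pullback N (pullback M F) v = pullback (M ** N) F v"
    unfolding vec_eq_iff pullback_nth[of N] pullback_nth[of "M ** N"] dot_pullback
    by (simp add: matrix_vector_mul_assoc)
qed

lemma pullback_mat_1: "pullback (mat 1) F = F"
  by (rule ext) (simp add: vec_eq_iff pullback_nth)

lemma homogeneous_poly_linear: "homogeneous_poly 1 (\<lambda>v. (M *v v) $ k)" for M :: "complex^3^3"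
  unfolding matrix_vector_mult_def using homogeneous_poly_coord
  by (auto simp: sum_3 intro!: homogeneous_poly_add homogeneous_poly_cmult)

lemma homogeneous_poly_compose:
  "homogeneous_poly n f \<Longrightarrow> homogeneous_poly n (\<lambda>v. f (M *v v))" for M :: "complex^3^3"
proof (induction rule: homogeneous_poly_induct)
  case (const c) show ?case by (rule homogeneous_poly_const)
next
  case (coord k) show ?case by (rule homogeneous_poly_linear)
next
  case (add n f g) then show ?case by (intro homogeneous_poly_add)
next
  case (mult m n f g) then show ?case by (intro homogeneous_poly_mult)
qed

lemma hform_pullback:
  assumes "hform n F"
  shows "hform n (pullback M F)"
  unfolding hform_def
proof (intro conjI allI)
  show "homogeneous_poly n (\<lambda>v. pullback M F v $ i)" for i
    unfolding pullback_nth using homogeneous_poly_compose[OF hform_pair[OF assms]] .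
  show "pullback M F v \<odot> v = 0" for v
    by (simp add: dot_pullback hform_euler[OF assms])
qed

lemma jf_pullback:
  assumes "hform n F"
  shows "jf (pullback M F) p a w = jf F (M *v p) (M *v a) (M *v w)"
proof -
  have "lpoly (pair (pullback M F) a) p w = lpoly (pair F (M *v a)) (M *v p) (M *v w)"
    by (rule lpoly_eqI)
      (simp add: dot_pullback poly_lpoly[OF hform_pair[OF assms]] matrix_vector_right_distrib matrix_smult)
  then show ?thesis by (simp add: jf_def ddir_def)
qed

text \<open>A constant factor can be absorbed into a scalar matrix because the form is homogeneous
  of degree \<open>n + 1\<close> together with its differentials.\<close>

lemma same_foliation_pullback:
  assumes "hform n F" "same_foliation G F"
  obtains M where "invertible M" "G = pullback M F"
proof -
  obtain c where c: "c \<noteq> 0" "\<And>v. G v = c *s F v" using assms(2) unfolding same_foliation_def by blast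
  obtain d where d: "d ^ Suc n = c" using exists_complex_root[of "Suc n" c] by auto
  then have "d \<noteq> 0" using c by auto
  let ?M = "mat3 (d *s axis 1 1) (d *s axis 2 1) (d *s axis 3 1)"
  have M: "?M *v v = d *s v" for v by (simp add: mat3_mult vec3_eq_iff axis_def)
  have "invertible ?M" using \<open>d \<noteq> 0\<close> by (simp add: invertible_mat3 det3_eq axis_def)
  moreover have "G v = pullback ?M F v" for v
    unfolding vec_eq_iff pullback_nth M c hform_scale[OF assms(1)] using d by (simp add: mult.assoc[symmetric] mult.commute)
  ultimately show ?thesis using that by blast
qed

text \<open>Once the constant factor is absorbed, conjugacy is an equality of forms, and composing
  or inverting conjugations is just \<open>pullback_pullback\<close>.\<close>

lemma linearly_conjugated_iff:
  assumes "hform n F" "hform n H"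
  shows "linearly_conjugated F H \<longleftrightarrow> (\<exists>M. invertible M \<and> F = pullback M H)"
proof
  assume "linearly_conjugated F H"
  then obtain M where M: "invertible M" "same_foliation (pullback M F) H"
    unfolding linearly_conjugated_def by blast
  then obtain K where K: "invertible K" "pullback M F = pullback K H"
    using same_foliation_pullback[OF assms(2)] by metis
  obtain N where N: "invertible N" "M ** N = mat 1" using invertible_inv[OF M(1)] by metis
  have "F = pullback (K ** N) H"
    by (metis K(2) N(2) pullback_mat_1 pullback_pullback)
  then show "\<exists>M. invertible M \<and> F = pullback M H" using K N invertible_mult by blast
next
  assume "\<exists>M. invertible M \<and> F = pullback M H"
  then obtain M where M: "invertible M" "F = pullback M H" by blast
  obtain N where N: "invertible N" "M ** N = mat 1" using invertible_inv[OF M(1)] by metis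
  then have "pullback N F = H" by (simp add: M pullback_pullback pullback_mat_1)
  then show "linearly_conjugated F H"
    unfolding linearly_conjugated_def same_foliation_def using N
    by (intro exI[of _ N]) (auto intro!: exI[of _ 1])
qed

lemma local_field_pullback: "local_field (pullback M F) N = local_field F (M ** N)"
  by (rule ext) (simp add: local_field_def pullback_pullback)

lemma centered_at_image:
  "invertible M \<Longrightarrow> centered_at N s \<Longrightarrow> centered_at (M ** N) ((*v) M ` s)"
  by (auto simp: centered_at_def invertible_mult image_span1 matrix_vector_mul_assoc)

lemma adapted_to_image:
  "invertible M \<Longrightarrow> adapted_to N s l \<Longrightarrow> adapted_to (M ** N) ((*v) M ` s) ((*v) M ` l)"
  by (auto simp: adapted_to_def centered_at_image image_span2 matrix_vector_mul_assoc)

lemma singular_point_image: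
  assumes "invertible M" "singular_point (pullback M F) s"
  shows "singular_point F ((*v) M ` s)"
  unfolding singular_point_def
proof
  show "proj_point ((*v) M ` s)" using assms proj_point_image by (auto simp: singular_point_def)
  show "\<forall>v\<in>(*v) M ` s. F v = 0"
  proof
    fix v assume "v \<in> (*v) M ` s"
    then obtain w where w: "w \<in> s" "v = M *v w" by blast
    then have 0: "pullback M F w = 0" using assms by (auto simp: singular_point_def)
    have d: "det3 (M *v axis 1 1) (M *v axis 2 1) (M *v axis 3 1) \<noteq> 0"
      using assms(1) by (simp add: invertible_det_nz flip: det_eq_det3)
    have "F v \<odot> (M *v axis k 1) = 0" for k
      using 0 w by (simp add: pullback_nth[symmetric])
    then show "F v = 0" using det3_dot_eq_0[OF d] by blast
  qed
qed

lemma radial_singularity_image: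
  assumes M: "invertible M" and r: "radial_singularity (pullback M F) s k"
  shows "radial_singularity F ((*v) M ` s) k"
proof -
  obtain N where "centered_at N s" "algebraic_multiplicity (local_field F (M ** N)) = 1"
    "tangency_order (local_field F (M ** N)) = k + 1"
    using r unfolding radial_singularity_def local_field_pullback by blast
  then show ?thesis
    using r singular_point_image[OF M] centered_at_image[OF M] unfolding radial_singularity_def by blast
qed

lemma nondegenerate_singularity_image:
  assumes M: "invertible M" and r: "nondegenerate_singularity (pullback M F) s"
  shows "nondegenerate_singularity F ((*v) M ` s)"
proof -
  obtain N where "centered_at N s" "bij (taylor_part (local_field F (M ** N)) 1)"
    using r unfolding nondegenerate_singularity_def local_field_pullback by blast
  then show ?thesis
    using r singular_point_image[OF M] centered_at_image[OF M] unfolding nondegenerate_singularity_def by blast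
qed

lemma camacho_sad_index_image:
  assumes M: "invertible M" and r: "camacho_sad_index (pullback M F) l s c"
  shows "camacho_sad_index F ((*v) M ` l) ((*v) M ` s) c"
proof -
  obtain N P Q where "adapted_to N s l" "\<forall>w. local_field F (M ** N) w = vector [P w, w$2 * Q w]"
    "continuous_on UNIV Q" "c = residue (\<lambda>u. Q (vector [u, 0]) / P (vector [u, 0])) 0"
    using r unfolding camacho_sad_index_def local_field_pullback by blast
  then show ?thesis
    using adapted_to_image[OF M] unfolding camacho_sad_index_def by blast
qed

lemma invariant_line_image:
  assumes M: "invertible M" and l: "invariant_line (pullback M F) l"
  shows "invariant_line F ((*v) M ` l)"
  using l proj_line_image[OF M] by (auto simp: invariant_line_def dot_pullback)

lemma pullback_inverse:
  assumes "invertible M"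
  obtains N where "invertible N" "F = pullback N (pullback M F)"
    "\<And>s. (*v) M ` (*v) N ` s = s" "\<And>s. (*v) N ` (*v) M ` s = s"
proof -
  obtain N where N: "invertible N" "M ** N = mat 1" "N ** M = mat 1" "\<And>v. M *v (N *v v) = v" "\<And>v. N *v (M *v v) = v"
    using invertible_inv[OF assms] by metis
  show ?thesis
    by (rule that[OF N(1)]) (simp_all add: pullback_pullback pullback_mat_1 N image_image)
qed

lemma CS_set_pullback_subset:
  assumes M: "invertible M"
  shows "CS_set (pullback M F) \<subseteq> CS_set F"
proof
  fix c assume "c \<in> CS_set (pullback M F)"
  then obtain l s where c: "c \<noteq> 0" "c \<noteq> 1" and "invariant_line (pullback M F) l" "s \<subseteq> l"
    "nondegenerate_singularity (pullback M F) s" "camacho_sad_index (pullback M F) l s c"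
    unfolding CS_set_def by blast
  then have "invariant_line F ((*v) M ` l)" "(*v) M ` s \<subseteq> (*v) M ` l"
    "nondegenerate_singularity F ((*v) M ` s)" "camacho_sad_index F ((*v) M ` l) ((*v) M ` s) c"
    using invariant_line_image[OF M] nondegenerate_singularity_image[OF M] camacho_sad_index_image[OF M] by blast+
  then show "c \<in> CS_set F" using c unfolding CS_set_def by blast
qed

lemma CS_set_pullback: "invertible M \<Longrightarrow> CS_set (pullback M F) = CS_set F"
  using CS_set_pullback_subset pullback_inverse[of M F] by (metis subset_antisym)

lemma invariant_lines_pullback:
  assumes "invertible M"
  shows "bij_betw (\<lambda>l. (*v) M ` l) {l. invariant_line (pullback M F) l} {l. invariant_line F l}"
proof -
  obtain N where N: "invertible N" "F = pullback N (pullback M F)"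
    "\<And>s. (*v) M ` (*v) N ` s = s" "\<And>s. (*v) N ` (*v) M ` s = s" using pullback_inverse[OF assms] by metis
  have "invariant_line (pullback M F) ((*v) N ` l)" if "invariant_line F l" for l
    using invariant_line_image[of N "pullback M F" l] N that by metis
  then show ?thesis
    by (intro bij_betwI[where g = "\<lambda>l. (*v) N ` l"]) (auto simp: N(3,4) invariant_line_image[OF assms])
qed

section \<open>Order of vanishing at a point\<close>

definition vanishes :: "(complex^3 \<Rightarrow> complex) \<Rightarrow> complex^3 \<Rightarrow> nat \<Rightarrow> bool" where
  "vanishes f p m \<longleftrightarrow> (\<forall>u. monom 1 m dvd lpoly f p u)"

lemma vanishes_iff: "vanishes f p m \<longleftrightarrow> (\<forall>u. \<forall>j<m. coeff (lpoly f p u) j = 0)"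
  by (simp add: vanishes_def monom_1_dvd_iff')

lemma vanishes_mono: "vanishes f p m \<Longrightarrow> k \<le> m \<Longrightarrow> vanishes f p k"
  by (auto simp: vanishes_iff)

text \<open>By homogeneity, \<open>p + t (u + a p)\<close> equals \<open>1 + a t\<close> times
  \<open>p + (t / (1 + a t)) u\<close>. The resulting identity holds away from one value of
  \<open>t\<close>, hence as an identity of polynomials.\<close>

lemma lpoly_shift:
  assumes "homogeneous_poly n f"
  shows "lpoly f p (u + a *s p) = (\<Sum>j\<le>n. monom (coeff (lpoly f p u) j) j * [:1, a:] ^ (n - j))"
proof -
  define R where "R = (\<Sum>j\<le>n. monom (coeff (lpoly f p u) j) j * [:1, a:] ^ (n - j))"
  have sum: "f (p + t *s u) = (\<Sum>j\<le>n. coeff (lpoly f p u) j * t ^ j)" for t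
    using arg_cong[OF poly_as_sum_of_monoms'[OF degree_lpoly[OF assms]], of "\<lambda>q. poly q t"]
    by (simp add: poly_sum poly_monom poly_lpoly[OF assms])
  have eq: "poly (lpoly f p (u + a *s p)) t = poly R t" if t: "1 + a * t \<noteq> 0" for t
  proof -
    have e: "p + t *s (u + a *s p) = (1 + a * t) *s (p + (t / (1 + a * t)) *s u)"
      using t by (simp add: vec_eq_iff field_simps)
    have "poly (lpoly f p (u + a *s p)) t = (1 + a * t) ^ n * f (p + (t / (1 + a * t)) *s u)"
      unfolding poly_lpoly[OF assms] e homogeneous_poly_scale[OF assms] ..
    also have "\<dots> = (\<Sum>j\<le>n. coeff (lpoly f p u) j * t ^ j * (1 + a * t) ^ (n - j))"
      unfolding sum sum_distrib_left
    proof (rule sum.cong[OF refl])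
      fix j assume "j \<in> {..n}"
      then have "(1 + a * t) ^ n = (1 + a * t) ^ j * (1 + a * t) ^ (n - j)"
        by (simp flip: power_add)
      then show "(1 + a * t) ^ n * (coeff (lpoly f p u) j * (t / (1 + a * t)) ^ j) =
          coeff (lpoly f p u) j * t ^ j * (1 + a * t) ^ (n - j)"
        using t by (simp add: power_divide)
    qed
    also have "\<dots> = poly R t"
      by (simp add: R_def poly_sum poly_monom mult.commute)
    finally show ?thesis .
  qed
  \<comment> \<open>For \<open>a = 0\<close> the quotient is 0 by convention, and omitting that one
    point is harmless.\<close>
  have "infinite (UNIV - {-1/a} :: complex set)"
    using infinite_UNIV_char_0 by (simp add: infinite_remove)
  moreover have "UNIV - {-1/a} \<subseteq> {t. poly (lpoly f p (u + a *s p) - R) t = 0}"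
  proof
    fix t assume "t \<in> UNIV - {-1/a}"
    then have "1 + a * t \<noteq> 0" by (cases "a = 0") (auto simp: field_simps add_eq_0_iff)
    then show "t \<in> {t. poly (lpoly f p (u + a *s p) - R) t = 0}" using eq by simp
  qed
  ultimately have "infinite {t. poly (lpoly f p (u + a *s p) - R) t = 0}"
    using finite_subset by blast
  then have "lpoly f p (u + a *s p) - R = 0" using poly_roots_finite by blast
  then show ?thesis by (simp add: R_def)
qed

lemma coeff_monom_mult_low:
  "coeff (monom c j * q) m = (if m < j then 0 else c * coeff q (m - j))" for q :: "complex poly"
  by (simp add: coeff_monom_mult)

text \<open>The factors \<open>[:1, a:] ^ (n - j)\<close> have constant coefficient 1, so the lowest
  term stays the same. Only the class of a direction modulo \<open>p\<close> matters, as it should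
  for a tangent direction at a projective point.\<close>

lemma leading_shift:
  assumes f: "homogeneous_poly n f" and low: "\<forall>j<m. coeff (lpoly f p u) j = 0"
  shows "(\<forall>j<m. coeff (lpoly f p (u + a *s p)) j = 0) \<and>
    coeff (lpoly f p (u + a *s p)) m = coeff (lpoly f p u) m"
proof -
  have c: "coeff (lpoly f p (u + a *s p)) i =
      (\<Sum>j\<le>n. if i < j then 0 else coeff (lpoly f p u) j * coeff ([:1, a:] ^ (n - j)) (i - j))" for i
    unfolding lpoly_shift[OF f] coeff_sum coeff_monom_mult_low ..
  have 1: "coeff (lpoly f p (u + a *s p)) i = 0" if "i < m" for i
    unfolding c by (rule sum.neutral) (use low that in auto)
  have "coeff (lpoly f p (u + a *s p)) m = coeff (lpoly f p u) m"
  proof (cases "m \<le> n")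
    case True
    have "coeff (lpoly f p (u + a *s p)) m = coeff (lpoly f p u) m * coeff ([:1, a:] ^ (n - m)) 0"
      unfolding c by (subst sum_single[of _ m]) (use True low in auto)
    then show ?thesis by (simp add: coeff_linear_poly_power)
  next
    case False
    then show ?thesis using degree_lpoly[OF f] by (metis coeff_eq_0 le_less_trans not_le)
  qed
  with 1 show ?thesis by blast
qed

lemma vanishes_basis:
  assumes f: "homogeneous_poly n f" and d: "det3 b1 b2 p \<noteq> 0"
    and low: "\<And>x y j. j < m \<Longrightarrow> coeff (lpoly f p (x *s b1 + y *s b2)) j = 0"
  shows "vanishes f p m"
  unfolding vanishes_iff
proof (intro allI impI)
  fix u j assume j: "j < m"
  obtain x y z where "u = x *s b1 + y *s b2 + z *s p" using det3_basis[OF d] .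
  then show "coeff (lpoly f p u) j = 0" using leading_shift[OF f, of m p] low j by blast
qed

text \<open>The order of vanishing at \<open>p\<close> of the equation \<open>v \<mapsto> F v \<cdot> p\<close> of the polar curve; it exceeds the
  tangency order at \<open>p\<close> by one.\<close>

definition kap :: "(complex^3 \<Rightarrow> complex^3) \<Rightarrow> complex^3 \<Rightarrow> nat" where
  "kap F p = (LEAST m. \<exists>u. coeff (lpoly (pair F p) p u) m \<noteq> 0)"

lemma lpoly_pair_basis:
  assumes "hform n F"
  shows "coeff (lpoly (pair F p) p u) (Suc m) = - coeff (lpoly (pair F u) p u) m"
  by (simp add: lpoly_pair_self[OF assms] coeff_pCons)

lemma coeff_2_pair:
  assumes "hform n F"
  shows "coeff (lpoly (pair F p) p u) 2 = - jf F p u u"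
  using lpoly_pair_basis[OF assms, of p u 1] by (simp add: jf_def ddir_def numeral_2_eq_2)

text \<open>Two uses are covered: the points of a line (\<open>d = 0\<close>), and one point
  selected by \<open>h\<close> on each line joining \<open>d\<close> to the points
  \<open>a + c b\<close>. Comparing the coordinates along \<open>a\<close> and \<open>b\<close>
  recovers \<open>c\<close>.\<close>

lemma infinite_points_on_line:
  assumes "ccross a b \<noteq> 0" "det3 a b d \<noteq> 0 \<or> d = 0"
  shows "infinite (range (\<lambda>c. vec.span {a + c *s b + h c *s d}))"
proof -
  have "inj (\<lambda>c. vec.span {a + c *s b + h c *s d})"
  proof (rule injI)
    fix c c' assume "vec.span {a + c *s b + h c *s d} = vec.span {a + c' *s b + h c' *s d}"
    then have "a + c *s b + h c *s d \<in> vec.span {a + c' *s b + h c' *s d}"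
      using vec.span_base by blast
    then obtain x where x: "a + c *s b + h c *s d = x *s (a + c' *s b + h c' *s d)"
      by (auto simp: in_span1)
    show "c = c'"
    proof (cases "d = 0")
      case True
      then have x: "a + c *s b = x *s (a + c' *s b)" using x by simp
      obtain e where e: "det3 e a b \<noteq> 0" using complete_basis[OF assms(1)] .
      have "det3 e (a + c *s b) b = det3 e (x *s (a + c' *s b)) b" using x by simp
      then have "x = 1" using e by simp
      have "det3 e a (a + c *s b) = det3 e a (x *s (a + c' *s b))" using x by simp
      then show ?thesis using e \<open>x = 1\<close> by simp
    next
      case False
      then have e: "det3 a b d \<noteq> 0" using assms(2) by simp
      have "det3 (a + c *s b + h c *s d) b d = det3 (x *s (a + c' *s b + h c' *s d)) b d" using x by simp
      then have "x = 1" using e by simp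
      have "det3 a (a + c *s b + h c *s d) d = det3 a (x *s (a + c' *s b + h c' *s d)) d" using x by simp
      then show ?thesis using e \<open>x = 1\<close> by simp
    qed
  qed
  then show ?thesis using finite_imageD infinite_UNIV_char_0 by blast
qed

lemma taylor_part_local_field:
  fixes M :: "complex^3^3"
  defines "b1 \<equiv> M *v axis 1 1" and "b2 \<equiv> M *v axis 2 1" and "p \<equiv> M *v axis 3 1"
  assumes "hform n F"
  shows "taylor_part (local_field F M) m w =
    vector [coeff (lpoly (pair F b2) p (w$1 *s b1 + w$2 *s b2)) m,
          - coeff (lpoly (pair F b1) p (w$1 *s b1 + w$2 *s b2)) m]"
proof -
  have M: "M *v vector [t * w$1, t * w$2, 1] = p + t *s (w$1 *s b1 + w$2 *s b2)" for t
    by (subst matrix_columns) (simp add: b1_def b2_def p_def vec_eq_iff algebra_simps)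
  have 1: "(\<lambda>t. local_field F M (t *s w) $ 1) = poly (lpoly (pair F b2) p (w$1 *s b1 + w$2 *s b2))"
    by (rule ext) (simp add: local_field_def Let_def pullback_nth M poly_lpoly[OF hform_pair[OF assms(4)]] b2_def)
  have 2: "(\<lambda>t. local_field F M (t *s w) $ 2) = poly (- lpoly (pair F b1) p (w$1 *s b1 + w$2 *s b2))"
    by (rule ext) (simp add: local_field_def Let_def pullback_nth M poly_lpoly[OF hform_pair[OF assms(4)]] b1_def)
  show ?thesis
    unfolding vec_eq_iff forall_2 taylor_part_def vec_lambda_beta 1 2 higher_deriv_poly_0 by simp
qed

text \<open>The setting for reading off the degree: \<open>has_degree_eq\<close> relates
  \<open>n\<close> to the degree before \<open>n \<ge> 2\<close> is known.\<close>

locale projective_form =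
  fixes F :: "complex^3 \<Rightarrow> complex^3" and n :: nat
  assumes hf: "hform n F" and n1: "n \<ge> 1"
begin

lemmas hp = hform_pair[OF hf]

end

text \<open>The bound on \<open>n\<close> excludes the pencils of lines through a point
  (\<open>n = 1\<close>): there the polar of the base point is identically 0 and \<open>kap\<close>
  would be meaningless.\<close>

locale projective_foliation = projective_form +
  assumes n2: "n \<ge> 2" and fin: "finite {s. singular_point F s}"
begin

lemma singular_span:
  assumes "p \<noteq> 0"
  shows "singular_point F (vec.span {p}) \<longleftrightarrow> F p = 0"
proof
  assume "singular_point F (vec.span {p})"
  then show "F p = 0" by (auto simp: singular_point_def intro: vec.span_base)
next
  assume "F p = 0"
  then show "singular_point F (vec.span {p})"
    using assms by (auto simp: singular_point_def proj_point_span in_span1 hform_scale[OF hf])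
qed

lemma singularE:
  assumes "singular_point F s"
  obtains p where "p \<noteq> 0" "s = vec.span {p}" "F p = 0"
  using assms proj_pointE singular_span unfolding singular_point_def by metis

lemma finite_zeros:
  assumes "det3 a b d \<noteq> 0 \<or> d = 0" "ccross a b \<noteq> 0"
  shows "\<exists>c. F (a + c *s b + h c *s d) \<noteq> 0"
proof (rule ccontr)
  assume *: "\<not> ?thesis"
  have nz: "a + c *s b + h c *s d \<noteq> 0" for c
  proof
    assume 0: "a + c *s b + h c *s d = 0"
    show False
    proof (cases "d = 0")
      case True
      then have "ccross (a + c *s b) b = 0" using 0 by simp
      then show False using assms(2) by (simp add: vec3_eq_iff algebra_simps)
    next
      case False
      have "det3 (a + c *s b + h c *s d) b d = 0" using 0 by simp
      then show False using assms(1) False by simp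
    qed
  qed
  have "range (\<lambda>c. vec.span {a + c *s b + h c *s d}) \<subseteq> {s. singular_point F s}"
    using * singular_span[OF nz] by auto
  then show False using infinite_points_on_line[OF assms(2,1)] fin finite_subset by blast
qed

lemma line_not_singular:
  assumes "ccross a b \<noteq> 0"
  shows "\<exists>c. F (a + c *s b) \<noteq> 0"
  using finite_zeros[of a b 0] assms by simp

text \<open>If the polar of \<open>p\<close> were identically 0, choose \<open>q\<close> with
  \<open>F q \<noteq> 0\<close> and \<open>e\<close> with \<open>e \<odot> F q \<noteq> 0\<close>.
  On each line \<open>e + c p + t q\<close> the polynomial \<open>F v \<odot> q\<close> has degree
  at least \<open>n - 1 \<ge> 1\<close> and so a root; there \<open>F\<close> is orthogonal to
  \<open>p\<close> and \<open>q\<close>, and by Euler also to \<open>e\<close>. This produces a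
  singular point for every \<open>c\<close>, infinitely many in all.\<close>

lemma pair_nonzero:
  assumes "p \<noteq> 0"
  shows "\<exists>v. pair F p v \<noteq> 0"
proof (rule ccontr)
  assume "\<not> ?thesis"
  then have z: "F v \<odot> p = 0" for v by blast
  have Fp: "F p = 0"
  proof -
    have "F p \<odot> u = 0" for u
    proof -
      have "lpoly (pair F p) p u = 0" by (rule lpoly_eqI) (simp add: z)
      then have "lpoly (pair F u) p u = 0" using lpoly_pair_self[OF hf, of p u] by simp
      then show ?thesis using coeff_lpoly_0[OF hp, of u p u] by simp
    qed
    then show ?thesis by (metis det3_dot_eq_0 complete_basis1 assms)
  qed
  obtain a b where ab: "det3 a b p \<noteq> 0" using complete_basis1[OF assms] .
  have "ccross a b \<noteq> 0" using ab det3_rotate[of a b p] det3_rotate[of b p a] by (auto simp: det3_def)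
  then obtain q where q: "F q \<noteq> 0" using line_not_singular by blast
  have pq: "ccross p q \<noteq> 0"
  proof
    assume "ccross p q = 0"
    then have "ccross q p = 0" by (subst ccross_antisym) simp
    then obtain c where "q = c *s p" using ccross_eq_0_right[of q p] assms by blast
    then show False using q Fp hform_scale[OF hf] by simp
  qed
  obtain e where e: "e \<odot> F q \<noteq> 0" using dot_nondegenerate[OF q] by blast
  have d: "det3 e p q \<noteq> 0"
  proof
    assume "det3 e p q = 0"
    then obtain x y where "e = x *s p + y *s q" using in_span2_det3[OF pq] in_span2 by blast
    then show False using e z[of q] hform_euler[OF hf, of q] by (simp add: dot_commute)
  qed
  have "\<exists>t. F (e + c *s p + t *s q) = 0" for c
  proof -
    let ?\<phi> = "lpoly (pair F q) (e + c *s p) q"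
    have "lpoly (pair F e) (e + c *s p) q = - pCons 0 ?\<phi>"
    proof (rule lpoly_eqI)
      fix t
      have "F (e + c *s p + t *s q) \<odot> (e + c *s p + t *s q) = 0" by (rule hform_euler[OF hf])
      then show "poly (- pCons 0 ?\<phi>) t = pair F e (e + c *s p + t *s q)"
        using z[of "e + c *s p + t *s q"] by (simp add: poly_lpoly[OF hp] add_eq_0_iff)
    qed
    then have "coeff (- pCons 0 ?\<phi>) n = F q \<odot> e" using coeff_lpoly_top[OF hp] by metis
    then have "coeff ?\<phi> (n - 1) \<noteq> 0" using e n2 by (cases n) (auto simp: dot_commute)
    then have "degree ?\<phi> \<ge> n - 1" by (rule le_degree)
    then have "\<not> constant (poly ?\<phi>)" using n2 by (simp add: constant_degree)
    then obtain t where "poly ?\<phi> t = 0" using fundamental_theorem_of_algebra by blast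
    then have 1: "F (e + c *s p + t *s q) \<odot> q = 0" by (simp add: poly_lpoly[OF hp])
    have "F (e + c *s p + t *s q) \<odot> (e + c *s p + t *s q) = 0" by (rule hform_euler[OF hf])
    then have "F (e + c *s p + t *s q) \<odot> e = 0" using 1 z[of "e + c *s p + t *s q"] by simp
    then have "F (e + c *s p + t *s q) = 0" using det3_dot_eq_0[OF d] 1 z by blast
    then show ?thesis by blast
  qed
  then obtain h where h: "\<And>c. F (e + c *s p + h c *s q) = 0" by metis
  have "ccross e p \<noteq> 0" using d det3_rotate[of q e p] by (auto simp: det3_def)
  then show False using finite_zeros[of e p q h] d h by blast
qed

section \<open>The order of the polar at a point, and radial singularities\<close>

lemma kap_exists:
  assumes "p \<noteq> 0"
  shows "\<exists>u. coeff (lpoly (pair F p) p u) (kap F p) \<noteq> 0"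
proof -
  obtain v where v: "pair F p v \<noteq> 0" using pair_nonzero[OF assms] by blast
  have "poly (lpoly (pair F p) p (v - p)) 1 \<noteq> 0" using v by (simp add: poly_lpoly[OF hp])
  then have "lpoly (pair F p) p (v - p) \<noteq> 0" by auto
  then have "\<exists>m u. coeff (lpoly (pair F p) p u) m \<noteq> 0" by (meson leading_coeff_0_iff)
  then show ?thesis unfolding kap_def by (rule LeastI_ex)
qed

lemma vanishes_kap: "vanishes (pair F p) p (kap F p)"
  unfolding vanishes_iff kap_def using not_less_Least by blast

lemma kap_le: "p \<noteq> 0 \<Longrightarrow> coeff (lpoly (pair F p) p u) m \<noteq> 0 \<Longrightarrow> kap F p \<le> m"
  unfolding kap_def by (rule Least_le) blast

lemma kap_geI:
  assumes "p \<noteq> 0" "vanishes (pair F p) p m"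
  shows "m \<le> kap F p"
  using kap_exists[OF assms(1)] assms(2) by (meson not_le vanishes_iff)

lemma kap_ge_iff: "p \<noteq> 0 \<Longrightarrow> m \<le> kap F p \<longleftrightarrow> vanishes (pair F p) p m"
  using kap_geI vanishes_kap vanishes_mono by blast

lemma kap_ge_2:
  assumes "p \<noteq> 0" "F p = 0"
  shows "2 \<le> kap F p"
proof (rule kap_geI[OF assms(1)], unfold vanishes_iff, intro allI impI)
  fix u j assume "j < (2::nat)"
  then consider "j = 0" | "j = 1" by linarith
  then show "coeff (lpoly (pair F p) p u) j = 0"
  proof cases
    case 1 then show ?thesis using coeff_lpoly_0[OF hp, of p p u] assms by simp
  next
    case 2
    then show ?thesis using jf_radial'[OF hf, of p u] assms by (simp add: jf_def ddir_def)
  qed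
qed

text \<open>The quadratic part of the polar is \<open>- jf F p u u\<close>. So the condition says
  that \<open>jf\<close> is alternating, that is, the linear part of the local field is a multiple
  of the radial field.\<close>

lemma kap_ge_3:
  assumes "p \<noteq> 0" "F p = 0"
  shows "3 \<le> kap F p \<longleftrightarrow> (\<forall>u. jf F p u u = 0)"
proof -
  have "vanishes (pair F p) p 2" using kap_ge_2[OF assms] kap_ge_iff[OF assms(1)] by blast
  then have "vanishes (pair F p) p 3 \<longleftrightarrow> (\<forall>u. coeff (lpoly (pair F p) p u) 2 = 0)"
    by (auto simp: vanishes_iff numeral_3_eq_3 numeral_2_eq_2 less_Suc_eq)
  then show ?thesis using kap_ge_iff[OF assms(1)] by (simp add: coeff_2_pair[OF hf])
qed

lemma kap_smult:
  assumes "c \<noteq> 0"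
  shows "kap F (c *s p) = kap F p"
proof -
  have "lpoly (pair F (c *s p)) (c *s p) (c *s u) = smult (c ^ Suc n) (lpoly (pair F p) p u)" for u
  proof (rule lpoly_eqI)
    fix t
    have e: "c *s p + t *s (c *s u) = c *s (p + t *s u)" by (simp add: vec_eq_iff algebra_simps)
    show "poly (smult (c ^ Suc n) (lpoly (pair F p) p u)) t = pair F (c *s p) (c *s p + t *s (c *s u))"
      unfolding e poly_smult poly_lpoly[OF hp] hform_scale[OF hf] by simp
  qed
  then have 1: "(\<exists>u. coeff (lpoly (pair F (c *s p)) (c *s p) (c *s u)) m \<noteq> 0) \<longleftrightarrow> (\<exists>u. coeff (lpoly (pair F p) p u) m \<noteq> 0)" for m
    using assms by simp
  have ex: "(\<exists>u. P (c *s u)) \<longleftrightarrow> (\<exists>u. P u)" for P :: "complex^3 \<Rightarrow> bool"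
  proof -
    have "u = c *s ((1/c) *s u)" for u :: "complex^3" using assms by (simp add: vector_smult_assoc)
    then show ?thesis by metis
  qed
  have "(\<exists>u. coeff (lpoly (pair F (c *s p)) (c *s p) u) m \<noteq> 0) \<longleftrightarrow> (\<exists>u. coeff (lpoly (pair F p) p u) m \<noteq> 0)" for m
    by (rule trans[OF ex[symmetric] 1])
  then show ?thesis unfolding kap_def by (rule arg_cong[OF ext])
qed

lemma kap_basis:
  assumes "det3 b1 b2 p \<noteq> 0"
  obtains x y where "coeff (lpoly (pair F p) p (x *s b1 + y *s b2)) (kap F p) \<noteq> 0"
proof -
  have "p \<noteq> 0" using assms by auto
  then obtain u where u: "coeff (lpoly (pair F p) p u) (kap F p) \<noteq> 0" using kap_exists by blast
  obtain x y z where xyz: "u = x *s b1 + y *s b2 + z *s p" using det3_basis[OF assms] .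
  have "coeff (lpoly (pair F p) p (x *s b1 + y *s b2 + z *s p)) (kap F p) =
    coeff (lpoly (pair F p) p (x *s b1 + y *s b2)) (kap F p)"
    using leading_shift[OF hp, of "kap F p" p p "x *s b1 + y *s b2" z] vanishes_kap[of p] by (simp add: vanishes_iff)
  then show ?thesis using that u xyz by simp
qed

lemma jf_basis_nonzero:
  assumes d: "det3 b1 b2 p \<noteq> 0" and "F p = 0" and "jf F p a w \<noteq> 0"
  obtains i j x y where "i \<in> {b1, b2}" "jf F p i (x *s b1 + y *s b2) \<noteq> 0"
proof -
  obtain x y z where w: "w = x *s b1 + y *s b2 + z *s p" using det3_basis[OF d] .
  obtain x' y' z' where a: "a = x' *s b1 + y' *s b2 + z' *s p" using det3_basis[OF d] .
  have "jf F p a w = jf F p a (x *s b1 + y *s b2)"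
    unfolding w by (simp add: jf_add2[OF hf] jf_smult2[OF hf] jf_radial[OF hf] assms)
  also have "\<dots> = x' * jf F p b1 (x *s b1 + y *s b2) + y' * jf F p b2 (x *s b1 + y *s b2)"
    unfolding a by (simp add: jf_add1[OF hf] jf_smult1[OF hf] jf_radial'[OF hf] assms)
  finally have "jf F p b1 (x *s b1 + y *s b2) \<noteq> 0 \<or> jf F p b2 (x *s b1 + y *s b2) \<noteq> 0"
    using assms(3) by auto
  then show ?thesis using that by blast
qed

lemma algebraic_multiplicity_1:
  assumes M: "invertible M" and p: "p = M *v axis 3 1" "F p = 0"
  shows "algebraic_multiplicity (local_field F M) = 1 \<longleftrightarrow> (\<exists>a w. jf F p a w \<noteq> 0)"
proof -
  let ?b1 = "M *v axis 1 1" and ?b2 = "M *v axis 2 1"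
  have d: "det3 ?b1 ?b2 p \<noteq> 0" using M by (simp add: p invertible_det_nz det_eq_det3)
  note tp = taylor_part_local_field[OF hf, of M, folded p]
  have t0: "taylor_part (local_field F M) 0 w = 0" for w
    unfolding tp by (simp add: coeff_lpoly_0[OF hp] p(2) vec_eq_iff forall_2)
  have t1: "(\<exists>w. taylor_part (local_field F M) 1 w \<noteq> 0) \<longleftrightarrow> (\<exists>a w. jf F p a w \<noteq> 0)"
  proof
    assume "\<exists>w. taylor_part (local_field F M) 1 w \<noteq> 0"
    then obtain w where "taylor_part (local_field F M) 1 w \<noteq> 0" by blast
    then show "\<exists>a w. jf F p a w \<noteq> 0"
      unfolding tp by (auto simp: vec_eq_iff forall_2 jf_def ddir_def)
  next
    assume "\<exists>a w. jf F p a w \<noteq> 0"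
    then obtain i x y where i: "i \<in> {?b1, ?b2}" "jf F p i (x *s ?b1 + y *s ?b2) \<noteq> 0"
      using jf_basis_nonzero[OF d p(2)] by metis
    from i(1) consider "i = ?b1" | "i = ?b2" by blast
    then have "taylor_part (local_field F M) 1 (vector [x, y]) \<noteq> 0"
      by cases (use i(2) in \<open>simp_all add: tp vec_eq_iff[of _ 0] forall_2 jf_def ddir_def\<close>)
    then show "\<exists>w. taylor_part (local_field F M) 1 w \<noteq> 0" by blast
  qed
  \<comment> \<open>The \<open>LEAST\<close> in \<open>algebraic_multiplicity\<close> has a meaning
    only if some homogeneous part is nonzero; the lowest term of the polar provides one.\<close>
  have ex: "\<exists>m w. taylor_part (local_field F M) m w \<noteq> 0"
  proof -
    obtain x y where xy: "coeff (lpoly (pair F p) p (x *s ?b1 + y *s ?b2)) (kap F p) \<noteq> 0"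
      using kap_basis[OF d] .
    have "p \<noteq> 0" using d by auto
    then have "kap F p \<noteq> 0" using kap_ge_2[OF _ p(2)] by fastforce
    then obtain m where m: "kap F p = Suc m" using not0_implies_Suc by blast
    have "coeff (lpoly (pair F (x *s ?b1 + y *s ?b2)) p (x *s ?b1 + y *s ?b2)) m \<noteq> 0"
      using xy unfolding m lpoly_pair_basis[OF hf] by simp
    then have "taylor_part (local_field F M) m (vector [x, y]) \<noteq> 0"
      unfolding lpoly_pair_linear[OF hf] tp by (auto simp: vec_eq_iff forall_2)
    then show ?thesis by blast
  qed
  show ?thesis
  proof
    assume "algebraic_multiplicity (local_field F M) = 1"
    then show "\<exists>a w. jf F p a w \<noteq> 0"
      using LeastI_ex[OF ex] t1 by (simp add: algebraic_multiplicity_def)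
  next
    assume "\<exists>a w. jf F p a w \<noteq> 0"
    then have "\<exists>w. taylor_part (local_field F M) 1 w \<noteq> 0" using t1 by blast
    then show "algebraic_multiplicity (local_field F M) = 1"
      unfolding algebraic_multiplicity_def
      by (rule Least_equality) (use t0 in \<open>metis One_nat_def Suc_leI gr0I\<close>)
  qed
qed

text \<open>Pairing the part of degree \<open>m\<close> of the field with the radial field gives
  minus the coefficient of degree \<open>m + 1\<close> of the polar, by
  \<open>lpoly_pair_basis\<close>. The first jet with nonzero determinant is therefore that of
  degree \<open>kap F p - 1\<close>.\<close>

lemma tangency_order_kap:
  assumes M: "invertible M" and p: "p = M *v axis 3 1" "F p = 0"
    and mult: "algebraic_multiplicity (local_field F M) = 1"
  shows "tangency_order (local_field F M) = kap F p - 1"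
proof -
  let ?b1 = "M *v axis 1 1" and ?b2 = "M *v axis 2 1"
  have d: "det3 ?b1 ?b2 p \<noteq> 0" using M by (simp add: p invertible_det_nz det_eq_det3)
  then have "p \<noteq> 0" by auto
  let ?u = "\<lambda>w :: complex^2. w$1 *s ?b1 + w$2 *s ?b2"
  note tp = taylor_part_local_field[OF hf, of M, folded p]
  have jet: "det_radial (jet k (local_field F M)) w = - (\<Sum>m\<le>k. coeff (lpoly (pair F p) p (?u w)) (Suc m))" for k w
  proof -
    have "det_radial (jet k (local_field F M)) w = (\<Sum>m\<le>k. det_radial (taylor_part (local_field F M) m) w)"
      by (simp add: det_radial_def jet_def sum_distrib_right sum_subtractf)
    also have "\<dots> = (\<Sum>m\<le>k. - coeff (lpoly (pair F p) p (?u w)) (Suc m))"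
      by (rule sum.cong[OF refl])
        (simp add: det_radial_def tp lpoly_pair_basis[OF hf] lpoly_pair_linear[OF hf] mult.commute add.commute del: dot_algebra)
    finally show ?thesis by (simp add: sum_negf)
  qed
  have k2: "kap F p \<ge> 2" using kap_ge_2 \<open>p \<noteq> 0\<close> p by blast
  have low: "coeff (lpoly (pair F p) p u) j = 0" if "j < kap F p" for u j
    using vanishes_kap[of p] that by (simp add: vanishes_iff)
  obtain x y where xy: "coeff (lpoly (pair F p) p (x *s ?b1 + y *s ?b2)) (kap F p) \<noteq> 0"
    using kap_basis[OF d] .
  have "det_radial (jet (kap F p - 1) (local_field F M)) (vector [x, y]) \<noteq> 0"
    unfolding jet using k2 xy low by (subst sum_single[of _ "kap F p - 1"]) auto
  moreover have "kap F p - 1 \<le> k" if "det_radial (jet k (local_field F M)) w \<noteq> 0" for k w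
  proof (rule ccontr)
    assume "\<not> kap F p - 1 \<le> k"
    then have "det_radial (jet k (local_field F M)) w = 0" unfolding jet using low by simp
    then show False using that by blast
  qed
  ultimately show ?thesis
    unfolding tangency_order_def mult using k2 by (intro Least_equality) auto
qed

text \<open>Replaces the existential over affine coordinates by data at \<open>p\<close>. Another
  chart changes the representative of the point by a factor, which rescales \<open>jf\<close> and
  leaves \<open>kap\<close> unchanged.\<close>

lemma radial_iff:
  assumes "p \<noteq> 0"
  shows "radial_singularity F (vec.span {p}) k \<longleftrightarrow>
    k \<ge> 1 \<and> F p = 0 \<and> (\<exists>a w. jf F p a w \<noteq> 0) \<and> kap F p = k + 2"
proof
  assume r: "radial_singularity F (vec.span {p}) k"
  then obtain M where M: "invertible M" "vec.span {p} = vec.span {M *v axis 3 1}"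
    "algebraic_multiplicity (local_field F M) = 1" "tangency_order (local_field F M) = k + 1"
    by (auto simp: radial_singularity_def centered_at_def)
  have k: "k \<ge> 1" "F p = 0" using r singular_span[OF assms] by (auto simp: radial_singularity_def)
  have nz: "M *v axis 3 1 \<noteq> 0" using M(1) by (simp add: invertible_mult_eq_0)
  have "M *v axis 3 1 \<in> vec.span {p}" unfolding M(2) by (rule vec.span_base) simp
  then obtain c where c: "M *v axis 3 1 = c *s p" by (auto simp: in_span1)
  then have c0: "c \<noteq> 0" using nz by auto
  have F0: "F (M *v axis 3 1) = 0" using k by (simp add: c hform_scale[OF hf])
  have "\<exists>a w. jf F p a w \<noteq> 0"
    using algebraic_multiplicity_1[OF M(1) refl F0] M(3) by (simp add: c jf_scale[OF hf])
  moreover have "kap F p - 1 = k + 1"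
    using tangency_order_kap[OF M(1) refl F0 M(3)] M(4) by (simp add: c kap_smult[OF c0])
  ultimately show "k \<ge> 1 \<and> F p = 0 \<and> (\<exists>a w. jf F p a w \<noteq> 0) \<and> kap F p = k + 2" using k by simp
next
  assume *: "k \<ge> 1 \<and> F p = 0 \<and> (\<exists>a w. jf F p a w \<noteq> 0) \<and> kap F p = k + 2"
  obtain a b where d: "det3 a b p \<noteq> 0" using complete_basis1[OF assms] .
  let ?M = "mat3 a b p"
  have M: "invertible ?M" "p = ?M *v axis 3 1" using d by (auto simp: invertible_mat3)
  have "algebraic_multiplicity (local_field F ?M) = 1" using algebraic_multiplicity_1[OF M] * by blast
  moreover from this have "tangency_order (local_field F ?M) = k + 1" using tangency_order_kap[OF M] * by simp
  ultimately show "radial_singularity F (vec.span {p}) k"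
    unfolding radial_singularity_def centered_at_def using * singular_span[OF assms] M by auto
qed

end

section \<open>Restriction to lines, degree\<close>

lemma invariant_lineD: "invariant_line F l \<Longrightarrow> v \<in> l \<Longrightarrow> w \<in> l \<Longrightarrow> F v \<odot> w = 0"
  by (auto simp: invariant_line_def)

text \<open>Write \<open>p + t q\<close> as \<open>t\<close> times \<open>q + p / t\<close>:
  exchanging the two points reverses the coefficients, so orders of vanishing at both ends of a line
  are visible in one polynomial.\<close>

lemma coeff_lpoly_reverse:
  assumes f: "homogeneous_poly n f" and "i \<le> n"
  shows "coeff (lpoly f p q) i = coeff (lpoly f q p) (n - i)"
proof -
  let ?c = "coeff (lpoly f q p)"
  define R where "R = (\<Sum>j\<le>n. monom (?c j) (n - j))"
  have sum: "f (q + t *s p) = (\<Sum>j\<le>n. ?c j * t ^ j)" for t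
    using arg_cong[OF poly_as_sum_of_monoms'[OF degree_lpoly[OF f]], of "\<lambda>q. poly q t"]
    by (simp add: poly_sum poly_monom poly_lpoly[OF f])
  have eq: "poly (lpoly f p q) t = poly R t" if t: "t \<noteq> 0" for t
  proof -
    have e: "p + t *s q = t *s (q + (1 / t) *s p)" using t by (simp add: vec_eq_iff field_simps)
    have "poly (lpoly f p q) t = t ^ n * (\<Sum>j\<le>n. ?c j * (1 / t) ^ j)"
      unfolding poly_lpoly[OF f] e homogeneous_poly_scale[OF f] sum ..
    also have "\<dots> = (\<Sum>j\<le>n. ?c j * t ^ (n - j))"
      unfolding sum_distrib_left
    proof (rule sum.cong[OF refl])
      fix j assume "j \<in> {..n}"
      then have "t ^ n = t ^ j * t ^ (n - j)" by (simp flip: power_add)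
      then show "t ^ n * (?c j * (1 / t) ^ j) = ?c j * t ^ (n - j)"
        using t by (simp add: power_divide)
    qed
    finally show ?thesis by (simp add: R_def poly_sum poly_monom)
  qed
  have "UNIV - {0} \<subseteq> {t. poly (lpoly f p q - R) t = 0}" using eq by auto
  moreover have "infinite (UNIV - {0 :: complex})" using infinite_UNIV_char_0 by (simp add: infinite_remove)
  ultimately have "infinite {t. poly (lpoly f p q - R) t = 0}" using finite_subset by blast
  then have "lpoly f p q - R = 0" using poly_roots_finite by blast
  then have "coeff (lpoly f p q) i = coeff R i" by simp
  also have "\<dots> = ?c (n - i)"
    unfolding R_def coeff_sum by (subst sum_single[of _ "n - i"]) (use assms(2) in auto)
  finally show ?thesis .
qed

lemma sum_order_eq_degree:
  fixes q :: "complex poly"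
  assumes "q \<noteq> 0"
  shows "(\<Sum>x | poly q x = 0. order x q) = degree q"
  using size_proots_complex[of q] assms by (simp add: size_multiset_overloaded_eq)

section \<open>Tangencies with a generic line\<close>

context projective_form
begin

text \<open>Along the line, \<open>lpoly_pair_self\<close> transfers the vanishing of
  \<open>F v \<odot> p\<close> to \<open>F v \<odot> b\<close>, and \<open>p\<close> and
  \<open>b\<close> span the line.\<close>

lemma invariant_line_span:
  assumes bp: "ccross b p \<noteq> 0" and z: "lpoly (pair F p) p b = 0"
  shows "invariant_line F (vec.span {b, p})"
proof -
  have z': "lpoly (pair F b) p b = 0" using lpoly_pair_self[OF hf, of p b] z by simp
  have 1: "F (p + t *s b) \<odot> p = 0" "F (p + t *s b) \<odot> b = 0" for t
    using poly_eq_0_on_line[OF hp z] poly_eq_0_on_line[OF hp z'] by auto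
  \<comment> \<open>The point \<open>b\<close> is not of the form \<open>p + t b\<close>; it lies at
    infinity of the parametrisation, where the value is the top coefficient.\<close>
  have 2: "F b \<odot> p = 0" using coeff_lpoly_top[OF hp, of p p b] z by simp
  have H: "F v \<odot> b = 0 \<and> F v \<odot> p = 0" if v: "v \<in> vec.span {b, p}" for v
  proof -
    obtain x y where v: "v = x *s b + y *s p" using v by (auto simp: in_span2)
    show ?thesis
    proof (cases "y = 0")
      case True
      then show ?thesis using v 2 hform_euler[OF hf, of b] by (simp add: hform_scale[OF hf])
    next
      case False
      then have e: "v = y *s (p + (x / y) *s b)" using v by (simp add: vec_eq_iff field_simps)
      show ?thesis unfolding e hform_scale[OF hf] using 1[of "x / y"] by simp
    qed
  qed
  show ?thesis
    unfolding invariant_line_def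
  proof (intro conjI ballI)
    fix v w assume v: "v \<in> vec.span {b, p}" and "w \<in> vec.span {b, p}"
    then obtain x y where "w = x *s b + y *s p" by (auto simp: in_span2)
    then show "F v \<odot> w = 0" using H[OF v] by simp
  qed (rule proj_line_span[OF bp])
qed

lemma line_tangency_nonroot:
  assumes M: "adapted_to M s l" and "F (M *v axis 3 1) \<odot> (M *v axis 1 1) \<noteq> 0"
  shows "zorder (\<lambda>u. local_field F M (vector [u, 0]) $ 2) 0 = 0"
proof -
  let ?b = "M *v axis 1 1" and ?p = "M *v axis 3 1"
  have "M *v vector [u, 0, 1] = ?p + u *s ?b" for u
    by (subst matrix_columns) (simp add: add.commute)
  then have e: "(\<lambda>u. local_field F M (vector [u, 0]) $ 2) = poly (- lpoly (pair F ?b) ?p ?b)"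
    by (auto simp: local_field_def Let_def pullback_nth poly_lpoly[OF hp])
  have "poly q holomorphic_on UNIV" for q :: "complex poly"
    by (auto simp: holomorphic_on_def field_differentiable_def intro: poly_DERIV has_field_derivative_at_within)
  then have "poly q analytic_on {0}" for q :: "complex poly"
    by (meson analytic_on_holomorphic open_UNIV subset_UNIV)
  then show ?thesis unfolding e
    by (rule zorder_eq_0I) (use assms(2) in \<open>simp add: poly_lpoly[OF hp]\<close>)
qed

text \<open>The chart coordinate \<open>u\<close> and the parameter \<open>t\<close> of
  \<open>q2 + t q1\<close> are related by a Moebius map taking 0 to \<open>t0\<close>. It preserves
  orders of vanishing, and rescaling the representative only adds a nonvanishing factor. The value
  is the same for every adapted \<open>M\<close>.\<close>

lemma line_tangency_root:
  assumes M: "adapted_to M (vec.span {q2 + t0 *s q1}) (vec.span {q1, q2})"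
    and q: "ccross q1 q2 \<noteq> 0" and nz: "lpoly (pair F q1) q2 q1 \<noteq> 0"
  shows "zorder (\<lambda>u. local_field F M (vector [u, 0]) $ 2) 0 = int (order t0 (lpoly (pair F q1) q2 q1))"
proof -
  define b p where "b = M *v axis 1 1" and "p = M *v axis 3 1"
  define w0 where "w0 = q2 + t0 *s q1"
  let ?\<phi> = "lpoly (pair F q1) q2 q1"
  define m where "m = order t0 ?\<phi>"
  obtain \<psi> where \<psi>: "?\<phi> = [:- t0, 1:] ^ m * \<psi>" "\<not> [:- t0, 1:] dvd \<psi>"
    using order_decomp[OF nz, of t0] unfolding m_def by blast
  then have \<psi>0: "poly \<psi> t0 \<noteq> 0" by (simp add: poly_eq_0_iff_dvd)
  have iM: "invertible M" and s: "vec.span {w0} = vec.span {p}" and l: "vec.span {q1, q2} = vec.span {b, p}"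
    using M by (auto simp: adapted_to_def centered_at_def b_def p_def w0_def)
  have p0: "p \<noteq> 0" unfolding p_def using iM by (simp add: invertible_mult_eq_0)
  have "p \<in> vec.span {w0}" unfolding s by (rule vec.span_base) simp
  then obtain c where c: "p = c *s w0" by (auto simp: in_span1)
  have c0: "c \<noteq> 0" using c p0 by auto
  have "b \<in> vec.span {q1, q2}" unfolding l by (rule vec.span_base) simp
  then obtain x y where xy: "b = x *s q1 + y *s q2" by (auto simp: in_span2)
  \<comment> \<open>\<open>\<alpha>\<close> and \<open>\<gamma>\<close> are the coordinates of
    \<open>b\<close> with respect to \<open>q1\<close> and \<open>p\<close>; \<open>\<alpha>\<close>
    is nonzero because \<open>b\<close> and \<open>p\<close> are independent.\<close>
  define \<gamma> where "\<gamma> = y / c"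
  define \<alpha> where "\<alpha> = x - y * t0"
  have b: "b = \<alpha> *s q1 + \<gamma> *s p"
    using c0 by (simp add: xy c w0_def \<gamma>_def \<alpha>_def vec_eq_iff algebra_simps)
  have det: "det3 b (M *v axis 2 1) p \<noteq> 0"
    using iM by (simp add: b_def p_def invertible_det_nz det_eq_det3)
  have \<alpha>0: "\<alpha> \<noteq> 0"
  proof
    assume "\<alpha> = 0"
    then show False using det b by simp
  qed
  define S where "S = {u. 1 + u * \<gamma> \<noteq> 0}"
  \<comment> \<open>\<open>\<tau> u\<close> is the parameter of the point with chart coordinate
    \<open>u\<close>, and \<open>g\<close> collects what remains of the local equation after the
    factor \<open>u ^ m\<close> is removed.\<close>
  define \<tau> where "\<tau> u = t0 + u * \<alpha> / ((1 + u * \<gamma>) * c)" for u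
  define g where "g u = - (((1 + u * \<gamma>) * c) ^ n * (\<alpha> / (1 + u * \<gamma>)) * (\<alpha> / ((1 + u * \<gamma>) * c)) ^ m * poly \<psi> (\<tau> u))" for u
  have "S = - (\<lambda>u. 1 + u * \<gamma>) -` {0}" by (auto simp: S_def)
  then have "open S" by (auto intro!: open_Compl closed_vimage continuous_intros simp: S_def)
  moreover have "0 \<in> S" by (simp add: S_def)
  moreover have "g holomorphic_on S"
    unfolding g_def \<tau>_def using c0 by (intro holomorphic_intros) (auto simp: S_def)
  moreover have "g 0 \<noteq> 0" using c0 \<alpha>0 \<psi>0 by (simp add: g_def \<tau>_def)
  moreover have "local_field F M (vector [u, 0]) $ 2 = g u * (u - 0) powi int m" if u: "u \<in> S" "u \<noteq> 0" for u
  proof -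
    have u1: "1 + u * \<gamma> \<noteq> 0" using u by (simp add: S_def)
    define w where "w = q2 + \<tau> u *s q1"
    have "M *v vector [u, 0, 1] = p + u *s b"
      by (subst matrix_columns) (simp add: add.commute b_def p_def)
    also have "\<dots> = ((1 + u * \<gamma>) * c) *s q2 + ((1 + u * \<gamma>) * c * t0 + u * \<alpha>) *s q1"
      by (simp add: b c w0_def vec_eq_iff algebra_simps)
    also have "(1 + u * \<gamma>) * c * t0 + u * \<alpha> = (1 + u * \<gamma>) * c * \<tau> u"
      using u1 c0 by (simp add: \<tau>_def distrib_left)
    also have "((1 + u * \<gamma>) * c) *s q2 + ((1 + u * \<gamma>) * c * \<tau> u) *s q1 = ((1 + u * \<gamma>) * c) *s w"
      by (simp add: w_def vec_eq_iff algebra_simps)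
    finally have Mw: "M *v vector [u, 0, 1] = ((1 + u * \<gamma>) * c) *s w" .
    have "local_field F M (vector [u, 0]) $ 2 = - (((1 + u * \<gamma>) * c) ^ n * (F w \<odot> b))"
      by (simp add: local_field_def Let_def pullback_nth Mw hform_scale[OF hf] flip: b_def)
    also have "F w \<odot> b = F w \<odot> q1 * (\<alpha> + \<gamma> * c * (t0 - \<tau> u))"
    proof -
      have e: "p = c *s (w + (t0 - \<tau> u) *s q1)" by (simp add: c w0_def w_def vec_eq_iff algebra_simps)
      have "F w \<odot> p = c * (t0 - \<tau> u) * (F w \<odot> q1)"
        unfolding e using hform_euler[OF hf, of w] by (simp add: algebra_simps)
      moreover have "F w \<odot> b = \<alpha> * (F w \<odot> q1) + \<gamma> * (F w \<odot> p)" by (simp add: b)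
      ultimately show ?thesis by (simp only:) (simp add: algebra_simps)
    qed
    also have "\<alpha> + \<gamma> * c * (t0 - \<tau> u) = \<alpha> / (1 + u * \<gamma>)"
    proof -
      have "c * (t0 - \<tau> u) = - (u * \<alpha> / (1 + u * \<gamma>))" using c0 by (simp add: \<tau>_def)
      then have "\<alpha> + \<gamma> * c * (t0 - \<tau> u) = \<alpha> - \<gamma> * (u * \<alpha> / (1 + u * \<gamma>))"
        by (simp add: mult.assoc)
      also have "\<dots> = \<alpha> / (1 + u * \<gamma>)" using u1 by (simp add: divide_simps) (simp add: algebra_simps)
      finally show ?thesis .
    qed
    also have "F w \<odot> q1 = (u * (\<alpha> / ((1 + u * \<gamma>) * c))) ^ m * poly \<psi> (\<tau> u)"
    proof -
      have "F w \<odot> q1 = poly ?\<phi> (\<tau> u)" by (simp add: w_def poly_lpoly[OF hp])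
      then show ?thesis by (simp add: \<psi>(1) \<tau>_def)
    qed
    also have "(u * (\<alpha> / ((1 + u * \<gamma>) * c))) ^ m = u ^ m * (\<alpha> / ((1 + u * \<gamma>) * c)) ^ m"
      by (rule power_mult_distrib)
    finally show ?thesis by (simp add: g_def)
  qed
  ultimately show ?thesis unfolding m_def[symmetric] by (intro zorder_eqI)
qed

text \<open>On a non-invariant line take \<open>q1, q2\<close> with
  \<open>F q1 \<odot> q2 \<noteq> 0\<close>. Then \<open>q1\<close> is no tangency, and all
  tangencies are the points \<open>q2 + t q1\<close> with \<open>t\<close> a root of
  \<open>?\<phi>\<close>, counted with multiplicity. So their number is the degree of
  \<open>?\<phi>\<close>, which is \<open>n - 1\<close>.\<close>

lemma has_degree_eq:
  assumes "has_degree F d"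
  shows "n = d + 1"
proof -
  obtain k G where G: "homogeneous_poly k G" "\<exists>a. G a \<noteq> 0"
    and deg: "\<And>a. a \<noteq> 0 \<Longrightarrow> G a \<noteq> 0 \<Longrightarrow> \<not> invariant_line F (line_of_equation a) \<and>
      (\<Sum>s\<in>{s. proj_point s \<and> s \<subseteq> line_of_equation a \<and> line_tangency F (line_of_equation a) s > 0}.
         line_tangency F (line_of_equation a) s) = d"
    using assms unfolding has_degree_def Let_def by blast
  obtain a where a: "a \<noteq> 0" "G a \<noteq> 0"
  proof -
    obtain b where b: "G b \<noteq> 0" using G by blast
    \<comment> \<open>\<open>G\<close> may be a nonzero constant, so a coordinate function is
      included to keep the chosen vector away from 0.\<close>
    obtain v where "\<forall>f\<in>{G, \<lambda>v. v$1}. f v \<noteq> 0"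
    proof -
      have "\<exists>v. \<forall>f\<in>{G, \<lambda>v. v$1}. f v \<noteq> 0"
      proof (rule common_nonzero)
        show "\<exists>n. homogeneous_poly n f" if "f \<in> {G, \<lambda>v. v$1}" for f
          using that G(1) homogeneous_poly_coord by auto
        show "\<exists>v. f v \<noteq> 0" if "f \<in> {G, \<lambda>v. v$1}" for f
          using that b by (auto intro: exI[of _ "axis 1 1"])
      qed simp
      then show ?thesis using that by blast
    qed
    then have "v \<noteq> 0" "G v \<noteq> 0" by auto
    then show ?thesis by (rule that)
  qed
  let ?l = "line_of_equation a"
  have l: "proj_line ?l" using proj_line_of_normal[OF a(1)] by (simp add: line_of_equation_def)
  then obtain q1 q2 where q12: "q1 \<in> ?l" "q2 \<in> ?l" "F q1 \<odot> q2 \<noteq> 0"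
    using deg[OF a] unfolding invariant_line_def by blast
  have q: "ccross q1 q2 \<noteq> 0"
  proof
    assume *: "ccross q1 q2 = 0"
    have "q2 \<noteq> 0" using q12 by auto
    then obtain c where c: "q1 = c *s q2" using ccross_eq_0_right * by blast
    then show False using q12(3) hform_euler[OF hf, of q2] by (simp add: hform_scale[OF hf])
  qed
  have lq: "?l = vec.span {q1, q2}" by (rule proj_line_through[OF l q12(1,2) q])
  have q0: "q1 \<noteq> 0" "q2 \<noteq> 0" using ccross_nonzeroD[OF q] by auto
  let ?\<phi> = "lpoly (pair F q1) q2 q1"
  have "coeff (lpoly (pair F q2) q2 q1) n = F q1 \<odot> q2" by (rule coeff_lpoly_top[OF hp])
  then have c1: "coeff ?\<phi> (n - 1) \<noteq> 0"
    using q12(3) n1 by (cases n) (auto simp: lpoly_pair_self[OF hf])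
  \<comment> \<open>The coefficient in degree \<open>n\<close> is \<open>F q1 \<odot> q1\<close>,
    zero by Euler, so the degree drops by exactly one.\<close>
  have "coeff ?\<phi> n = 0" using coeff_lpoly_top[OF hp, of q1 q2 q1] hform_euler[OF hf, of q1] by simp
  then have "degree ?\<phi> \<noteq> n" using c1 by (metis coeff_0 leading_coeff_0_iff)
  then have deg\<phi>: "degree ?\<phi> = n - 1"
    using degree_lpoly[OF hp, of q1 q2 q1] le_degree[OF c1] by linarith
  have \<phi>0: "?\<phi> \<noteq> 0" using c1 by auto
  define s where "s t = vec.span {q2 + t *s q1}" for t
  have nz: "q2 + t *s q1 \<noteq> 0" for t
  proof
    assume "q2 + t *s q1 = 0"
    then have "ccross q1 (q2 + t *s q1) = 0" by simp
    then show False using q by (simp add: vec3_eq_iff algebra_simps)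
  qed
  \<comment> \<open>\<open>line_tangency\<close> picks its chart with \<open>SOME\<close>. Existence
    is shown here; since \<open>line_tangency_root\<close> holds for every adapted chart, the choice
    is immaterial.\<close>
  have adapted: "\<exists>M. adapted_to M s' ?l" if s': "proj_point s'" "s' \<subseteq> ?l" for s'
  proof -
    obtain p where p: "p \<noteq> 0" "s' = vec.span {p}" using proj_pointE[OF s'(1)] .
    then have "p \<in> ?l" using s' by (auto intro: vec.span_base)
    then obtain b where b: "ccross b p \<noteq> 0" "?l = vec.span {b, p}" using proj_lineE1[OF l _ p(1)] by blast
    obtain e where "det3 e b p \<noteq> 0" using complete_basis[OF b(1)] .
    then have "det3 b e p \<noteq> 0" using det3_swap(2)[of e b p] by simp
    then have "adapted_to (mat3 b e p) s' ?l" by (simp add: adapted_to_def centered_at_def invertible_mat3 p b)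
    then show ?thesis by blast
  qed
  have tan: "line_tangency F ?l s' = nat (zorder (\<lambda>u. local_field F (SOME M. adapted_to M s' ?l) (vector [u, 0]) $ 2) 0)" for s'
    by (simp add: line_tangency_def Let_def)
  have s_in: "proj_point (s t)" "s t \<subseteq> ?l" for t
  proof -
    show "proj_point (s t)" unfolding s_def using nz by (rule proj_point_span)
    have "q2 + t *s q1 \<in> vec.span {q1, q2}" 
      unfolding in_span2 by (rule exI[of _ t], rule exI[of _ 1]) (simp add: add.commute)
    then show "s t \<subseteq> ?l" unfolding s_def lq span1_subset .
  qed
  have root: "line_tangency F ?l (s t) = order t ?\<phi>" for t
  proof -
    have "adapted_to (SOME M. adapted_to M (s t) ?l) (s t) ?l" using someI_ex[OF adapted[OF s_in]] .
    from line_tangency_root[OF this[unfolded s_def lq] q \<phi>0] show ?thesis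
      unfolding tan unfolding s_def lq by simp
  qed
  have nonroot: "line_tangency F ?l (vec.span {q1}) = 0"
  proof -
    have "q1 \<in> vec.span {q1, q2}" by (rule vec.span_base) simp
    then have s1: "proj_point (vec.span {q1})" "vec.span {q1} \<subseteq> ?l"
      using q0 unfolding lq span1_subset by (auto intro: proj_point_span)
    define M where "M = (SOME M. adapted_to M (vec.span {q1}) ?l)"
    have M: "adapted_to M (vec.span {q1}) ?l" unfolding M_def using someI_ex[OF adapted[OF s1]] .
    define b p where "b = M *v axis 1 1" and "p = M *v axis 3 1"
    have iM: "invertible M" and s: "vec.span {q1} = vec.span {p}" and l: "vec.span {q1, q2} = vec.span {b, p}"
      using M by (auto simp: adapted_to_def centered_at_def b_def p_def lq)
    have "p \<noteq> 0" unfolding p_def using iM by (simp add: invertible_mult_eq_0)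
    have "p \<in> vec.span {q1}" unfolding s by (rule vec.span_base) simp
    then obtain c where c: "p = c *s q1" by (auto simp: in_span1)
    have "b \<in> vec.span {q1, q2}" unfolding l by (rule vec.span_base) simp
    then obtain x y where xy: "b = x *s q1 + y *s q2" by (auto simp: in_span2)
    have det: "det3 b (M *v axis 2 1) p \<noteq> 0"
      using iM by (simp add: b_def p_def invertible_det_nz det_eq_det3)
    have "y \<noteq> 0" using det unfolding xy c by auto
    have "F p \<odot> b = c ^ n * y * (F q1 \<odot> q2)"
      using hform_euler[OF hf, of q1] by (simp add: c xy hform_scale[OF hf])
    then have "F p \<odot> b \<noteq> 0" using \<open>y \<noteq> 0\<close> \<open>p \<noteq> 0\<close> c q12(3) by auto
    then show ?thesis
      using line_tangency_nonroot[OF M] unfolding tan M_def[symmetric] b_def p_def by simp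
  qed
  have T: "{s'. proj_point s' \<and> s' \<subseteq> ?l \<and> line_tangency F ?l s' > 0} = s ` {t. poly ?\<phi> t = 0}"
  proof (intro equalityI subsetI)
    fix s' assume s': "s' \<in> {s'. proj_point s' \<and> s' \<subseteq> ?l \<and> line_tangency F ?l s' > 0}"
    then obtain p where p: "p \<noteq> 0" "s' = vec.span {p}" using proj_pointE by blast
    then have "p \<in> ?l" using s' by (auto intro: vec.span_base)
    then obtain x y where xy: "p = x *s q1 + y *s q2" by (auto simp: lq in_span2)
    have "y \<noteq> 0"
    proof
      assume "y = 0"
      then have "s' = vec.span {q1}" using p xy q0 by (simp add: span1_eq_iff)
      then show False using s' nonroot by simp
    qed
    then have e: "p = y *s (q2 + (x / y) *s q1)" using xy by (simp add: vec_eq_iff field_simps)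
    have st: "s' = s (x / y)" unfolding s_def p(2) e by (rule span1_smult[OF \<open>y \<noteq> 0\<close> nz])
    then have "order (x / y) ?\<phi> > 0" using s' root by simp
    then have "poly ?\<phi> (x / y) = 0" using \<phi>0 by (simp add: order_root)
    then show "s' \<in> s ` {t. poly ?\<phi> t = 0}" using st by blast
  next
    fix s' assume "s' \<in> s ` {t. poly ?\<phi> t = 0}"
    then show "s' \<in> {s'. proj_point s' \<and> s' \<subseteq> ?l \<and> line_tangency F ?l s' > 0}"
      using s_in root \<phi>0 by (auto simp: order_root)
  qed
  have inj: "inj_on s {t. poly ?\<phi> t = 0}"
  proof (rule inj_onI)
    fix t t' assume "s t = s t'"
    then have "ccross (q2 + t *s q1) (q2 + t' *s q1) = 0" using nz span1_eq_iff by (simp add: s_def)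
    moreover have "ccross (q2 + t *s q1) (q2 + t' *s q1) = (t - t') *s ccross q1 q2"
      by (simp add: vec3_eq_iff algebra_simps)
    ultimately show "t = t'" using q by simp
  qed
  have "d = (\<Sum>t | poly ?\<phi> t = 0. order t ?\<phi>)"
    using deg[OF a] unfolding T sum.reindex[OF inj] by (simp add: root)
  also have "\<dots> = n - 1" using sum_order_eq_degree[OF \<phi>0] deg\<phi> by simp
  finally show ?thesis using n1 by simp
qed

end

section \<open>Lines through two points of high order\<close>

context projective_foliation
begin

text \<open>On the line \<open>p q\<close> the polynomial \<open>?k\<close> has no coefficient below
  degree \<open>kap F p - 1\<close> (polar of \<open>p\<close>, shifted by one) and none above
  \<open>n - kap F q\<close> (polar of \<open>q\<close>, reversed). The assumption leaves no degree
  in between.\<close>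

lemma joined:
  assumes pq: "ccross p q \<noteq> 0" and "F p = 0" "F q = 0"
    and a: "kap F p + kap F q \<ge> n + 2"
  shows "invariant_line F (vec.span {p, q})"
proof -
  let ?h = "lpoly (pair F p) p q" and ?k = "lpoly (pair F q) p q"
  have p0: "p \<noteq> 0" "q \<noteq> 0" using ccross_nonzeroD[OF pq] by auto
  have hk: "?h = - pCons 0 ?k" by (rule lpoly_pair_self[OF hf])
  have low: "coeff ?h j = 0" if "j < kap F p" for j
    using vanishes_kap[of p] that by (simp add: vanishes_iff)
  have "coeff ?k j = 0" for j
  proof (cases "Suc j < kap F p")
    case True
    then have "coeff ?h (Suc j) = 0" using low by blast
    then show ?thesis by (simp add: hk)
  next
    case False
    show ?thesis
    proof (cases "j \<le> n")
      case True
      then have "coeff ?k j = coeff (lpoly (pair F q) q p) (n - j)" by (rule coeff_lpoly_reverse[OF hp])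
      moreover have "n - j < kap F q" using False a True by linarith
      ultimately show ?thesis using vanishes_kap[of q] by (simp add: vanishes_iff)
    next
      case False
      then show ?thesis using degree_lpoly[OF hp, of q p q] by (simp add: coeff_eq_0)
    qed
  qed
  then have "?k = 0" by (simp add: poly_eq_iff)
  then have "?h = 0" using hk by simp
  moreover have "ccross q p \<noteq> 0" using pq ccross_antisym[of p q] by auto
  ultimately have "invariant_line F (vec.span {q, p})" using invariant_line_span by blast
  then show ?thesis by (simp add: span2_commute)
qed

end

text \<open>Split \<open>f (p + v)\<close> into its homogeneous parts \<open>?g j v\<close> and
  differentiate each in \<open>v\<close>; every part loses one degree.\<close>

lemma coeff_lpoly_ddir:
  assumes f: "homogeneous_poly n f"
  shows "coeff (lpoly (ddir f w) p u) i = ddir (\<lambda>u. coeff (lpoly f p u) (Suc i)) w u"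
proof -
  let ?g = "\<lambda>j u. coeff (lpoly f p u) j"
  have hg: "homogeneous_poly j (?g j)" for j by (rule homogeneous_poly_coeff_lpoly[OF f])
  have g_big: "?g j = (\<lambda>_. 0)" if "j > n" for j
    using degree_lpoly[OF f] that by (intro ext coeff_eq_0) (meson le_less_trans)
  have sum: "f (p + v) = (\<Sum>j\<le>n. ?g j v)" for v
    using arg_cong[OF poly_as_sum_of_monoms'[OF degree_lpoly[OF f, of p v]], of "\<lambda>q. poly q 1"]
    by (simp add: poly_sum poly_monom poly_lpoly[OF f])
  \<comment> \<open>For \<open>j = 0\<close> the truncated exponent is 0 as well, but the part
    \<open>?g 0\<close> is constant and has derivative 0.\<close>
  define R where "R = (\<Sum>j\<le>n. monom (ddir (?g j) w u) (j - 1))"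
  have "lpoly (ddir f w) p u = R"
  proof (rule lpoly_eqI)
    fix t
    have "lpoly f (p + t *s u) w = (\<Sum>j\<le>n. lpoly (?g j) (t *s u) w)"
    proof (rule lpoly_eqI)
      fix s
      show "poly (\<Sum>j\<le>n. lpoly (?g j) (t *s u) w) s = f (p + t *s u + s *s w)"
        by (simp add: poly_sum poly_lpoly[OF hg] add.assoc sum)
    qed
    then have "ddir f w (p + t *s u) = (\<Sum>j\<le>n. ddir (?g j) w (t *s u))"
      by (simp add: ddir_def coeff_sum)
    also have "\<dots> = (\<Sum>j\<le>n. t ^ (j - 1) * ddir (?g j) w u)"
      by (intro sum.cong refl homogeneous_poly_scale homogeneous_poly_ddir hg)
    finally show "poly R t = ddir f w (p + t *s u)"
      by (simp add: R_def poly_sum poly_monom mult.commute)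
  qed
  then have "coeff (lpoly (ddir f w) p u) i = (\<Sum>j\<le>n. if j - 1 = i then ddir (?g j) w u else 0)"
    by (simp add: R_def coeff_sum)
  also have "\<dots> = ddir (?g (Suc i)) w u"
  proof (cases "Suc i \<le> n")
    case True
    have z: "(if j - 1 = i then ddir (?g j) w u else 0) = 0" if "j \<noteq> Suc i" for j
      using that homogeneous_poly_ddir_aux[OF hg[of 0], of w] by (cases j) simp_all
    have "(\<Sum>j\<le>n. if j - 1 = i then ddir (?g j) w u else 0) = (if Suc i - 1 = i then ddir (?g (Suc i)) w u else 0)"
      by (rule sum_single) (use z True in simp_all)
    then show ?thesis by simp
  next
    case False
    then have "(if j - 1 = i then ddir (?g j) w u else 0) = 0" if "j \<le> n" for j
      using that homogeneous_poly_ddir_aux[OF hg[of 0], of w] by (cases j) simp_all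
    then have "(\<Sum>j\<le>n. if j - 1 = i then ddir (?g j) w u else 0) = 0" by (intro sum.neutral) simp
    then show ?thesis using False g_big[of "Suc i"] by (simp add: ddir_const)
  qed
  finally show ?thesis .
qed

lemma vanishes_ddir:
  assumes "homogeneous_poly n f" "vanishes f p (Suc m)"
  shows "vanishes (ddir f w) p m"
proof -
  have "(\<lambda>u. coeff (lpoly f p u) (Suc j)) = (\<lambda>_. 0)" if "j < m" for j
    using assms(2) that by (auto simp: vanishes_iff)
  then show ?thesis by (auto simp: vanishes_iff coeff_lpoly_ddir[OF assms(1)] ddir_const)
qed

section \<open>Three radial singularities of order three\<close>

lemma lpoly_of_degree_5:
  assumes "degree q \<le> 5"
  shows "q = [:coeff q 0, coeff q 1, coeff q 2, coeff q 3, coeff q 4, coeff q 5:]"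
proof (rule poly_eqI)
  fix i
  consider "i = (0::nat)" | "i = (1::nat)" | "i = (2::nat)" | "i = (3::nat)" | "i = (4::nat)" | "i = (5::nat)" | "i > (5::nat)"
    by linarith
  then show "coeff q i = coeff [:coeff q 0, coeff q 1, coeff q 2, coeff q 3, coeff q 4, coeff q 5:] i"
    using assms by cases (auto simp: coeff_eq_0 coeff_pCons numeral_eq_Suc split: nat.splits)
qed

text \<open>The hypotheses say that the binary quintics with dehomogenisations \<open>q\<close>, \<open>r\<close> and \<open>q + r\<close> are
  divisible by the fourth powers of three distinct linear forms.\<close>

lemma fourth_powers_independent:
  fixes q r :: "complex poly"
  assumes "degree q \<le> 5" "\<And>j. j < 4 \<Longrightarrow> coeff q j = 0"
    and "degree r \<le> 5" "\<And>j. 2 \<le> j \<Longrightarrow> coeff r j = 0"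
    and s: "\<And>j. j < 4 \<Longrightarrow> coeff (pcompose (q + r) [:1, 1:]) j = 0"
  shows "r = 0"
proof -
  obtain a b where q: "q = [:0, 0, 0, 0, a, b:]"
  proof -
    have "coeff q 0 = 0" "coeff q 1 = 0" "coeff q 2 = 0" "coeff q 3 = 0" using assms(2) by simp_all
    then show ?thesis using lpoly_of_degree_5[OF assms(1)] that by metis
  qed
  obtain c d where r: "r = [:c, d:]"
  proof -
    have "coeff r 2 = 0" "coeff r 3 = 0" "coeff r 4 = 0" "coeff r 5 = 0" using assms(4) by simp_all
    then show ?thesis using lpoly_of_degree_5[OF assms(3)] that by (metis pCons_0_0)
  qed
  have e: "pcompose (q + r) [:1, 1:] = [:a + b + c + d, 4 * a + 5 * b + d, 6 * a + 10 * b, 4 * a + 10 * b, a + 5 * b, b:]"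
    by (simp add: q r pcompose_pCons algebra_simps)
  have "a + b + c + d = 0" "4 * a + 5 * b + d = 0" "6 * a + 10 * b = 0" "4 * a + 10 * b = 0"
    using s[of 0] s[of 1] s[of 2] s[of 3] unfolding e by (simp_all add: numeral_eq_Suc)
  then have "a = 0" "b = 0" "c = 0" "d = 0" by algebra+
  then show ?thesis by (simp add: r)
qed

locale quintic_foliation = projective_foliation F 6 for F
begin

text \<open>Differentiate the three polars in a direction \<open>q\<close> transversal to the line.
  The derivatives have degree 5, vanish to order 4 at their points, and the one for
  \<open>p3\<close> is the sum of the other two. Restricted to the line they are quintics divisible
  by fourth powers of distinct linear forms, so \<open>fourth_powers_independent\<close> makes the
  one of \<open>p2\<close> vanish. Then \<open>jf F p1\<close> is zero, against
  \<open>nz\<close>.\<close>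

lemma radial_not_aligned:
  assumes p12: "ccross p1 p2 \<noteq> 0" and p3: "p1 + p2 = p3"
    and k: "kap F p1 \<ge> 5" "kap F p2 \<ge> 5" "kap F p3 \<ge> 5"
    and F0: "F p1 = 0" and nz: "jf F p1 a w \<noteq> 0"
  shows False
proof -
  have ne: "p1 \<noteq> 0" "p2 \<noteq> 0" using ccross_nonzeroD[OF p12] by auto
  have p30: "p3 \<noteq> 0"
  proof
    assume "p3 = 0"
    then have "ccross p1 (p1 + p2) = 0" using p3 by simp
    then show False using p12 by (simp add: vec3_eq_iff algebra_simps)
  qed
  obtain q where d: "det3 q p1 p2 \<noteq> 0" using complete_basis[OF p12] .
  have h5: "homogeneous_poly 5 (ddir (pair F c) q)" for c
    using homogeneous_poly_ddir[OF hp, of c q] by simp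
  have van: "vanishes (ddir (pair F c) q) c 4" if "c \<noteq> 0" "kap F c \<ge> 5" for c
    using that kap_ge_iff[of c 5] vanishes_ddir[OF hp, of c c 4 q] by simp
  let ?A = "lpoly (ddir (pair F p1) q) p1 p2" and ?B = "lpoly (ddir (pair F p2) q) p1 p2"
  have "lpoly (ddir (pair F p3) q) p3 p2 = pcompose (?A + ?B) [:1, 1:]"
  proof (rule lpoly_eqI)
    fix t
    have d: "ddir (pair F p3) q v = ddir (pair F p1) q v + ddir (pair F p2) q v" for v
      using jf_add1[OF hf, of v p1 p2 q] p3 by (simp add: jf_def)
    have e: "p3 + t *s p2 = p1 + (1 + t) *s p2" by (simp add: p3[symmetric] vec_eq_iff algebra_simps)
    show "poly (pcompose (?A + ?B) [:1, 1:]) t = ddir (pair F p3) q (p3 + t *s p2)"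
      unfolding poly_pcompose poly_add poly_lpoly[OF h5] d e by simp
  qed
  then have s: "coeff (pcompose (?A + ?B) [:1, 1:]) j = 0" if "j < 4" for j
    using van[OF p30 k(3)] that by (metis vanishes_iff)
  have r: "coeff ?B j = 0" if "2 \<le> j" for j
  proof (cases "j \<le> 5")
    case True
    have "coeff ?B j = coeff (lpoly (ddir (pair F p2) q) p2 p1) (5 - j)"
      by (rule coeff_lpoly_reverse[OF h5 True])
    then show ?thesis using van[OF ne(2) k(2)] that by (simp add: vanishes_iff)
  next
    case False
    then show ?thesis using degree_lpoly[OF h5, of p2 p1 p2] by (simp add: coeff_eq_0)
  qed
  have "?B = 0"
    by (rule fourth_powers_independent[of ?A])
      (use degree_lpoly[OF h5] van[OF ne(1) k(1)] r s in \<open>auto simp: vanishes_iff\<close>)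
  \<comment> \<open>At parameter 0 the quintic \<open>?B\<close> takes the value
    \<open>jf F p1 p2 q\<close>. As \<open>jf\<close> at \<open>p1\<close> is alternating and zero
    on \<open>p1\<close>, this was its only free entry.\<close>
  then have B: "jf F p1 p2 q = 0"
    using coeff_lpoly_0[OF h5, of p2 p1 p2] by (simp add: jf_def)
  have sym: "jf F p1 u u = 0" for u using kap_ge_3[OF ne(1) F0] k by auto
  have B': "jf F p1 q p2 = 0"
    using sym[of "q + p2"] sym[of q] sym[of p2] B by (simp add: jf_add1[OF hf] jf_add2[OF hf])
  have z: "jf F p1 c p1 = 0" "jf F p1 p1 c = 0" for c
    using F0 by (simp_all add: jf_radial[OF hf] jf_radial'[OF hf])
  obtain x y s where a: "a = x *s q + y *s p1 + s *s p2" using det3_basis[OF d] .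
  obtain x' y' s' where w: "w = x' *s q + y' *s p1 + s' *s p2" using det3_basis[OF d] .
  have "jf F p1 a w = 0"
    unfolding a w
    by (simp add: jf_add1[OF hf] jf_add2[OF hf] jf_smult1[OF hf] jf_smult2[OF hf] z B B' sym)
  then show False using nz by blast
qed

end

section \<open>The Jacobian determinant\<close>

text \<open>The equation of the inflection divisor: at a nonsingular point, in a basis starting with
  the tangent direction \<open>u\<close>, it reduces to a nonzero multiple of
  \<open>jf F v u u\<close>, so it vanishes iff the tangent line has higher contact there.\<close>

definition Ed :: "(complex^3 \<Rightarrow> complex^3) \<Rightarrow> complex^3 \<Rightarrow> complex" where
  "Ed F v = det (\<chi> i j. ddir (\<lambda>v. F v $ i) (axis j 1) v)"

lemma homogeneous_poly_Ed:
  assumes "hform n F"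
  shows "homogeneous_poly (3 * (n - 1)) (Ed F)"
proof -
  have e: "3 * (n - 1) = (n - 1) + (n - 1) + (n - 1)" by simp
  have h: "homogeneous_poly (n - 1) (ddir (\<lambda>v. F v $ i) w)" for i w
    by (rule homogeneous_poly_ddir) (use assms in \<open>simp add: hform_def\<close>)
  show ?thesis
    unfolding Ed_def[abs_def] det_3 vec_lambda_beta e
    by (intro homogeneous_poly_add homogeneous_poly_diff homogeneous_poly_mult h)
qed

lemma jf_matrix:
  assumes "hform n F"
  shows "jf F v a w = a \<odot> ((\<chi> i j. ddir (\<lambda>v. F v $ i) (axis j 1) v) *v w)"
proof -
  have w: "w = w$1 *s axis 1 1 + w$2 *s axis 2 1 + w$3 *s axis 3 1"
    by (simp add: vec3_eq_iff axis_def)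
  have a: "a = a$1 *s axis 1 1 + a$2 *s axis 2 1 + a$3 *s axis 3 1"
    by (simp add: vec3_eq_iff axis_def)
  have "jf F v (axis i 1) (axis j 1) = ddir (\<lambda>v. F v $ i) (axis j 1) v" for i j
    by (simp add: jf_def)
  then show ?thesis
    by (subst a, subst w)
      (simp add: jf_add1[OF assms] jf_add2[OF assms] jf_smult1[OF assms] jf_smult2[OF assms]
        dot_3 matrix_vector_mult_def sum_3 axis_def algebra_simps)
qed

text \<open>A change of basis acts on the bilinear form \<open>jf F v\<close> by congruence, so
  \<open>Ed\<close> may be computed in whichever basis suits the point.\<close>

lemma det_jf:
  fixes M :: "complex^3^3"
  assumes "hform n F"
  shows "det (\<chi> i j. jf F v (M *v axis i 1) (M *v axis j 1)) = (det M)\<^sup>2 * Ed F v"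
proof -
  let ?J = "\<chi> i j. ddir (\<lambda>v. F v $ i) (axis j 1) v"
  have "(\<chi> i j. jf F v (M *v axis i 1) (M *v axis j 1)) = transpose M ** ?J ** M"
  proof -
    have "jf F v (M *v axis i 1) (M *v axis j 1) = (transpose M ** ?J ** M) $ i $ j" for i j
    proof -
      have 1: "(M *v axis j 1) $ k = M $ k $ j" for j k
        using exhaust_3[of j] by (auto simp: matrix_vector_mult_def sum_3 axis_def)
      have 2: "(?J *v w) $ k = ?J $ k $ 1 * w $ 1 + ?J $ k $ 2 * w $ 2 + ?J $ k $ 3 * w $ 3" for w k
        by (simp add: matrix_vector_mult_def sum_3)
      show ?thesis
        unfolding jf_matrix[OF assms] dot_3 2 1
        by (simp add: matrix_matrix_mult_def transpose_def sum_3 algebra_simps)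
    qed
    then show ?thesis by (simp add: vec_eq_iff)
  qed
  then show ?thesis by (simp add: det_mul power2_eq_square Ed_def)
qed

text \<open>In a basis \<open>e, b, v\<close> with \<open>b\<close> and \<open>v\<close> in the
  line, the 2 by 2 block of the Gram matrix on \<open>b, v\<close> is zero, which forces the 3 by 3
  determinant to be 0.\<close>

lemma Ed_invariant_line:
  assumes hf: "hform n F" and n: "n \<ge> 2" and l: "invariant_line F l" "v \<in> l"
  shows "Ed F v = 0"
proof (cases "v = 0")
  case True
  then show ?thesis
    using homogeneous_poly_scale[OF homogeneous_poly_Ed[OF hf], of 0 0] n by (simp add: power_0_left)
next
  case False
  obtain b where b: "ccross b v \<noteq> 0" "l = vec.span {b, v}"
    using proj_lineE1[OF _ l(2) False] l(1) unfolding invariant_line_def by metis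
  have bl: "b \<in> l" "v \<in> l" using b by (auto intro: vec.span_base)
  have vb: "v + t *s b \<in> l" for t unfolding b in_span2 by (rule exI[of _ t], rule exI[of _ 1]) (simp add: add.commute)
  obtain e where e: "det3 e b v \<noteq> 0" using complete_basis[OF b(1)] .
  have b0: "jf F v b b = 0"
  proof -
    have "lpoly (pair F b) v b = 0" by (rule lpoly_eqI) (simp add: invariant_lineD[OF l(1) vb bl(1)])
    then show ?thesis by (simp add: jf_def ddir_def)
  qed
  have "det (\<chi> i j. jf F v (mat3 e b v *v axis i 1) (mat3 e b v *v axis j 1)) = 0"
    by (simp add: det_3 b0 jf_radial[OF hf] jf_radial'[OF hf] invariant_lineD[OF l(1) bl(2)] bl)
  then show ?thesis using det_jf[OF hf, of v "mat3 e b v"] e by (simp add: det_mat3)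
qed

text \<open>In the basis \<open>u, b, p + t u\<close> the Jacobian determinant involves only the restrictions to the
  line \<open>p + t u\<close>.\<close>

lemma Ed_lpoly:
  assumes hf: "hform n F"
  defines "f u \<equiv> lpoly (pair F u)" and "m w a \<equiv> lpoly (\<lambda>v. jf F v a w)"
  shows "smult ((det3 u b p)\<^sup>2) (lpoly (Ed F) p u) =
    smult (of_nat n) (pderiv (f u p u) * (f b p u)\<^sup>2 - m b u p u * f u p u * f b p u
      - f u p u * f b p u * pderiv (f b p u) + m b b p u * (f u p u)\<^sup>2)"
    (is "?L = ?R")
proof -
  have "poly ?L t = poly ?R t" for t
  proof -
    let ?v = "p + t *s u"
    have "(det3 u b p)\<^sup>2 * Ed F ?v = det (\<chi> i j. jf F ?v (mat3 u b ?v *v axis i 1) (mat3 u b ?v *v axis j 1))"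
      unfolding det_jf[OF hf] det_mat3 by simp
    also have "\<dots> = of_nat n * (jf F ?v u u * (F ?v \<odot> b)\<^sup>2 - jf F ?v u b * (F ?v \<odot> u) * (F ?v \<odot> b)
      - (F ?v \<odot> u) * (F ?v \<odot> b) * jf F ?v b u + jf F ?v b b * (F ?v \<odot> u)\<^sup>2)"
      using hform_euler[OF hf, of ?v]
      by (simp add: det_3 jf_radial[OF hf] jf_radial'[OF hf] power2_eq_square algebra_simps del: dot_algebra)
    finally show ?thesis
      unfolding f_def m_def
      by (simp add: poly_lpoly[OF hform_pair[OF hf]] poly_lpoly[OF homogeneous_poly_jf[OF hf]]
          poly_lpoly[OF homogeneous_poly_Ed[OF hf]] poly_pderiv_lpoly[OF hform_pair[OF hf]] flip: jf_def)
  qed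
  then show ?thesis by (simp add: poly_eq_poly_eq_iff[symmetric] fun_eq_iff)
qed

lemma X_power_dvd_iff: "[:0, 1:] ^ m dvd q \<longleftrightarrow> (\<forall>j<m. coeff q j = 0)" for q :: "complex poly"
  using monom_1_dvd_iff'[of m q] by (simp add: monom_altdef)

lemma coeff_X_power_mult_0: "coeff ([:0, 1:] ^ m * q) m = poly q 0" for q :: "complex poly"
  using coeff_monom_mult[of 1 m q m] by (simp add: monom_altdef poly_0_coeff_0)

text \<open>A coefficient is polynomial in the direction. If \<open>u\<close> is a multiple of
  \<open>p\<close>, perturb it to \<open>u + t b\<close> with \<open>b\<close> independent of
  \<open>p\<close>; the coefficient is 0 for all \<open>t \<noteq> 0\<close>, hence at
  \<open>t = 0\<close>.\<close>

lemma vanishes_indep: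
  assumes f: "homogeneous_poly n f" and p: "p \<noteq> 0"
    and v: "\<And>u j. ccross u p \<noteq> 0 \<Longrightarrow> j < m \<Longrightarrow> coeff (lpoly f p u) j = 0"
  shows "vanishes f p m"
  unfolding vanishes_iff
proof (intro allI impI)
  fix u j assume j: "j < m"
  let ?g = "\<lambda>u. coeff (lpoly f p u) j"
  have g: "homogeneous_poly j ?g" by (rule homogeneous_poly_coeff_lpoly[OF f])
  show "?g u = 0"
  proof (cases "ccross u p = 0")
    case True
    obtain a b where "det3 a b p \<noteq> 0" using complete_basis1[OF p] .
    then have b: "ccross b p \<noteq> 0" by (auto simp: det3_def)
    have "poly (lpoly ?g u b) t = 0" if "t \<noteq> 0" for t
    proof -
      have "ccross (u + t *s b) p = ccross u p + t *s ccross b p" by (simp add: vec3_eq_iff algebra_simps)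
      then have "ccross (u + t *s b) p \<noteq> 0" using True b that by simp
      then show ?thesis unfolding poly_lpoly[OF g] using v j by blast
    qed
    then have "UNIV - {0} \<subseteq> {t. poly (lpoly ?g u b) t = 0}" by auto
    moreover have "infinite (UNIV - {0 :: complex})" using infinite_UNIV_char_0 by (simp add: infinite_remove)
    ultimately have "lpoly ?g u b = 0" using poly_roots_finite finite_subset by blast
    then show ?thesis using coeff_lpoly_0[OF g, of u b] by simp
  qed (use v j in blast)
qed

lemma order_plus_roots:
  fixes q :: "complex poly"
  assumes "q \<noteq> 0" "[:0, 1:] ^ k dvd q" "\<And>t. t \<in> S \<Longrightarrow> t \<noteq> 0 \<and> poly q t = 0"
  shows "k + card S \<le> degree q"
proof -
  obtain r where r: "q = [:0, 1:] ^ k * r" using assms(2) by (elim dvdE)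
  then have r0: "r \<noteq> 0" using assms(1) by auto
  have "S \<subseteq> {t. poly r t = 0}" using assms(3) by (auto simp: r)
  then have "card S \<le> card {t. poly r t = 0}" by (rule card_mono[OF poly_roots_finite[OF r0]])
  also have "\<dots> \<le> degree r" by (rule card_poly_roots_bound[OF r0])
  finally show ?thesis using r0 by (simp add: r degree_mult_eq degree_linear_power)
qed

context projective_foliation
begin

lemmas Ed_hom = homogeneous_poly_Ed[OF hf]

text \<open>\<open>X\<close> is the variable and \<open>Y\<close> stands for \<open>X ^ k\<close>;
  extracting the factor \<open>X ^ (k + 2)\<close> becomes ring algebra without symbolic
  exponents.\<close>

lemma Ed_leading_aux:
  fixes X :: "'a::comm_ring_1"
  shows "(Y * A) * (X * g)\<^sup>2 - m * (X * Y * f) * (X * g) - (X * Y * f) * (X * g) * (g + X * g') + m' * (X * Y * f)\<^sup>2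
    = X * X * Y * (A * g\<^sup>2 - m * f * g - f * g * (g + X * g') + Y * m' * f\<^sup>2)"
  by (simp add: power2_eq_square algebra_simps)

text \<open>Here \<open>?f\<close> is divisible by \<open>X ^ (k + 1)\<close> and \<open>?g\<close>
  by \<open>X\<close>, so every term of \<open>Ed_lpoly\<close> is divisible by
  \<open>X ^ (k + 2)\<close>. The term with \<open>jf F p b b\<close> carries an extra
  \<open>X ^ k\<close>; the factor \<open>0 ^ k\<close> records that it reaches the leading
  coefficient only for \<open>k = 0\<close>.\<close>

lemma Ed_leading:
  assumes p0: "F p = 0" and d: "det3 u b p \<noteq> 0" and k: "kap F p = k + 2"
  shows "\<forall>j<k+2. coeff (lpoly (Ed F) p u) j = 0"
    and "(det3 u b p)\<^sup>2 * coeff (lpoly (Ed F) p u) (k + 2) = of_nat n *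
      (of_nat k * coeff (lpoly (pair F u) p u) (Suc k) * (jf F p b u)\<^sup>2
       - jf F p u b * coeff (lpoly (pair F u) p u) (Suc k) * jf F p b u
       + 0 ^ k * jf F p b b * (coeff (lpoly (pair F u) p u) (Suc k))\<^sup>2)"
proof -
  let ?X = "[:0, 1:] :: complex poly"
  let ?f = "lpoly (pair F u) p u" and ?g = "lpoly (pair F b) p u"
  let ?m = "\<lambda>w a. lpoly (\<lambda>v. jf F v a w) p u"
  have "?X ^ (k + 2) dvd lpoly (pair F p) p u"
    unfolding X_power_dvd_iff using vanishes_kap[of p] k by (simp add: vanishes_iff)
  then have "coeff ?f j = 0" if "j < Suc k" for j
    using that lpoly_pair_basis[OF hf, of p u j] unfolding X_power_dvd_iff by simp
  then have "?X ^ Suc k dvd ?f" unfolding X_power_dvd_iff by blast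
  then obtain f1 where f1: "?f = ?X ^ Suc k * f1" by (elim dvdE)
  have f10: "poly f1 0 = coeff ?f (Suc k)" unfolding f1 coeff_X_power_mult_0 ..
  have "?X ^ 1 dvd ?g" unfolding X_power_dvd_iff using coeff_lpoly_0[OF hp, of b p u] p0 by simp
  then obtain g1 where g1: "?g = ?X * g1" by (auto elim!: dvdE)
  have g10: "poly g1 0 = jf F p b u"
    using coeff_X_power_mult_0[of 1 g1] by (simp add: jf_def ddir_def g1)
  have m: "poly (?m w a) 0 = jf F p a w" for w a
    by (simp add: poly_lpoly[OF homogeneous_poly_jf[OF hf]])
  define Q where "Q = (of_nat (Suc k) * f1 + ?X * pderiv f1) * g1\<^sup>2 - ?m b u * f1 * g1
    - f1 * g1 * (g1 + ?X * pderiv g1) + ?X ^ k * ?m b b * f1\<^sup>2"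
  have df: "pderiv ?f = ?X ^ k * (of_nat (Suc k) * f1 + ?X * pderiv f1)"
    unfolding f1 pderiv_mult pderiv_power_Suc
    by (simp add: pderiv_pCons algebra_simps of_nat_mult_conv_smult smult_add_left del: of_nat_Suc)
  have dg: "pderiv ?g = g1 + ?X * pderiv g1"
    unfolding g1 pderiv_mult by (simp add: pderiv_pCons)
  have "pderiv ?f * ?g\<^sup>2 - ?m b u * ?f * ?g - ?f * ?g * pderiv ?g + ?m b b * ?f\<^sup>2 = ?X ^ (k + 2) * Q"
  proof -
    have "?X ^ Suc k = ?X * ?X ^ k" "?X ^ (k + 2) = ?X * ?X * ?X ^ k" by (simp_all add: mult.assoc)
    then show ?thesis
      unfolding df dg unfolding f1 g1 Q_def
      by (simp only:) (rule Ed_leading_aux)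
  qed
  then have E: "smult ((det3 u b p)\<^sup>2) (lpoly (Ed F) p u) = smult (of_nat n) (?X ^ (k + 2) * Q)"
    using Ed_lpoly[OF hf, of u b p] by simp
  show "\<forall>j<k+2. coeff (lpoly (Ed F) p u) j = 0"
  proof (intro allI impI)
    fix j assume "j < k + 2"
    moreover have "?X ^ (k + 2) dvd ?X ^ (k + 2) * Q" by (rule dvd_triv_left)
    ultimately have "coeff (?X ^ (k + 2) * Q) j = 0" unfolding X_power_dvd_iff by blast
    then have "coeff (smult ((det3 u b p)\<^sup>2) (lpoly (Ed F) p u)) j = 0"
      unfolding E coeff_smult by (simp only: mult_zero_right)
    then show "coeff (lpoly (Ed F) p u) j = 0" using d by simp
  qed
  have "(det3 u b p)\<^sup>2 * coeff (lpoly (Ed F) p u) (k + 2) = of_nat n * poly Q 0"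
    using arg_cong[OF E, of "\<lambda>q. coeff q (k + 2)"] unfolding coeff_smult coeff_X_power_mult_0 .
  also have "poly Q 0 = of_nat k * coeff ?f (Suc k) * (jf F p b u)\<^sup>2
       - jf F p u b * coeff ?f (Suc k) * jf F p b u + 0 ^ k * jf F p b b * (coeff ?f (Suc k))\<^sup>2"
    by (simp add: Q_def m g10 f10 power2_eq_square algebra_simps)
  finally show "(det3 u b p)\<^sup>2 * coeff (lpoly (Ed F) p u) (k + 2) = of_nat n *
      (of_nat k * coeff ?f (Suc k) * (jf F p b u)\<^sup>2
       - jf F p u b * coeff ?f (Suc k) * jf F p b u
       + 0 ^ k * jf F p b b * (coeff ?f (Suc k))\<^sup>2)" .
qed

lemma det3_complete2:
  assumes "ccross u p \<noteq> 0"
  obtains b where "det3 u b p \<noteq> 0"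
proof -
  obtain b where "det3 b u p \<noteq> 0" using complete_basis[OF assms] .
  then show ?thesis using that det3_swap(2)[of b u p] by simp
qed

lemma Ed_vanishes:
  assumes "p \<noteq> 0" "F p = 0"
  shows "vanishes (Ed F) p (kap F p)"
proof -
  obtain k where k: "kap F p = k + 2" using kap_ge_2[OF assms] by (metis add.commute le_Suc_ex)
  show ?thesis unfolding k
  proof (rule vanishes_indep[OF Ed_hom assms(1)])
    fix u j assume "ccross u p \<noteq> 0" and j: "j < k + 2"
    then obtain b where "det3 u b p \<noteq> 0" using det3_complete2 by blast
    then show "coeff (lpoly (Ed F) p u) j = 0" using Ed_leading(1)[OF assms(2) _ k] j by blast
  qed
qed

lemma Ed_vanishes_Suc:
  assumes "p \<noteq> 0" "F p = 0"
    and z: "\<And>u. ccross u p \<noteq> 0 \<Longrightarrow> \<exists>b. det3 u b p \<noteq> 0 \<and> coeff (lpoly (Ed F) p u) (kap F p) = 0"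
  shows "vanishes (Ed F) p (Suc (kap F p))"
  using Ed_vanishes[OF assms(1,2)] z
  by (intro vanishes_indep[OF Ed_hom assms(1)]) (auto simp: less_Suc_eq vanishes_iff)

text \<open>Every term of the leading coefficient in \<open>Ed_leading\<close> contains an entry of
  \<open>jf\<close>, so a zero linear part raises the order by one.\<close>

lemma Ed_vanishes_zero_linear_part:
  assumes "p \<noteq> 0" "F p = 0" and z: "\<And>a w. jf F p a w = 0"
  shows "vanishes (Ed F) p (Suc (kap F p))"
proof (rule Ed_vanishes_Suc[OF assms(1,2)])
  fix u assume "ccross u p \<noteq> 0"
  then obtain b where b: "det3 u b p \<noteq> 0" using det3_complete2 by blast
  obtain k where k: "kap F p = k + 2" using kap_ge_2[OF assms(1,2)] by (metis add.commute le_Suc_ex)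
  show "\<exists>b. det3 u b p \<noteq> 0 \<and> coeff (lpoly (Ed F) p u) (kap F p) = 0"
    using Ed_leading(2)[OF assms(2) b k] b k z by (intro exI[of _ b]) simp
qed

text \<open>The case \<open>k = 0\<close>: the leading form is the quadratic form
  \<open>jf F p u u\<close> times the determinant of \<open>jf\<close> in the basis
  \<open>u, b\<close>.\<close>

lemma Ed_coeff_2:
  assumes "F p = 0" "det3 u b p \<noteq> 0" "kap F p = 2"
  shows "(det3 u b p)\<^sup>2 * coeff (lpoly (Ed F) p u) 2 =
    of_nat n * jf F p u u * (jf F p b b * jf F p u u - jf F p u b * jf F p b u)"
  using Ed_leading(2)[OF assms(1,2), of 0] assms(3)
  by (simp add: jf_def ddir_def power2_eq_square algebra_simps numeral_2_eq_2)

text \<open>The determinant in \<open>Ed_coeff_2\<close> is 0 when \<open>b\<close> is isotropic and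
  in a kernel. This uses the basis \<open>u, b\<close>; if \<open>u\<close> lies in the span of
  \<open>b\<close> and \<open>p\<close>, the other factor \<open>jf F p u u\<close> is 0
  instead.\<close>

lemma Ed_vanishes_degenerate:
  assumes p: "F p = 0" "kap F p = 2" and b: "ccross b p \<noteq> 0"
    and z: "jf F p b b = 0" "(\<forall>w. jf F p b w = 0) \<or> (\<forall>a. jf F p a b = 0)"
  shows "vanishes (Ed F) p 3"
proof -
  have p0: "p \<noteq> 0" using ccross_nonzeroD[OF b] by blast
  have "vanishes (Ed F) p (Suc (kap F p))"
  proof (rule Ed_vanishes_Suc[OF p0 p(1)])
    fix u assume u: "ccross u p \<noteq> 0"
    show "\<exists>b. det3 u b p \<noteq> 0 \<and> coeff (lpoly (Ed F) p u) (kap F p) = 0"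
    proof (cases "det3 u b p = 0")
      case False
      then show ?thesis using Ed_coeff_2[OF p(1) False p(2)] z p(2) by (intro exI[of _ b]) auto
    next
      case True
      then obtain x y where xy: "u = x *s b + y *s p" using in_span2_det3[OF b] in_span2 by blast
      have "jf F p u u = 0"
        unfolding xy by (simp add: jf_add1[OF hf] jf_add2[OF hf] jf_smult1[OF hf] jf_smult2[OF hf]
            jf_radial[OF hf] jf_radial'[OF hf] p z)
      moreover obtain c where c: "det3 u c p \<noteq> 0" using det3_complete2[OF u] .
      ultimately show ?thesis using Ed_coeff_2[OF p(1) c p(2)] p(2) by (intro exI[of _ c]) auto
    qed
  qed
  then show ?thesis using p by (simp add: numeral_3_eq_3)
qed

text \<open>The last hypothesis says that \<open>jf\<close> is not alternating, so some
  \<open>u\<close> off the direction \<open>b1\<close> has \<open>jf F p u u \<noteq> 0\<close>. As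
  \<open>b1\<close> is isotropic, the determinant in \<open>Ed_coeff_2\<close> is minus the product
  of the two mixed entries.\<close>

lemma Ed_nonzero:
  assumes p: "F p = 0" and d: "det3 b1 b2 p \<noteq> 0" and "jf F p b1 b1 = 0"
    "jf F p b1 b2 \<noteq> 0" "jf F p b2 b1 \<noteq> 0" "jf F p b1 b2 + jf F p b2 b1 \<noteq> 0"
  shows "\<exists>v. Ed F v \<noteq> 0"
proof -
  have p0: "p \<noteq> 0" using d by auto
  have "\<exists>u. det3 u b1 p \<noteq> 0 \<and> jf F p u u \<noteq> 0 \<and> jf F p u b1 * jf F p b1 u \<noteq> 0"
  proof (cases "jf F p b2 b2 = 0")
    case True
    \<comment> \<open>If \<open>b2\<close> is isotropic too, \<open>b1 + b2\<close> has value
      \<open>jf F p b1 b2 + jf F p b2 b1\<close>.\<close>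
    then have "det3 (b1 + b2) b1 p \<noteq> 0" using d det3_swap(2)[of b1 b2 p] by simp
    then show ?thesis using assms True by (intro exI[of _ "b1 + b2"]) (simp add: jf_add1[OF hf] jf_add2[OF hf] add.commute)
  next
    case False
    then show ?thesis using assms det3_swap(2)[of b1 b2 p] by (intro exI[of _ b2]) simp
  qed
  then obtain u where u: "det3 u b1 p \<noteq> 0" "jf F p u u \<noteq> 0" "jf F p u b1 * jf F p b1 u \<noteq> 0" by blast
  have "\<not> 3 \<le> kap F p" using kap_ge_3[OF p0 p] u by blast
  then have k: "kap F p = 2" using kap_ge_2[OF p0 p] by simp
  have "(det3 u b1 p)\<^sup>2 * coeff (lpoly (Ed F) p u) 2 \<noteq> 0"
    unfolding Ed_coeff_2[OF p u(1) k] using u assms(3) n2 by simp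
  then have "lpoly (Ed F) p u \<noteq> 0" by auto
  then obtain t where "poly (lpoly (Ed F) p u) t \<noteq> 0" using poly_all_0_iff_0 by blast
  then show ?thesis by (auto simp: poly_lpoly[OF Ed_hom])
qed

section \<open>Counting invariant lines\<close>

text \<open>Restrict \<open>Ed\<close> to a generic line through \<open>p\<close>. The restriction
  is nonzero of degree at most \<open>3 * (n - 1)\<close>, has order at least \<open>k\<close> at
  \<open>p\<close>, and has a further root at the intersection with each line of
  \<open>S\<close>.\<close>

lemma count_lines:
  assumes E: "\<exists>v. Ed F v \<noteq> 0" and p: "p \<noteq> 0"
    and S: "finite S" "\<And>l. l \<in> S \<Longrightarrow> invariant_line F l \<and> p \<notin> l"
    and k: "vanishes (Ed F) p k"
  shows "k + card S \<le> 3 * (n - 1)"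
proof -
  have "\<exists>a. \<forall>l\<in>S. a l \<noteq> 0 \<and> l = {v. a l \<odot> v = 0}"
  proof (rule bchoice, rule ballI)
    fix l assume "l \<in> S"
    then have "proj_line l" using S by (auto simp: invariant_line_def)
    then show "\<exists>a. a \<noteq> 0 \<and> l = {v. a \<odot> v = 0}" using proj_line_normal by metis
  qed
  then obtain a where a: "\<And>l. l \<in> S \<Longrightarrow> a l \<noteq> 0" "\<And>l. l \<in> S \<Longrightarrow> l = {v. a l \<odot> v = 0}" by blast
  have ap: "a l \<odot> p \<noteq> 0" if "l \<in> S" for l using S(2)[OF that] a(2)[OF that] by blast
  \<comment> \<open>\<open>h (l, l')\<close> vanishes in the directions for which the line through
    \<open>p\<close> meets \<open>l\<close> and \<open>l'\<close> at the same point; a generic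
    direction avoids all of these.\<close>
  define h where "h = (\<lambda>(l, l') u. (a l \<odot> p) * (u \<odot> a l') - (a l' \<odot> p) * (u \<odot> a l))"
  define A where "A = insert (Ed F) (h ` {(l, l') \<in> S \<times> S. l \<noteq> l'})"
  have "\<exists>v. \<forall>f\<in>A. f v \<noteq> 0"
  proof (rule common_nonzero)
    have "{(l, l') \<in> S \<times> S. l \<noteq> l'} \<subseteq> S \<times> S" by auto
    then show "finite A" unfolding A_def using S(1) finite_subset by blast
  next
    fix f assume f: "f \<in> A"
    have hom: "homogeneous_poly 1 (\<lambda>u. c * (u \<odot> x) - d * (u \<odot> y))" for c d and x y :: "complex^3"
      unfolding dot_3
      by (intro homogeneous_poly_diff homogeneous_poly_cmult homogeneous_poly_add homogeneous_poly_cmult' homogeneous_poly_coord)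
    show "\<exists>m. homogeneous_poly m f"
    proof (cases "f = Ed F")
      case True then show ?thesis using Ed_hom by blast
    next
      case False
      then obtain l l' where "f = h (l, l')" using f unfolding A_def by auto
      then show ?thesis unfolding h_def using hom by (simp only: prod.case) blast
    qed
  next
    fix f assume f: "f \<in> A"
    show "\<exists>v. f v \<noteq> 0"
    proof (cases "f = Ed F")
      case True then show ?thesis using E by simp
    next
      case False
      then obtain l l' where l: "l \<in> S" "l' \<in> S" "l \<noteq> l'" and f: "f = h (l, l')"
        using f unfolding A_def by auto
      let ?w = "(a l \<odot> p) *s a l' - (a l' \<odot> p) *s a l"
      have "?w \<noteq> 0"
      proof
        assume "?w = 0"
        then have eq: "(a l \<odot> p) *s a l' = (a l' \<odot> p) *s a l" by simp
        have "(a l \<odot> p) * (a l' \<odot> v) = (a l' \<odot> p) * (a l \<odot> v)" for v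
          using arg_cong[OF eq, of "\<lambda>w. w \<odot> v"] by simp
        then have "a l' \<odot> v = 0 \<longleftrightarrow> a l \<odot> v = 0" for v
          using ap l by (metis mult_eq_0_iff)
        then have "l = l'" using a(2)[OF l(1)] a(2)[OF l(2)] by blast
        then show False using l by simp
      qed
      then obtain e where "e \<odot> ?w \<noteq> 0" using dot_nondegenerate by blast
      then show ?thesis unfolding f h_def by (intro exI[of _ e]) simp
    qed
  qed
  then obtain u where u: "\<And>f. f \<in> A \<Longrightarrow> f u \<noteq> 0" by blast
  have Eu: "Ed F u \<noteq> 0" using u by (simp add: A_def)
  have au: "a l \<odot> u \<noteq> 0" if "l \<in> S" for l
  proof
    assume "a l \<odot> u = 0"
    then have "u \<in> l" using a(2)[OF that] by blast
    then show False using Ed_invariant_line[OF hf n2] S(2)[OF that] Eu by blast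
  qed
  define t where "t l = - (a l \<odot> p) / (a l \<odot> u)" for l
  have t: "t l \<noteq> 0 \<and> poly (lpoly (Ed F) p u) (t l) = 0" if "l \<in> S" for l
  proof
    show "t l \<noteq> 0" using ap[OF that] au[OF that] by (simp add: t_def)
    have "a l \<odot> (p + t l *s u) = 0" using au[OF that] by (simp add: t_def)
    then have "p + t l *s u \<in> l" using a(2)[OF that] by blast
    then show "poly (lpoly (Ed F) p u) (t l) = 0"
      unfolding poly_lpoly[OF Ed_hom] using Ed_invariant_line[OF hf n2] S(2)[OF that] by blast
  qed
  have inj: "inj_on t S"
  proof (rule inj_onI, rule ccontr)
    fix l l' assume l: "l \<in> S" "l' \<in> S" "t l = t l'" "l \<noteq> l'"
    then have "h (l, l') u \<noteq> 0" using u[of "h (l, l')"] by (auto simp: A_def)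
    moreover have "(a l \<odot> p) * (a l' \<odot> u) = (a l' \<odot> p) * (a l \<odot> u)"
      using l(3) au[OF l(1)] au[OF l(2)] by (simp add: t_def divide_simps mult.commute)
    ultimately show False by (simp add: h_def dot_commute)
  qed
  have nz: "lpoly (Ed F) p u \<noteq> 0"
    using coeff_lpoly_top[OF Ed_hom, of p u] Eu by auto
  have "k + card (t ` S) \<le> degree (lpoly (Ed F) p u)"
    by (rule order_plus_roots[OF nz]) (use k t in \<open>auto simp: X_power_dvd_iff vanishes_iff\<close>)
  also have "\<dots> \<le> 3 * (n - 1)" by (rule degree_lpoly[OF Ed_hom])
  finally show ?thesis by (simp add: card_image[OF inj])
qed

text \<open>A point where \<open>Ed\<close> is nonzero lies on no invariant line, so
  \<open>count_lines\<close> applies there with \<open>k = 0\<close> to all of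
  \<open>S\<close>.\<close>

lemma card_invariant_lines_le:
  assumes E: "\<exists>v. Ed F v \<noteq> 0" and S: "finite S" "\<And>l. l \<in> S \<Longrightarrow> invariant_line F l"
  shows "card S \<le> 3 * (n - 1)"
proof -
  obtain v where v: "Ed F v \<noteq> 0" using E by blast
  have "v \<noteq> 0" using v homogeneous_poly_scale[OF Ed_hom, of 0 0] n2 by (auto simp: power_0_left)
  then show ?thesis
    using count_lines[OF E, of v S 0] S Ed_invariant_line[OF hf n2] v by (auto simp: vanishes_iff)
qed

text \<open>The leading form \<open>?g\<close> of the polar at \<open>p\<close> vanishes in the
  direction of every invariant line through \<open>p\<close>. With \<open>?g u0 \<noteq> 0\<close>,
  each such line contains a point \<open>u1 + s u0\<close> for exactly one root \<open>s\<close> of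
  a nonzero polynomial of degree at most \<open>kap F p\<close>.\<close>

lemma card_lines_through_le_kap:
  assumes p: "p \<noteq> 0" "F p = 0"
  shows "finite {l. invariant_line F l \<and> p \<in> l} \<and> card {l. invariant_line F l \<and> p \<in> l} \<le> kap F p"
proof -
  let ?g = "\<lambda>u. coeff (lpoly (pair F p) p u) (kap F p)"
  let ?L = "{l. invariant_line F l \<and> p \<in> l}"
  have g: "homogeneous_poly (kap F p) ?g" by (rule homogeneous_poly_coeff_lpoly[OF hp])
  obtain b1 b2 where d: "det3 b1 b2 p \<noteq> 0" using complete_basis1[OF p(1)] .
  obtain x y where xy: "?g (x *s b1 + y *s b2) \<noteq> 0" using kap_basis[OF d] .
  define u0 where "u0 = x *s b1 + y *s b2"
  have gu0: "?g u0 \<noteq> 0" using xy by (simp add: u0_def)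
  have "\<exists>u1. det3 u0 u1 p \<noteq> 0"
  proof (cases "x = 0")
    case False then show ?thesis using d by (intro exI[of _ b2]) (simp add: u0_def)
  next
    case True
    have "y \<noteq> 0"
    proof
      assume "y = 0"
      then have "u0 = 0 *s u0" using True by (simp add: u0_def)
      then show False using homogeneous_poly_scale[OF g, of 0 u0] gu0 kap_ge_2[OF p] by (simp add: power_0_left)
    qed
    then show ?thesis using d True det3_swap(2)[of b1 b2 p] by (intro exI[of _ b1]) (simp add: u0_def)
  qed
  then obtain u1 where d': "det3 u0 u1 p \<noteq> 0" by blast
  have zero: "?g v = 0" if l: "invariant_line F l" "p \<in> l" "v \<in> l" for l v
  proof -
    have "vec.subspace l" using l by (auto simp: invariant_line_def proj_line_def)
    then have "p + t *s v \<in> l" for t using l by (simp add: vec.subspace_add vec.subspace_scale)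
    then have "lpoly (pair F p) p v = 0" using invariant_lineD[OF l(1) _ l(2)] by (intro lpoly_eqI) simp
    then show ?thesis by simp
  qed
  have "\<exists>s. u1 + s *s u0 \<in> l" if l: "l \<in> ?L" for l
  proof -
    have pl: "proj_line l" "p \<in> l" using l by (auto simp: invariant_line_def)
    obtain b where bc: "ccross b p \<noteq> 0" and b: "l = vec.span {b, p}" using proj_lineE1[OF pl p(1)] .
    obtain x y z where xyz: "b = x *s u0 + y *s u1 + z *s p" using det3_basis[OF d'] .
    have "vec.subspace l" unfolding b by simp
    moreover have "b \<in> l" "p \<in> l" unfolding b by (auto intro: vec.span_base)
    ultimately have "b - z *s p \<in> l" by (simp add: vec.subspace_diff vec.subspace_scale)
    then have xl: "x *s u0 + y *s u1 \<in> l" using xyz by simp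
    have "y \<noteq> 0"
    proof
      assume y: "y = 0"
      have "x \<noteq> 0"
      proof
        assume "x = 0"
        then show False using bc xyz y by simp
      qed
      then have "(1 / x) *s (x *s u0 + y *s u1) = u0" using y by (simp add: vec_eq_iff)
      then have "u0 \<in> l" using xl \<open>vec.subspace l\<close> vec.subspace_scale by metis
      then show False using zero l gu0 by blast
    qed
    then have "(1 / y) *s (x *s u0 + y *s u1) = u1 + (x / y) *s u0" by (simp add: vec_eq_iff field_simps)
    then have "u1 + (x / y) *s u0 \<in> l" using xl \<open>vec.subspace l\<close> vec.subspace_scale by metis
    then show ?thesis by blast
  qed
  then obtain s where s: "\<And>l. l \<in> ?L \<Longrightarrow> u1 + s l *s u0 \<in> l" by metis
  let ?q = "lpoly ?g u1 u0"
  have q0: "?q \<noteq> 0" using coeff_lpoly_top[OF g, of u1 u0] gu0 by auto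
  have sub: "s ` ?L \<subseteq> {t. poly ?q t = 0}" using s zero by (auto simp: poly_lpoly[OF g])
  have inj: "inj_on s ?L"
  proof (rule inj_onI)
    fix l l' assume l: "l \<in> ?L" "l' \<in> ?L" "s l = s l'"
    have "ccross (u1 + s l *s u0) p \<noteq> 0"
    proof
      assume "ccross (u1 + s l *s u0) p = 0"
      then have "det3 u0 (u1 + s l *s u0) p = 0" by (simp only: det3_def) simp
      then show False using d' by simp
    qed
    moreover have "u1 + s l *s u0 \<in> l" "u1 + s l *s u0 \<in> l'" using s[OF l(1)] s[OF l(2)] l(3) by auto
    ultimately show "l = l'" using l proj_line_subset_eq[of l l' "u1 + s l *s u0" p] by (auto simp: invariant_line_def)
  qed
  have "finite ?L" by (rule finite_imageD[OF finite_subset[OF sub poly_roots_finite[OF q0]] inj])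
  moreover have "card ?L \<le> card {t. poly ?q t = 0}" by (rule card_inj_on_le[OF inj sub poly_roots_finite[OF q0]])
  moreover have "card {t. poly ?q t = 0} \<le> kap F p"
    using card_poly_roots_bound[OF q0] degree_lpoly[OF g, of u1 u0] by linarith
  ultimately show ?thesis by linarith
qed

text \<open>When there are \<open>3 (n - 1)\<close> invariant lines, the Jacobian determinant is the product of their
  equations, so its order at a singular point is the number of lines through that point.\<close>

lemma maximal_lines:
  assumes E: "\<exists>v. Ed F v \<noteq> 0" and L: "card {l. invariant_line F l} = 3 * (n - 1)"
    and p: "p \<noteq> 0" "F p = 0"
  shows "card {l. invariant_line F l \<and> p \<in> l} = kap F p"
    and "\<exists>a w. jf F p a w \<noteq> 0"
    and "kap F p = 2 \<Longrightarrow> ccross b p \<noteq> 0 \<Longrightarrow> jf F p b b = 0 \<Longrightarrow>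
      (\<exists>w. jf F p b w \<noteq> 0) \<and> (\<exists>a. jf F p a b \<noteq> 0)"
proof -
  let ?L = "{l. invariant_line F l}" and ?P = "{l. invariant_line F l \<and> p \<in> l}"
  have fin: "finite ?L" using L n2 by (intro card_ge_0_finite) simp
  have P: "?P \<subseteq> ?L" by auto
  \<comment> \<open>Counting the lines that miss \<open>p\<close> shows that the order of
    \<open>Ed\<close> at \<open>p\<close> is at most the number of lines through \<open>p\<close>.
    Any order above \<open>kap F p\<close> would then contradict \<open>le\<close>.\<close>
  have bound: "k \<le> card ?P" if "vanishes (Ed F) p k" for k
  proof -
    have "k + card (?L - ?P) \<le> 3 * (n - 1)"
      using fin by (intro count_lines[OF E p(1) _ _ that]) auto
    moreover have "card (?L - ?P) = card ?L - card ?P"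
      using P fin finite_subset by (intro card_Diff_subset) auto
    moreover have "card ?P \<le> card ?L" using P fin by (rule card_mono[rotated])
    ultimately show ?thesis using L by linarith
  qed
  have le: "card ?P \<le> kap F p" using card_lines_through_le_kap[OF p] by blast
  show "card ?P = kap F p" using bound[OF Ed_vanishes[OF p]] le by simp
  show "\<exists>a w. jf F p a w \<noteq> 0"
    using bound[OF Ed_vanishes_zero_linear_part[OF p]] le by fastforce
  assume k: "kap F p = 2" and b: "ccross b p \<noteq> 0" "jf F p b b = 0"
  show "(\<exists>w. jf F p b w \<noteq> 0) \<and> (\<exists>a. jf F p a b \<noteq> 0)"
    using bound[OF Ed_vanishes_degenerate[OF p(2) k b]] le k by fastforce
qed

end

section \<open>Camacho--Sad indices\<close>

text \<open>Supplies the continuous \<open>Q\<close> in \<open>camacho_sad_index\<close>, as the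
  difference quotient in the second coordinate. Continuity of the restriction to the line belongs to
  the induction because the product case multiplies by it.\<close>

lemma continuous_division_by_second_coordinate:
  fixes M :: "complex^3^3"
  assumes "homogeneous_poly n f"
  shows "\<exists>g. continuous_on UNIV g \<and> (\<forall>w :: complex^2.
      f (M *v vector [w$1, w$2, 1]) = f (M *v vector [w$1, 0, 1]) + w$2 * g w) \<and>
    continuous_on UNIV (\<lambda>w :: complex^2. f (M *v vector [w$1, 0, 1]))"
  using assms
proof (induction rule: homogeneous_poly_induct)
  case (const c)
  show ?case by (rule exI[of _ "\<lambda>_. 0"]) auto
next
  case (coord k)
  show ?case
    by (rule exI[of _ "\<lambda>_. M$k$2"])
      (auto simp: matrix_vector_mult_def sum_3 algebra_simps intro!: continuous_intros)
next
  case (add n f g)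
  then obtain f' g' where "continuous_on UNIV f' \<and> (\<forall>w :: complex^2.
      f (M *v vector [w$1, w$2, 1]) = f (M *v vector [w$1, 0, 1]) + w$2 * f' w)"
    "continuous_on UNIV g' \<and> (\<forall>w :: complex^2.
      g (M *v vector [w$1, w$2, 1]) = g (M *v vector [w$1, 0, 1]) + w$2 * g' w)" by blast
  then show ?case using add
    by (intro exI[of _ "\<lambda>w. f' w + g' w"]) (auto simp: algebra_simps intro!: continuous_intros)
next
  case (mult m n f g)
  then obtain f' g' where *: "continuous_on UNIV f'" "\<And>w :: complex^2.
      f (M *v vector [w$1, w$2, 1]) = f (M *v vector [w$1, 0, 1]) + w$2 * f' w"
    "continuous_on UNIV g'" "\<And>w :: complex^2.
      g (M *v vector [w$1, w$2, 1]) = g (M *v vector [w$1, 0, 1]) + w$2 * g' w" by blast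
  show ?case
    by (rule exI[of _ "\<lambda>w. f (M *v vector [w$1, 0, 1]) * g' w + f' w * g (M *v vector [w$1, 0, 1]) + w$2 * f' w * g' w"])
      (use mult *(1,3) in \<open>auto simp: *(2,4) algebra_simps intro!: continuous_intros\<close>)
qed

lemma poly_holomorphic: "poly q holomorphic_on A" for q :: "complex poly"
  by (auto simp: holomorphic_on_def field_differentiable_def intro: poly_DERIV has_field_derivative_at_within)

section \<open>Indices computed from the linear part\<close>

context projective_foliation
begin

lemma jf_invariant_line:
  assumes "invariant_line F l" "b \<in> l" "v \<in> l"
  shows "jf F v b b = 0"
proof -
  have "vec.subspace l" using assms by (auto simp: invariant_line_def proj_line_def)
  then have "v + t *s b \<in> l" for t using assms by (simp add: vec.subspace_add vec.subspace_scale)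
  then have "lpoly (pair F b) v b = 0" using invariant_lineD[OF assms(1) _ assms(2)] by (intro lpoly_eqI) simp
  then show ?thesis by (simp add: jf_def ddir_def)
qed

text \<open>On the line, \<open>P\<close> is \<open>F v \<odot> b2\<close>, with a simple zero of
  derivative \<open>jf F p b2 b1\<close>. Off the line \<open>Q\<close> is a quotient, and
  continuity fixes its value on the line as \<open>- jf F v b1 b2\<close>. The residue is the ratio
  of the two at \<open>p\<close>.\<close>

lemma camacho_sad_residue:
  fixes M :: "complex^3^3"
  defines "b1 \<equiv> M *v axis 1 1" and "b2 \<equiv> M *v axis 2 1" and "p \<equiv> M *v axis 3 1"
  assumes l: "invariant_line F l" "l = vec.span {b1, p}" and p: "F p = 0"
    and P: "\<And>w. local_field F M w = vector [P w, w$2 * Q w]" and Q: "continuous_on UNIV Q"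
    and nz: "jf F p b1 b2 \<noteq> 0" "jf F p b2 b1 \<noteq> 0"
  shows "residue (\<lambda>u. Q (vector [u, 0]) / P (vector [u, 0])) 0 = - jf F p b1 b2 / jf F p b2 b1"
proof -
  have M: "M *v vector [x, y, 1] = (p + x *s b1) + y *s b2" for x y
    by (subst matrix_columns) (simp add: b1_def b2_def p_def vec_eq_iff algebra_simps)
  let ?g = "lpoly (pair F b2) p b1" and ?f = "- lpoly (\<lambda>v. jf F v b1 b2) p b1"
  have "P (vector [u, 0]) = poly ?g u" for u
  proof -
    have "P (vector [u, 0]) = local_field F M (vector [u, 0]) $ 1" unfolding P by simp
    then show ?thesis by (simp add: local_field_def Let_def pullback_nth M poly_lpoly[OF hp] flip: b2_def)
  qed
  moreover have "Q (vector [u, 0]) = poly ?f u" for u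
  proof -
    let ?r = "lpoly (pair F b1) (p + u *s b1) b2"
    have "p + u *s b1 \<in> l" "b1 \<in> l" unfolding l(2) by (auto intro: vec.span_base vec.span_add vec.span_scale)
    then have "coeff ?r 0 = 0" using invariant_lineD[OF l(1)] coeff_lpoly_0[OF hp] by simp
    then obtain r where r: "?r = pCons 0 r" by (metis coeff_pCons_0 pCons_cases)
    have "Q (vector [u, v]) = - poly r v" if "v \<noteq> 0" for v
    proof -
      have "v * Q (vector [u, v]) = local_field F M (vector [u, v]) $ 2" unfolding P by simp
      also have "\<dots> = - poly ?r v"
        by (simp add: local_field_def Let_def pullback_nth M poly_lpoly[OF hp] flip: b1_def)
      finally have "v * Q (vector [u, v]) = v * (- poly r v)" unfolding r by simp
      then show ?thesis using that mult_left_cancel by blast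
    qed
    then have "\<forall>\<^sub>F v in at 0. - poly r v = Q (vector [u, v])"
      by (intro eventually_at_filter[THEN iffD2] always_eventually) auto
    moreover have "((\<lambda>v. - poly r v) \<longlongrightarrow> - poly r 0) (at 0)" by (intro tendsto_intros)
    ultimately have 1: "((\<lambda>v. Q (vector [u, v])) \<longlongrightarrow> - poly r 0) (at 0)" by (rule Lim_transform_eventually[rotated])
    have "((\<lambda>v. vector [u, v] :: complex^2) \<longlongrightarrow> vector [u, 0]) (at 0)"
    proof (rule vec_tendstoI)
      fix i :: 2
      show "((\<lambda>v. (vector [u, v] :: complex^2) $ i) \<longlongrightarrow> (vector [u, 0] :: complex^2) $ i) (at 0)"
        using exhaust_2[of i] by auto
    qed
    moreover have "isCont Q (vector [u, 0])" using Q by (simp add: continuous_on_eq_continuous_at)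
    ultimately have "((\<lambda>v. Q (vector [u, v])) \<longlongrightarrow> Q (vector [u, 0])) (at 0)" by (rule isCont_tendsto_compose[rotated])
    then have "Q (vector [u, 0]) = - poly r 0" using 1 tendsto_unique[of "at (0::complex)"] by force
    also have "poly r 0 = jf F (p + u *s b1) b1 b2"
      by (simp add: jf_def ddir_def r poly_0_coeff_0)
    finally show ?thesis by (simp add: poly_lpoly[OF homogeneous_poly_jf[OF hf]])
  qed
  ultimately have "residue (\<lambda>u. Q (vector [u, 0]) / P (vector [u, 0])) 0 = residue (\<lambda>u. poly ?f u / poly ?g u) 0"
    by simp
  also have "\<dots> = poly ?f 0 / jf F p b2 b1"
  proof (rule residue_simple_pole_deriv[where s = UNIV])
    have "poly (pderiv ?g) 0 = jf F p b2 b1" by (simp add: poly_pderiv_lpoly[OF hp] jf_def)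
    then show "(poly ?g has_field_derivative jf F p b2 b1) (at 0)" using poly_DERIV[of ?g 0] by simp
    show "poly ?f 0 \<noteq> 0" using nz by (simp add: poly_lpoly[OF homogeneous_poly_jf[OF hf]])
    show "poly ?g 0 = 0" using p by (simp add: poly_lpoly[OF hp])
  qed (use nz in \<open>auto intro: poly_holomorphic holomorphic_on_minus\<close>)
  finally show ?thesis by (simp add: poly_lpoly[OF homogeneous_poly_jf[OF hf]])
qed

lemma camacho_sad_exists:
  assumes l: "invariant_line F l" "l = vec.span {b1, p}" and d: "det3 b1 b2 p \<noteq> 0" and p: "F p = 0"
    and nz: "jf F p b1 b2 \<noteq> 0" "jf F p b2 b1 \<noteq> 0"
  shows "camacho_sad_index F l (vec.span {p}) (- jf F p b1 b2 / jf F p b2 b1)"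
proof -
  let ?M = "mat3 b1 b2 p"
  obtain g where g: "continuous_on UNIV g" "\<And>w :: complex^2.
      pair F b1 (?M *v vector [w$1, w$2, 1]) = pair F b1 (?M *v vector [w$1, 0, 1]) + w$2 * g w"
    using continuous_division_by_second_coordinate[where M = ?M and f = "pair F b1", OF hp] by blast
  define P where "P w = local_field F ?M w $ 1" for w
  have z: "pair F b1 (?M *v vector [w$1, 0, 1]) = 0" for w :: "complex^2"
  proof (rule invariant_lineD[OF l(1)])
    show "?M *v vector [w$1, 0, 1] \<in> l" unfolding l(2) mat3_mult
      by (auto intro: vec.span_base vec.span_add vec.span_scale)
    show "b1 \<in> l" unfolding l(2) by (auto intro: vec.span_base)
  qed
  have PQ: "local_field F ?M w = vector [P w, w$2 * - g w]" for w
    using g(2)[of w] z[of w] by (simp add: vec_eq_iff forall_2 P_def local_field_def Let_def pullback_nth)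
  have c: "continuous_on UNIV (\<lambda>w. - g w)" using g(1) by (intro continuous_intros)
  have "residue (\<lambda>u. - g (vector [u, 0]) / P (vector [u, 0])) 0 = - jf F p b1 b2 / jf F p b2 b1"
    using camacho_sad_residue[where l = l and M = ?M and P = P and Q = "\<lambda>w. - g w"] l p nz PQ c by simp
  moreover have "adapted_to ?M (vec.span {p}) l"
    using d l by (simp add: adapted_to_def centered_at_def invertible_mat3)
  ultimately show ?thesis
    unfolding camacho_sad_index_def
    by (intro exI[of _ ?M] exI[of _ P] exI[of _ "\<lambda>w. - g w"] conjI allI PQ c) simp_all
qed

lemma taylor_1_jf:
  fixes M :: "complex^3^3"
  defines "b1 \<equiv> M *v axis 1 1" and "b2 \<equiv> M *v axis 2 1" and "p \<equiv> M *v axis 3 1"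
  shows "taylor_part (local_field F M) 1 w =
    vector [jf F p b2 (w$1 *s b1 + w$2 *s b2), - jf F p b1 (w$1 *s b1 + w$2 *s b2)]"
  using taylor_part_local_field[OF hf, of M 1 w] by (simp add: jf_def ddir_def b1_def b2_def p_def)

text \<open>Injectivity of the linear part excludes a kernel in the second argument of
  \<open>jf\<close>, surjectivity excludes one in the first; in both cases only multiples of
  \<open>p\<close> remain.\<close>

lemma nondegenerate_kernel:
  assumes "nondegenerate_singularity F s" "p \<noteq> 0" "s = vec.span {p}"
  shows "(\<forall>a. jf F p a w = 0) \<Longrightarrow> w \<in> s" and "(\<forall>w. jf F p b w = 0) \<Longrightarrow> b \<in> s"
proof -
  obtain M where M: "invertible M" "s = vec.span {M *v axis 3 1}" "bij (taylor_part (local_field F M) 1)"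
    and "singular_point F s"
    using assms(1) unfolding nondegenerate_singularity_def centered_at_def by blast
  let ?b1 = "M *v axis 1 1" and ?b2 = "M *v axis 2 1" and ?q = "M *v axis 3 1"
  have d: "det3 ?b1 ?b2 ?q \<noteq> 0" using M by (simp add: invertible_det_nz det_eq_det3)
  have q0: "?q \<noteq> 0" using M(1) by (simp add: invertible_mult_eq_0)
  have "?q \<in> vec.span {p}" using M(2) assms(3) vec.span_base[of ?q "{?q}"] by simp
  then obtain c where c: "?q = c *s p" by (auto simp: in_span1)
  have c0: "c \<noteq> 0" using c q0 by auto
  have Fp: "F p = 0" using singular_span[OF assms(2)] \<open>singular_point F s\<close> assms(3) by simp
  have jq: "jf F ?q a w = c ^ (n - 1) * jf F p a w" for a w unfolding c jf_scale[OF hf] ..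
  have Fq: "F ?q = 0" unfolding c by (simp add: hform_scale[OF hf] Fp)
  show "w \<in> s" if "\<forall>a. jf F p a w = 0"
  proof -
    obtain x y z where w: "w = x *s ?b1 + y *s ?b2 + z *s ?q" using det3_basis[OF d] .
    have "jf F p a (x *s ?b1 + y *s ?b2) = jf F p a w" for a
      unfolding w c by (simp add: jf_add2[OF hf] jf_smult2[OF hf] jf_radial[OF hf] Fp)
    then have "taylor_part (local_field F M) 1 (vector [x, y]) = taylor_part (local_field F M) 1 (vector [0, 0])"
      using that c0 jf_smult2[OF hf, of ?q _ 0 0]
      unfolding taylor_1_jf jq by (simp add: vec_eq_iff forall_2 jf_smult2[OF hf] jf_add2[OF hf])
    then have "vector [x, y] = (vector [0, 0] :: complex^2)" using M(3) by (meson bij_is_inj injD)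
    then have "x = 0" "y = 0" by (simp_all add: vec_eq_iff forall_2)
    then show ?thesis unfolding M(2) w by (auto simp: in_span1)
  qed
  show "b \<in> s" if *: "\<forall>w. jf F p b w = 0"
  proof -
    obtain x y z where b: "b = x *s ?b1 + y *s ?b2 + z *s ?q" using det3_basis[OF d] .
    have e: "x * jf F ?q ?b1 w + y * jf F ?q ?b2 w = 0" for w
    proof -
      have "jf F ?q b w = x * jf F ?q ?b1 w + y * jf F ?q ?b2 w"
        unfolding b by (simp add: jf_add1[OF hf] jf_smult1[OF hf] jf_radial'[OF hf] Fq)
      then show ?thesis using * jq by simp
    qed
    obtain w1 where w1: "taylor_part (local_field F M) 1 w1 = vector [1, 0]" using M(3) by (metis bij_pointE)
    obtain w2 where w2: "taylor_part (local_field F M) 1 w2 = vector [0, 1]" using M(3) by (metis bij_pointE)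
    have "y = 0" using e[of "w1$1 *s ?b1 + w1$2 *s ?b2"] w1 unfolding taylor_1_jf
      by (simp add: vec_eq_iff forall_2)
    moreover have "x = 0"
      using e[of "w2$1 *s ?b1 + w2$2 *s ?b2"] arg_cong[OF w2, of "\<lambda>v. v$1"] arg_cong[OF w2, of "\<lambda>v. - v$2"]
      unfolding taylor_1_jf by simp
    ultimately show ?thesis unfolding M(2) b by (auto simp: in_span1)
  qed
qed

text \<open>Since \<open>b1\<close> is isotropic the linear part is triangular in the chart
  \<open>b1, b2, p\<close>, and \<open>S\<close> is its explicit inverse.\<close>

lemma nondegenerateI:
  assumes p: "F p = 0" and d: "det3 b1 b2 p \<noteq> 0" and "jf F p b1 b1 = 0"
    and nz: "jf F p b1 b2 \<noteq> 0" "jf F p b2 b1 \<noteq> 0"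
  shows "nondegenerate_singularity F (vec.span {p})"
proof -
  have p0: "p \<noteq> 0" using d by auto
  let ?M = "mat3 b1 b2 p"
  let ?T = "taylor_part (local_field F ?M) 1"
  have T: "?T w = vector [w$1 * jf F p b2 b1 + w$2 * jf F p b2 b2, - (w$2 * jf F p b1 b2)]" for w
    unfolding taylor_1_jf by (simp add: jf_add2[OF hf] jf_smult2[OF hf] assms(3))
  define S where "S y = (vector [(y$1 + y$2 / jf F p b1 b2 * jf F p b2 b2) / jf F p b2 b1, - y$2 / jf F p b1 b2] :: complex^2)" for y :: "complex^2"
  have "bij ?T"
  proof (rule bij_betw_byWitness[where f' = S])
    show "\<forall>a\<in>UNIV. S (?T a) = a" unfolding T S_def using nz by (simp add: vec_eq_iff forall_2 field_simps)
    show "\<forall>a\<in>UNIV. ?T (S a) = a" unfolding T S_def using nz by (simp add: vec_eq_iff forall_2 field_simps)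
  qed auto
  moreover have "centered_at ?M (vec.span {p})" using d by (simp add: centered_at_def invertible_mat3)
  ultimately show ?thesis unfolding nondegenerate_singularity_def using singular_span[OF p0] p by blast
qed

text \<open>Nondegeneracy makes both mixed entries of \<open>jf\<close> nonzero: otherwise the
  direction \<open>b1\<close> of the line, which is isotropic, would lie in a kernel and hence in
  \<open>s\<close>. So the residue formula applies.\<close>

lemma CS_setE:
  assumes "c \<in> CS_set F"
  obtains l p b1 b2 where "c \<noteq> 0" "c \<noteq> 1" "invariant_line F l" "F p = 0" "det3 b1 b2 p \<noteq> 0" "b1 \<in> l" "p \<in> l"
    "jf F p b1 b1 = 0" "jf F p b1 b2 \<noteq> 0" "jf F p b2 b1 \<noteq> 0" "c = - jf F p b1 b2 / jf F p b2 b1"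
proof -
  obtain l s where c: "c \<noteq> 0" "c \<noteq> 1" "invariant_line F l" "s \<subseteq> l" "nondegenerate_singularity F s"
    "camacho_sad_index F l s c" using assms unfolding CS_set_def by blast
  then obtain M P Q where M: "adapted_to M s l" "\<And>w. local_field F M w = vector [P w, w$2 * Q w]"
    "continuous_on UNIV Q" "c = residue (\<lambda>u. Q (vector [u, 0]) / P (vector [u, 0])) 0"
    unfolding camacho_sad_index_def by blast
  let ?b1 = "M *v axis 1 1" and ?b2 = "M *v axis 2 1" and ?p = "M *v axis 3 1"
  have iM: "invertible M" and s: "s = vec.span {?p}" and l: "l = vec.span {?b1, ?p}"
    using M(1) by (auto simp: adapted_to_def centered_at_def)
  have d: "det3 ?b1 ?b2 ?p \<noteq> 0" using iM by (simp add: invertible_det_nz det_eq_det3)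
  have p0: "?p \<noteq> 0" using iM by (simp add: invertible_mult_eq_0)
  have Fp: "F ?p = 0" using c(5) singular_span[OF p0] s by (simp add: nondegenerate_singularity_def)
  have bl: "?b1 \<in> l" "?p \<in> l" unfolding l by (auto intro: vec.span_base)
  have j11: "jf F ?p ?b1 ?b1 = 0" by (rule jf_invariant_line[OF c(3) bl])
  have b1s: "?b1 \<notin> s"
  proof
    assume "?b1 \<in> s"
    then obtain k where "?b1 = k *s ?p" by (auto simp: s in_span1)
    then show False using d by simp
  qed
  have expand: "jf F ?p a ?b1 = 0" if z: "jf F ?p ?b2 ?b1 = 0" for a
  proof -
    obtain x y z where "a = x *s ?b1 + y *s ?b2 + z *s ?p" using det3_basis[OF d] .
    then show ?thesis using j11 \<open>jf F ?p ?b2 ?b1 = 0\<close> Fp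
      by (simp add: jf_add1[OF hf] jf_smult1[OF hf] jf_radial'[OF hf])
  qed
  have expand': "jf F ?p ?b1 a = 0" if z: "jf F ?p ?b1 ?b2 = 0" for a
  proof -
    obtain x y z where "a = x *s ?b1 + y *s ?b2 + z *s ?p" using det3_basis[OF d] .
    then show ?thesis using j11 \<open>jf F ?p ?b1 ?b2 = 0\<close> Fp
      by (simp add: jf_add2[OF hf] jf_smult2[OF hf] jf_radial[OF hf])
  qed
  have nz: "jf F ?p ?b1 ?b2 \<noteq> 0" "jf F ?p ?b2 ?b1 \<noteq> 0"
    using nondegenerate_kernel[OF c(5) p0 s] expand expand' b1s by blast+
  have "c = - jf F ?p ?b1 ?b2 / jf F ?p ?b2 ?b1"
    unfolding M(4) by (rule camacho_sad_residue[OF c(3) l Fp M(2,3) nz])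
  then show ?thesis using that[OF c(1-3) Fp d bl j11 nz] by blast
qed

lemma CS_setI:
  assumes l: "invariant_line F l" "b1 \<in> l" "p \<in> l" and d: "det3 b1 b2 p \<noteq> 0" and p: "F p = 0"
    and nz: "jf F p b1 b2 \<noteq> 0" "jf F p b2 b1 \<noteq> 0" and c: "c = - jf F p b1 b2 / jf F p b2 b1" "c \<noteq> 1"
  shows "c \<in> CS_set F"
proof -
  have pl: "proj_line l" using l by (simp add: invariant_line_def)
  have "ccross b1 p \<noteq> 0"
  proof
    assume "ccross b1 p = 0"
    then have "det3 b2 b1 p = 0" by (simp add: det3_def)
    then show False using d det3_swap(2)[of b1 b2 p] by simp
  qed
  then have l2: "l = vec.span {b1, p}" using proj_line_through[OF pl l(2,3)] by blast
  have "nondegenerate_singularity F (vec.span {p})"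
    by (rule nondegenerateI[OF p d jf_invariant_line[OF l] nz])
  moreover have "camacho_sad_index F l (vec.span {p}) c"
    unfolding c(1) by (rule camacho_sad_exists[OF l(1) l2 d p nz])
  moreover have "vec.span {p} \<subseteq> l" unfolding l2 by (rule vec.span_mono) simp
  moreover have "c \<noteq> 0" using nz c by simp
  ultimately show ?thesis unfolding CS_set_def using l(1) c(2) by blast
qed

end

section \<open>The index sum on an invariant line\<close>

text \<open>Lagrange interpolation: both sides are the coefficient of degree \<open>m\<close> of the interpolation
  polynomial of \<open>q\<close> at the roots of \<open>c\<close>.\<close>

lemma sum_residues:
  fixes c q :: "complex poly"
  assumes dc: "degree c = Suc m" and dq: "degree q \<le> m"
    and simple: "\<And>t. poly c t = 0 \<Longrightarrow> poly (pderiv c) t \<noteq> 0"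
  shows "card {t. poly c t = 0} = Suc m"
    and "(\<Sum>t | poly c t = 0. poly q t / poly (pderiv c) t) = coeff q m / lead_coeff c"
proof -
  let ?R = "{t. poly c t = 0}"
  have c0: "c \<noteq> 0" using dc by auto
  have fin: "finite ?R" by (rule poly_roots_finite[OF c0])
  have "rsquarefree c" unfolding rsquarefree_roots using simple by blast
  then have "order t c = 1" if "t \<in> ?R" for t
  proof -
    have "order t c \<noteq> 0" using that c0 by (simp add: order_root)
    moreover have "\<forall>a. order a c = 0 \<or> order a c = 1" using \<open>rsquarefree c\<close> by (simp add: rsquarefree_def)
    ultimately show ?thesis by (metis (full_types))
  qed
  then have "(\<Sum>t\<in>?R. order t c) = card ?R" by simp
  then show card: "card ?R = Suc m" using sum_order_eq_degree[OF c0] dc by simp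
  have "\<exists>d. c = [:- t, 1:] * d" if "t \<in> ?R" for t
    using that by (simp add: poly_eq_0_iff_dvd dvd_def)
  then obtain d where d: "\<And>t. t \<in> ?R \<Longrightarrow> c = [:- t, 1:] * d t" by metis
  have d0: "d t \<noteq> 0" if "t \<in> ?R" for t using d[OF that] c0 by auto
  have deg_d: "degree (d t) = m" if "t \<in> ?R" for t
    using arg_cong[OF d[OF that], of degree] degree_mult_eq[of "[:- t, 1:]" "d t"] d0[OF that] dc by simp
  have lead_d: "coeff (d t) m = lead_coeff c" if "t \<in> ?R" for t
    using lead_coeff_mult[of "[:- t, 1:]" "d t", folded d[OF that]] deg_d[OF that] by simp
  have d_self: "poly (d t) t = poly (pderiv c) t" if "t \<in> ?R" for t
    unfolding arg_cong[OF d[OF that], of pderiv] pderiv_mult by (simp add: pderiv_pCons)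
  have d_other: "poly (d t) r = 0" if "t \<in> ?R" "r \<in> ?R" "r \<noteq> t" for t r
    using arg_cong[OF d[OF that(1)], of "\<lambda>q. poly q r"] that by auto
  define e where "e = q - (\<Sum>t\<in>?R. smult (poly q t / poly (pderiv c) t) (d t))"
  have "poly e r = 0" if r: "r \<in> ?R" for r
  proof -
    have "(\<Sum>t\<in>?R. poly q t / poly (pderiv c) t * poly (d t) r) = poly q r / poly (pderiv c) r * poly (d r) r"
      by (rule sum_single[OF fin r]) (use d_other r in auto)
    then show ?thesis using d_self[OF r] simple r by (simp add: e_def poly_sum)
  qed
  moreover have "degree e \<le> m"
    unfolding e_def using dq deg_d by (intro degree_diff_le degree_sum_le fin) (auto intro: order_trans[OF degree_smult_le])
  moreover have "Suc m \<le> degree e" if "e \<noteq> 0" "?R \<subseteq> {t. poly e t = 0}"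
    using card card_poly_roots_bound[OF that(1)] card_mono[OF poly_roots_finite[OF that(1)] that(2)] by linarith
  ultimately have "e = 0" by fastforce
  then have q: "q = (\<Sum>t\<in>?R. smult (poly q t / poly (pderiv c) t) (d t))" by (simp add: e_def)
  have "coeff q m = (\<Sum>t\<in>?R. poly q t / poly (pderiv c) t * coeff (d t) m)"
    by (subst q) (simp add: coeff_sum)
  also have "\<dots> = (\<Sum>t\<in>?R. poly q t / poly (pderiv c) t) * lead_coeff c"
    unfolding sum_distrib_right using lead_d by (intro sum.cong) auto
  finally show "(\<Sum>t\<in>?R. poly q t / poly (pderiv c) t) = coeff q m / lead_coeff c"
    using c0 by simp
qed

lemma card_2E:
  assumes "card A = 2"
  obtains a b where "a \<in> A" "b \<in> A" "a \<noteq> b"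
  using assms card_2_iff[of A] by auto

text \<open>Eliminating \<open>n1\<close> leaves \<open>(a - b) * sqrt 5 = 5 * (a + b - 2)\<close>.
  Squaring gives an equation between integers whose only solutions in the range have
  \<open>a + b = 2\<close>.\<close>

lemma index_count:
  fixes a b n1 :: nat
  assumes "of_nat n1 + of_nat a * complex_of_real (- 3/2 + sqrt 5 / 2)
      + of_nat b * complex_of_real (- 3/2 - sqrt 5 / 2) = 1"
    and "n1 + a + b = 6"
  shows "n1 = 4"
proof -
  have "complex_of_real (real n1 + real a * (- 3/2 + sqrt 5 / 2) + real b * (- 3/2 - sqrt 5 / 2)) = complex_of_real 1"
    using assms(1) by simp
  then have "real n1 + real a * (- 3/2 + sqrt 5 / 2) + real b * (- 3/2 - sqrt 5 / 2) = 1"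
    by (simp only: of_real_eq_iff)
  moreover have "real n1 = 6 - real a - real b" using assms(2) by linarith
  ultimately have *: "(real a - real b) * sqrt 5 = 5 * (real a + real b - 2)" by (simp add: field_simps)
  have "x\<^sup>2 = 5 * y\<^sup>2" if "x * sqrt 5 = 5 * y" for x y :: real
    using arg_cong[OF that, of "\<lambda>x. x\<^sup>2"] by (simp add: power_mult_distrib)
  from this[OF *] have "real_of_int ((int a - int b)\<^sup>2) = real_of_int (5 * (int a + int b - 2)\<^sup>2)" by simp
  then have eq: "(int a - int b)\<^sup>2 = 5 * (int a + int b - 2)\<^sup>2" by (simp only: of_int_eq_iff)
  have "a \<in> {0..6}" "b \<in> {0..6}" using assms(2) by auto
  then have "a \<in> {0,1,2,3,4,5,6}" "b \<in> {0,1,2,3,4,5,6}" by (auto simp: numeral_eq_Suc le_Suc_eq)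
  then have "a + b = 2" using eq assms(2) by auto
  then show ?thesis using assms(2) by simp
qed

section \<open>Combinatorics of the arrangement\<close>

text \<open>Give a point of multiplicity \<open>N\<close> the weight \<open>N - 3\<close>. Any two
  points of positive weight are joined, so from such a point \<open>s0\<close> all others are seen
  along its \<open>N\<close> lines, each with remaining weight \<open>7 - N\<close>. The total
  weight \<open>N - 3 + N * (7 - N)\<close> is 13, 12, 9 or 4 for \<open>N\<close> = 4, 5, 6, 7, so
  all these points have the same \<open>N\<close>. Double counting incidences gives
  \<open>N * W = 60\<close>; the candidates are 52, 60, 54 and 28.\<close>

lemma arrangement_count:
  fixes S :: "'a set" and L :: "'b set" and inc :: "'a \<Rightarrow> 'b \<Rightarrow> bool"
  defines "N s \<equiv> card {l \<in> L. inc s l}"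
  assumes fin: "finite S" "finite L" and L: "card L = 15"
    and unique: "\<And>s s' l l'. s \<in> S \<Longrightarrow> s' \<in> S \<Longrightarrow> s \<noteq> s' \<Longrightarrow> l \<in> L \<Longrightarrow> l' \<in> L \<Longrightarrow>
      inc s l \<Longrightarrow> inc s' l \<Longrightarrow> inc s l' \<Longrightarrow> inc s' l' \<Longrightarrow> l = l'"
    and joined: "\<And>s s'. s \<in> S \<Longrightarrow> s' \<in> S \<Longrightarrow> s \<noteq> s' \<Longrightarrow> N s + N s' \<ge> 8 \<Longrightarrow> \<exists>l\<in>L. inc s l \<and> inc s' l"
    and lines: "\<And>l. l \<in> L \<Longrightarrow> (\<Sum>s\<in>{s \<in> S. inc s l}. N s - 3) = 4"
    and s: "s \<in> S" "N s \<ge> 4"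
  shows "N s = 5"
proof -
  let ?w = "\<lambda>s. N s - 3"
  define W where "W = (\<Sum>s\<in>S. ?w s)"
  have W: "N s0 \<le> 7 \<and> W = (N s0 - 3) + N s0 * (7 - N s0)" if s0: "s0 \<in> S" "N s0 \<ge> 4" for s0
  proof -
    let ?L0 = "{l \<in> L. inc s0 l}" and ?S0 = "S - {s0}"
    have fin0: "finite ?L0" "finite ?S0" using fin by auto
    have part: "?w s0 + (\<Sum>s\<in>{s \<in> ?S0. inc s l}. ?w s) = 4" if l: "l \<in> ?L0" for l
    proof -
      have "{s \<in> S. inc s l} = insert s0 {s \<in> ?S0. inc s l}" using s0 l by auto
      then show ?thesis using lines[of l] l fin0 by simp
    qed
    have "?L0 \<noteq> {}" using s0(2) unfolding N_def by (metis card.empty not_numeral_le_zero)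
    then have le: "N s0 \<le> 7" using part s0(2) by fastforce
    have "(\<Sum>s\<in>?S0. ?w s) = (\<Sum>s\<in>?S0. \<Sum>l\<in>{l \<in> ?L0. inc s l}. ?w s)"
    proof (rule sum.cong[OF refl])
      fix s assume s: "s \<in> ?S0"
      show "?w s = (\<Sum>l\<in>{l \<in> ?L0. inc s l}. ?w s)"
      proof (cases "?w s = 0")
        case False
        then obtain l where l: "l \<in> L" "inc s0 l" "inc s l" using joined[of s0 s] s s0 by auto
        then have "{l \<in> ?L0. inc s l} = {l}" using unique[of s0 s] s s0 by auto
        then show ?thesis by simp
      qed simp
    qed
    also have "\<dots> = (\<Sum>l\<in>?L0. \<Sum>s\<in>{s \<in> ?S0. inc s l}. ?w s)"
      by (rule sum.swap_restrict[OF fin0(2,1)])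
    also have "\<dots> = (\<Sum>l\<in>?L0. 7 - N s0)"
      using part s0(2) by (intro sum.cong) fastforce+
    also have "\<dots> = N s0 * (7 - N s0)" by (simp add: N_def)
    finally have "(\<Sum>s\<in>?S0. ?w s) = N s0 * (7 - N s0)" .
    then show ?thesis using le fin(1) s0(1) by (simp add: W_def sum.remove)
  qed
  have same: "N s' = N s" if "s' \<in> S" "N s' \<ge> 4" for s'
  proof -
    have "N s \<in> {4,5,6,7}" "N s' \<in> {4,5,6,7}" using W[OF s] W[OF that] s that by auto
    then show ?thesis using W[OF s] W[OF that] by auto
  qed
  have "60 = (\<Sum>l\<in>L. \<Sum>s\<in>{s \<in> S. inc s l}. ?w s)" using lines L by simp
  also have "\<dots> = (\<Sum>s\<in>S. \<Sum>l\<in>{l \<in> L. inc s l}. ?w s)"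
    by (rule sum.swap_restrict[OF fin(2,1)])
  also have "\<dots> = (\<Sum>s'\<in>S. N s * ?w s')"
  proof (rule sum.cong[OF refl])
    fix s' assume s': "s' \<in> S"
    show "(\<Sum>l\<in>{l \<in> L. inc s' l}. ?w s') = N s * ?w s'"
      using same[OF s'] by (cases "N s' \<ge> 4") (auto simp: N_def)
  qed
  finally have "N s * W = 60" by (simp add: W_def sum_distrib_left)
  moreover have "N s \<in> {4,5,6,7}" using W[OF s] s by auto
  ultimately show ?thesis using W[OF s] by auto
qed

section \<open>Indices and incidences for quintic foliations with 15 invariant lines\<close>

context quintic_foliation
begin

text \<open>At least two invariant lines pass through \<open>p\<close>. For their directions
  \<open>b\<close> and \<open>b2\<close> the form \<open>jf\<close> has only mixed entries
  \<open>?x\<close> and \<open>?y\<close>; the quotient \<open>- ?x / ?y\<close> is the index for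
  any transversal \<open>q\<close>, and \<open>kap F p \<ge> 3\<close> iff
  \<open>?x + ?y = 0\<close>. The equality case in \<open>maximal_lines\<close> keeps both entries
  nonzero.\<close>

lemma local_index:
  assumes E: "\<exists>v. Ed F v \<noteq> 0" and L: "card {l. invariant_line F l} = 15"
    and l: "invariant_line F l" "b \<in> l" "p \<in> l" and p: "F p = 0" and d: "det3 b q p \<noteq> 0"
  shows "jf F p b q \<noteq> 0" "jf F p q b \<noteq> 0"
    "kap F p \<ge> 3 \<Longrightarrow> - jf F p b q / jf F p q b = 1"
    "kap F p < 3 \<Longrightarrow> - jf F p b q / jf F p q b \<in> CS_set F \<and> - jf F p b q / jf F p q b \<noteq> 1"
proof -
  have p0: "p \<noteq> 0" using d by auto
  have L': "card {l. invariant_line F l} = 3 * (6 - 1)" using L by simp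
  have N: "card {l. invariant_line F l \<and> p \<in> l} = kap F p" by (rule maximal_lines(1)[OF E L' p0 p])
  have k2: "kap F p \<ge> 2" by (rule kap_ge_2[OF p0 p])
  have "\<exists>l'. l' \<noteq> l \<and> invariant_line F l' \<and> p \<in> l'"
  proof (rule ccontr)
    assume "\<not> ?thesis"
    then have "{l. invariant_line F l \<and> p \<in> l} \<subseteq> {l}" by auto
    then have "card {l. invariant_line F l \<and> p \<in> l} \<le> 1" using card_mono[of "{l}"] by fastforce
    then show False using N k2 by simp
  qed
  then obtain l' where l': "l' \<noteq> l" "invariant_line F l'" "p \<in> l'" by blast
  have pl: "proj_line l" "proj_line l'" using l l' by (auto simp: invariant_line_def)
  obtain b2 where b2: "ccross b2 p \<noteq> 0" "l' = vec.span {b2, p}" using proj_lineE1[OF pl(2) l'(3) p0] .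
  have b2l': "b2 \<in> l'" unfolding b2 by (auto intro: vec.span_base)
  have "det3 q b p \<noteq> 0" using d det3_swap(2)[of b q p] by simp
  then have bp: "ccross b p \<noteq> 0" by (auto simp: det3_def)
  have lspan: "l = vec.span {b, p}" by (rule proj_line_through[OF pl(1) l(2,3) bp])
  have "det3 b2 b p \<noteq> 0"
  proof
    assume "det3 b2 b p = 0"
    then have "b2 \<in> l" using in_span2_det3[OF bp] lspan by simp
    then have "l' = l" using proj_line_subset_eq[OF pl(2,1) b2l' l'(3) _ l(3) b2(1)] by simp
    then show False using l' by simp
  qed
  then have d2: "det3 b b2 p \<noteq> 0" using det3_swap(2)[of b b2 p] by simp
  have z: "jf F p b b = 0" "jf F p b2 b2 = 0"
    using jf_invariant_line[OF l] jf_invariant_line[OF l'(2) b2l' l'(3)] by auto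
  have zp: "jf F p c p = 0" "jf F p p c = 0" for c
    using p by (simp_all add: jf_radial[OF hf] jf_radial'[OF hf])
  note lin = jf_add1[OF hf] jf_add2[OF hf] jf_smult1[OF hf] jf_smult2[OF hf] z zp
  let ?x = "jf F p b b2" and ?y = "jf F p b2 b"
  have uu: "jf F p (x *s b + y *s b2 + w *s p) (x *s b + y *s b2 + w *s p) = x * y * (?x + ?y)" for x y w
    by (simp add: lin algebra_simps)
  have uu': "\<exists>x y. jf F p u u = x * y * (?x + ?y)" for u
  proof -
    obtain x y w where u: "u = x *s b + y *s b2 + w *s p" using det3_basis[OF d2] .
    show ?thesis unfolding u uu by blast
  qed
  have k3: "kap F p \<ge> 3 \<longleftrightarrow> ?x + ?y = 0"
    unfolding kap_ge_3[OF p0 p] using uu'[of "1 *s b + 1 *s b2 + 0 *s p"] uu[of 1 1 0] uu'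
    by (metis mult_zero_right mult_1)
  obtain x y w where q: "q = x *s b + y *s b2 + w *s p" using det3_basis[OF d2] .
  have y0: "y \<noteq> 0"
  proof
    assume "y = 0"
    then show False using d unfolding q by simp
  qed
  have bq: "jf F p b q = y * ?x" "jf F p q b = y * ?y" unfolding q by (simp_all add: lin)
  have nz: "?x \<noteq> 0 \<and> ?y \<noteq> 0"
  proof (cases "kap F p \<ge> 3")
    case True
    obtain a c where ac: "jf F p a c \<noteq> 0" using maximal_lines(2)[OF E L' p0 p] by blast
    obtain x1 y1 w1 where a: "a = x1 *s b + y1 *s b2 + w1 *s p" using det3_basis[OF d2] .
    obtain x2 y2 w2 where c: "c = x2 *s b + y2 *s b2 + w2 *s p" using det3_basis[OF d2] .
    have "jf F p a c = x1 * y2 * ?x + y1 * x2 * ?y" unfolding a c by (simp add: lin algebra_simps)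
    then show ?thesis using ac True k3 by (auto simp: add_eq_0_iff)
  next
    case False
    then have "kap F p = 2" using k2 by simp
    then obtain c a where c: "jf F p b c \<noteq> 0" and a: "jf F p a b \<noteq> 0"
      using maximal_lines(3)[OF E L' p0 p _ bp z(1)] by blast
    obtain x1 y1 w1 where a': "a = x1 *s b + y1 *s b2 + w1 *s p" using det3_basis[OF d2] .
    obtain x2 y2 w2 where c': "c = x2 *s b + y2 *s b2 + w2 *s p" using det3_basis[OF d2] .
    show ?thesis using a c unfolding a' c' by (simp add: lin)
  qed
  show nz1: "jf F p b q \<noteq> 0" and nz2: "jf F p q b \<noteq> 0" using nz y0 bq by auto
  have idx: "- jf F p b q / jf F p q b = 1 \<longleftrightarrow> ?x + ?y = 0"
    using nz y0 unfolding bq by (auto simp: field_simps add_eq_0_iff)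
  show "kap F p \<ge> 3 \<Longrightarrow> - jf F p b q / jf F p q b = 1" using k3 idx by blast
  show "kap F p < 3 \<Longrightarrow> - jf F p b q / jf F p q b \<in> CS_set F \<and> - jf F p b q / jf F p q b \<noteq> 1"
    using k3 idx CS_setI[OF l d p nz1 nz2 refl] by (metis not_le)
qed

lemma lines_meet_singular:
  assumes "invariant_line F l" "invariant_line F l'" "l \<noteq> l'" "p \<in> l" "p \<in> l'" "p \<noteq> 0"
  shows "F p = 0"
proof -
  have pl: "proj_line l" "proj_line l'" using assms by (auto simp: invariant_line_def)
  obtain b where b: "ccross b p \<noteq> 0" "l = vec.span {b, p}" using proj_lineE1[OF pl(1) assms(4,6)] .
  obtain c where c: "ccross c p \<noteq> 0" "l' = vec.span {c, p}" using proj_lineE1[OF pl(2) assms(5,6)] .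
  have bl: "b \<in> l" "c \<in> l'" unfolding b c by (auto intro: vec.span_base)
  have "det3 c b p \<noteq> 0"
  proof
    assume "det3 c b p = 0"
    then have "c \<in> l" using in_span2_det3[OF b(1)] b(2) by simp
    then show False using proj_line_subset_eq[OF pl _ assms(4) bl(2) assms(5) c(1)] assms(3) by simp
  qed
  then show ?thesis
    by (rule det3_dot_eq_0)
      (use invariant_lineD[OF assms(1,4)] invariant_lineD[OF assms(2,5)] bl assms in auto)
qed

definition lines_at :: "(complex^3) set \<Rightarrow> nat" where
  "lines_at s = card {l. invariant_line F l \<and> s \<subseteq> l}"

lemma span_subset_line: "invariant_line F l \<Longrightarrow> vec.span {p} \<subseteq> l \<longleftrightarrow> p \<in> l"
  by (metis invariant_line_def proj_lineE span1_subset)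

lemma lines_at_kap:
  assumes E: "\<exists>v. Ed F v \<noteq> 0" and L: "card {l. invariant_line F l} = 15" and p: "p \<noteq> 0" "F p = 0"
  shows "lines_at (vec.span {p}) = kap F p"
proof -
  have "{l. invariant_line F l \<and> vec.span {p} \<subseteq> l} = {l. invariant_line F l \<and> p \<in> l}"
    using span_subset_line by blast
  then show ?thesis using maximal_lines(1)[OF E _ p] L by (simp add: lines_at_def)
qed

text \<open>The singular points on \<open>l\<close> are the roots of \<open>C\<close> and their
  indices are \<open>- Nn / C'\<close>, so \<open>sum_residues\<close> yields the index theorem on
  the line. With the prescribed values, \<open>index_count\<close> then finds four points of
  multiplicity at least 3 among the six.\<close>

lemma line_data:
  assumes E: "\<exists>v. Ed F v \<noteq> 0" and L: "card {l. invariant_line F l} = 15"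
    and CS: "CS_set F = {complex_of_real (- 3/2 + sqrt 5 / 2), complex_of_real (- 3/2 - sqrt 5 / 2)}"
    and l: "invariant_line F l"
  defines "S \<equiv> {s. singular_point F s \<and> s \<subseteq> l}"
  shows "card S = 6" "card {s \<in> S. lines_at s \<ge> 3} = 4" "\<And>s. s \<in> S \<Longrightarrow> lines_at s \<ge> 2"
    "(\<Sum>s\<in>S. lines_at s - 1) = 14"
proof -
  have pl: "proj_line l" using l by (simp add: invariant_line_def)
  obtain a b where ab: "ccross a b \<noteq> 0" "l = vec.span {a, b}" using proj_lineE[OF pl] .
  obtain c where c: "F (a + c *s b) \<noteq> 0" using line_not_singular[OF ab(1)] by blast
  \<comment> \<open>A nonsingular point is placed at infinity of the parameter \<open>t\<close>, so
    that every singular point of \<open>l\<close> is a root of \<open>C\<close>.\<close>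
  define q1 where "q1 = a + c *s b"
  define q2 where "q2 = b"
  have "ccross q1 q2 = ccross a b" by (simp add: q1_def q2_def vec3_eq_iff algebra_simps)
  then have q12: "ccross q1 q2 \<noteq> 0" using ab by simp
  have ql: "q1 \<in> l" "q2 \<in> l" unfolding ab(2) q1_def q2_def
    by (auto intro: vec.span_base vec.span_add vec.span_scale)
  have lq: "l = vec.span {q1, q2}" by (rule proj_line_through[OF pl ql q12])
  have sub: "vec.subspace l" using pl by (simp add: proj_line_def)
  obtain q3 where d: "det3 q3 q1 q2 \<noteq> 0" using complete_basis[OF q12] .
  have Fl: "F v \<odot> q1 = 0" "F v \<odot> q2 = 0" if "v \<in> l" for v using invariant_lineD[OF l that] ql by auto
  have Fq: "F v = 0 \<longleftrightarrow> F v \<odot> q3 = 0" if "v \<in> l" for v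
    using det3_dot_eq_0[OF d] Fl[OF that] by auto
  define p where "p t = q2 + t *s q1" for t
  have pt: "p t \<in> l" for t unfolding p_def using ql sub by (simp add: vec.subspace_add vec.subspace_scale)
  have dp: "det3 q1 q3 (p t) \<noteq> 0" for t
    using d det3_swap(2)[of q3 q1 q2] by (simp add: p_def)
  have p0: "p t \<noteq> 0" for t using dp[of t] by auto
  define C where "C = lpoly (pair F q3) q2 q1"
  define Nn where "Nn = lpoly (\<lambda>v. jf F v q1 q3) q2 q1"
  have hj: "homogeneous_poly 5 (\<lambda>v. jf F v q1 q3)" using homogeneous_poly_jf[OF hf, of q1 q3] by simp
  let ?R = "{t. poly C t = 0}"
  have root: "poly C t = 0 \<longleftrightarrow> F (p t) = 0" for t
    unfolding Fq[OF pt] by (simp add: C_def poly_lpoly[OF hp] p_def)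
  have Nt: "poly Nn t = jf F (p t) q1 q3" for t by (simp add: Nn_def poly_lpoly[OF hj] p_def)
  have Ct: "poly (pderiv C) t = jf F (p t) q3 q1" for t
    by (simp add: C_def poly_pderiv_lpoly[OF hp] p_def jf_def)
  note idx = local_index[OF E L l ql(1) pt _ dp]
  have q13: "F q1 \<odot> q3 \<noteq> 0" using Fq[OF ql(1)] c by (simp add: q1_def)
  have lead: "coeff C 6 = F q1 \<odot> q3" unfolding C_def by (rule coeff_lpoly_top[OF hp])
  have "degree C \<le> 6" unfolding C_def by (rule degree_lpoly[OF hp])
  moreover have "6 \<le> degree C" using lead q13 by (intro le_degree) simp
  ultimately have degC: "degree C = Suc 5" by simp
  have degN: "degree Nn \<le> 5" unfolding Nn_def by (rule degree_lpoly[OF hj])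
  have simple: "poly (pderiv C) t \<noteq> 0" if "poly C t = 0" for t
    unfolding Ct by (rule idx(2)) (use that root in blast)
  \<comment> \<open>At infinity \<open>jf_radial'\<close> gives minus the leading coefficient of
    \<open>C\<close>; this is why the indices add up to 1.\<close>
  have "coeff Nn 5 = jf F q1 q1 q3" unfolding Nn_def by (rule coeff_lpoly_top[OF hj])
  then have N5: "coeff Nn 5 = - (F q1 \<odot> q3)" by (simp add: jf_radial'[OF hf])
  have cardR: "card ?R = 6" using sum_residues(1)[OF degC degN simple] by simp
  have finR: "finite ?R" using cardR by (intro card_ge_0_finite) simp
  have sumR: "(\<Sum>t\<in>?R. - poly Nn t / poly (pderiv C) t) = 1"
  proof -
    have "(\<Sum>t\<in>?R. poly Nn t / poly (pderiv C) t) = -1"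
      using sum_residues(2)[OF degC degN simple] lead N5 q13 degC by simp
    then show ?thesis by (simp add: sum_negf)
  qed
  define la mu where "la = complex_of_real (- 3/2 + sqrt 5 / 2)" and "mu = complex_of_real (- 3/2 - sqrt 5 / 2)"
  have "la \<noteq> mu" unfolding la_def mu_def of_real_eq_iff by simp
  let ?i = "\<lambda>t. - poly Nn t / poly (pderiv C) t"
  let ?R1 = "{t \<in> ?R. kap F (p t) \<ge> 3}" and ?Ra = "{t \<in> ?R. kap F (p t) < 3 \<and> ?i t = la}"
    and ?Rb = "{t \<in> ?R. kap F (p t) < 3 \<and> ?i t = mu}"
  have i1: "?i t = 1" if "t \<in> ?R1" for t using idx(3)[of t] that root by (simp add: Nt Ct)
  have i2: "?i t = la \<or> ?i t = mu" if "t \<in> ?R" "kap F (p t) < 3" for t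
    using idx(4)[of t] that root CS by (simp add: Nt Ct la_def mu_def)
  have part: "?R = ?R1 \<union> (?Ra \<union> ?Rb)" using i2 by fastforce
  have disj: "?R1 \<inter> (?Ra \<union> ?Rb) = {}" "?Ra \<inter> ?Rb = {}" using \<open>la \<noteq> mu\<close> by auto
  have fins: "finite ?R1" "finite ?Ra" "finite ?Rb" "finite (?Ra \<union> ?Rb)" using finR by auto
  have "card ?R = card ?R1 + (card ?Ra + card ?Rb)"
    by (subst part) (use fins disj in \<open>simp add: card_Un_disjoint\<close>)
  then have c6: "card ?R1 + card ?Ra + card ?Rb = 6" using cardR by simp
  have "(\<Sum>t\<in>?R. ?i t) = sum ?i ?R1 + (sum ?i ?Ra + sum ?i ?Rb)"
    by (subst part) (use fins disj in \<open>simp add: sum.union_disjoint\<close>)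
  also have "sum ?i ?R1 = of_nat (card ?R1)" using i1 by simp
  also have "sum ?i ?Ra = of_nat (card ?Ra) * la" by simp
  also have "sum ?i ?Rb = of_nat (card ?Rb) * mu" by simp
  finally have sum1: "of_nat (card ?R1) + of_nat (card ?Ra) * la + of_nat (card ?Rb) * mu = 1"
    using sumR by (simp add: add.assoc)
  have R1: "card ?R1 = 4" by (rule index_count[folded la_def mu_def, OF sum1 c6])
  define s where "s t = vec.span {p t}" for t
  have inj: "inj_on s A" for A
  proof (rule inj_onI)
    fix t t' assume "s t = s t'"
    then have "ccross (p t) (p t') = 0" using p0 span1_eq_iff by (simp add: s_def)
    moreover have "ccross (p t) (p t') = (t - t') *s ccross q1 q2"
      by (simp add: p_def vec3_eq_iff algebra_simps)
    ultimately show "t = t'" using q12 by simp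
  qed
  have S: "S = s ` ?R"
  proof (intro equalityI subsetI)
    fix s' assume "s' \<in> S"
    then obtain v where v: "v \<noteq> 0" "s' = vec.span {v}" "F v = 0" "s' \<subseteq> l"
      unfolding S_def using singularE by blast
    then have "v \<in> l" using span_subset_line[OF l] by simp
    then obtain x y where xy: "v = x *s q1 + y *s q2" unfolding lq by (auto simp: in_span2)
    have "y \<noteq> 0"
    proof
      assume "y = 0"
      then have "x ^ 6 *s F q1 = 0" "x \<noteq> 0" using v xy hform_scale[OF hf, of x q1] by auto
      then show False using q13 by auto
    qed
    then have e: "v = y *s p (x / y)" using xy by (simp add: p_def vec_eq_iff field_simps)
    have "s' = s (x / y)" unfolding s_def v(2) e by (rule span1_smult[OF \<open>y \<noteq> 0\<close> p0])
    moreover have "F (p (x / y)) = 0" using v(3) \<open>y \<noteq> 0\<close> unfolding e hform_scale[OF hf] by simp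
    ultimately show "s' \<in> s ` ?R" using root by blast
  next
    fix s' assume "s' \<in> s ` ?R"
    then show "s' \<in> S" unfolding S_def s_def using singular_span[OF p0] root span_subset_line[OF l] pt by auto
  qed
  show "card S = 6" unfolding S card_image[OF inj] by (rule cardR)
  have N: "lines_at (s t) = kap F (p t)" if "t \<in> ?R" for t
    unfolding s_def using lines_at_kap[OF E L p0] that root by blast
  have "{s' \<in> S. lines_at s' \<ge> 3} = s ` ?R1" unfolding S using N by auto
  then show "card {s' \<in> S. lines_at s' \<ge> 3} = 4" using R1 card_image[OF inj] by simp
  show ge2: "lines_at s' \<ge> 2" if "s' \<in> S" for s'
    using that N kap_ge_2[OF p0] root unfolding S by auto
  have finL: "finite {l. invariant_line F l}" using L by (intro card_ge_0_finite) simp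
  have finS: "finite S" unfolding S using finR by simp
  let ?L1 = "{l'. invariant_line F l' \<and> l' \<noteq> l}"
  have "card ?L1 = 14"
  proof -
    have "?L1 = {l. invariant_line F l} - {l}" by auto
    then show ?thesis using L l finL by simp
  qed
  have "(\<Sum>s'\<in>S. lines_at s' - 1) = (\<Sum>s'\<in>S. card {l' \<in> ?L1. s' \<subseteq> l'})"
  proof (rule sum.cong[OF refl])
    fix s' assume s': "s' \<in> S"
    have "{l' \<in> ?L1. s' \<subseteq> l'} = {l. invariant_line F l \<and> s' \<subseteq> l} - {l}" by auto
    moreover have "l \<in> {l. invariant_line F l \<and> s' \<subseteq> l}" using l s' by (auto simp: S_def)
    ultimately show "lines_at s' - 1 = card {l' \<in> ?L1. s' \<subseteq> l'}"
      by (simp add: lines_at_def)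
  qed
  \<comment> \<open>Count incidences with the other 14 lines: each meets \<open>l\<close> in exactly
    one point, and that point is singular.\<close>
  also have "\<dots> = (\<Sum>s'\<in>S. \<Sum>l'\<in>{l' \<in> ?L1. s' \<subseteq> l'}. 1)" by simp
  also have "\<dots> = (\<Sum>l'\<in>?L1. \<Sum>s'\<in>{s' \<in> S. s' \<subseteq> l'}. 1)"
    by (rule sum.swap_restrict[OF finS]) (use finL in simp)
  also have "\<dots> = (\<Sum>l'\<in>?L1. 1)"
  proof (rule sum.cong[OF refl])
    fix l' assume l': "l' \<in> ?L1"
    then have pl': "proj_line l'" by (simp add: invariant_line_def)
    obtain v where v: "v \<noteq> 0" "v \<in> l" "v \<in> l'" using lines_meet[OF pl pl'] .
    have Fv: "F v = 0" by (rule lines_meet_singular[OF l _ _ v(2,3,1)]) (use l' in auto)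
    have "{s' \<in> S. s' \<subseteq> l'} = {vec.span {v}}"
    proof (intro equalityI subsetI)
      fix s' assume s': "s' \<in> {s' \<in> S. s' \<subseteq> l'}"
      then obtain w where w: "w \<noteq> 0" "s' = vec.span {w}" unfolding S_def using singularE by blast
      then have "w \<in> l" "w \<in> l'" using s' span_subset_line l l' by (auto simp: S_def)
      then have "ccross w v = 0" using proj_line_subset_eq[OF pl pl' _ v(2) _ v(3), of w] l' by blast
      then show "s' \<in> {vec.span {v}}" using w v span1_eq_iff by simp
    qed (use v Fv singular_span span_subset_line l l' in \<open>auto simp: S_def\<close>)
    then show "(\<Sum>s'\<in>{s' \<in> S. s' \<subseteq> l'}. 1) = (1::nat)" by simp
  qed
  finally show "(\<Sum>s'\<in>S. lines_at s' - 1) = 14" using \<open>card ?L1 = 14\<close> by simp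
qed

text \<open>An index different from 1 sits at a nondegenerate singularity whose \<open>jf\<close> is
  not alternating, as \<open>Ed_nonzero\<close> demands.\<close>

lemma Ed_nonzero_of_CS:
  assumes "CS_set F \<noteq> {}"
  shows "\<exists>v. Ed F v \<noteq> 0"
proof -
  obtain c where "c \<in> CS_set F" using assms by blast
  then obtain l p b1 b2 where c: "c \<noteq> 1" "F p = 0" "det3 b1 b2 p \<noteq> 0" "jf F p b1 b1 = 0"
    "jf F p b1 b2 \<noteq> 0" "jf F p b2 b1 \<noteq> 0" "c = - jf F p b1 b2 / jf F p b2 b1"
    by (rule CS_setE)
  have "jf F p b1 b2 + jf F p b2 b1 \<noteq> 0"
  proof
    assume "jf F p b1 b2 + jf F p b2 b1 = 0"
    then have "jf F p b1 b2 = - jf F p b2 b1" by (simp add: add_eq_0_iff)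
    then show False using c by simp
  qed
  then show ?thesis using Ed_nonzero[OF c(2-6)] by blast
qed

definition three_radial :: "(complex^3) set \<Rightarrow> (complex^3) set \<Rightarrow> (complex^3) set \<Rightarrow> bool" where
  "three_radial m1 m2 m3 \<longleftrightarrow> distinct [m1, m2, m3] \<and>
     (\<forall>m\<in>{m1, m2, m3}. radial_singularity F m 3) \<and>
     (\<forall>(p, q)\<in>{(m1, m2), (m1, m3), (m2, m3)}.
        \<exists>r1 r2. r1 \<noteq> r2 \<and> r1 \<subseteq> line_through p q \<and> r2 \<subseteq> line_through p q \<and>
          radial_singularity F r1 1 \<and> radial_singularity F r2 1)"

text \<open>Multiplicities are at most 5 and never 4, so each line carries two points of
  multiplicity 5 and two of multiplicity 3. These become the radial singularities of order 3 and
  1.\<close>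

lemma reduced_convex_imp_three_radial:
  assumes L: "card {l. invariant_line F l} = 15"
    and CS: "CS_set F = {complex_of_real (- 3/2 + sqrt 5 / 2), complex_of_real (- 3/2 - sqrt 5 / 2)}"
  shows "\<exists>m1 m2 m3. three_radial m1 m2 m3"
proof -
  have E: "\<exists>v. Ed F v \<noteq> 0" by (rule Ed_nonzero_of_CS) (simp add: CS)
  let ?S = "{s. singular_point F s}" and ?L = "{l. invariant_line F l}"
  have finL: "finite ?L" using L by (intro card_ge_0_finite) simp
  have N: "lines_at s = card {l \<in> ?L. s \<subseteq> l}" for s by (simp add: lines_at_def)
  note data = line_data[OF E L CS]
  have rad: "radial_singularity F s k" if hyp: "singular_point F s" "lines_at s = k + 2" "k \<ge> 1" for s k
  proof -
    obtain p where p: "p \<noteq> 0" "s = vec.span {p}" "F p = 0" using singularE[OF hyp(1)] .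
    have "\<exists>a w. jf F p a w \<noteq> 0" using maximal_lines(2)[OF E _ p(1,3)] L by simp
    then show ?thesis using radial_iff[OF p(1)] lines_at_kap[OF E L p(1,3)] p hyp by simp
  qed
  have through: "line_through s s' = l" if hyp: "singular_point F s" "singular_point F s'" "s \<noteq> s'" "s \<subseteq> l" "s' \<subseteq> l" "invariant_line F l" for s s' l
  proof -
    obtain p where p: "p \<noteq> 0" "s = vec.span {p}" using singularE[OF hyp(1)] .
    obtain q where q: "q \<noteq> 0" "s' = vec.span {q}" using singularE[OF hyp(2)] .
    have "ccross p q \<noteq> 0" using hyp(3) p q span1_eq_iff by simp
    moreover have "p \<in> l" "q \<in> l" using hyp p q span_subset_line by simp_all
    ultimately show ?thesis
      using proj_line_through[of l p q] hyp(6) unfolding p(2) q(2) line_through_span by (simp add: invariant_line_def)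
  qed
  have sum4: "(\<Sum>s\<in>{s \<in> ?S. s \<subseteq> l}. lines_at s - 3) = 4" if l: "invariant_line F l" for l
  proof -
    let ?T = "{s. singular_point F s \<and> s \<subseteq> l}"
    let ?T3 = "{s \<in> ?T. lines_at s \<ge> 3}"
    note d = data[OF l]
    have finT: "finite ?T" using d(1) by (intro card_ge_0_finite) simp
    have finT3: "finite ?T3" by (rule finite_subset[OF _ finT]) auto
    have "card (?T - ?T3) = 2" using d(1,2) finT3 by (subst card_Diff_subset) auto
    \<comment> \<open>At a point of multiplicity 2 the truncated difference
      \<open>lines_at s - 3\<close> is 0, so the correction there is 1 instead of 2. The corrections
      add up to 4 * 2 + 2 * 1 = 10.\<close>
    have "(\<Sum>s\<in>?T. lines_at s - 1) = (\<Sum>s\<in>?T. (lines_at s - 3) + (if lines_at s \<ge> 3 then 2 else 1))"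
      by (rule sum.cong[OF refl]) (use d(3) in fastforce)
    also have "\<dots> = (\<Sum>s\<in>?T. lines_at s - 3) + (\<Sum>s\<in>?T. if lines_at s \<ge> 3 then 2 else 1)"
      by (rule sum.distrib)
    also have "(\<Sum>s\<in>?T. if lines_at s \<ge> 3 then 2 else 1) =
        (\<Sum>s\<in>?T - ?T3. if lines_at s \<ge> 3 then 2 else 1) + (\<Sum>s\<in>?T3. if lines_at s \<ge> 3 then 2 else (1::nat))"
      by (rule sum.subset_diff[OF _ finT]) auto
    also have "(\<Sum>s\<in>?T - ?T3. if lines_at s \<ge> 3 then 2 else (1::nat)) = (\<Sum>s\<in>?T - ?T3. 1)"
      by (rule sum.cong) auto
    also have "(\<Sum>s\<in>?T3. if lines_at s \<ge> 3 then 2 else (1::nat)) = (\<Sum>s\<in>?T3. 2)"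
      by (rule sum.cong) auto
    also have "(\<Sum>s\<in>?T - ?T3. 1) + (\<Sum>s\<in>?T3. 2) = (10::nat)"
      using d(2) \<open>card (?T - ?T3) = 2\<close> by simp
    finally show ?thesis using d(4) by simp
  qed
  \<comment> \<open>The threshold 8 of \<open>arrangement_count\<close> is \<open>n + 2\<close> in
    \<open>joined\<close>, with \<open>n = 6\<close>.\<close>
  have five: "lines_at s = 5" if "singular_point F s" "lines_at s \<ge> 4" for s
    unfolding N
  proof (rule arrangement_count[OF fin finL L])
    show "l = l'" if "s \<in> ?S" "s' \<in> ?S" "s \<noteq> s'" "l \<in> ?L" "l' \<in> ?L" "s \<subseteq> l" "s' \<subseteq> l" "s \<subseteq> l'" "s' \<subseteq> l'" for s s' l l'
      using through[of s s' l] through[of s s' l'] that by simp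
    show "\<exists>l\<in>?L. s \<subseteq> l \<and> s' \<subseteq> l" if s: "s \<in> ?S" "s' \<in> ?S" "s \<noteq> s'"
      and 8: "8 \<le> card {l \<in> ?L. s \<subseteq> l} + card {l \<in> ?L. s' \<subseteq> l}" for s s'
    proof -
      obtain p where p: "p \<noteq> 0" "s = vec.span {p}" "F p = 0" using singularE s by blast
      obtain q where q: "q \<noteq> 0" "s' = vec.span {q}" "F q = 0" using singularE s by blast
      have pq: "ccross p q \<noteq> 0" using s p q span1_eq_iff by simp
      have "invariant_line F (vec.span {p, q})"
        using joined[OF pq p(3) q(3)] lines_at_kap[OF E L] p q 8 unfolding N[symmetric] by simp
      moreover have "s \<subseteq> vec.span {p, q}" "s' \<subseteq> vec.span {p, q}" unfolding p q by (intro vec.span_mono, simp)+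
      ultimately show ?thesis by blast
    qed
    show "(\<Sum>s\<in>{s \<in> ?S. s \<subseteq> l}. card {l \<in> ?L. s \<subseteq> l} - 3) = 4" if "l \<in> ?L" for l
      using sum4[of l] that unfolding N by simp
  qed (use that N in auto)
  have counts: "card {s. singular_point F s \<and> s \<subseteq> l \<and> lines_at s = 5} = 2 \<and>
      card {s. singular_point F s \<and> s \<subseteq> l \<and> lines_at s = 3} = 2" if l: "invariant_line F l" for l
  proof -
    let ?T = "{s. singular_point F s \<and> s \<subseteq> l}"
    let ?T3 = "{s. singular_point F s \<and> s \<subseteq> l \<and> lines_at s = 3}" and ?T5 = "{s. singular_point F s \<and> s \<subseteq> l \<and> lines_at s = 5}"
    note d = data[OF l]
    have finT: "finite ?T" using d(1) by (intro card_ge_0_finite) simp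
    have sub: "?T5 \<subseteq> ?T" "?T3 \<subseteq> ?T" by auto
    have fin5: "finite ?T5" "finite ?T3" using finite_subset[OF sub(1) finT] finite_subset[OF sub(2) finT] by auto
    \<comment> \<open>Only points of multiplicity 5 have positive weight, namely 2, so there are
      two; the remaining two of the four multiple points have multiplicity 3.\<close>
    have "4 = (\<Sum>s\<in>?T. lines_at s - 3)" using sum4[OF l] by simp
    also have "\<dots> = (\<Sum>s\<in>?T5. lines_at s - 3)"
      by (rule sum.mono_neutral_right[OF finT sub(1)]) (use five in fastforce)
    also have "\<dots> = 2 * card ?T5" by simp
    finally have 5: "card ?T5 = 2" by simp
    have "lines_at s \<ge> 3 \<longleftrightarrow> lines_at s = 5 \<or> lines_at s = 3" if "singular_point F s" for s
      using five[OF that] by linarith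
    then have "{s \<in> ?T. lines_at s \<ge> 3} = ?T5 \<union> ?T3" by blast
    then have "card (?T5 \<union> ?T3) = 4" using d(2) by simp
    moreover have "card (?T5 \<union> ?T3) = card ?T5 + card ?T3" using fin5 by (intro card_Un_disjoint) auto
    ultimately show ?thesis using 5 by simp
  qed
  have order1: "\<exists>r1 r2. r1 \<noteq> r2 \<and> r1 \<subseteq> l \<and> r2 \<subseteq> l \<and> radial_singularity F r1 1 \<and> radial_singularity F r2 1"
    if l: "invariant_line F l" for l
  proof -
    obtain r1 r2 where r: "r1 \<in> {s. singular_point F s \<and> s \<subseteq> l \<and> lines_at s = 3}"
        "r2 \<in> {s. singular_point F s \<and> s \<subseteq> l \<and> lines_at s = 3}" "r1 \<noteq> r2"
      by (rule card_2E[OF conjunct2[OF counts[OF l]]])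
    from r(1,2) have "r1 \<subseteq> l" "r2 \<subseteq> l" "radial_singularity F r1 1" "radial_singularity F r2 1"
      using rad[of r1 1] rad[of r2 1] by simp_all
    then show ?thesis using r(3) by blast
  qed
  have other: "\<exists>s'. singular_point F s' \<and> s' \<subseteq> l \<and> lines_at s' = 5 \<and> s' \<noteq> s" if l: "invariant_line F l" for l s
  proof -
    obtain r1 r2 where r: "r1 \<in> {s. singular_point F s \<and> s \<subseteq> l \<and> lines_at s = 5}"
        "r2 \<in> {s. singular_point F s \<and> s \<subseteq> l \<and> lines_at s = 5}" "r1 \<noteq> r2"
      by (rule card_2E[OF conjunct1[OF counts[OF l]]])
    then show ?thesis by (cases "r1 = s") auto
  qed
  have "?L \<noteq> {}" using L by (metis card.empty zero_neq_numeral)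
  then obtain l0 where l0: "invariant_line F l0" by blast
  obtain m1 where m1: "singular_point F m1" "lines_at m1 = 5" using other[OF l0] by blast
  have "\<not> card {l. invariant_line F l \<and> m1 \<subseteq> l} \<le> 1" using m1(2) by (simp add: lines_at_def)
  then obtain l2 l3 where l23: "invariant_line F l2" "m1 \<subseteq> l2" "invariant_line F l3" "m1 \<subseteq> l3" "l2 \<noteq> l3"
    using card_le_Suc0_iff_eq[of "{l. invariant_line F l \<and> m1 \<subseteq> l}"] finL by auto
  \<comment> \<open>Two different lines through \<open>m1\<close> each carry one more point of
    multiplicity 5. These are distinct, and 5 + 5 \<ge> 8 makes the line joining them
    invariant.\<close>
  obtain m2 where m2: "singular_point F m2" "m2 \<subseteq> l2" "lines_at m2 = 5" "m2 \<noteq> m1" using other[OF l23(1)] by blast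
  obtain m3 where m3: "singular_point F m3" "m3 \<subseteq> l3" "lines_at m3 = 5" "m3 \<noteq> m1" using other[OF l23(3)] by blast
  have l2: "line_through m1 m2 = l2" using through[OF m1(1) m2(1) _ l23(2) m2(2) l23(1)] m2 by simp
  have l3: "line_through m1 m3 = l3" using through[OF m1(1) m3(1) _ l23(4) m3(2) l23(3)] m3 by simp
  have m23: "m2 \<noteq> m3" using l2 l3 l23 by auto
  obtain p where p: "p \<noteq> 0" "m2 = vec.span {p}" "F p = 0" using singularE[OF m2(1)] .
  obtain q where q: "q \<noteq> 0" "m3 = vec.span {q}" "F q = 0" using singularE[OF m3(1)] .
  have pq: "ccross p q \<noteq> 0" using m23 p q span1_eq_iff by simp
  have "invariant_line F (vec.span {p, q})"
    using joined[OF pq p(3) q(3)] lines_at_kap[OF E L] p q m2 m3 by simp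
  then have l23': "invariant_line F (line_through m2 m3)" unfolding p q line_through_span .
  have "radial_singularity F m1 3" "radial_singularity F m2 3" "radial_singularity F m3 3"
    using m1 m2 m3 rad[of m1 3] rad[of m2 3] rad[of m3 3] by simp_all
  then have "three_radial m1 m2 m3"
    unfolding three_radial_def using m2(4) m3(4) m23 order1[OF l23(1)] order1[OF l23(3)] order1[OF l23'] l2 l3
    by simp
  then show ?thesis by blast
qed

end

section \<open>Normal form with three radial singularities of order three\<close>

lemma ddir_eqI:
  assumes "homogeneous_poly n f" "((\<lambda>s. f (p + s *s w)) has_field_derivative D) (at 0)"
  shows "ddir f w p = D"
proof -
  have "(\<lambda>s. f (p + s *s w)) = poly (lpoly f p w)" by (auto simp: poly_lpoly[OF assms(1)])
  then have "poly (pderiv (lpoly f p w)) 0 = D"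
    using assms(2) poly_DERIV[of "lpoly f p w" 0] DERIV_unique by metis
  then show ?thesis by (simp add: ddir_def poly_0_coeff_0 coeff_pderiv)
qed

text \<open>Reversing the restriction to a line through \<open>e\<close> turns order 5 at
  \<open>e\<close> into degree at most 1 in the coordinate along \<open>e\<close>.\<close>

lemma vanishes_5_expand:
  assumes f: "homogeneous_poly 6 f" and v: "vanishes f e 5"
  obtains g where "homogeneous_poly 5 g" "\<And>u z. f (u + z *s e) = z * g u + f u"
proof
  let ?g = "\<lambda>u. coeff (lpoly f e u) 5"
  show "homogeneous_poly 5 ?g" by (rule homogeneous_poly_coeff_lpoly[OF f])
  fix u z
  have "coeff (lpoly f u e) j = coeff [:f u, ?g u:] j" for j
  proof -
    consider "j = 0" | "j = 1" | "2 \<le> j" "j \<le> 6" | "j > 6" by linarith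
    then show ?thesis
    proof cases
      case 1 then show ?thesis using coeff_lpoly_0[OF f] by simp
    next
      case 2 then show ?thesis using coeff_lpoly_reverse[OF f, of 1 u e] by simp
    next
      case 3
      then have "coeff (lpoly f u e) j = 0"
        using coeff_lpoly_reverse[OF f, of j u e] v by (simp add: vanishes_iff)
      then show ?thesis using 3 by (auto simp: coeff_pCons split: nat.splits)
    next
      case 4
      then have "coeff (lpoly f u e) j = 0" using degree_lpoly[OF f, of u e] by (simp add: coeff_eq_0)
      then show ?thesis using 4 by (auto simp: coeff_pCons split: nat.splits)
    qed
  qed
  then have "lpoly f u e = [:f u, ?g u:]" by (simp add: poly_eq_iff)
  then show "f (u + z *s e) = z * ?g u + f u" using poly_lpoly[OF f, of u e z] by (simp add: add.commute)
qed

lemma binary_form_12: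
  assumes "homogeneous_poly n f"
  obtains c where "\<And>x y. f (vector [x, y, 0]) = (\<Sum>i\<le>n. c i * x^i * y^(n - i))"
proof -
  obtain c where c: "\<And>v. f v = (\<Sum>i\<le>n. \<Sum>j\<le>n - i. c i j * (v$1)^i * (v$2)^j * (v$3)^(n - i - j))"
    using assms unfolding homogeneous_poly_def by blast
  have "f (vector [x, y, 0]) = (\<Sum>i\<le>n. c i (n - i) * x^i * y^(n - i))" for x y
    unfolding c
  proof (rule sum.cong[OF refl])
    fix i assume "i \<in> {..n}"
    show "(\<Sum>j\<le>n - i. c i j * ((vector [x, y, 0] :: complex^3) $ 1)^i * ((vector [x, y, 0] :: complex^3) $ 2)^j
        * ((vector [x, y, 0] :: complex^3) $ 3)^(n - i - j)) = c i (n - i) * x^i * y^(n - i)"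
      by (subst sum_single[of _ "n - i"]) (auto simp: power_0_left)
  qed
  then show ?thesis by (rule that)
qed

lemma binary_form_13:
  assumes "homogeneous_poly n f"
  obtains c where "\<And>x z. f (vector [x, 0, z]) = (\<Sum>i\<le>n. c i * x^i * z^(n - i))"
proof -
  obtain c where c: "\<And>v. f v = (\<Sum>i\<le>n. \<Sum>j\<le>n - i. c i j * (v$1)^i * (v$2)^j * (v$3)^(n - i - j))"
    using assms unfolding homogeneous_poly_def by blast
  have "f (vector [x, 0, z]) = (\<Sum>i\<le>n. c i 0 * x^i * z^(n - i))" for x z
    unfolding c
  proof (rule sum.cong[OF refl])
    fix i assume "i \<in> {..n}"
    show "(\<Sum>j\<le>n - i. c i j * ((vector [x, 0, z] :: complex^3) $ 1)^i * ((vector [x, 0, z] :: complex^3) $ 2)^j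
        * ((vector [x, 0, z] :: complex^3) $ 3)^(n - i - j)) = c i 0 * x^i * z^(n - i)"
      by (subst sum_single[of _ "0"]) (auto simp: power_0_left)
  qed
  then show ?thesis by (rule that)
qed

lemma binary_form_23:
  assumes "homogeneous_poly n f"
  obtains c where "\<And>y z. f (vector [0, y, z]) = (\<Sum>j\<le>n. c j * y^j * z^(n - j))"
proof -
  obtain c where c: "\<And>v. f v = (\<Sum>i\<le>n. \<Sum>j\<le>n - i. c i j * (v$1)^i * (v$2)^j * (v$3)^(n - i - j))"
    using assms unfolding homogeneous_poly_def by blast
  have "f (vector [0, y, z]) = (\<Sum>j\<le>n. c 0 j * y^j * z^(n - j))" for y z
    unfolding c by (subst sum_single[of _ 0]) (auto simp: power_0_left)
  then show ?thesis by (rule that)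
qed

text \<open>One component of a form whose vertices have order 5. It is affine in \<open>z\<close>;
  the quartic on the side \<open>z = 0\<close> has no term \<open>x^2 y^2\<close>, as forced by the
  Euler condition.\<close>

definition edge where
  "edge k1 k2 k3 k4 X f h Y x y z =
    x * y * (z * (k1 * x^3 + k2 * x^2 * y + k3 * x * y^2 + k4 * y^3)
      + (X * x^4 + f * x^3 * y + h * x * y^3 - Y * (y::complex)^4))"

text \<open>The three components are cyclic copies of \<open>edge\<close>. Sharing of parameters
  between them, up to sign, is exactly what the Euler condition imposes.\<close>

definition gform where
  "gform X Y Z f1 f2 f3 h1 h2 h3 p q w v =
    (vector [edge (- h1) (- q) w (- f3) Y f2 h2 Z (v$2) (v$3) (v$1),
      edge (- h2) (- w) (- p) (- f1) Z f3 h3 X (v$3) (v$1) (v$2),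
      edge (- h3) p q (- f2) X f1 h1 Y (v$1) (v$2) (v$3)] :: complex^3)"

text \<open>Each component is affine in its own coordinate by \<open>vanishes_5_expand\<close>, with
  binary forms as coefficients. Comparing coefficients in the Euler condition identifies these with
  the twelve parameters.\<close>

lemma gform_of_order_5:
  assumes hf: "hform 6 G"
    and v: "\<And>k. vanishes (\<lambda>v. G v $ k) (axis k 1) 5"
  obtains X Y Z f1 f2 f3 h1 h2 h3 p q w where "G = gform X Y Z f1 f2 f3 h1 h2 h3 p q w"
proof -
  have h: "homogeneous_poly 6 (\<lambda>v. G v $ k)" for k using hf by (simp add: hform_def)
  obtain A where A: "homogeneous_poly 5 A" "\<And>u x. G (u + x *s axis 1 1) $ 1 = x * A u + G u $ 1"
    using vanishes_5_expand[OF h v] by blast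
  obtain B where B: "homogeneous_poly 5 B" "\<And>u x. G (u + x *s axis 2 1) $ 2 = x * B u + G u $ 2"
    using vanishes_5_expand[OF h v] by blast
  obtain C where C: "homogeneous_poly 5 C" "\<And>u x. G (u + x *s axis 3 1) $ 3 = x * C u + G u $ 3"
    using vanishes_5_expand[OF h v] by blast
  obtain a where a: "\<And>y z. A (vector [0, y, z]) = (\<Sum>j\<le>5. a j * y^j * z^(5 - j))"
    using binary_form_23[OF A(1)] by blast
  obtain a' where a': "\<And>y z. G (vector [0, y, z]) $ 1 = (\<Sum>j\<le>6. a' j * y^j * z^(6 - j))"
    using binary_form_23[OF h] by blast
  obtain b where b: "\<And>x z. B (vector [x, 0, z]) = (\<Sum>j\<le>5. b j * x^j * z^(5 - j))"
    using binary_form_13[OF B(1)] by blast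
  obtain b' where b': "\<And>x z. G (vector [x, 0, z]) $ 2 = (\<Sum>j\<le>6. b' j * x^j * z^(6 - j))"
    using binary_form_13[OF h] by blast
  obtain c where c: "\<And>x y. C (vector [x, y, 0]) = (\<Sum>j\<le>5. c j * x^j * y^(5 - j))"
    using binary_form_12[OF C(1)] by blast
  obtain c' where c': "\<And>x y. G (vector [x, y, 0]) $ 3 = (\<Sum>j\<le>6. c' j * x^j * y^(6 - j))"
    using binary_form_12[OF h] by blast
  have s5: "(\<Sum>j\<le>5. g j) = g 0 + g 1 + g 2 + g 3 + g 4 + g 5" for g :: "nat \<Rightarrow> complex"
    by (simp add: numeral_eq_Suc)
  have s6: "(\<Sum>j\<le>6. g j) = g 0 + g 1 + g 2 + g 3 + g 4 + g 5 + g 6" for g :: "nat \<Rightarrow> complex"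
    by (simp add: numeral_eq_Suc)
  have G1: "G (vector [x, y, z]) $ 1 = x * (a 0 * z^5 + a 1 * y * z^4 + a 2 * y^2 * z^3 + a 3 * y^3 * z^2 + a 4 * y^4 * z + a 5 * y^5)
      + (a' 0 * z^6 + a' 1 * y * z^5 + a' 2 * y^2 * z^4 + a' 3 * y^3 * z^3 + a' 4 * y^4 * z^2 + a' 5 * y^5 * z + a' 6 * y^6)" for x y z
  proof -
    have e: "(vector [x, y, z] :: complex^3) = vector [0, y, z] + x *s axis 1 1" by (simp add: vec3_eq_iff axis_def)
    show ?thesis unfolding e A(2) a a' s5 s6 by simp
  qed
  have G2: "G (vector [x, y, z]) $ 2 = y * (b 0 * z^5 + b 1 * x * z^4 + b 2 * x^2 * z^3 + b 3 * x^3 * z^2 + b 4 * x^4 * z + b 5 * x^5)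
      + (b' 0 * z^6 + b' 1 * x * z^5 + b' 2 * x^2 * z^4 + b' 3 * x^3 * z^3 + b' 4 * x^4 * z^2 + b' 5 * x^5 * z + b' 6 * x^6)" for x y z
  proof -
    have e: "(vector [x, y, z] :: complex^3) = vector [x, 0, z] + y *s axis 2 1" by (simp add: vec3_eq_iff axis_def)
    show ?thesis unfolding e B(2) b b' s5 s6 by simp
  qed
  have G3: "G (vector [x, y, z]) $ 3 = z * (c 0 * y^5 + c 1 * x * y^4 + c 2 * x^2 * y^3 + c 3 * x^3 * y^2 + c 4 * x^4 * y + c 5 * x^5)
      + (c' 0 * y^6 + c' 1 * x * y^5 + c' 2 * x^2 * y^4 + c' 3 * x^3 * y^3 + c' 4 * x^4 * y^2 + c' 5 * x^5 * y + c' 6 * x^6)" for x y z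
  proof -
    have e: "(vector [x, y, z] :: complex^3) = vector [x, y, 0] + z *s axis 3 1" by (simp add: vec3_eq_iff axis_def)
    show ?thesis unfolding e C(2) c c' s5 s6 by simp
  qed
  \<comment> \<open>The Euler expression at \<open>(x, y, 1)\<close> as a polynomial in
    \<open>x\<close> whose coefficients are polynomials in \<open>y\<close>; since it vanishes for
    all \<open>x\<close> and \<open>y\<close>, every inner coefficient is 0.\<close>
  define E where "E = (\<lambda>y. [:poly [:0, b' 0, b 0, 0, 0, c 0, c' 0:] y,
      poly [:a' 0, b' 1 + a' 1, b 1 + a' 2, a' 3, c 1 + a' 4, c' 1 + a' 5, a' 6:] y,
      poly [:a 0, b' 2 + a 1, b 2 + a 2, c 2 + a 3, c' 2 + a 4, a 5:] y,
      poly [:0, b' 3, b 3 + c 3, c' 3:] y,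
      poly [:0, b' 4 + c 4, b 4 + c' 4:] y,
      poly [:c 5, b' 5 + c' 5, b 5:] y,
      poly [:c' 6, b' 6:] y:])"
  have "poly (E y) x = 0" for x y
  proof -
    have "G (vector [x, y, 1]) $ 1 * x + G (vector [x, y, 1]) $ 2 * y + G (vector [x, y, 1]) $ 3 * 1 = 0"
      using hform_euler[OF hf, of "vector [x, y, 1]"] by (simp add: dot_3)
    moreover have "poly (E y) x = G (vector [x, y, 1]) $ 1 * x + G (vector [x, y, 1]) $ 2 * y + G (vector [x, y, 1]) $ 3 * 1"
      unfolding G1 G2 G3 E_def by (simp add: algebra_simps power_numeral_reduce)
    ultimately show ?thesis by simp
  qed
  then have E0: "E y = 0" for y using poly_all_0_iff_0 by blast
  have "poly [:0, b' 0, b 0, 0, 0, c 0, c' 0:] y = 0" "poly [:a' 0, b' 1 + a' 1, b 1 + a' 2, a' 3, c 1 + a' 4, c' 1 + a' 5, a' 6:] y = 0"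
    "poly [:a 0, b' 2 + a 1, b 2 + a 2, c 2 + a 3, c' 2 + a 4, a 5:] y = 0" "poly [:0, b' 3, b 3 + c 3, c' 3:] y = 0"
    "poly [:0, b' 4 + c 4, b 4 + c' 4:] y = 0" "poly [:c 5, b' 5 + c' 5, b 5:] y = 0" "poly [:c' 6, b' 6:] y = 0" for y
    using E0[of y] unfolding E_def pCons_eq_0_iff by blast+
  then have "[:0, b' 0, b 0, 0, 0, c 0, c' 0:] = 0" "[:a' 0, b' 1 + a' 1, b 1 + a' 2, a' 3, c 1 + a' 4, c' 1 + a' 5, a' 6:] = 0"
    "[:a 0, b' 2 + a 1, b 2 + a 2, c 2 + a 3, c' 2 + a 4, a 5:] = 0" "[:0, b' 3, b 3 + c 3, c' 3:] = 0"
    "[:0, b' 4 + c 4, b 4 + c' 4:] = 0" "[:c 5, b' 5 + c' 5, b 5:] = 0" "[:c' 6, b' 6:] = 0"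
    by (simp_all only: poly_all_0_iff_0[symmetric] simp_thms)
  then have z: "b' 0 = 0" "b 0 = 0" "c 0 = 0" "c' 0 = 0" "a' 0 = 0" "a' 1 = - b' 1" "b 1 = - a' 2" "a' 3 = 0"
    "c 1 = - a' 4" "a' 5 = - c' 1" "a' 6 = 0" "a 0 = 0" "a 1 = - b' 2" "b 2 = - a 2" "a 3 = - c 2" "a 4 = - c' 2"
    "a 5 = 0" "b' 3 = 0" "b 3 = - c 3" "c' 3 = 0" "c 4 = - b' 4" "b 4 = - c' 4" "c 5 = 0" "b' 5 = - c' 5" "b 5 = 0"
    "c' 6 = 0" "b' 6 = 0"
    by (simp_all add: add_eq_0_iff2 add_eq_0_iff)
  have "G v = gform (c' 5) (- c' 1) (b' 1) (c' 4) (a' 4) (b' 2) (c' 2) (a' 2) (b' 4) (c 3) (c 2) (a 2) v" for v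
  proof -
    have e: "v = vector [v$1, v$2, v$3]" by (simp add: vec3_eq_iff)
    have "G v $ 1 = gform (c' 5) (- c' 1) (b' 1) (c' 4) (a' 4) (b' 2) (c' 2) (a' 2) (b' 4) (c 3) (c 2) (a 2) v $ 1"
      by (subst e) (simp add: G1 z z[unfolded One_nat_def] gform_def edge_def algebra_simps power_numeral_reduce)
    moreover have "G v $ 2 = gform (c' 5) (- c' 1) (b' 1) (c' 4) (a' 4) (b' 2) (c' 2) (a' 2) (b' 4) (c 3) (c 2) (a 2) v $ 2"
      by (subst e) (simp add: G2 z z[unfolded One_nat_def] gform_def edge_def algebra_simps power_numeral_reduce)
    moreover have "G v $ 3 = gform (c' 5) (- c' 1) (b' 1) (c' 4) (a' 4) (b' 2) (c' 2) (a' 2) (b' 4) (c 3) (c 2) (a 2) v $ 3"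
      by (subst e) (simp add: G3 z z[unfolded One_nat_def] gform_def edge_def algebra_simps power_numeral_reduce)
    ultimately show ?thesis by (simp add: vec3_eq_iff)
  qed
  then show ?thesis using that by blast
qed

text \<open>Rotation of the coordinates. It permutes the parameters of \<open>gform\<close> up to
  sign, so what is shown for the side joining the first two vertices holds for all sides.\<close>

definition cyc :: "complex^3^3" where
  "cyc = mat3 (axis 2 1) (axis 3 1) (axis 1 1)"

lemma cyc_mult: "cyc *v v = vector [v$3, v$1, v$2]"
  by (simp add: cyc_def mat3_mult vec3_eq_iff axis_def)

lemma invertible_cyc: "invertible cyc"
  by (simp add: cyc_def invertible_mat3 det3_eq axis_def)

lemma pullback_cyc_gform:
  "pullback cyc (gform X Y Z f1 f2 f3 h1 h2 h3 p q w) = gform Y Z X f2 f3 f1 h2 h3 h1 (- q) w (- p)"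
  by (rule ext) (simp add: vec3_eq_iff pullback_nth cyc_mult gform_def dot_3 axis_def)

text \<open>At a singularity on the side \<open>z = 0\<close> the third component gives the quartic
  equation. The condition \<open>sym\<close> means \<open>kap \<ge> 3\<close>: the entry on the
  third axis gives the cubic with coefficients \<open>p, q\<close>, and the sum of the two mixed
  entries on axes 2 and 3 gives the remaining equation.\<close>

lemma gform_edge_equations:
  assumes G: "G = gform X Y Z f1 f2 f3 h1 h2 h3 p q w" and hf: "hform 6 G"
    and P: "P = axis 1 1 + t *s axis 2 1" and G0: "G P = 0" and t: "t \<noteq> 0"
    and sym: "\<And>u. jf G P u u = 0"
  shows "X + f1 * t + h1 * t^3 - Y * t^4 = 0" "f1 + 4 * h1 * t^2 - 5 * Y * t^3 = 0"
    "- h3 + p * t + q * t^2 - f2 * t^3 = 0"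
proof -
  have h: "homogeneous_poly 6 (\<lambda>v. G v $ k)" for k using hf by (simp add: hform_def)
  have Pn: "P$1 = 1" "P$2 = t" "P$3 = 0" by (simp_all add: P axis_def)
  have "G P $ 3 = 0" using G0 by simp
  then show 1: "X + f1 * t + h1 * t^3 - Y * t^4 = 0" using t by (simp add: G gform_def edge_def Pn)
  have j33: "jf G P (axis 3 1) (axis 3 1) = t * (- h3 + p * t + q * t^2 - f2 * t^3)"
    unfolding jf_def dot_axis
    by (rule ddir_eqI[OF h]) (auto simp: G gform_def edge_def Pn axis_def power_numeral_reduce
        algebra_simps intro!: derivative_eq_intros)
  then show "- h3 + p * t + q * t^2 - f2 * t^3 = 0" using sym[of "axis 3 1"] t by simp
  have j32: "jf G P (axis 3 1) (axis 2 1) = (X + f1 * t + h1 * t^3 - Y * t^4) + t * (f1 + 3 * h1 * t^2 - 4 * Y * t^3)"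
    unfolding jf_def dot_axis
    by (rule ddir_eqI[OF h]) (auto simp: G gform_def edge_def Pn axis_def power_numeral_reduce
        algebra_simps intro!: derivative_eq_intros)
  have j23: "jf G P (axis 2 1) (axis 3 1) = - f1 * t - X"
    unfolding jf_def dot_axis
    by (rule ddir_eqI[OF h]) (auto simp: G gform_def edge_def Pn axis_def power_numeral_reduce
        algebra_simps intro!: derivative_eq_intros)
  have "jf G P (axis 3 1) (axis 2 1) + jf G P (axis 2 1) (axis 3 1) = 0"
    using sym[of "axis 3 1 + axis 2 1"] sym[of "axis 3 1"] sym[of "axis 2 1"]
    by (simp add: jf_add1[OF hf] jf_add2[OF hf] add.commute)
  then have "t * (f1 + 4 * h1 * t^2 - 5 * Y * t^3) = 0"
    unfolding j32 j23 by (simp add: algebra_simps power_numeral_reduce)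
  then show "f1 + 4 * h1 * t^2 - 5 * Y * t^3 = 0" using t by simp
qed

text \<open>All first derivatives at the third vertex carry the factor \<open>Z\<close>.\<close>

lemma gform_linear_part_3:
  assumes G: "G = gform X Y Z f1 f2 f3 h1 h2 h3 p q w" and hf: "hform 6 G"
    and nz: "jf G (axis 3 1) a b \<noteq> 0"
  shows "Z \<noteq> 0"
proof
  assume Z: "Z = 0"
  have h: "homogeneous_poly 6 (\<lambda>v. G v $ k)" for k using hf by (simp add: hform_def)
  have "ddir (\<lambda>v. G v $ k) b (axis 3 1) = 0" for k
    using exhaust_3[of k]
    by (intro ddir_eqI[OF h]) (auto simp: G Z gform_def edge_def axis_def power_numeral_reduce
        algebra_simps intro!: derivative_eq_intros)
  moreover have "jf G (axis 3 1) a b = (\<Sum>k\<in>UNIV. a$k * jf G (axis 3 1) (axis k 1) b)"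
  proof -
    have a: "a = a$1 *s axis 1 1 + a$2 *s axis 2 1 + a$3 *s axis 3 1" by (simp add: vec3_eq_iff axis_def)
    show ?thesis by (subst a) (simp add: jf_add1[OF hf] jf_smult1[OF hf] sum_3)
  qed
  ultimately show False using nz by (simp add: jf_def)
qed

section \<open>Solving the edge equations\<close>

text \<open>The two root patterns of a side: \<open>t1 + t2 = - al * s\<close> and
  \<open>t1 * t2 = be * s^2\<close>, so the roots are those of \<open>t^2 + 5 s t + 5 s^2\<close> or
  of \<open>t^2 + 3 s t - 3 s^2\<close>. The numbers \<open>ph\<close> and \<open>ep\<close> give
  \<open>f\<close> and \<open>X\<close> in units of \<open>s^3 * Y\<close> and
  \<open>s^4 * Y\<close>.\<close>

definition edge_const :: "complex \<Rightarrow> complex \<Rightarrow> complex \<Rightarrow> complex \<Rightarrow> bool" where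
  "edge_const al be ph ep \<longleftrightarrow> 
    al = 5 \<and> be = 5 \<and> ph = 25 \<and> ep = 25 \<or> al = 3 \<and> be = -3 \<and> ph = 15 \<and> ep = -9"

lemma quadratic_remainder:
  fixes t1 t2 :: complex
  assumes "t1 \<noteq> t2" "u + v * t1 = 0" "u + v * t2 = 0"
  shows "u = 0" "v = 0"
proof -
  have "v * (t1 - t2) = 0" using assms(2,3) by algebra
  then show "v = 0" using assms(1) by simp
  then show "u = 0" using assms(2) by simp
qed

text \<open>Subtracting the equations at \<open>t1\<close> and \<open>t2\<close> and dividing by
  \<open>t1 - t2\<close> gives relations in the symmetric functions of the roots. Once the quadratic
  with these roots is known, the cubic in \<open>k1\<close> to \<open>k4\<close> is reduced modulo
  it, and both coefficients of the remainder vanish.\<close>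

lemma edge_solution:
  fixes t1 t2 :: complex
  assumes t: "t1 \<noteq> t2" "t1 \<noteq> 0" "t2 \<noteq> 0"
    and q: "X + f * t1 + h * t1^3 - Y * t1^4 = 0" "X + f * t2 + h * t2^3 - Y * t2^4 = 0"
    and c: "f + 4 * h * t1^2 - 5 * Y * t1^3 = 0" "f + 4 * h * t2^2 - 5 * Y * t2^3 = 0"
    and k: "k1 + k2 * t1 + k3 * t1^2 + k4 * t1^3 = 0" "k1 + k2 * t2 + k3 * t2^2 + k4 * t2^3 = 0"
    and Y: "Y \<noteq> 0"
  obtains s al be ph ep where "edge_const al be ph ep" "s \<noteq> 0" "h = - 5 * s * Y" "f = ph * s^3 * Y" "X = ep * s^4 * Y"
    "be * s^2 * k3 = k1 + al * be * s^3 * k4" "be * s * k2 = al * k1 + be^2 * s^3 * k4"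
proof -
  have "(4 * h * (t1 + t2) - 5 * Y * (t1^2 + t1 * t2 + t2^2)) * (t1 - t2) = 0" using c by algebra
  then have D1: "4 * h * (t1 + t2) = 5 * Y * (t1^2 + t1 * t2 + t2^2)" using t by simp
  have "(f + h * (t1^2 + t1 * t2 + t2^2) - Y * (t1^3 + t1^2 * t2 + t1 * t2^2 + t2^3)) * (t1 - t2) = 0"
    using q by algebra
  then have D3: "f + h * (t1^2 + t1 * t2 + t2^2) - Y * (t1^3 + t1^2 * t2 + t1 * t2^2 + t2^3) = 0" using t by simp
  \<comment> \<open>The eliminant splits, one factor for each pattern of \<open>edge_const\<close>.
    In both cases \<open>s\<close> is scaled so that \<open>h = - 5 * s * Y\<close>.\<close>
  have "(Y * (t1 + t2) - h) * ((t1 + t2)^2 + 3 * (t1 * t2)) = 0" using D1 D3 c by algebra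
  then consider "h = Y * (t1 + t2)" | "(t1 + t2)^2 = - 3 * (t1 * t2)" by (auto simp: add_eq_0_iff2)
  then show ?thesis
  proof cases
    case 1
    define s where "s = - (t1 + t2) / 5"
    have s1: "t1 + t2 = - 5 * s" by (simp add: s_def)
    have h: "h = - 5 * s * Y" using 1 s1 by (simp add: mult.commute)
    have "Y * (5 * (t1 * t2) - (t1 + t2)^2) = 0" using D1 1 by algebra
    then have "5 * (t1 * t2) = (t1 + t2)^2" using Y by simp
    then have s2: "t1 * t2 = 5 * s^2" unfolding s1 by (simp add: power2_eq_square)
    then have s0: "s \<noteq> 0" using t by auto
    have e: "t1^2 = - 5 * s * t1 - 5 * s^2" "t2^2 = - 5 * s * t2 - 5 * s^2" using s1 s2 by algebra+
    have f: "f = 25 * s^3 * Y" using c(1) h e(1) by algebra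
    have X: "X = 25 * s^4 * Y" using q(1) h e(1) f by algebra
    have "(k1 - 5 * s^2 * k3 + 25 * s^3 * k4) + (k2 - 5 * s * k3 + 20 * s^2 * k4) * t1 = 0"
      "(k1 - 5 * s^2 * k3 + 25 * s^3 * k4) + (k2 - 5 * s * k3 + 20 * s^2 * k4) * t2 = 0"
      using k e by algebra+
    then have "k1 - 5 * s^2 * k3 + 25 * s^3 * k4 = 0" "k2 - 5 * s * k3 + 20 * s^2 * k4 = 0"
      using quadratic_remainder[OF t(1)] by blast+
    then have "5 * s^2 * k3 = k1 + 5 * 5 * s^3 * k4" "5 * s * k2 = 5 * k1 + 5^2 * s^3 * k4"
      by algebra+
    then show ?thesis using that[of 5 5 25 25 s] s0 h f X by (simp add: edge_const_def)
  next
    case 2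
    define s where "s = - (t1 + t2) / 3"
    have s1: "t1 + t2 = - 3 * s" by (simp add: s_def)
    have s2: "t1 * t2 = - 3 * s^2" using 2 unfolding s1 by (simp add: power2_eq_square)
    then have s0: "s \<noteq> 0" using t by auto
    have "s * (h + 5 * s * Y) = 0" using D1 s1 s2 by algebra
    then have h: "h = - 5 * s * Y" using s0 by (simp add: add_eq_0_iff2)
    have e: "t1^2 = - 3 * s * t1 + 3 * s^2" "t2^2 = - 3 * s * t2 + 3 * s^2" using s1 s2 by algebra+
    have f: "f = 15 * s^3 * Y" using c(1) h e(1) D1 D3 s1 s2 by algebra
    have X: "X = - 9 * s^4 * Y" using q(1) h e(1) f by algebra
    have "(k1 + 3 * s^2 * k3 - 9 * s^3 * k4) + (k2 - 3 * s * k3 + 12 * s^2 * k4) * t1 = 0"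
      "(k1 + 3 * s^2 * k3 - 9 * s^3 * k4) + (k2 - 3 * s * k3 + 12 * s^2 * k4) * t2 = 0"
      using k e by algebra+
    then have "k1 + 3 * s^2 * k3 - 9 * s^3 * k4 = 0" "k2 - 3 * s * k3 + 12 * s^2 * k4 = 0"
      using quadratic_remainder[OF t(1)] by blast+
    then have "(-3) * s^2 * k3 = k1 + 3 * (-3) * s^3 * k4" "(-3) * s * k2 = 3 * k1 + (-3)^2 * s^3 * k4"
      by algebra+
    then show ?thesis using that[of 3 "-3" 15 "-9" s] s0 h f X by (simp add: edge_const_def)
  qed
qed

text \<open>The parameter \<open>q\<close> occurs on two adjacent sides. Equating its two
  expressions and removing the factor \<open>s1^3 * s2^4 * Z\<close> leaves a relation in the
  product \<open>s1 * s2 * s3\<close> alone.\<close>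

lemma edge_relation:
  assumes "h1 = - 5 * s1 * Y" "X = ep1 * s1^4 * Y" "f2 = ph2 * s2^3 * Z" "Y = ep2 * s2^4 * Z"
    "h3 = - 5 * s3 * X" "f3 = ph3 * s3^3 * X"
    and q: "be1 * s1^2 * q = - h3 + al1 * be1 * s1^3 * (- f2)" "be2 * s2 * (- q) = al2 * (- h1) + be2^2 * s2^3 * (- f3)"
    and nz: "s1 \<noteq> 0" "Y \<noteq> (0::complex)"
  shows "ep2 * (5 * be2 * ep1 * (s1 * s2 * s3) + 5 * al2 * be1 - be1 * be2^2 * ph3 * ep1 * (s1 * s2 * s3)^3)
    = al1 * be1 * be2 * ph2"
proof -
  have "0 = be2 * s2 * (be1 * s1^2 * q) + be1 * s1^2 * (be2 * s2 * (- q))" by algebra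
  also have "\<dots> = be2 * s2 * (5 * s3 * X - al1 * be1 * s1^3 * f2) + be1 * s1^2 * (5 * al2 * s1 * Y - be2^2 * s2^3 * f3)"
    unfolding q assms(1,5) by algebra
  also have "\<dots> = s1^3 * s2^4 * Z * (ep2 * (5 * be2 * ep1 * (s1 * s2 * s3) + 5 * al2 * be1
      - be1 * be2^2 * ph3 * ep1 * (s1 * s2 * s3)^3) - al1 * be1 * be2 * ph2)"
    unfolding assms(3,6) unfolding assms(2) unfolding assms(4) by (simp add: algebra_simps power_numeral_reduce)
  finally show ?thesis using nz assms(4) by auto
qed

text \<open>Each side has one of two patterns, which gives eight combinations. If all sides have the
  first pattern, the relation is \<open>u * (125 * u^2 - 1) = 0\<close>; each other combination
  makes the system inconsistent.\<close>

lemma edge_types: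
  fixes u :: complex
  assumes "edge_const al1 be1 ph1 ep1" "edge_const al2 be2 ph2 ep2" "edge_const al3 be3 ph3 ep3"
    and u: "ep1 * ep2 * ep3 * u^4 = 1"
    and e: "ep2 * (5 * be2 * ep1 * u + 5 * al2 * be1 - be1 * be2^2 * ph3 * ep1 * u^3) = al1 * be1 * be2 * ph2"
      "ep3 * (5 * be3 * ep2 * u + 5 * al3 * be2 - be2 * be3^2 * ph1 * ep2 * u^3) = al2 * be2 * be3 * ph3"
      "ep1 * (5 * be1 * ep3 * u + 5 * al1 * be3 - be3 * be1^2 * ph2 * ep3 * u^3) = al3 * be3 * be1 * ph1"
  shows "ph1 = 25 \<and> ph2 = 25 \<and> ph3 = 25 \<and> ep1 = 25 \<and> ep2 = 25 \<and> ep3 = 25 \<and> be1 = 5 \<and> be2 = 5 \<and> be3 = 5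
    \<and> al1 = 5 \<and> al2 = 5 \<and> al3 = 5 \<and> 125 * u^2 = 1"
proof -
  have u0: "u \<noteq> 0" using u by auto
  have F: "P" if "(1::complex) = 0" for P using that by simp
  show ?thesis
    using assms(1-3) unfolding edge_const_def
  proof (elim disjE conjE, goal_cases)
    case 1
    have "u * (125 * u^2 - 1) = 0" using e(1) unfolding 1 by algebra
    then show ?case using u0 1 by simp
  next
    case 2
    have "(1::complex) = 0" using u e unfolding 2 by algebra
    then show ?case by (rule F)
  next
    case 3
    have "(1::complex) = 0" using u e unfolding 3 by algebra
    then show ?case by (rule F)
  next
    case 4
    have "(1::complex) = 0" using u e unfolding 4 by algebra
    then show ?case by (rule F)
  next
    case 5
    have "(1::complex) = 0" using u e unfolding 5 by algebra
    then show ?case by (rule F)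
  next
    case 6
    have "(1::complex) = 0" using u e unfolding 6 by algebra
    then show ?case by (rule F)
  next
    case 7
    have "(1::complex) = 0" using u e unfolding 7 by algebra
    then show ?case by (rule F)
  next
    case 8
    have "(1::complex) = 0" using u e unfolding 8 by algebra
    then show ?case by (rule F)
  qed
qed

text \<open>Here \<open>r\<close> is a square root of 5. The three sides carry equal data, so the
  form is invariant under \<open>cyc\<close>.\<close>

definition nform :: "complex \<Rightarrow> complex^3 \<Rightarrow> complex^3" where
  "nform r = gform 1 1 1 r r r (- r) (- r) (- r) (5 - r) (r - 5) (r - 5)"

lemma pullback_diag_gform:
  "pullback (mat3 (d1 *s axis 1 1) (d2 *s axis 2 1) (d3 *s axis 3 1)) (gform X Y Z f1 f2 f3 h1 h2 h3 p q w) =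
    gform (X * (d1^5 * d2 * d3)) (Y * (d1 * d2^5 * d3)) (Z * (d1 * d2 * d3^5))
      (f1 * (d1^4 * d2^2 * d3)) (f2 * (d1 * d2^4 * d3^2)) (f3 * (d1^2 * d2 * d3^4))
      (h1 * (d1^2 * d2^4 * d3)) (h2 * (d1 * d2^2 * d3^4)) (h3 * (d1^4 * d2 * d3^2))
      (p * (d1^3 * d2^2 * d3^2)) (q * (d1^2 * d2^3 * d3^2)) (w * (d1^2 * d2^2 * d3^3))"
proof (rule ext)
  fix v
  have "mat3 (d1 *s axis 1 1) (d2 *s axis 2 1) (d3 *s axis 3 1) *v v = vector [d1 * v$1, d2 * v$2, d3 * v$3]" for v
    by (simp add: mat3_mult vec3_eq_iff axis_def mult.commute)
  then show "pullback (mat3 (d1 *s axis 1 1) (d2 *s axis 2 1) (d3 *s axis 3 1)) (gform X Y Z f1 f2 f3 h1 h2 h3 p q w) v =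
    gform (X * (d1^5 * d2 * d3)) (Y * (d1 * d2^5 * d3)) (Z * (d1 * d2 * d3^5))
      (f1 * (d1^4 * d2^2 * d3)) (f2 * (d1 * d2^4 * d3^2)) (f3 * (d1^2 * d2 * d3^4))
      (h1 * (d1^2 * d2^4 * d3)) (h2 * (d1 * d2^2 * d3^4)) (h3 * (d1^4 * d2 * d3^2))
      (p * (d1^3 * d2^2 * d3^2)) (q * (d1^2 * d2^3 * d3^2)) (w * (d1^2 * d2^2 * d3^3)) v"
    by (simp add: vec3_eq_iff pullback_nth gform_def edge_def dot_3 axis_def algebra_simps power_numeral_reduce)
qed

lemma gform_smult:
  "gform (c * X) (c * Y) (c * Z) (c * f1) (c * f2) (c * f3) (c * h1) (c * h2) (c * h3) (c * p) (c * q) (c * w) v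
    = c *s gform X Y Z f1 f2 f3 h1 h2 h3 p q w v"
  by (simp add: vec3_eq_iff gform_def edge_def algebra_simps)

text \<open>After \<open>edge_types\<close> the free data are \<open>s1\<close>, \<open>s2\<close>,
  \<open>Z\<close> and the sign of \<open>u\<close>. A diagonal coordinate change and a common
  factor remove the first three, and the sign survives as the choice of the root
  \<open>25 * u\<close> of 5.\<close>

lemma gform_normalise:
  fixes s1 s2 s3 :: complex
  defines "u \<equiv> s1 * s2 * s3"
  assumes u: "125 * u^2 = 1" and Z: "Z \<noteq> 0" and nz: "s1 \<noteq> 0" "s2 \<noteq> 0"
    and Y: "Y = 25 * s2^4 * Z" and X: "X = 25 * s1^4 * Y"
    and h: "h1 = - 5 * s1 * Y" "h2 = - 5 * s2 * Z" "h3 = - 5 * s3 * X"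
    and f: "f1 = 25 * s1^3 * Y" "f2 = 25 * s2^3 * Z" "f3 = 25 * s3^3 * X"
    and p: "5 * s1 * p = 5 * (- h3) + 5^2 * s1^3 * (- f2)"
    and q: "5 * s1^2 * q = - h3 + 5 * 5 * s1^3 * (- f2)"
    and w: "5 * s2^2 * w = - h1 + 5 * 5 * s2^3 * (- f3)"
  shows "(25 * u)^2 = 5"
    "linearly_conjugated (gform X Y Z f1 f2 f3 h1 h2 h3 p q w) (nform (25 * u))"
proof -
  show "(25 * u)^2 = 5" using u by algebra
  have u0: "u \<noteq> 0" using u by auto
  \<comment> \<open>\<open>d2 ^ 4 = X / Y\<close> and \<open>d3 ^ 4 = X / Z\<close>, with fourth
    roots chosen so that the other parameters agree as well; \<open>c\<close> is then the common
    value of the transformed \<open>X\<close>, \<open>Y\<close>, \<open>Z\<close>.\<close>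
  define c where "c = 78125 * u * s1^6 * s2^5 * Z"
  define d2 where "d2 = 25 * u * s1"
  define d3 where "d3 = 5 * s1 * s2"
  have h3: "h3 = - 3125 * u * s1^3 * s2^3 * Z" unfolding h X Y u_def by algebra
  have f3: "f3 = 125 * u * s1 * s2 * Z"
  proof -
    have "f3 = 125 * u * s1 * s2 * Z * (125 * u^2)" unfolding f X Y u_def by algebra
    then show ?thesis using u by simp
  qed
  have p': "p = 3125 * u * s1^2 * s2^3 * Z - 125 * s1^2 * s2^3 * Z"
  proof -
    have "5 * s1 * p = 5 * s1 * (3125 * u * s1^2 * s2^3 * Z - 125 * s1^2 * s2^3 * Z)"
      unfolding p h3 f by algebra
    then show ?thesis using nz by simp
  qed
  have q': "q = 625 * u * s1 * s2^3 * Z - 125 * s1 * s2^3 * Z"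
  proof -
    have "5 * s1^2 * q = 5 * s1^2 * (625 * u * s1 * s2^3 * Z - 125 * s1 * s2^3 * Z)"
      unfolding q h3 f by algebra
    then show ?thesis using nz by simp
  qed
  have w': "w = 25 * s1 * s2^2 * Z - 625 * u * s1 * s2^2 * Z"
  proof -
    have "5 * s2^2 * w = 5 * s2^2 * (25 * s1 * s2^2 * Z - 625 * u * s1 * s2^2 * Z)"
      unfolding w h(1) f3 Y by algebra
    then show ?thesis using nz by simp
  qed
  have "pullback (mat3 (1 *s axis 1 1) (d2 *s axis 2 1) (d3 *s axis 3 1)) (gform X Y Z f1 f2 f3 h1 h2 h3 p q w) =
    gform (c * 1) (c * 1) (c * 1) (c * (25 * u)) (c * (25 * u)) (c * (25 * u)) (c * - (25 * u)) (c * - (25 * u)) (c * - (25 * u))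
      (c * (5 - 25 * u)) (c * (25 * u - 5)) (c * (25 * u - 5))"
  proof -
    have "X * (1^5 * d2 * d3) = c * 1" unfolding X Y c_def d2_def d3_def power_one mult_1_left mult_1_right by algebra
    moreover have "Y * (1 * d2^5 * d3) = c * 1" using u unfolding Y c_def d2_def d3_def power_one mult_1_left mult_1_right by algebra
    moreover have "Z * (1 * d2 * d3^5) = c * 1" unfolding c_def d2_def d3_def power_one mult_1_left mult_1_right by algebra
    moreover have "f1 * (1^4 * d2^2 * d3) = c * (25 * u)" unfolding f Y c_def d2_def d3_def power_one mult_1_left mult_1_right by algebra
    moreover have "f2 * (1 * d2^4 * d3^2) = c * (25 * u)" using u unfolding f c_def d2_def d3_def power_one mult_1_left mult_1_right by algebra
    moreover have "f3 * (1^2 * d2 * d3^4) = c * (25 * u)" unfolding f3 c_def d2_def d3_def power_one mult_1_left mult_1_right by algebra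
    moreover have "h1 * (1^2 * d2^4 * d3) = c * - (25 * u)" using u unfolding h Y c_def d2_def d3_def power_one mult_1_left mult_1_right by algebra
    moreover have "h2 * (1 * d2^2 * d3^4) = c * - (25 * u)" unfolding h c_def d2_def d3_def power_one mult_1_left mult_1_right by algebra
    moreover have "h3 * (1^4 * d2 * d3^2) = c * - (25 * u)" unfolding h3 c_def d2_def d3_def power_one mult_1_left mult_1_right by algebra
    moreover have "p * (1^3 * d2^2 * d3^2) = c * (5 - 25 * u)" using u unfolding p' c_def d2_def d3_def power_one mult_1_left mult_1_right by algebra
    moreover have "q * (1^2 * d2^3 * d3^2) = c * (25 * u - 5)" using u unfolding q' c_def d2_def d3_def power_one mult_1_left mult_1_right by algebra
    moreover have "w * (1^2 * d2^2 * d3^3) = c * (25 * u - 5)" using u unfolding w' c_def d2_def d3_def power_one mult_1_left mult_1_right by algebra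
    ultimately show ?thesis unfolding pullback_diag_gform by (simp only:)
  qed
  then have "same_foliation (pullback (mat3 (1 *s axis 1 1) (d2 *s axis 2 1) (d3 *s axis 3 1)) (gform X Y Z f1 f2 f3 h1 h2 h3 p q w))
      (nform (25 * u))"
    unfolding same_foliation_def nform_def gform_smult[symmetric]
    using u0 Z nz by (intro exI[of _ c]) (simp add: c_def)
  moreover have "invertible (mat3 (1 *s axis 1 1) (d2 *s axis 2 1) (d3 *s axis 3 1))"
    using u0 nz by (simp add: invertible_mat3 det3_eq axis_def d2_def d3_def)
  ultimately show "linearly_conjugated (gform X Y Z f1 f2 f3 h1 h2 h3 p q w) (nform (25 * u))"
    unfolding linearly_conjugated_def by blast
qed

section \<open>From three radial singularities of order 3 to the normal form\<close>

context quintic_foliation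
begin

lemma radial_3E:
  assumes "radial_singularity F m 3"
  obtains p a w where "p \<noteq> 0" "m = vec.span {p}" "F p = 0" "kap F p = 5" "jf F p a w \<noteq> 0"
proof -
  have "singular_point F m" using assms by (simp add: radial_singularity_def)
  then obtain p where p: "p \<noteq> 0" "m = vec.span {p}" "F p = 0" by (rule singularE)
  then show ?thesis using that assms radial_iff[OF p(1), of 3] by auto
qed

text \<open>Rescaling \<open>p1\<close> and \<open>p2\<close> turns a linear dependence into the
  relation \<open>p1 + p2 = p3\<close> treated by \<open>radial_not_aligned\<close>.\<close>

lemma radial_3_independent:
  assumes p: "ccross p1 p2 \<noteq> 0" "ccross p1 p3 \<noteq> 0" "ccross p2 p3 \<noteq> 0"
    and k: "kap F p1 = 5" "kap F p2 = 5" "kap F p3 = 5" and F0: "F p1 = 0" and nz: "jf F p1 a w \<noteq> 0"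
  shows "det3 p1 p2 p3 \<noteq> 0"
proof
  assume "det3 p1 p2 p3 = 0"
  then have "det3 p3 p1 p2 = 0" using det3_rotate[of p3 p1 p2] by simp
  then obtain x y where xy: "p3 = x *s p1 + y *s p2" using in_span2_det3[OF p(1)] in_span2 by blast
  have x0: "x \<noteq> 0"
  proof
    assume "x = 0"
    then show False using p(3) xy by simp
  qed
  have y0: "y \<noteq> 0"
  proof
    assume "y = 0"
    then show False using p(2) xy by simp
  qed
  have "ccross (x *s p1) (y *s p2) = (x * y) *s ccross p1 p2" by (simp add: vec3_eq_iff algebra_simps)
  then have c: "ccross (x *s p1) (y *s p2) \<noteq> 0" using x0 y0 p(1) by simp
  have "jf F (x *s p1) a w \<noteq> 0" unfolding jf_scale[OF hf] using x0 nz by simp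
  then show False
    using radial_not_aligned[OF c xy[symmetric]] k F0 x0 y0 by (simp add: kap_smult hform_scale[OF hf])
qed

text \<open>The sides are invariant by \<open>joined\<close>, because the two polars at the ends
  have orders with 5 + 5 \<ge> 6 + 2.\<close>

lemma three_radial_triangle:
  assumes d: "distinct [m1, m2, m3]" and r: "\<forall>m\<in>{m1, m2, m3}. radial_singularity F m 3"
  shows "\<not> (\<exists>l. proj_line l \<and> m1 \<subseteq> l \<and> m2 \<subseteq> l \<and> m3 \<subseteq> l) \<and>
        invariant_line F (line_through m1 m2) \<and>
        invariant_line F (line_through m1 m3) \<and>
        invariant_line F (line_through m2 m3)"
proof -
  obtain p1 a1 w1 where p1: "p1 \<noteq> 0" "m1 = vec.span {p1}" "F p1 = 0" "kap F p1 = 5" "jf F p1 a1 w1 \<noteq> 0"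
    using r by (auto elim: radial_3E)
  obtain p2 a2 w2 where p2: "p2 \<noteq> 0" "m2 = vec.span {p2}" "F p2 = 0" "kap F p2 = 5" "jf F p2 a2 w2 \<noteq> 0"
    using r by (auto elim: radial_3E)
  obtain p3 a3 w3 where p3: "p3 \<noteq> 0" "m3 = vec.span {p3}" "F p3 = 0" "kap F p3 = 5" "jf F p3 a3 w3 \<noteq> 0"
    using r by (auto elim: radial_3E)
  have c: "ccross p1 p2 \<noteq> 0" "ccross p1 p3 \<noteq> 0" "ccross p2 p3 \<noteq> 0"
    using d p1 p2 p3 span1_eq_iff by auto
  have det: "det3 p1 p2 p3 \<noteq> 0" by (rule radial_3_independent[OF c p1(4) p2(4) p3(4) p1(3,5)])
  have "\<not> (proj_line l \<and> m1 \<subseteq> l \<and> m2 \<subseteq> l \<and> m3 \<subseteq> l)" for l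
  proof
    assume l: "proj_line l \<and> m1 \<subseteq> l \<and> m2 \<subseteq> l \<and> m3 \<subseteq> l"
    have "p1 \<in> m1" "p2 \<in> m2" "p3 \<in> m3" using p1 p2 p3 by (auto intro: vec.span_base)
    then have "p1 \<in> l" "p2 \<in> l" "p3 \<in> l" using l by auto
    then have "p3 \<in> vec.span {p1, p2}" using proj_line_through[of l p1 p2] l c by auto
    then show False using in_span2_det3[OF c(1)] det det3_rotate[of p3 p1 p2] by simp
  qed
  moreover have "invariant_line F (line_through m1 m2)" "invariant_line F (line_through m1 m3)" "invariant_line F (line_through m2 m3)"
    unfolding p1(2) p2(2) p3(2) line_through_span
    using joined[OF c(1)] joined[OF c(2)] joined[OF c(3)] p1 p2 p3 by simp_all
  ultimately show ?thesis by blast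
qed

text \<open>A point of order 1 has \<open>kap\<close> equal to 3 while the ends have 5, so it is
  neither end and its parameter is finite and nonzero.\<close>

lemma order_1_on_edge:
  assumes q: "ccross q1 q2 \<noteq> 0" "kap F q1 = 5" "kap F q2 = 5"
    and r: "r \<subseteq> vec.span {q1, q2}" "radial_singularity F r 1"
  obtains t where "t \<noteq> 0" "r = vec.span {q1 + t *s q2}" "F (q1 + t *s q2) = 0" "\<And>u. jf F (q1 + t *s q2) u u = 0"
proof -
  have "singular_point F r" using r by (simp add: radial_singularity_def)
  then obtain y where y: "y \<noteq> 0" "r = vec.span {y}" "F y = 0" by (rule singularE)
  have ky: "kap F y = 3" using radial_iff[OF y(1), of 1] r y by simp
  have "y \<in> vec.span {q1, q2}" using r(1) y(2) by (auto intro: vec.span_base)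
  then obtain \<alpha> \<beta> where ab: "y = \<alpha> *s q1 + \<beta> *s q2" by (auto simp: in_span2)
  have a0: "\<alpha> \<noteq> 0"
  proof
    assume "\<alpha> = 0"
    moreover from this have "\<beta> \<noteq> 0" using ab y by auto
    ultimately show False using ky kap_smult[of \<beta> q2] q ab by simp
  qed
  have b0: "\<beta> \<noteq> 0"
  proof
    assume "\<beta> = 0"
    then show False using ky kap_smult[OF a0, of q1] q ab by simp
  qed
  let ?z = "q1 + (\<beta> / \<alpha>) *s q2"
  have yz: "y = \<alpha> *s ?z" using ab a0 by (simp add: vec_eq_iff field_simps)
  have z0: "?z \<noteq> 0"
  proof
    assume "?z = 0"
    then have "\<alpha> *s ?z = 0" by (simp only: vec.scale_zero_right)
    with yz have "y = 0" by (rule trans)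
    then show False using y(1) by contradiction
  qed
  have Fz: "F ?z = 0" using y(3) a0 unfolding yz hform_scale[OF hf] by simp
  have "kap F ?z = 3" using ky unfolding yz kap_smult[OF a0] .
  then have "jf F ?z u u = 0" for u using kap_ge_3[OF z0 Fz] by simp
  moreover have "r = vec.span {?z}" unfolding y(2) yz by (rule span1_smult[OF a0 z0])
  ultimately show ?thesis using that[of "\<beta> / \<alpha>"] a0 b0 Fz by simp
qed

lemma three_radial_conjugated:
  assumes "three_radial m1 m2 m3"
  shows "\<exists>r. r^2 = 5 \<and> linearly_conjugated F (nform r)"
proof -
  have r: "\<forall>m\<in>{m1, m2, m3}. radial_singularity F m 3" and d: "distinct [m1, m2, m3]"
    and o: "\<exists>r1 r2. r1 \<noteq> r2 \<and> r1 \<subseteq> line_through m1 m2 \<and> r2 \<subseteq> line_through m1 m2 \<and> radial_singularity F r1 1 \<and> radial_singularity F r2 1"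
      "\<exists>r1 r2. r1 \<noteq> r2 \<and> r1 \<subseteq> line_through m1 m3 \<and> r2 \<subseteq> line_through m1 m3 \<and> radial_singularity F r1 1 \<and> radial_singularity F r2 1"
      "\<exists>r1 r2. r1 \<noteq> r2 \<and> r1 \<subseteq> line_through m2 m3 \<and> r2 \<subseteq> line_through m2 m3 \<and> radial_singularity F r1 1 \<and> radial_singularity F r2 1"
    using assms unfolding three_radial_def by auto
  obtain p1 a1 w1 where p1: "p1 \<noteq> 0" "m1 = vec.span {p1}" "F p1 = 0" "kap F p1 = 5" "jf F p1 a1 w1 \<noteq> 0"
    using r by (auto elim: radial_3E)
  obtain p2 a2 w2 where p2: "p2 \<noteq> 0" "m2 = vec.span {p2}" "F p2 = 0" "kap F p2 = 5" "jf F p2 a2 w2 \<noteq> 0"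
    using r by (auto elim: radial_3E)
  obtain p3 a3 w3 where p3: "p3 \<noteq> 0" "m3 = vec.span {p3}" "F p3 = 0" "kap F p3 = 5" "jf F p3 a3 w3 \<noteq> 0"
    using r by (auto elim: radial_3E)
  have c: "ccross p1 p2 \<noteq> 0" "ccross p1 p3 \<noteq> 0" "ccross p2 p3 \<noteq> 0"
    using d p1 p2 p3 span1_eq_iff by auto
  then have c': "ccross p3 p1 \<noteq> 0" using ccross_antisym[of p1 p3] by auto
  have det: "det3 p1 p2 p3 \<noteq> 0" by (rule radial_3_independent[OF c p1(4) p2(4) p3(4) p1(3,5)])
  define M where "M = mat3 p1 p2 p3"
  have M: "invertible M" using det by (simp add: M_def invertible_mat3)
  have Me: "M *v axis 1 1 = p1" "M *v axis 2 1 = p2" "M *v axis 3 1 = p3" by (simp_all add: M_def)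
  obtain N where N: "\<And>v. M *v (N *v v) = v" using invertible_inv[OF M] by metis
  define G where "G = pullback M F"
  have hG: "hform 6 G" unfolding G_def by (rule hform_pullback[OF hf])
  have van: "vanishes (\<lambda>v. G v $ k) (axis k 1) 5" if k: "kap F (M *v axis k 1) = 5" "M *v axis k 1 \<noteq> 0" for k
  proof -
    have "lpoly (\<lambda>v. G v $ k) (axis k 1) u = lpoly (pair F (M *v axis k 1)) (M *v axis k 1) (M *v u)" for u
      by (rule lpoly_eqI) (simp add: G_def pullback_nth poly_lpoly[OF hp] matrix_vector_right_distrib matrix_smult)
    then show ?thesis using kap_ge_iff[OF k(2), of 5] k(1) by (simp add: vanishes_iff)
  qed
  have "vanishes (\<lambda>v. G v $ k) (axis k 1) 5" for k
    using exhaust_3[of k] van[of k] Me p1 p2 p3 by auto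
  then obtain X Y Z f1 f2 f3 h1 h2 h3 p q w where G: "G = gform X Y Z f1 f2 f3 h1 h2 h3 p q w"
    using gform_of_order_5[OF hG] by metis
  \<comment> \<open>The rotated forms bring the second and third side into the position of the
    first, so \<open>gform_edge_equations\<close> serves all three. The third side is therefore run
    from \<open>p3\<close> to \<open>p1\<close>.\<close>
  define G' where "G' = pullback cyc G"
  define G'' where "G'' = pullback cyc G'"
  have G': "G' = gform Y Z X f2 f3 f1 h2 h3 h1 (- q) w (- p)" unfolding G'_def G pullback_cyc_gform ..
  have G'': "G'' = gform Z X Y f3 f1 f2 h3 h1 h2 (- w) (- p) q" unfolding G''_def G' pullback_cyc_gform by simp
  have hG': "hform 6 G'" unfolding G'_def by (rule hform_pullback[OF hG])
  have hG'': "hform 6 G''" unfolding G''_def by (rule hform_pullback[OF hG'])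
  have cy: "cyc *v axis 1 1 = axis 2 1" "cyc *v axis 2 1 = axis 3 1" "cyc *v axis 3 1 = axis 1 1" by (simp_all add: cyc_def)
  obtain cN where cN: "\<And>v. cyc *v (cN *v v) = v" using invertible_inv[OF invertible_cyc] by metis
  have jG: "jf G v a b = jf F (M *v v) (M *v a) (M *v b)" for v a b
    unfolding G_def by (rule jf_pullback[OF hf])
  have jG': "jf G' v a b = jf G (cyc *v v) (cyc *v a) (cyc *v b)" for v a b
    unfolding G'_def by (rule jf_pullback[OF hG])
  have jG'': "jf G'' v a b = jf G' (cyc *v v) (cyc *v a) (cyc *v b)" for v a b
    unfolding G''_def by (rule jf_pullback[OF hG'])
  have "jf G (axis 3 1) (N *v a3) (N *v w3) \<noteq> 0" using p3(5) by (simp add: jG Me N)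
  then have Z0: "Z \<noteq> 0" by (rule gform_linear_part_3[OF G hG])
  have "jf G' (axis 3 1) (cN *v (N *v a1)) (cN *v (N *v w1)) \<noteq> 0" using p1(5) by (simp add: jG' jG cy cN Me N)
  then have X0: "X \<noteq> 0" by (rule gform_linear_part_3[OF G' hG'])
  have "jf G'' (axis 3 1) (cN *v (cN *v (N *v a2))) (cN *v (cN *v (N *v w2))) \<noteq> 0"
    using p2(5) by (simp add: jG'' jG' jG cy cN Me N)
  then have Y0: "Y \<noteq> 0" by (rule gform_linear_part_3[OF G'' hG''])
  have edge: "\<exists>t1 t2. t1 \<noteq> t2 \<and> (\<forall>t\<in>{t1, t2}. t \<noteq> 0 \<and> F (q1 + t *s q2) = 0 \<and> (\<forall>u. jf F (q1 + t *s q2) u u = 0))"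
    if hyp: "ccross q1 q2 \<noteq> 0" "kap F q1 = 5" "kap F q2 = 5"
      "\<exists>r1 r2. r1 \<noteq> r2 \<and> r1 \<subseteq> vec.span {q1, q2} \<and> r2 \<subseteq> vec.span {q1, q2} \<and> radial_singularity F r1 1 \<and> radial_singularity F r2 1"
    for q1 q2
  proof -
    obtain r1 r2 where r: "r1 \<noteq> r2" "r1 \<subseteq> vec.span {q1, q2}" "r2 \<subseteq> vec.span {q1, q2}" "radial_singularity F r1 1" "radial_singularity F r2 1"
      using hyp(4) by blast
    obtain t1 where t1: "t1 \<noteq> 0" "r1 = vec.span {q1 + t1 *s q2}" "F (q1 + t1 *s q2) = 0" "\<And>u. jf F (q1 + t1 *s q2) u u = 0"
      using order_1_on_edge[OF hyp(1-3) r(2,4)] by blast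
    obtain t2 where t2: "t2 \<noteq> 0" "r2 = vec.span {q1 + t2 *s q2}" "F (q1 + t2 *s q2) = 0" "\<And>u. jf F (q1 + t2 *s q2) u u = 0"
      using order_1_on_edge[OF hyp(1-3) r(3,5)] by blast
    have "t1 \<noteq> t2" using r(1) t1(2) t2(2) by blast
    then show ?thesis using t1 t2 by blast
  qed
  have zero: "pullback K H v = 0" if "H (K *v v) = 0" for K H v
    by (rule vec_eq_iff[THEN iffD2]) (simp add: pullback_nth that)
  obtain t1 t2 where t: "t1 \<noteq> t2" "\<And>t. t \<in> {t1, t2} \<Longrightarrow> t \<noteq> 0 \<and> F (p1 + t *s p2) = 0 \<and> (\<forall>u. jf F (p1 + t *s p2) u u = 0)"
    using edge[OF c(1) p1(4) p2(4)] o(1) unfolding p1(2) p2(2) line_through_span by blast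
  have e1: "X + f1 * t + h1 * t^3 - Y * t^4 = 0" "f1 + 4 * h1 * t^2 - 5 * Y * t^3 = 0" "- h3 + p * t + q * t^2 - f2 * t^3 = 0"
    if "t \<in> {t1, t2}" for t
  proof -
    have MP: "M *v (axis 1 1 + t *s axis 2 1) = p1 + t *s p2" by (simp add: matrix_vector_right_distrib matrix_smult Me)
    have "G (axis 1 1 + t *s axis 2 1) = 0" unfolding G_def by (rule zero) (simp add: MP t(2)[OF that])
    note * = gform_edge_equations[OF G hG refl this]
    show "X + f1 * t + h1 * t^3 - Y * t^4 = 0" "f1 + 4 * h1 * t^2 - 5 * Y * t^3 = 0" "- h3 + p * t + q * t^2 - f2 * t^3 = 0"
      by (rule *; simp add: jG MP t(2)[OF that])+
  qed
  obtain u1 u2 where u: "u1 \<noteq> u2" "\<And>t. t \<in> {u1, u2} \<Longrightarrow> t \<noteq> 0 \<and> F (p2 + t *s p3) = 0 \<and> (\<forall>u. jf F (p2 + t *s p3) u u = 0)"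
    using edge[OF c(3) p2(4) p3(4)] o(3) unfolding p2(2) p3(2) line_through_span by blast
  have e2: "Y + f2 * t + h2 * t^3 - Z * t^4 = 0" "f2 + 4 * h2 * t^2 - 5 * Z * t^3 = 0" "- h1 + (- q) * t + w * t^2 - f3 * t^3 = 0"
    if "t \<in> {u1, u2}" for t
  proof -
    have MP: "M *v (cyc *v (axis 1 1 + t *s axis 2 1)) = p2 + t *s p3" by (simp add: matrix_vector_right_distrib matrix_smult Me cy)
    have "G' (axis 1 1 + t *s axis 2 1) = 0" unfolding G'_def G_def by (intro zero) (simp add: MP u(2)[OF that])
    note * = gform_edge_equations[OF G' hG' refl this]
    show "Y + f2 * t + h2 * t^3 - Z * t^4 = 0" "f2 + 4 * h2 * t^2 - 5 * Z * t^3 = 0" "- h1 + (- q) * t + w * t^2 - f3 * t^3 = 0"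
      by (rule *; simp add: jG jG' MP u(2)[OF that])+
  qed
  obtain v1 v2 where v: "v1 \<noteq> v2" "\<And>t. t \<in> {v1, v2} \<Longrightarrow> t \<noteq> 0 \<and> F (p3 + t *s p1) = 0 \<and> (\<forall>u. jf F (p3 + t *s p1) u u = 0)"
    using edge[OF c' p3(4) p1(4)] o(2) unfolding p1(2) p3(2) line_through_span span2_commute[of p1 p3] by blast
  have e3: "Z + f3 * t + h3 * t^3 - X * t^4 = 0" "f3 + 4 * h3 * t^2 - 5 * X * t^3 = 0" "- h2 + (- w) * t + (- p) * t^2 - f1 * t^3 = 0"
    if "t \<in> {v1, v2}" for t
  proof -
    have MP: "M *v (cyc *v (cyc *v (axis 1 1 + t *s axis 2 1))) = p3 + t *s p1" by (simp add: matrix_vector_right_distrib matrix_smult Me cy)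
    have "G'' (axis 1 1 + t *s axis 2 1) = 0" unfolding G''_def G'_def G_def by (intro zero) (simp add: MP v(2)[OF that])
    note * = gform_edge_equations[OF G'' hG'' refl this]
    show "Z + f3 * t + h3 * t^3 - X * t^4 = 0" "f3 + 4 * h3 * t^2 - 5 * X * t^3 = 0" "- h2 + (- w) * t + (- p) * t^2 - f1 * t^3 = 0"
      by (rule *; simp add: jG jG' jG'' MP v(2)[OF that])+
  qed
  obtain s1 al1 be1 ph1 ep1 where s1: "edge_const al1 be1 ph1 ep1" "s1 \<noteq> 0" "h1 = - 5 * s1 * Y" "f1 = ph1 * s1^3 * Y" "X = ep1 * s1^4 * Y"
    "be1 * s1^2 * q = - h3 + al1 * be1 * s1^3 * (- f2)" "be1 * s1 * p = al1 * (- h3) + be1^2 * s1^3 * (- f2)"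
    by (rule edge_solution[of t1 t2 X f1 h1 Y "- h3" p q "- f2"])
      (use t e1 Y0 in simp_all)
  obtain s2 al2 be2 ph2 ep2 where s2: "edge_const al2 be2 ph2 ep2" "s2 \<noteq> 0" "h2 = - 5 * s2 * Z" "f2 = ph2 * s2^3 * Z" "Y = ep2 * s2^4 * Z"
    "be2 * s2^2 * w = - h1 + al2 * be2 * s2^3 * (- f3)" "be2 * s2 * (- q) = al2 * (- h1) + be2^2 * s2^3 * (- f3)"
    by (rule edge_solution[of u1 u2 Y f2 h2 Z "- h1" "- q" w "- f3"])
      (use u e2 Z0 in simp_all)
  obtain s3 al3 be3 ph3 ep3 where s3: "edge_const al3 be3 ph3 ep3" "s3 \<noteq> 0" "h3 = - 5 * s3 * X" "f3 = ph3 * s3^3 * X" "Z = ep3 * s3^4 * X"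
    "be3 * s3^2 * (- p) = - h2 + al3 * be3 * s3^3 * (- f1)" "be3 * s3 * (- w) = al3 * (- h2) + be3^2 * s3^3 * (- f1)"
    by (rule edge_solution[of v1 v2 Z f3 h3 X "- h2" "- w" "- p" "- f1"])
      (use v e3 X0 in simp_all)
  define U where "U = s1 * s2 * s3"
  have U1: "s2 * s3 * s1 = U" "s3 * s1 * s2 = U" by (simp_all add: U_def mult_ac)
  \<comment> \<open>Going once around the triangle expresses \<open>X\<close> through
    \<open>Y\<close>, \<open>Y\<close> through \<open>Z\<close> and \<open>Z\<close> through
    \<open>X\<close>.\<close>
  have "X = ep1 * ep2 * ep3 * U^4 * X"
    using s1(5) s2(5) s3(5) unfolding U_def by algebra
  then have U4: "ep1 * ep2 * ep3 * U^4 = 1" using X0 by simp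
  have r1: "ep2 * (5 * be2 * ep1 * U + 5 * al2 * be1 - be1 * be2^2 * ph3 * ep1 * U^3) = al1 * be1 * be2 * ph2"
    using edge_relation[OF s1(3,5) s2(4,5) s3(3,4) s1(6) s2(7) s1(2) Y0] unfolding U_def .
  have r2: "ep3 * (5 * be3 * ep2 * U + 5 * al3 * be2 - be2 * be3^2 * ph1 * ep2 * U^3) = al2 * be2 * be3 * ph3"
    using edge_relation[OF s2(3,5) s3(4,5) s1(3,4) s2(6) s3(7) s2(2) Z0] unfolding U1 .
  have r3: "ep1 * (5 * be1 * ep3 * U + 5 * al1 * be3 - be3 * be1^2 * ph2 * ep3 * U^3) = al3 * be3 * be1 * ph1"
    using edge_relation[OF s3(3,5) s1(4,5) s2(3,4) s3(6) _ s3(2) X0] s1(7) unfolding U1 by simp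
  note types = edge_types[OF s1(1) s2(1) s3(1) U4 r1 r2 r3]
  have T: "ph1 = 25" "ph2 = 25" "ph3 = 25" "ep1 = 25" "ep2 = 25" "ep3 = 25" "be1 = 5" "be2 = 5" "be3 = 5"
    "al1 = 5" "al2 = 5" "al3 = 5" and U2: "125 * U^2 = 1"
    using types by blast+
  note normal = gform_normalise[of s1 s2 s3, folded U_def, OF U2 Z0 s1(2) s2(2) s2(5)[unfolded T] s1(5)[unfolded T]
      s1(3) s2(3) s3(3) s1(4)[unfolded T] s2(4)[unfolded T] s3(4)[unfolded T]
      s1(7)[unfolded T] s1(6)[unfolded T] s2(6)[unfolded T]]
  from normal have "(25 * U)^2 = 5 \<and> linearly_conjugated (gform X Y Z f1 f2 f3 h1 h2 h3 p q w) (nform (25 * U))"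
    by blast
  then have "linearly_conjugated G (nform (25 * U))" "(25 * U)^2 = 5" using G by auto
  moreover from this obtain K where "invertible K" "same_foliation (pullback K G) (nform (25 * U))"
    unfolding linearly_conjugated_def by blast
  then have "linearly_conjugated F (nform (25 * U))"
    unfolding linearly_conjugated_def G_def pullback_pullback using M invertible_mult by blast
  ultimately show ?thesis by blast
qed

end

section \<open>The Hilbert modular foliation in normal form\<close>

lemma hform_gform: "hform 6 (gform X Y Z f1 f2 f3 h1 h2 h3 p q w)"
proof -
  have edge: "homogeneous_poly 6 (\<lambda>v. edge k1 k2 k3 k4 X f h Y (v$a) (v$b) (v$c))" for k1 k2 k3 k4 X f h Y a b c
  proof -
    have m: "homogeneous_poly 6 (\<lambda>v. k * (v$a)^i * (v$b)^j * (v$c)^l)" if "i + j + l = 6" for k i j l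
    proof -
      have "homogeneous_poly (0 + 1 * i + 1 * j + 1 * l) (\<lambda>v. k * (v$a)^i * (v$b)^j * (v$c)^l)"
        by (intro homogeneous_poly_mult homogeneous_poly_const homogeneous_poly_power homogeneous_poly_coord)
      then show ?thesis using that by simp
    qed
    have "(\<lambda>v :: complex^3. edge k1 k2 k3 k4 X f h Y (v$a) (v$b) (v$c)) = (\<lambda>v.
      k1 * (v$a)^4 * (v$b)^1 * (v$c)^1 + k2 * (v$a)^3 * (v$b)^2 * (v$c)^1 + k3 * (v$a)^2 * (v$b)^3 * (v$c)^1
      + k4 * (v$a)^1 * (v$b)^4 * (v$c)^1 + X * (v$a)^5 * (v$b)^1 * (v$c)^0 + f * (v$a)^4 * (v$b)^2 * (v$c)^0
      + h * (v$a)^2 * (v$b)^4 * (v$c)^0 + (- Y) * (v$a)^1 * (v$b)^5 * (v$c)^0)"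
      by (rule ext) (simp add: edge_def algebra_simps power_numeral_reduce)
    then show ?thesis by (simp only:) (intro homogeneous_poly_add m; simp)
  qed
  have "homogeneous_poly 6 (\<lambda>v. gform X Y Z f1 f2 f3 h1 h2 h3 p q w v $ i)" for i
    using exhaust_3[of i] edge unfolding gform_def by auto
  moreover have "gform X Y Z f1 f2 f3 h1 h2 h3 p q w v \<odot> v = 0" for v
    by (simp add: dot_3 gform_def edge_def algebra_simps power_numeral_reduce)
  ultimately show ?thesis by (simp add: hform_def)
qed

lemma hform_nform: "hform 6 (nform r)"
  unfolding nform_def by (rule hform_gform)

text \<open>The Hilbert modular form with sqrt 5 replaced by a parameter, so that both square roots
  of 5 can be compared.\<close>

definition hmod :: "complex \<Rightarrow> complex^3 \<Rightarrow> complex^3" where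
  "hmod r v =
     (let x = v$1; y = v$2; z = v$3;
          P = (y^2 - z^2) * (y^2 - (r - 2)^2 * z^2) * (y + r * x);
          Q = (x^2 - z^2) * (x^2 - (r - 2)^2 * z^2) * (x + r * y)
      in vector [z * P, - (z * Q), y * Q - x * P])"

lemma hilbert_modular5_hmod: "hilbert_modular5 = hmod (complex_of_real (sqrt 5))"
  by (rule ext) (simp add: hilbert_modular5_def hmod_def Let_def)

lemma edge_nform:
  assumes "r^2 = 5"
  shows "edge r (5 - r) (r - 5) (- r) 1 r (- r) 1 x y z = x * y * (x - y) * (x^2 + r * x * y + y^2) * (x + y + r * z)"
proof -
  \<comment> \<open>With 5 written as \<open>r^2\<close> the factorisation is an identity in
    \<open>r\<close>, verified by expansion.\<close>
  have "edge r (5 - r) (r - 5) (- r) 1 r (- r) 1 x y z = edge r (r^2 - r) (r - r^2) (- r) 1 r (- r) 1 x y z"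
    using assms by simp
  also have "\<dots> = x * y * (x - y) * (x^2 + r * x * y + y^2) * (x + y + r * z)"
    by (simp add: edge_def algebra_simps power_numeral_reduce)
  finally show ?thesis .
qed

lemma nform_nth:
  assumes "r^2 = 5"
  shows "nform r v $ 1 = v$2 * v$3 * (v$2 - v$3) * ((v$2)^2 + r * v$2 * v$3 + (v$3)^2) * (v$2 + v$3 + r * v$1)"
    "nform r v $ 2 = v$3 * v$1 * (v$3 - v$1) * ((v$3)^2 + r * v$3 * v$1 + (v$1)^2) * (v$3 + v$1 + r * v$2)"
    "nform r v $ 3 = v$1 * v$2 * (v$1 - v$2) * ((v$1)^2 + r * v$1 * v$2 + (v$2)^2) * (v$1 + v$2 + r * v$3)"
  unfolding nform_def gform_def using edge_nform[OF assms] by simp_all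

text \<open>The substitution \<open>T = (3 - r) * t + (r - 2) * z\<close> sends \<open>t = 0\<close>
  and \<open>t = z\<close> to the roots \<open>(r - 2) * z\<close> and \<open>z\<close> of the
  quartic; since \<open>r^2 = 5\<close>, the roots of \<open>t^2 + r * t * z + z^2\<close> go to the
  other two.\<close>

lemma pullback_hmod_nform:
  assumes r: "r^2 = 5"
  shows "pullback (mat3 ((3 - r) *s axis 1 1) ((3 - r) *s axis 2 1) (vector [r - 2, r - 2, 1])) (hmod r) v
    = (3 - r)^6 *s nform r v"
proof -
  let ?d = "3 - r"
  define x y z where "x = v$1" and "y = v$2" and "z = v$3"
  let ?M = "mat3 (?d *s axis 1 1) (?d *s axis 2 1) (vector [r - 2, r - 2, 1])"
  define X Y where "X = ?d * x + (r - 2) * z" and "Y = ?d * y + (r - 2) * z"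
  have M: "?M *v v = vector [X, Y, z]"
    by (simp add: mat3_mult vec3_eq_iff axis_def X_def Y_def x_def y_def z_def algebra_simps)
  define Pn where "Pn = y * (y - z) * (y^2 + r * y * z + z^2) * (y + z + r * x)"
  define Qn where "Qn = x * (x - z) * (x^2 + r * x * z + z^2) * (x + z + r * y)"
  have f: "(T^2 - z^2) * (T^2 - (r - 2)^2 * z^2) = ?d^4 * (t * (t - z) * (t^2 + r * t * z + z^2))"
    if "T = ?d * t + (r - 2) * z" for T t
  proof -
    have "(T + z) * (T + (r - 2) * z) = ?d^2 * (t^2 + r * t * z + z^2) + (r^2 - 5) * (?d * t * z + z^2)"
      unfolding that by algebra
    then have "(T + z) * (T + (r - 2) * z) = ?d^2 * (t^2 + r * t * z + z^2)" using r by simp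
    moreover have "(T - z) * (T - (r - 2) * z) = ?d^2 * (t * (t - z))" unfolding that by algebra
    ultimately show ?thesis by algebra
  qed
  have g: "Y + r * X = ?d * (y + z + r * x)" "X + r * Y = ?d * (x + z + r * y)"
  proof -
    have "Y + r * X = ?d * (y + z + r * x) + (r^2 - 5) * z" "X + r * Y = ?d * (x + z + r * y) + (r^2 - 5) * z"
      unfolding X_def Y_def by algebra+
    then show "Y + r * X = ?d * (y + z + r * x)" "X + r * Y = ?d * (x + z + r * y)" using r by simp_all
  qed
  have P: "(Y^2 - z^2) * (Y^2 - (r - 2)^2 * z^2) * (Y + r * X) = ?d^5 * Pn"
    unfolding f[OF Y_def] g Pn_def by algebra
  have Q: "(X^2 - z^2) * (X^2 - (r - 2)^2 * z^2) * (X + r * Y) = ?d^5 * Qn"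
    unfolding f[OF X_def] g Qn_def by algebra
  have h: "hmod r (vector [X, Y, z]) = vector [z * (?d^5 * Pn), - (z * (?d^5 * Qn)), Y * (?d^5 * Qn) - X * (?d^5 * Pn)]"
    by (simp add: hmod_def Let_def P Q)
  have n: "nform r v $ 1 = z * Pn" "nform r v $ 2 = - (z * Qn)"
    unfolding nform_nth[OF r] Pn_def Qn_def x_def[symmetric] y_def[symmetric] z_def[symmetric] by algebra+
  have n3: "nform r v $ 3 = y * Qn - x * Pn"
    unfolding nform_nth[OF r] Pn_def Qn_def x_def[symmetric] y_def[symmetric] z_def[symmetric] by algebra
  show ?thesis
    unfolding vec3_eq_iff pullback_nth M h vector_smult_component n n3 mat3_axis
    by (simp add: dot_3 axis_def X_def Y_def algebra_simps power_numeral_reduce)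
qed

text \<open>Since \<open>(r + 2) * (r - 2) = 1\<close>, scaling by \<open>r + 2\<close> exchanges
  the two quadratic factors, and the opposite signs on the two axes undo the change of sign of
  \<open>r\<close> in the last factor.\<close>

lemma pullback_hmod_minus:
  assumes r: "r^2 = 5"
  shows "pullback (mat3 (- (r + 2) *s axis 1 1) ((r + 2) *s axis 2 1) (axis 3 1)) (hmod (- r)) v = - ((r + 2)^6) *s hmod r v"
proof -
  define x y z where "x = v$1" and "y = v$2" and "z = v$3"
  let ?k = "r + 2"
  have M: "mat3 (- ?k *s axis 1 1) (?k *s axis 2 1) (axis 3 1) *v v = vector [- ?k * x, ?k * y, z]"
    by (simp add: mat3_mult vec3_eq_iff axis_def x_def y_def z_def algebra_simps)
  have k: "?k * (r - 2) = 1" using r by (simp add: algebra_simps power2_eq_square)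
  have f: "((?k * y)^2 - z^2) * ((?k * y)^2 - (- r - 2)^2 * z^2) = ?k^4 * ((y^2 - z^2) * (y^2 - (r - 2)^2 * z^2))" for y
  proof -
    have "(?k * y)^2 - z^2 = ?k^2 * (y^2 - (r - 2)^2 * z^2)" using k by algebra
    moreover have "(?k * y)^2 - (- r - 2)^2 * z^2 = ?k^2 * (y^2 - z^2)" by algebra
    ultimately show ?thesis by algebra
  qed
  define P where "P = (y^2 - z^2) * (y^2 - (r - 2)^2 * z^2) * (y + r * x)"
  define Q where "Q = (x^2 - z^2) * (x^2 - (r - 2)^2 * z^2) * (x + r * y)"
  have P': "((?k * y)^2 - z^2) * ((?k * y)^2 - (- r - 2)^2 * z^2) * (?k * y + (- r) * (- ?k * x)) = ?k^5 * P"
    unfolding f P_def by algebra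
  have Q': "((- ?k * x)^2 - z^2) * ((- ?k * x)^2 - (- r - 2)^2 * z^2) * (- ?k * x + (- r) * (?k * y)) = - (?k^5 * Q)"
    using f[of "- x"] unfolding Q_def by algebra
  have h: "hmod (- r) (vector [- ?k * x, ?k * y, z]) =
    vector [z * (?k^5 * P), - (z * (- (?k^5 * Q))), ?k * y * (- (?k^5 * Q)) - (- ?k * x) * (?k^5 * P)]"
    unfolding hmod_def Let_def vector_3 P' Q' ..
  have h': "hmod r v = vector [z * P, - (z * Q), y * Q - x * P]"
    unfolding hmod_def Let_def P_def Q_def x_def y_def z_def ..
  show ?thesis
    unfolding vec3_eq_iff pullback_nth M h h' vector_smult_component mat3_axis
    by (simp add: dot_3 axis_def algebra_simps power_numeral_reduce)
qed

text \<open>Homogeneity of \<open>F\<close> is a conclusion: after absorbing \<open>c\<close>,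
  \<open>F\<close> is a pullback of \<open>H\<close>. In this way \<open>hmod\<close> inherits it
  from \<open>nform\<close>.\<close>

lemma pullback_eq_smult_imp:
  assumes "invertible M" "c \<noteq> 0" "\<And>v. pullback M F v = c *s H v" "hform n H"
  shows "hform n F \<and> (\<exists>K. invertible K \<and> F = pullback K H) \<and> (\<exists>K. invertible K \<and> H = pullback K F)"
proof -
  have "same_foliation (pullback M F) H" unfolding same_foliation_def using assms by blast
  then obtain K where K: "invertible K" "pullback M F = pullback K H" using same_foliation_pullback[OF assms(4)] by metis
  obtain N where N: "invertible N" "M ** N = mat 1" using invertible_inv[OF assms(1)] by metis
  obtain L where L: "invertible L" "K ** L = mat 1" using invertible_inv[OF K(1)] by metis
  have "F = pullback (K ** N) H" by (metis K(2) N(2) pullback_mat_1 pullback_pullback)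
  moreover have "H = pullback (M ** L) F" by (metis K(2) L(2) pullback_mat_1 pullback_pullback)
  ultimately show ?thesis using K N L assms(1) invertible_mult hform_pullback[OF assms(4)] by metis
qed

lemma hmod_nform:
  assumes r: "r^2 = 5"
  shows "hform 6 (hmod r)" "\<exists>K. invertible K \<and> hmod r = pullback K (nform r)" "\<exists>K. invertible K \<and> nform r = pullback K (hmod r)"
proof -
  have d: "3 - r \<noteq> 0"
  proof
    assume "3 - r = 0"
    then have "(4::complex) = 0" using r by algebra
    then show False by simp
  qed
  then have "invertible (mat3 ((3 - r) *s axis 1 1) ((3 - r) *s axis 2 1) (vector [r - 2, r - 2, 1]))"
    by (simp add: invertible_mat3 det3_eq axis_def)
  from pullback_eq_smult_imp[OF this _ pullback_hmod_nform[OF r] hform_nform] d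
  show "hform 6 (hmod r)" "\<exists>K. invertible K \<and> hmod r = pullback K (nform r)" "\<exists>K. invertible K \<and> nform r = pullback K (hmod r)"
    by auto
qed

lemma nform_hilbert:
  assumes r: "r^2 = 5"
  shows "\<exists>K. invertible K \<and> nform r = pullback K hilbert_modular5"
proof -
  let ?s = "complex_of_real (sqrt 5)"
  have s: "?s^2 = 5" by (simp flip: of_real_power)
  have k: "?s + 2 \<noteq> 0"
  proof
    assume "?s + 2 = 0"
    then have "(1::complex) = 0" using s by algebra
    then show False by simp
  qed
  have k': "- ?s \<noteq> 2" using k by (metis add.right_inverse)
  have "\<exists>K. invertible K \<and> hmod r = pullback K (hmod ?s)"
  proof -
    have "r^2 = ?s^2" using r s by simp
    then consider "r = ?s" | "r = - ?s" unfolding power2_eq_iff by blast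
    then show ?thesis
    proof cases
      case 1
      have "invertible (mat 1 :: complex^3^3)" by (simp add: invertible_det_nz)
      then show ?thesis using 1 by (intro exI[of _ "mat 1"]) (simp add: pullback_mat_1)
    next
      case 2
      have "invertible (mat3 (- (?s + 2) *s axis 1 1) ((?s + 2) *s axis 2 1) (axis 3 1))"
        using k k' by (simp add: invertible_mat3 det3_eq axis_def)
      from pullback_eq_smult_imp[OF this _ pullback_hmod_minus[OF s] hmod_nform(1)[OF s]] k 2
      show ?thesis by auto
    qed
  qed
  then obtain K where K: "invertible K" "hmod r = pullback K (hmod ?s)" by blast
  obtain L where L: "invertible L" "nform r = pullback L (hmod r)" using hmod_nform(3)[OF r] by blast
  then show ?thesis using K invertible_mult[OF K(1) L(1)] unfolding hilbert_modular5_hmod by (metis pullback_pullback)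
qed

section \<open>Singularities and invariant lines of the normal form\<close>

text \<open>This and the next two are the partial derivatives of \<open>edge\<close>, written out so
  that their values at points over Z[g] can be reduced by \<open>algebra\<close>.\<close>

definition edge_x where
  "edge_x k1 k2 k3 k4 X f h Y x y z =
    y * (z * (4 * k1 * x^3 + 3 * k2 * x^2 * y + 2 * k3 * x * y^2 + k4 * y^3)
      + 5 * X * x^4 + 4 * f * x^3 * y + 2 * h * x * y^3 - Y * (y::complex)^4)"

definition edge_y where
  "edge_y k1 k2 k3 k4 X f h Y x y z =
    x * (z * (k1 * x^3 + 2 * k2 * x^2 * y + 3 * k3 * x * y^2 + 4 * k4 * y^3)
      + X * x^4 + 2 * f * x^3 * y + 4 * h * x * y^3 - 5 * Y * (y::complex)^4)"

definition edge_z where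
  "edge_z k1 k2 k3 k4 x y = x * y * (k1 * x^3 + k2 * x^2 * y + k3 * x * y^2 + k4 * (y::complex)^3)"

lemma edge_derivative:
  fixes x y z u v w :: complex
  shows "((\<lambda>s. edge k1 k2 k3 k4 X f h Y (x + s * u) (y + s * v) (z + s * w)) has_field_derivative
    u * edge_x k1 k2 k3 k4 X f h Y x y z + v * edge_y k1 k2 k3 k4 X f h Y x y z + w * edge_z k1 k2 k3 k4 x y) (at 0)"
proof -
  have c: "((\<lambda>s. x + s * u) has_field_derivative u) (at 0)" for x u :: complex by (auto intro!: derivative_eq_intros)
  have m: "((\<lambda>s. A s * B s) has_field_derivative A' * B 0 + A 0 * B') (at 0)"
    if "(A has_field_derivative A') (at 0)" "(B has_field_derivative B') (at 0)" for A B :: "complex \<Rightarrow> complex" and A' B'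
    using DERIV_mult[OF that] by (simp add: ac_simps)
  have 3: "((\<lambda>s. k1 * (x + s * u)^3 + k2 * (x + s * u)^2 * (y + s * v) + k3 * (x + s * u) * (y + s * v)^2 + k4 * (y + s * v)^3)
      has_field_derivative u * (3 * k1 * x^2 + 2 * k2 * x * y + k3 * y^2) + v * (k2 * x^2 + 2 * k3 * x * y + 3 * k4 * y^2)) (at 0)"
    by (rule derivative_eq_intros refl)+ (simp, algebra)
  have 4: "((\<lambda>s. X * (x + s * u)^4 + f * (x + s * u)^3 * (y + s * v) + h * (x + s * u) * (y + s * v)^3 - Y * (y + s * v)^4)
      has_field_derivative u * (4 * X * x^3 + 3 * f * x^2 * y + h * y^3) + v * (f * x^3 + 3 * h * x * y^2 - 4 * Y * y^3)) (at 0)"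
    by (rule derivative_eq_intros refl)+ (simp, algebra)
  show ?thesis
    unfolding edge_def
    by (rule DERIV_cong[OF m[OF m[OF c c] DERIV_add[OF m[OF c 3] 4]]]) (simp add: edge_x_def edge_y_def edge_z_def, algebra)
qed

lemma ddir_edge:
  assumes "homogeneous_poly 6 (\<lambda>v. edge k1 k2 k3 k4 X f h Y (v$a) (v$b) (v$c))"
  shows "ddir (\<lambda>v. edge k1 k2 k3 k4 X f h Y (v$a) (v$b) (v$c)) w p =
    w$a * edge_x k1 k2 k3 k4 X f h Y (p$a) (p$b) (p$c) + w$b * edge_y k1 k2 k3 k4 X f h Y (p$a) (p$b) (p$c)
    + w$c * edge_z k1 k2 k3 k4 (p$a) (p$b)"
  by (rule ddir_eqI[OF assms]) (simp only: vector_add_component vector_smult_component edge_derivative)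

abbreviation "nedge r \<equiv> edge r (5 - r) (r - 5) (- r) 1 r (- r) 1"
abbreviation "nedge_x r \<equiv> edge_x r (5 - r) (r - 5) (- r) 1 r (- r) 1"
abbreviation "nedge_y r \<equiv> edge_y r (5 - r) (r - 5) (- r) 1 r (- r) 1"
abbreviation "nedge_z r \<equiv> edge_z r (5 - r) (r - 5) (- r)"

lemma nform_edges: "nform r v = vector [nedge r (v$2) (v$3) (v$1), nedge r (v$3) (v$1) (v$2), nedge r (v$1) (v$2) (v$3)]"
  by (simp add: nform_def gform_def)

lemma jf_nform:
  "jf (nform r) p a w =
    a$1 * (w$2 * nedge_x r (p$2) (p$3) (p$1) + w$3 * nedge_y r (p$2) (p$3) (p$1) + w$1 * nedge_z r (p$2) (p$3)) +
    a$2 * (w$3 * nedge_x r (p$3) (p$1) (p$2) + w$1 * nedge_y r (p$3) (p$1) (p$2) + w$2 * nedge_z r (p$3) (p$1)) +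
    a$3 * (w$1 * nedge_x r (p$1) (p$2) (p$3) + w$2 * nedge_y r (p$1) (p$2) (p$3) + w$3 * nedge_z r (p$1) (p$2))"
proof -
  have hk: "homogeneous_poly 6 (\<lambda>v. nform r v $ k)" for k using hform_nform by (simp add: hform_def)
  have a: "a = a$1 *s axis 1 1 + a$2 *s axis 2 1 + a$3 *s axis 3 1" by (simp add: vec3_eq_iff axis_def)
  have e: "jf (nform r) p (axis k 1) w = ddir (\<lambda>v. nform r v $ k) w p" for k by (simp add: jf_def)
  have h: "homogeneous_poly 6 (\<lambda>v :: complex^3. nedge r (v$2) (v$3) (v$1))"
    "homogeneous_poly 6 (\<lambda>v :: complex^3. nedge r (v$3) (v$1) (v$2))"
    "homogeneous_poly 6 (\<lambda>v :: complex^3. nedge r (v$1) (v$2) (v$3))"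
    using hk[of 1] hk[of 2] hk[of 3] unfolding nform_edges by simp_all
  show ?thesis
    by (subst a)
      (simp add: jf_add1[OF hform_nform] jf_smult1[OF hform_nform] e nform_edges ddir_edge[OF h(1)] ddir_edge[OF h(2)] ddir_edge[OF h(3)])
qed

lemma pullback_cyc_nform: "pullback cyc (nform r) = nform r"
  unfolding nform_def pullback_cyc_gform by simp

text \<open>The cubic whose roots are the admissible Camacho--Sad indices \<open>- s / t\<close>.\<close>

definition cs_cubic :: "complex \<Rightarrow> complex \<Rightarrow> bool" where
  "cs_cubic s t \<longleftrightarrow> (s + t) * (s^2 - 3 * s * t + t^2) = 0"

lemma cs_cubic_scale: "cs_cubic s t \<Longrightarrow> cs_cubic (k * s) (k * t)"
proof -
  assume "cs_cubic s t"
  then have "k^3 * ((s + t) * (s^2 - 3 * s * t + t^2)) = 0" by (simp add: cs_cubic_def)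
  then show ?thesis unfolding cs_cubic_def by algebra
qed

text \<open>Over Z[g] the quadratic \<open>x^2 + r * x * y + y^2\<close> splits, with
  \<open>1 + g\<close> the inverse of \<open>g\<close>; all invariant lines then have equations over
  this ring.\<close>

locale normal_form_foliation = quintic_foliation "nform r" for r :: complex +
  fixes g :: complex
  assumes gg: "g^2 + g = 1" and rg: "r = 2 * g + 1"
begin

abbreviation "N \<equiv> nform r"

lemma r5: "r^2 = 5" using gg rg by algebra

lemma g_ne: "g \<noteq> 0" "g \<noteq> 1" "g \<noteq> -1" "1 + g \<noteq> -1" "1 + g \<noteq> 0"
  using gg minus_equation_iff[of g 1] minus_equation_iff[of g 2] by (auto simp: add_eq_0_iff2 power2_eq_square)

lemma g_inverse: "g * (1 + g) = 1" using gg by algebra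

lemma quadratic_factor: "x^2 + r * x * y + y^2 = (x + g * y) * (x + (1 + g) * y)"
  using gg rg by algebra

lemmas N_nth = nform_nth[OF r5, unfolded quadratic_factor]

text \<open>All indices on the line are admissible, in cross-multiplied form and for every choice of
  tangent and transversal vector, so that the property can be transported by
  \<open>cyc\<close>.\<close>

definition good :: "(complex^3) set \<Rightarrow> bool" where
  "good l \<longleftrightarrow> invariant_line N l \<and> (\<forall>p b1 b2. p \<in> l \<longrightarrow> b1 \<in> l \<longrightarrow> N p = 0 \<longrightarrow> det3 b1 b2 p \<noteq> 0 \<longrightarrow>
     cs_cubic (jf N p b1 b2) (jf N p b2 b1))"

text \<open>Changing the representative of the point, the tangent vector or the transversal
  multiplies both entries by the same factor, and the cubic is homogeneous.\<close>

lemma cs_cubic_jf: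
  assumes N0: "N z = 0" and ee: "jf N z e e = 0" and d: "det3 e q z \<noteq> 0" and b1: "b1 = a *s z + b *s e"
    and c: "cs_cubic (jf N z e q) (jf N z q e)"
  shows "cs_cubic (jf N (x *s z) b1 b2) (jf N (x *s z) b2 b1)"
proof -
  obtain x' y' z' where b2: "b2 = x' *s e + y' *s q + z' *s z" using det3_basis[OF d] .
  note lin = jf_add1[OF hf] jf_add2[OF hf] jf_smult1[OF hf] jf_smult2[OF hf] jf_radial[OF hf] jf_radial'[OF hf] N0 ee
  let ?k = "x^5 * (b * y')"
  have "jf N z b1 b2 = b * y' * jf N z e q" "jf N z b2 b1 = b * y' * jf N z q e"
    unfolding b1 b2 by (simp_all add: lin)
  then have "jf N (x *s z) b1 b2 = ?k * jf N z e q" "jf N (x *s z) b2 b1 = ?k * jf N z q e"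
    unfolding jf_scale[OF hf] by (simp_all add: mult.assoc)
  then show ?thesis using cs_cubic_scale[OF c, of ?k] by (simp only:)
qed

text \<open>By \<open>cs_cubic_jf\<close> one tangent vector and one transversal suffice at each
  point; the points of the line are \<open>e\<close> and the \<open>e' + t e\<close>.\<close>

lemma goodI:
  assumes inv: "invariant_line N (vec.span {e', e})" and d: "det3 e q e' \<noteq> 0"
    and c: "cs_cubic (jf N e e' q) (jf N e q e')"
    and t: "\<And>t. N (e' + t *s e) = 0 \<Longrightarrow> cs_cubic (jf N (e' + t *s e) e q) (jf N (e' + t *s e) q e)"
  shows "good (vec.span {e', e})"
  unfolding good_def
proof (intro conjI allI impI inv)
  fix p b1 b2
  assume p: "p \<in> vec.span {e', e}" and b1: "b1 \<in> vec.span {e', e}" and N0: "N p = 0" and d': "det3 b1 b2 p \<noteq> 0"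
  obtain x y where xy: "p = x *s e' + y *s e" using p by (auto simp: in_span2)
  obtain u v where uv: "b1 = u *s e' + v *s e" using b1 by (auto simp: in_span2)
  have e: "e \<in> vec.span {e', e}" "e' \<in> vec.span {e', e}" by (auto intro: vec.span_base)
  show "cs_cubic (jf N p b1 b2) (jf N p b2 b1)"
  proof (cases "x = 0")
    case True
    then have p: "p = y *s e" using xy by simp
    moreover have "y \<noteq> 0" using d' p by (auto simp: det3_def)
    ultimately have "N e = 0" using N0 unfolding p hform_scale[OF hf] by simp
    moreover have "det3 e' q e \<noteq> 0" using d by (simp add: det3_eq algebra_simps)
    moreover have "b1 = v *s e + u *s e'" using uv by (simp add: add.commute)
    ultimately show ?thesis unfolding p using cs_cubic_jf[OF _ jf_invariant_line[OF inv e(2) e(1)] _ _ c] by blast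
  next
    case False
    let ?z = "e' + (y / x) *s e"
    have z: "p = x *s ?z" unfolding xy using False by (simp add: vec_eq_iff field_simps)
    have Nz: "N ?z = 0" using N0 False unfolding z hform_scale[OF hf] by simp
    have "?z \<in> vec.span {e', e}" by (auto intro: vec.span_base vec.span_add vec.span_scale)
    from jf_invariant_line[OF inv e(1) this] have ee: "jf N ?z e e = 0" .
    have b1: "b1 = u *s ?z + (v - u * y / x) *s e" using uv by (simp add: vec_eq_iff algebra_simps)
    have dz: "det3 e q ?z \<noteq> 0" using d by (simp add: det3_eq algebra_simps)
    show ?thesis unfolding z by (rule cs_cubic_jf[OF Nz ee dz b1 t[OF Nz]])
  qed
qed

lemma good_cyc:
  assumes "good l"
  shows "good ((*v) cyc ` l)"
  unfolding good_def
proof (intro conjI allI impI)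
  show "invariant_line N ((*v) cyc ` l)"
    using invariant_line_image[OF invertible_cyc, of N l] assms pullback_cyc_nform unfolding good_def by simp
  fix p b1 b2
  assume "p \<in> (*v) cyc ` l" "b1 \<in> (*v) cyc ` l" and N0: "N p = 0" and d: "det3 b1 b2 p \<noteq> 0"
  then obtain p' b1' where p: "p' \<in> l" "p = cyc *v p'" "b1' \<in> l" "b1 = cyc *v b1'" by blast
  obtain cN where cN: "\<And>v. cyc *v (cN *v v) = v" using invertible_inv[OF invertible_cyc] by metis
  let ?b2 = "cN *v b2"
  have b2: "b2 = cyc *v ?b2" using cN by simp
  have jfc: "jf N (cyc *v p') (cyc *v a) (cyc *v b) = jf N p' a b" for a b
    using jf_pullback[OF hf, of cyc p' a b] by (simp add: pullback_cyc_nform)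
  have "pullback cyc N p' = 0" by (rule vec_eq_iff[THEN iffD2]) (use N0 p in \<open>simp add: pullback_nth\<close>)
  then have N0': "N p' = 0" by (simp add: pullback_cyc_nform)
  have "det3 (cyc *v a) (cyc *v b) (cyc *v c) = det3 a b c" for a b c
    by (simp add: cyc_mult det3_eq algebra_simps)
  then have "det3 b1' ?b2 p' \<noteq> 0" using d p b2 by metis
  then have "cs_cubic (jf N p' b1' ?b2) (jf N p' ?b2 b1')" using assms p N0' unfolding good_def by blast
  then show "cs_cubic (jf N p b1 b2) (jf N p b2 b1)" using jfc p b2 by metis
qed

section \<open>The fifteen lines of the normal form and the indices on them\<close>

definition good_normal :: "complex \<Rightarrow> complex \<Rightarrow> complex \<Rightarrow> bool" where
  "good_normal a b c \<longleftrightarrow> good {v. vector [a, b, c] \<odot> v = 0}"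

lemma good_normal_rotate:
  assumes "good_normal a b c"
  shows "good_normal c a b"
proof -
  have "(*v) cyc ` {v. vector [a, b, c] \<odot> v = 0} = {v. vector [c, a, b] \<odot> v = 0}"
  proof (intro equalityI subsetI)
    fix v :: "complex^3" assume "v \<in> {v. vector [c, a, b] \<odot> v = 0}"
    then have "(vector [v$2, v$3, v$1] :: complex^3) \<in> {v. vector [a, b, c] \<odot> v = 0}" by (simp add: dot_3 algebra_simps)
    moreover have "v = cyc *v vector [v$2, v$3, v$1]" by (simp add: cyc_mult vec3_eq_iff)
    ultimately show "v \<in> (*v) cyc ` {v. vector [a, b, c] \<odot> v = 0}" by blast
  qed (auto simp: cyc_mult dot_3 algebra_simps)
  then show ?thesis using good_cyc assms unfolding good_normal_def by metis
qed

lemma good_normal_scale: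
  assumes "good_normal a b c" "k \<noteq> 0"
  shows "good_normal (k * a) (k * b) (k * c)"
proof -
  have "vector [k * a, k * b, k * c] \<odot> v = k * (vector [a, b, c] \<odot> v)" for v :: "complex^3"
    by (simp add: dot_3 algebra_simps)
  then show ?thesis using assms unfolding good_normal_def by simp
qed

lemma span_normal:
  assumes "ccross p q = k *s vector [a, b, c]" "k \<noteq> 0" "vector [a, b, c] \<noteq> (0 :: complex^3)"
  shows "vec.span {p, q} = {v. vector [a, b, c] \<odot> v = 0}"
proof -
  have "ccross p q \<noteq> 0" using assms by simp
  from in_span2_det3[OF this] show ?thesis using assms by (auto simp: det3_def dot_commute)
qed

lemma jf_axis_3_self: "jf N (axis 3 1) u u = 0"
  by (simp add: jf_nform edge_x_def edge_y_def edge_z_def axis_def algebra_simps)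

lemma N_zero_1: "N v = 0 \<Longrightarrow> v$2 * v$3 * (v$2 - v$3) * ((v$2 + g * v$3) * (v$2 + (1 + g) * v$3)) * (v$2 + v$3 + r * v$1) = 0"
  using N_nth(1)[of v] by simp

text \<open>The line joins the third vertex to \<open>(a, b, 0)\<close>, and \<open>ab\<close> says
  that its direction is a root of the quintic of invariant directions there. At the vertex
  \<open>jf\<close> is alternating. As \<open>b \<noteq> 0\<close>, the first component of the form
  vanishes at \<open>(a, b, t)\<close> only for the five listed values of \<open>t\<close>.\<close>

lemma good_through_3:
  assumes ab: "a * b * (a - b) * ((a + g * b) * (a + (1 + g) * b)) = 0" "b \<noteq> 0"
    and t: "\<And>t. t = 0 \<or> t = b \<or> b + g * t = 0 \<or> b + (1 + g) * t = 0 \<or> t = - b - r * a \<Longrightarrow>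
      cs_cubic (nedge_x r a b t) (nedge_y r b t a)"
  shows "good_normal b (- a) 0"
proof -
  let ?e = "axis 3 1 :: complex^3" and ?e' = "vector [a, b, 0] :: complex^3"
  have c: "ccross ?e' ?e \<noteq> 0" using ab(2) by (simp add: vec3_eq_iff axis_def)
  have "lpoly (pair N ?e) ?e ?e' = 0"
  proof (rule lpoly_eqI)
    fix s
    have v: "(?e + s *s ?e') $ 1 = s * a" "(?e + s *s ?e') $ 2 = s * b" "(?e + s *s ?e') $ 3 = 1" by (simp_all add: axis_def)
    have "N (?e + s *s ?e') $ 3 = s^5 * (a * b * (a - b) * ((a + g * b) * (a + (1 + g) * b))) * (s * a + s * b + r * 1)"
      unfolding N_nth v by algebra
    then show "poly 0 s = pair N ?e (?e + s *s ?e')" using ab(1) by simp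
  qed
  then have inv: "invariant_line N (vec.span {?e', ?e})" by (rule invariant_line_span[OF c])
  have "good (vec.span {?e', ?e})"
  proof (rule goodI[OF inv])
    show "det3 ?e (axis 1 1) ?e' \<noteq> 0" using ab(2) by (simp add: det3_eq axis_def)
    show "cs_cubic (jf N ?e ?e' (axis 1 1)) (jf N ?e (axis 1 1) ?e')"
      using jf_axis_3_self[of "?e' + axis 1 1"] jf_axis_3_self[of ?e'] jf_axis_3_self[of "axis 1 1"]
      by (simp add: jf_add1[OF hf] jf_add2[OF hf] cs_cubic_def add.commute)
    fix s assume N0: "N (?e' + s *s ?e) = 0"
    have v: "(?e' + s *s ?e) $ 1 = a" "(?e' + s *s ?e) $ 2 = b" "(?e' + s *s ?e) $ 3 = s" by (simp_all add: axis_def)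
    have "b * s * (b - s) * ((b + g * s) * (b + (1 + g) * s)) * (b + s + r * a) = 0"
      using N_zero_1[OF N0] unfolding v .
    then have "s = 0 \<or> s = b \<or> b + g * s = 0 \<or> b + (1 + g) * s = 0 \<or> b + s + r * a = 0" using ab(2) by auto
    moreover have "s = - b - r * a" if "b + s + r * a = 0" using that by algebra
    ultimately have "cs_cubic (nedge_x r a b s) (nedge_y r b s a)" using t by blast
    moreover have "jf N (?e' + s *s ?e) ?e (axis 1 1) = nedge_x r a b s" "jf N (?e' + s *s ?e) (axis 1 1) ?e = nedge_y r b s a"
      unfolding jf_nform v by (simp_all add: axis_def)
    ultimately show "cs_cubic (jf N (?e' + s *s ?e) ?e (axis 1 1)) (jf N (?e' + s *s ?e) (axis 1 1) ?e)" by simp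
  qed
  moreover have "vec.span {?e', ?e} = {v. vector [b, - a, 0] \<odot> v = 0}"
    by (rule span_normal[where k = 1]) (use ab(2) in \<open>simp_all add: vec3_eq_iff axis_def\<close>)
  ultimately show ?thesis unfolding good_normal_def by simp
qed

lemma g_solve: "x + g * y = 0 \<longleftrightarrow> y = - (1 + g) * x" "x + (1 + g) * y = 0 \<longleftrightarrow> y = - g * x"
proof -
  note i = g_inverse
  show "x + g * y = 0 \<longleftrightarrow> y = - (1 + g) * x"
  proof
    assume "x + g * y = 0" then show "y = - (1 + g) * x" using i by algebra
  next
    assume "y = - (1 + g) * x" then show "x + g * y = 0" using i by algebra
  qed
  show "x + (1 + g) * y = 0 \<longleftrightarrow> y = - g * x"
  proof
    assume "x + (1 + g) * y = 0" then show "y = - g * x" using i by algebra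
  next
    assume "y = - g * x" then show "x + (1 + g) * y = 0" using i by algebra
  qed
qed

text \<open>The five cases are the singular points off the third vertex. The entries of
  \<open>jf\<close> are reduced to Z[g] by \<open>g^2 = 1 - g\<close>; opposite entries mean index
  1. The other lines through this vertex follow the same scheme.\<close>

lemma good_1_0_0: "good_normal 1 0 0"
proof -
  have "good_normal 1 (- 0) 0"
  proof (rule good_through_3)
    show "0 * 1 * (0 - 1) * ((0 + g * 1) * (0 + (1 + g) * 1)) = 0" by simp
    show "1 \<noteq> (0::complex)" by simp
    fix t assume "t = 0 \<or> t = 1 \<or> 1 + g * t = 0 \<or> 1 + (1 + g) * t = 0 \<or> t = - 1 - r * 0"
    then consider (1) "t = 0" | (2) "t = 1" | (3) "t = - (1 + g) * 1" | (4) "t = - g * 1" | (5) "t = - 1 - r * 0" unfolding g_solve by blast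
    then show "cs_cubic (nedge_x r 0 1 t) (nedge_y r 1 t 0)"
    proof cases
      case 1
      have E: "nedge_x r 0 1 t = - 1" "nedge_y r 1 t 0 = 1"
        unfolding edge_x_def edge_y_def power_one mult_1_left mult_1_right 1 using gg rg by (algebra | simp)+
      show ?thesis unfolding cs_cubic_def E using gg by (algebra | simp)
    next
      case 2
      have E: "nedge_x r 0 1 t = - 2 - 2 * g" "nedge_y r 1 t 0 = - 6 - 4 * g"
        unfolding edge_x_def edge_y_def power_one mult_1_left mult_1_right 2 using gg rg by (algebra | simp)+
      show ?thesis unfolding cs_cubic_def E using gg by (algebra | simp)
    next
      case 3
      have E: "nedge_x r 0 1 t = 2 + g" "nedge_y r 1 t 0 = - 2 - g"
        unfolding edge_x_def edge_y_def power_one mult_1_left mult_1_right 3 using gg rg by (algebra | simp)+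
      show ?thesis unfolding cs_cubic_def E using gg by (algebra | simp)
    next
      case 4
      have E: "nedge_x r 0 1 t = 1 - g" "nedge_y r 1 t 0 = - 1 + g"
        unfolding edge_x_def edge_y_def power_one mult_1_left mult_1_right 4 using gg rg by (algebra | simp)+
      show ?thesis unfolding cs_cubic_def E using gg by (algebra | simp)
    next
      case 5
      have E: "nedge_x r 0 1 t = 2 * g" "nedge_y r 1 t 0 = - 2 + 4 * g"
        unfolding edge_x_def edge_y_def power_one mult_1_left mult_1_right 5 using gg rg by (algebra | simp)+
      show ?thesis unfolding cs_cubic_def E using gg by (algebra | simp)
    qed
  qed
  then show ?thesis by simp
qed

lemma good_1_minus_1_0: "good_normal 1 (- 1) 0"
proof -
  have "good_normal 1 (- 1) 0"
  proof (rule good_through_3)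
    show "1 * 1 * (1 - 1) * ((1 + g * 1) * (1 + (1 + g) * 1)) = 0" by simp
    show "1 \<noteq> (0::complex)" by simp
    fix t assume "t = 0 \<or> t = 1 \<or> 1 + g * t = 0 \<or> 1 + (1 + g) * t = 0 \<or> t = - 1 - r * 1"
    then consider (1) "t = 0" | (2) "t = 1" | (3) "t = - (1 + g) * 1" | (4) "t = - g * 1" | (5) "t = - 1 - r * 1" unfolding g_solve by blast
    then show "cs_cubic (nedge_x r 1 1 t) (nedge_y r 1 t 1)"
    proof cases
      case 1
      have E: "nedge_x r 1 1 t = 6 + 4 * g" "nedge_y r 1 t 1 = 2 + 2 * g"
        unfolding edge_x_def edge_y_def power_one mult_1_left mult_1_right 1 using gg rg by (algebra | simp)+
      show ?thesis unfolding cs_cubic_def E using gg by (algebra | simp)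
    next
      case 2
      have E: "nedge_x r 1 1 t = 13 + 8 * g" "nedge_y r 1 t 1 = - 13 - 8 * g"
        unfolding edge_x_def edge_y_def power_one mult_1_left mult_1_right 2 using gg rg by (algebra | simp)+
      show ?thesis unfolding cs_cubic_def E using gg by (algebra | simp)
    next
      case 3
      have E: "nedge_x r 1 1 t = - 5 - 3 * g" "nedge_y r 1 t 1 = 5 + 3 * g"
        unfolding edge_x_def edge_y_def power_one mult_1_left mult_1_right 3 using gg rg by (algebra | simp)+
      show ?thesis unfolding cs_cubic_def E using gg by (algebra | simp)
    next
      case 4
      have E: "nedge_x r 1 1 t = 2 + g" "nedge_y r 1 t 1 = - 2 - g"
        unfolding edge_x_def edge_y_def power_one mult_1_left mult_1_right 4 using gg rg by (algebra | simp)+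
      show ?thesis unfolding cs_cubic_def E using gg by (algebra | simp)
    next
      case 5
      have E: "nedge_x r 1 1 t = - 16 - 10 * g" "nedge_y r 1 t 1 = - 42 - 26 * g"
        unfolding edge_x_def edge_y_def power_one mult_1_left mult_1_right 5 using gg rg by (algebra | simp)+
      show ?thesis unfolding cs_cubic_def E using gg by (algebra | simp)
    qed
  qed
  then show ?thesis by simp
qed

lemma good_1_g_0: "good_normal 1 g 0"
proof -
  have "good_normal 1 (- (- g)) 0"
  proof (rule good_through_3)
    show "(- g) * 1 * ((- g) - 1) * (((- g) + g * 1) * ((- g) + (1 + g) * 1)) = 0" by simp
    show "1 \<noteq> (0::complex)" by simp
    fix t assume "t = 0 \<or> t = 1 \<or> 1 + g * t = 0 \<or> 1 + (1 + g) * t = 0 \<or> t = - 1 - r * (- g)"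
    then consider (1) "t = 0" | (2) "t = 1" | (3) "t = - (1 + g) * 1" | (4) "t = - g * 1" | (5) "t = - 1 - r * (- g)" unfolding g_solve by blast
    then show "cs_cubic (nedge_x r (- g) 1 t) (nedge_y r 1 t (- g))"
    proof cases
      case 1
      have E: "nedge_x r (- g) 1 t = 1 - g" "nedge_y r 1 t (- g) = - 1 + g"
        unfolding edge_x_def edge_y_def power_one mult_1_left mult_1_right 1 using gg rg by (algebra | simp)+
      show ?thesis unfolding cs_cubic_def E using gg by (algebra | simp)
    next
      case 2
      have E: "nedge_x r (- g) 1 t = 2 + g" "nedge_y r 1 t (- g) = - 2 - g"
        unfolding edge_x_def edge_y_def power_one mult_1_left mult_1_right 2 using gg rg by (algebra | simp)+
      show ?thesis unfolding cs_cubic_def E using gg by (algebra | simp)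
    next
      case 3
      have E: "nedge_x r (- g) 1 t = - 2 - 2 * g" "nedge_y r 1 t (- g) = - 6 - 4 * g"
        unfolding edge_x_def edge_y_def power_one mult_1_left mult_1_right 3 using gg rg by (algebra | simp)+
      show ?thesis unfolding cs_cubic_def E using gg by (algebra | simp)
    next
      case 4
      have E: "nedge_x r (- g) 1 t = - 1" "nedge_y r 1 t (- g) = 1"
        unfolding edge_x_def edge_y_def power_one mult_1_left mult_1_right 4 using gg rg by (algebra | simp)+
      show ?thesis unfolding cs_cubic_def E using gg by (algebra | simp)
    next
      case 5
      have E: "nedge_x r (- g) 1 t = 2 * g" "nedge_y r 1 t (- g) = - 2 + 4 * g"
        unfolding edge_x_def edge_y_def power_one mult_1_left mult_1_right 5 using gg rg by (algebra | simp)+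
      show ?thesis unfolding cs_cubic_def E using gg by (algebra | simp)
    qed
  qed
  then show ?thesis by simp
qed

text \<open>This is the line with normal \<open>(1, 1 + g, 0)\<close>, rescaled by
  \<open>- g\<close>.\<close>

lemma good_minus_g_minus_1_0: "good_normal (- g) (- 1) 0"
proof -
  have "good_normal (- g) (- 1) 0"
  proof (rule good_through_3)
    show "1 * (- g) * (1 - (- g)) * ((1 + g * (- g)) * (1 + (1 + g) * (- g))) = 0" using gg by algebra
    show "(- g) \<noteq> 0" using g_ne by simp
    fix t assume "t = 0 \<or> t = (- g) \<or> (- g) + g * t = 0 \<or> (- g) + (1 + g) * t = 0 \<or> t = - (- g) - r * 1"
    then consider (1) "t = 0" | (2) "t = (- g)" | (3) "t = - (1 + g) * (- g)" | (4) "t = - g * (- g)" | (5) "t = - (- g) - r * 1" unfolding g_solve by blast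
    then show "cs_cubic (nedge_x r 1 (- g) t) (nedge_y r (- g) t 1)"
    proof cases
      case 1
      have E: "nedge_x r 1 (- g) t = 1 - 2 * g" "nedge_y r (- g) t 1 = - 1 + 2 * g"
        unfolding edge_x_def edge_y_def power_one mult_1_left mult_1_right 1 using gg rg by (algebra | simp)+
      show ?thesis unfolding cs_cubic_def E using gg by (algebra | simp)
    next
      case 2
      have E: "nedge_x r 1 (- g) t = g" "nedge_y r (- g) t 1 = - g"
        unfolding edge_x_def edge_y_def power_one mult_1_left mult_1_right 2 using gg rg by (algebra | simp)+
      show ?thesis unfolding cs_cubic_def E using gg by (algebra | simp)
    next
      case 3
      have E: "nedge_x r 1 (- g) t = - 1 - g" "nedge_y r (- g) t 1 = 1 + g"
        unfolding edge_x_def edge_y_def power_one mult_1_left mult_1_right 3 using gg rg by (algebra | simp)+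
      show ?thesis unfolding cs_cubic_def E using gg by (algebra | simp)
    next
      case 4
      have E: "nedge_x r 1 (- g) t = - 2 + 2 * g" "nedge_y r (- g) t 1 = - 4 + 6 * g"
        unfolding edge_x_def edge_y_def power_one mult_1_left mult_1_right 4 using gg rg by (algebra | simp)+
      show ?thesis unfolding cs_cubic_def E using gg by (algebra | simp)
    next
      case 5
      have E: "nedge_x r 1 (- g) t = 2" "nedge_y r (- g) t 1 = 4 + 2 * g"
        unfolding edge_x_def edge_y_def power_one mult_1_left mult_1_right 5 using gg rg by (algebra | simp)+
      show ?thesis unfolding cs_cubic_def E using gg by (algebra | simp)
    qed
  qed
  then show ?thesis by simp
qed

text \<open>Up to rotation, the only line that avoids the coordinate vertices, so it has its own
  parametrisation and computation.\<close>

lemma good_1_1_g: "good_normal 1 1 g"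
proof -
  \<comment> \<open>\<open>w\<close> is \<open>- 2 / g\<close>, which puts \<open>(1, 1, w)\<close>
    on the line \<open>x + y + g z = 0\<close>.\<close>
  define w where "w = - 2 - 2 * g"
  define e :: "complex^3" where "e = vector [1, 1, w]"
  define e' :: "complex^3" where "e' = vector [1, - 1, 0]"
  let ?q = "axis 3 1 :: complex^3"
  have e_nth: "e$1 = 1" "e$2 = 1" "e$3 = w" "e'$1 = 1" "e'$2 = - 1" "e'$3 = 0" by (simp_all add: e_def e'_def)
  have w0: "w \<noteq> 0"
  proof
    assume "w = 0"
    then have "(4::complex) = 0" using gg unfolding w_def by algebra
    then show False by simp
  qed
  have c: "ccross e' e \<noteq> 0" using w0 by (simp add: vec3_eq_iff e_nth)
  have "lpoly (pair N e) e e' = 0"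
  proof (rule lpoly_eqI)
    fix s
    have v: "(e + s *s e') $ 1 = 1 + s" "(e + s *s e') $ 2 = 1 - s" "(e + s *s e') $ 3 = w" by (simp_all add: e_nth)
    let ?A = "2 * g * w * s * (1 - s^2) * ((3 + 2 * g)^2 - s^2)"
    have "N (e + s *s e') $ 1 = ?A" "N (e + s *s e') $ 2 = ?A" "N (e + s *s e') $ 3 = g * ?A"
      unfolding N_nth v w_def using gg rg by algebra+
    then have "pair N e (e + s *s e') = ?A * (2 + g * w)"
      unfolding dot_3 e_nth by algebra
    moreover have "2 + g * w = 0" unfolding w_def using gg by algebra
    ultimately show "poly 0 s = pair N e (e + s *s e')" by simp
  qed
  then have inv: "invariant_line N (vec.span {e', e})" by (rule invariant_line_span[OF c])
  have "good (vec.span {e', e})"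
  proof (rule goodI[OF inv])
    show "det3 e ?q e' \<noteq> 0" by (simp add: det3_eq e_nth axis_def)
    have "jf N e e' ?q = - 84 - 52 * g" "jf N e ?q e' = - 32 - 20 * g"
    proof -
      have E: "nedge_y r 1 w 1 - nedge_x r w 1 1 = - 84 - 52 * g" "nedge_x r 1 1 w - nedge_y r 1 1 w = - 32 - 20 * g"
        unfolding edge_x_def edge_y_def power_one mult_1_left mult_1_right w_def using gg rg by algebra+
      then show "jf N e e' ?q = - 84 - 52 * g" "jf N e ?q e' = - 32 - 20 * g"
        unfolding jf_nform e_nth by (simp_all add: axis_def)
    qed
    then show "cs_cubic (jf N e e' ?q) (jf N e ?q e')" unfolding cs_cubic_def using gg by (algebra | simp)
    fix t assume N0: "N (e' + t *s e) = 0"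
    have v: "(e' + t *s e) $ 1 = 1 + t" "(e' + t *s e) $ 2 = t - 1" "(e' + t *s e) $ 3 = w * t" by (simp_all add: e_nth)
    \<comment> \<open>Factoring one component already confines the singular points other than
      \<open>e\<close> to five values of \<open>t\<close>.\<close>
    have C: "N (e' + t *s e) $ 3 = (- 32 - 20 * g) * (t * (t - 1) * (t + 1) * (t - (2 * g - 1)) * (t - (1 - 2 * g)))"
      unfolding N_nth v w_def using gg rg by algebra
    have jfs: "jf N (e' + t *s e) e ?q = nedge_y r (t - 1) (w * t) (1 + t) + nedge_x r (w * t) (1 + t) (t - 1) + w * nedge_z r (1 + t) (t - 1)"
      "jf N (e' + t *s e) ?q e = nedge_x r (1 + t) (t - 1) (w * t) + nedge_y r (1 + t) (t - 1) (w * t) + w * nedge_z r (1 + t) (t - 1)"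
      unfolding jf_nform v e_nth by (simp_all add: axis_def)
    consider (1) "t = 0" | (2) "t = 1" | (3) "t = - 1" | (4) "t = 2 * g - 1" | (5) "t = 1 - 2 * g"
    proof -
      have "- 32 - 20 * g \<noteq> 0"
      proof
        assume "- 32 - 20 * g = 0"
        then have "(16::complex) = 0" using gg by algebra
        then show False by simp
      qed
      then have "t * (t - 1) * (t + 1) * (t - (2 * g - 1)) * (t - (1 - 2 * g)) = 0" using C N0 by simp
      then show ?thesis using that by (auto simp: add_eq_0_iff2)
    qed
    then show "cs_cubic (jf N (e' + t *s e) e ?q) (jf N (e' + t *s e) ?q e)"
    proof cases
      case 1
      have p: "1 + t = 1" "t - 1 = - 1" "w * t = 0" unfolding w_def 1 using gg by (algebra | simp)+
      have E: "nedge_y r (- 1) 0 1 = 2 * g" "nedge_x r 0 1 (- 1) = 2 * g" "nedge_z r 1 (- 1) = 6 - 8 * g" "nedge_x r 1 (- 1) 0 = - 2 + 4 * g" "nedge_y r 1 (- 1) 0 = - 2 + 4 * g"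
        unfolding edge_x_def edge_y_def edge_z_def power_one mult_1_left mult_1_right mult_zero_left mult_zero_right power_zero_numeral add_0_left add_0_right
        using gg rg by (algebra | simp)+
      have "jf N (e' + t *s e) e ?q = 4 - 8 * g" "jf N (e' + t *s e) ?q e = - 4 * g"
        unfolding jfs p E unfolding w_def using gg by (algebra | simp)+
      then show ?thesis unfolding cs_cubic_def using gg by (algebra | simp)
    next
      case 2
      have p: "1 + t = 2" "t - 1 = 0" "w * t = - 2 - 2 * g" unfolding w_def 2 using gg by (algebra | simp)+
      have E: "nedge_y r 0 (- 2 - 2 * g) 2 = 0" "nedge_x r (- 2 - 2 * g) 2 0 = 64 + 32 * g" "nedge_z r 2 0 = 0" "nedge_x r 2 0 (- 2 - 2 * g) = 0" "nedge_y r 2 0 (- 2 - 2 * g) = - 64 - 32 * g"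
        unfolding edge_x_def edge_y_def edge_z_def power_one mult_1_left mult_1_right mult_zero_left mult_zero_right power_zero_numeral add_0_left add_0_right
        using gg rg by (algebra | simp)+
      have "jf N (e' + t *s e) e ?q = 64 + 32 * g" "jf N (e' + t *s e) ?q e = - 64 - 32 * g"
        unfolding jfs p E unfolding w_def using gg by (algebra | simp)+
      then show ?thesis unfolding cs_cubic_def using gg by (algebra | simp)
    next
      case 3
      have p: "1 + t = 0" "t - 1 = - 2" "w * t = 2 + 2 * g" unfolding w_def 3 using gg by (algebra | simp)+
      have E: "nedge_y r (- 2) (2 + 2 * g) 0 = 64 + 32 * g" "nedge_x r (2 + 2 * g) 0 (- 2) = 0" "nedge_z r 0 (- 2) = 0" "nedge_x r 0 (- 2) (2 + 2 * g) = - 64 - 32 * g" "nedge_y r 0 (- 2) (2 + 2 * g) = 0"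
        unfolding edge_x_def edge_y_def edge_z_def power_one mult_1_left mult_1_right mult_zero_left mult_zero_right power_zero_numeral add_0_left add_0_right
        using gg rg by (algebra | simp)+
      have "jf N (e' + t *s e) e ?q = 64 + 32 * g" "jf N (e' + t *s e) ?q e = - 64 - 32 * g"
        unfolding jfs p E unfolding w_def using gg by (algebra | simp)+
      then show ?thesis unfolding cs_cubic_def using gg by (algebra | simp)
    next
      case 4
      have p: "1 + t = 2 * g" "t - 1 = - 2 + 2 * g" "w * t = - 2 + 2 * g" unfolding w_def 4 using gg by (algebra | simp)+
      have pow: "(2 * g)^2 = 4 - 4 * g" "(2 * g)^3 = - 8 + 16 * g" "(2 * g)^4 = 32 - 48 * g" "(- 2 + 2 * g)^2 = 8 - 12 * g" "(- 2 + 2 * g)^3 = - 40 + 64 * g" "(- 2 + 2 * g)^4 = 208 - 336 * g"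
        using gg by algebra+
      have E: "nedge_y r (- 2 + 2 * g) (- 2 + 2 * g) (2 * g) = - 160 + 256 * g" "nedge_x r (- 2 + 2 * g) (2 * g) (- 2 + 2 * g) = 96 - 160 * g" "nedge_z r (2 * g) (- 2 + 2 * g) = 0" "nedge_x r (2 * g) (- 2 + 2 * g) (- 2 + 2 * g) = 160 - 256 * g" "nedge_y r (2 * g) (- 2 + 2 * g) (- 2 + 2 * g) = - 96 + 160 * g"
        unfolding edge_x_def edge_y_def edge_z_def power_one mult_1_left mult_1_right mult_zero_left mult_zero_right power_zero_numeral add_0_left add_0_right pow rg
        using gg by (algebra | simp)+
      have "jf N (e' + t *s e) e ?q = - 64 + 96 * g" "jf N (e' + t *s e) ?q e = 64 - 96 * g"
        unfolding jfs p E unfolding w_def using gg by (algebra | simp)+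
      then show ?thesis unfolding cs_cubic_def using gg by (algebra | simp)
    next
      case 5
      have p: "1 + t = 2 - 2 * g" "t - 1 = - 2 * g" "w * t = 2 - 2 * g" unfolding w_def 5 using gg by (algebra | simp)+
      have pow: "(2 - 2 * g)^2 = 8 - 12 * g" "(2 - 2 * g)^3 = 40 - 64 * g" "(2 - 2 * g)^4 = 208 - 336 * g" "(- 2 * g)^2 = 4 - 4 * g" "(- 2 * g)^3 = 8 - 16 * g" "(- 2 * g)^4 = 32 - 48 * g"
        using gg by algebra+
      have E: "nedge_y r (- 2 * g) (2 - 2 * g) (2 - 2 * g) = 96 - 160 * g" "nedge_x r (2 - 2 * g) (2 - 2 * g) (- 2 * g) = - 160 + 256 * g" "nedge_z r (2 - 2 * g) (- 2 * g) = 0" "nedge_x r (2 - 2 * g) (- 2 * g) (2 - 2 * g) = - 96 + 160 * g" "nedge_y r (2 - 2 * g) (- 2 * g) (2 - 2 * g) = 160 - 256 * g"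
        unfolding edge_x_def edge_y_def edge_z_def power_one mult_1_left mult_1_right mult_zero_left mult_zero_right power_zero_numeral add_0_left add_0_right pow rg
        using gg by (algebra | simp)+
      have "jf N (e' + t *s e) e ?q = - 64 + 96 * g" "jf N (e' + t *s e) ?q e = 64 - 96 * g"
        unfolding jfs p E unfolding w_def using gg by (algebra | simp)+
      then show ?thesis unfolding cs_cubic_def using gg by (algebra | simp)
    qed
  qed
  moreover have "vec.span {e', e} = {v. vector [1, 1, g] \<odot> v = 0}"
  proof (rule span_normal)
    show "ccross e' e = - w *s vector [1, 1, g]"
    proof -
      have "- w * g = 2" unfolding w_def using gg by algebra
      then show ?thesis by (simp add: vec3_eq_iff e_nth)
    qed
  qed (use w0 in \<open>simp_all add: vec3_eq_iff\<close>)
  ultimately show ?thesis unfolding good_normal_def by simp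
qed

text \<open>Each vector is scaled so that its first nonzero coordinate is 1; proportional members
  are therefore equal.\<close>

definition normals :: "(complex^3) set" where
  "normals = {vector [1, 0, 0], vector [0, 1, 0], vector [0, 0, 1],
    vector [1, - 1, 0], vector [0, 1, - 1], vector [1, 0, - 1],
    vector [1, g, 0], vector [0, 1, g], vector [1, 0, 1 + g],
    vector [1, 1 + g, 0], vector [0, 1, 1 + g], vector [1, 0, g],
    vector [1, 1, g], vector [1, g, 1], vector [1, 1 + g, 1 + g]}"

lemma card_normals: "card normals = 15"
  unfolding normals_def using g_ne by (simp add: vec3_eq_iff eq_commute[of _ g])

lemma inj_on_normals: "inj_on (\<lambda>a. {v. a \<odot> v = 0}) normals"
proof (rule inj_onI)
  fix a b assume ab: "a \<in> normals" "b \<in> normals" "{v. a \<odot> v = 0} = {v. b \<odot> v = 0}"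
  have n: "c$1 = 1 \<or> c$1 = 0 \<and> c$2 = 1 \<or> c$1 = 0 \<and> c$2 = 0 \<and> c$3 = 1" if "c \<in> normals" for c
    using that unfolding normals_def by auto
  have nz: "c \<noteq> 0" if "c \<in> normals" for c using n[OF that] by auto
  have "ccross a b = 0" by (rule normal_unique[OF nz[OF ab(1)] nz[OF ab(2)] ab(3)])
  then have "a$2 * b$3 = a$3 * b$2" "a$3 * b$1 = a$1 * b$3" "a$1 * b$2 = a$2 * b$1"
    by (simp_all add: vec3_eq_iff)
  then show "a = b" using n[OF ab(1)] n[OF ab(2)] by (auto simp: vec3_eq_iff)
qed

text \<open>The fifteen lines are the \<open>cyc\<close>-orbits of the five computed ones; factors
  \<open>g\<close>, \<open>1 + g\<close> or -1 restore the chosen scaling.\<close>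

lemma good_normals:
  assumes "a \<in> normals"
  shows "good {v. a \<odot> v = 0}"
proof -
  have 1: "good_normal 1 0 0" using good_1_0_0 by simp
  have 2: "good_normal 1 (- 1) 0" using good_1_minus_1_0 .
  have 3: "good_normal 1 g 0" using good_1_g_0 by simp
  have "good_normal g 1 0" using good_normal_scale[OF good_minus_g_minus_1_0, of "- 1"] by simp
  from good_normal_scale[OF this, of "1 + g"] have 4: "good_normal 1 (1 + g) 0"
    using g_ne g_inverse by (simp add: mult.commute)
  note rot = good_normal_rotate
  have 5: "good_normal g 1 1" using rot[OF good_1_1_g] .
  have s1: "good_normal 1 0 (- 1)" using good_normal_scale[OF rot[OF rot[OF 2]], of "- 1"] by simp
  have s2: "good_normal 1 0 (1 + g)"
    using good_normal_scale[OF rot[OF rot[OF 3]], of "1 + g"] g_ne g_inverse by (simp add: mult.commute)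
  have s3: "good_normal 1 0 g"
    using good_normal_scale[OF rot[OF rot[OF 4]], of g] g_ne g_inverse by simp
  have s4: "good_normal 1 (1 + g) (1 + g)"
    using good_normal_scale[OF 5, of "1 + g"] g_ne g_inverse by (simp add: mult.commute)
  show ?thesis
    using assms 1 rot[OF 1] rot[OF rot[OF 1]] 2 rot[OF 2] s1 3 rot[OF 3] s2 4 rot[OF 4] s3 good_1_1_g rot[OF 5] s4
    unfolding normals_def good_normal_def by blast
qed

end

section \<open>All invariant lines and the index set of the normal form\<close>

context normal_form_foliation
begin

lemma jf_axes:
  assumes "p$1 = 0"
  shows "jf N p (axis 3 1) (axis 1 1) = nedge_x r 0 (p$2) (p$3)" "jf N p (axis 1 1) (axis 3 1) = nedge_y r (p$2) (p$3) 0"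
    "jf N p (axis 3 1) (axis 3 1) = 0"
  using assms unfolding jf_nform by (simp_all add: axis_def edge_z_def)

lemma jf_0_1:
  "jf N (vector [0, 1, 1]) (axis 3 1) (axis 1 1) = - 2 - 2 * g" "jf N (vector [0, 1, 1]) (axis 1 1) (axis 3 1) = - 6 - 4 * g"
  "jf N (vector [0, 1, - 1]) (axis 3 1) (axis 1 1) = 2 * g" "jf N (vector [0, 1, - 1]) (axis 1 1) (axis 3 1) = - 2 + 4 * g"
proof -
  have 1: "nedge_x r 0 1 1 = - 2 - 2 * g" "nedge_y r 1 1 0 = - 6 - 4 * g"
    "nedge_x r 0 1 (- 1) = 2 * g" "nedge_y r 1 (- 1) 0 = - 2 + 4 * g"
    unfolding edge_x_def edge_y_def rg by simp_all
  show "jf N (vector [0, 1, 1]) (axis 3 1) (axis 1 1) = - 2 - 2 * g" "jf N (vector [0, 1, 1]) (axis 1 1) (axis 3 1) = - 6 - 4 * g"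
    "jf N (vector [0, 1, - 1]) (axis 3 1) (axis 1 1) = 2 * g" "jf N (vector [0, 1, - 1]) (axis 1 1) (axis 3 1) = - 2 + 4 * g"
    by (simp_all only: jf_axes vector_3 1)
qed

lemma jf_0_1_nonzero: "- 2 - 2 * g \<noteq> 0" "- 6 - 4 * g \<noteq> 0" "2 * g \<noteq> 0" "- 2 + 4 * g \<noteq> 0" "(- 2 - 2 * g) + (- 6 - 4 * g) \<noteq> 0"
proof -
  \<comment> \<open>Each number is multiplied by a suitable element of Z[g] to give a nonzero
    integer.\<close>
  have *: "x \<noteq> 0" if hyp: "x * y = c" "c \<noteq> 0" for x y c :: complex using hyp by auto
  show "- 2 - 2 * g \<noteq> 0" by (rule *[of _ g "- 2"]) (use gg in algebra, simp)
  show "- 6 - 4 * g \<noteq> 0" by (rule *[of _ "- 2 + 4 * g" "- 4"]) (use gg in algebra, simp)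
  show "2 * g \<noteq> 0" using g_ne by simp
  show "- 2 + 4 * g \<noteq> 0" by (rule *[of _ "- 6 - 4 * g" "- 4"]) (use gg in algebra, simp)
  show "(- 2 - 2 * g) + (- 6 - 4 * g) \<noteq> 0" by (rule *[of _ "- 2 + 6 * g" "- 20"]) (use gg in algebra, simp)
qed

lemma N_0_1: "N (vector [0, 1, 1]) = 0" "N (vector [0, 1, - 1]) = 0"
  unfolding vec3_eq_iff N_nth by simp_all

text \<open>The Jacobian determinant is nonzero because of the singularity \<open>(0, 1, 1)\<close>,
  so there are at most 15 invariant lines, and 15 are known.\<close>

lemma invariant_lines: "{l. invariant_line N l} = (\<lambda>a. {v. a \<odot> v = 0}) ` normals"
proof (intro equalityI subsetI)
  let ?S = "(\<lambda>a. {v. a \<odot> v = 0}) ` normals"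
  have S: "finite ?S" "card ?S = 15"
    using card_image[OF inj_on_normals] card_normals by (auto intro: card_ge_0_finite simp: normals_def)
  have inv: "invariant_line N l" if "l \<in> ?S" for l using that good_normals unfolding good_def by blast
  have E: "\<exists>v. Ed N v \<noteq> 0"
  proof (rule Ed_nonzero)
    show "det3 (axis 3 1) (axis 1 1) (vector [0, 1, 1] :: complex^3) \<noteq> 0" by (simp add: det3_eq axis_def)
    show "jf N (vector [0, 1, 1]) (axis 3 1) (axis 3 1) = 0" by (simp add: jf_axes)
  qed (use jf_0_1_nonzero in \<open>simp_all only: jf_0_1 N_0_1 not_False_eq_True\<close>)
  fix l assume l: "l \<in> {l. invariant_line N l}"
  show "l \<in> ?S"
  proof (rule ccontr)
    assume "l \<notin> ?S"
    then have "card (insert l ?S) = 16" using S by simp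
    moreover have "card (insert l ?S) \<le> 15"
      using card_invariant_lines_le[OF E, of "insert l ?S"] S(1) inv l by auto
    ultimately show False by simp
  qed
qed (use good_normals in \<open>auto simp: good_def\<close>)

lemma card_invariant_lines: "card {l. invariant_line N l} = 15"
  unfolding invariant_lines card_image[OF inj_on_normals] by (rule card_normals)

lemma CS_axis_1:
  defines "p t \<equiv> vector [0, 1, t]"
  assumes p: "N (p t) = 0"
    and nz: "jf N (p t) (axis 3 1) (axis 1 1) \<noteq> 0" "jf N (p t) (axis 1 1) (axis 3 1) \<noteq> 0"
    and c: "c * jf N (p t) (axis 1 1) (axis 3 1) = - jf N (p t) (axis 3 1) (axis 1 1)" "c \<noteq> 1"
  shows "c \<in> CS_set N"
proof -
  let ?l = "{v :: complex^3. vector [1, 0, 0] \<odot> v = 0}"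
  have l: "invariant_line N ?l" using good_normals[of "vector [1, 0, 0]"] by (simp add: good_def normals_def)
  have m: "axis 3 1 \<in> ?l" "p t \<in> ?l" by (simp_all add: p_def dot_3 axis_def)
  have d: "det3 (axis 3 1) (axis 1 1) (p t) \<noteq> 0" by (simp add: p_def det3_eq axis_def)
  have "c = - jf N (p t) (axis 3 1) (axis 1 1) / jf N (p t) (axis 1 1) (axis 3 1)"
    using c(1) nz(2) by (simp only: eq_divide_eq) simp
  then show ?thesis by (rule CS_setI[OF l m d p nz _ c(2)])
qed

text \<open>With index \<open>c\<close> the cubic becomes
  \<open>(1 - c) * t^3 * (c^2 + 3 * c + 1)\<close>, and 1 is excluded. Conversely the two roots
  \<open>g - 1\<close> and \<open>- 2 - g\<close> are the indices on \<open>x = 0\<close> at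
  \<open>(0, 1, 1)\<close> and \<open>(0, 1, -1)\<close>.\<close>

lemma CS_set_N: "CS_set N = {c. c^2 + 3 * c + 1 = 0}"
proof (intro equalityI subsetI)
  fix c assume "c \<in> CS_set N"
  then obtain l p b1 b2 where c: "c \<noteq> 1" "invariant_line N l" "N p = 0" "det3 b1 b2 p \<noteq> 0" "b1 \<in> l" "p \<in> l"
    "jf N p b2 b1 \<noteq> 0" "c = - jf N p b1 b2 / jf N p b2 b1"
    by (rule CS_setE)
  have "l \<in> {l. invariant_line N l}" using c(2) by simp
  then obtain a where "a \<in> normals" "l = {v. a \<odot> v = 0}" unfolding invariant_lines by (elim imageE) simp
  then have "good l" using good_normals by simp
  then have cub: "cs_cubic (jf N p b1 b2) (jf N p b2 b1)" using c unfolding good_def by blast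
  define t where "t = jf N p b2 b1"
  have t: "t \<noteq> 0" "jf N p b1 b2 = - c * t" using c by (simp_all add: t_def)
  have "(- c * t + t) * ((- c * t)^2 - 3 * (- c * t) * t + t^2) = (1 - c) * t^3 * (c^2 + 3 * c + 1)" by algebra
  then have "(1 - c) * t^3 * (c^2 + 3 * c + 1) = 0"
    using cub unfolding cs_cubic_def t(2) t_def[symmetric] by metis
  then show "c \<in> {c. c^2 + 3 * c + 1 = 0}" using t(1) c(1) by simp
next
  fix c :: complex assume "c \<in> {c. c^2 + 3 * c + 1 = 0}"
  then have c: "c^2 + 3 * c + 1 = 0" by simp
  have "(c - (g - 1)) * (c - (- 2 - g)) = 0" using gg c by algebra
  then consider "c = g - 1" | "c = - 2 - g" by auto
  then show "c \<in> CS_set N"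
  proof cases
    case 1
    have "c \<noteq> 1"
    proof
      assume "c = 1"
      then have "(5::complex) = 0" using gg unfolding 1 by algebra
      then show False by simp
    qed
    moreover have "c * (- 6 - 4 * g) = - (- 2 - 2 * g)" unfolding 1 using gg by algebra
    ultimately show ?thesis using CS_axis_1[of 1 c] N_0_1 jf_0_1 jf_0_1_nonzero by simp
  next
    case 2
    have "c \<noteq> 1"
    proof
      assume "c = 1"
      then have "(5::complex) = 0" using gg unfolding 2 by algebra
      then show False by simp
    qed
    moreover have "c * (- 2 + 4 * g) = - (2 * g)" unfolding 2 using gg by algebra
    ultimately show ?thesis using CS_axis_1[of "- 1" c] N_0_1 jf_0_1 jf_0_1_nonzero by simp
  qed
qed

section \<open>Radial singularities of the normal form on its triangle\<close>

lemma radial_singularity_axis_3: "radial_singularity N (vec.span {axis 3 1}) 3"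
proof -
  let ?e = "axis 3 1 :: complex^3"
  have e: "?e \<noteq> 0" by (simp add: vec3_eq_iff axis_def)
  have F0: "N ?e = 0" unfolding vec3_eq_iff N_nth by (simp add: axis_def)
  have l: "lpoly (pair N ?e) ?e (x *s axis 1 1 + y *s axis 2 1) =
    smult (x * y * (x - y) * ((x + g * y) * (x + (1 + g) * y))) (monom r 5 + monom (x + y) 6)" for x y
  proof (rule lpoly_eqI)
    fix s
    let ?v = "?e + s *s (x *s axis 1 1 + y *s axis 2 1)"
    have v: "?v $ 1 = s * x" "?v $ 2 = s * y" "?v $ 3 = 1" by (simp_all add: axis_def)
    have "pair N ?e ?v = N ?v $ 3" by (simp add: dot_3 axis_def)
    also have "\<dots> = x * y * (x - y) * ((x + g * y) * (x + (1 + g) * y)) * (r * s^5 + (x + y) * s^6)"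
      unfolding N_nth v by algebra
    finally show "poly (smult (x * y * (x - y) * ((x + g * y) * (x + (1 + g) * y))) (monom r 5 + monom (x + y) 6)) s = pair N ?e ?v"
      by (simp add: poly_monom)
  qed
  have "det3 (axis 1 1) (axis 2 1) ?e \<noteq> 0" by (simp add: det3_eq axis_def)
  then have "vanishes (pair N ?e) ?e 5" by (rule vanishes_basis[OF hp]) (simp only: l coeff_smult coeff_add coeff_monom, simp)
  then have "5 \<le> kap N ?e" using kap_ge_iff[OF e] by blast
  moreover have "kap N ?e \<le> 5"
  proof (rule kap_le[OF e])
    \<comment> \<open>The test direction (1, 2) is tangent to none of the five invariant lines
      through the vertex; this is its value on the quadratic factor.\<close>
    have "(1 + g * 2) * (1 + (1 + g) * 2) = 5 + 2 * r" using gg rg by algebra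
    moreover have "5 + 2 * r \<noteq> 0" "r \<noteq> 0"
    proof -
      show "5 + 2 * r \<noteq> 0"
      proof
        assume "5 + 2 * r = 0"
        then have "(5::complex) = 0" using r5 by algebra
        then show False by simp
      qed
      show "r \<noteq> 0" using r5 by auto
    qed
    ultimately have k: "(1 + g * 2) * (1 + (1 + g) * 2) \<noteq> 0" "r \<noteq> 0" by (simp_all only: not_False_eq_True)
    have "1 * 2 * (1 - 2) * ((1 + g * 2) * (1 + (1 + g) * 2)) \<noteq> 0"
      unfolding mult_eq_0_iff[of _ "(1 + g * 2) * (1 + (1 + g) * 2)"] using k(1) by simp
    then show "coeff (lpoly (pair N ?e) ?e (1 *s axis 1 1 + 2 *s axis 2 1)) 5 \<noteq> 0"
      using k(2) unfolding l by (simp only: coeff_smult coeff_add coeff_monom) simp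
  qed
  moreover have "jf N ?e (axis 1 1) (axis 2 1) \<noteq> 0"
    unfolding jf_nform by (simp add: axis_def edge_x_def)
  ultimately show ?thesis unfolding radial_iff[OF e] using F0 by auto
qed

text \<open>On the side \<open>z = 0\<close> this point and that of
  \<open>radial_singularity_minus_1_minus_g\<close> are the zeros of the quadratic factor. There
  \<open>jf\<close> is alternating but nonzero, and the cubic coefficient of the polar in direction
  (0, 1, 1) is nonzero, so \<open>kap\<close> is 3.\<close>

lemma radial_singularity_minus_g: "radial_singularity N (vec.span {vector [1, (- g), 0]}) 1"
proof -
  let ?p = "vector [1, (- g), 0] :: complex^3"
  have p: "?p \<noteq> 0" by (simp add: vec3_eq_iff)
  have "(1 + g * (- g)) * (1 + (1 + g) * (- g)) = 0" using gg by algebra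
  then have F0: "N ?p = 0" unfolding vec3_eq_iff N_nth by simp
  have pow: "(- g)^2 = 1 - g" "(- g)^3 = 1 - 2 * g" "(- g)^4 = 2 - 3 * g"
    using gg by algebra+
  have E: "nedge_y r (- g) 0 1 = - 1 + 2 * g" "nedge_x r 0 1 (- g) = 1 - g" "nedge_x r 1 (- g) 0 = 1 - 2 * g" "nedge_y r 1 (- g) 0 = - 1 + g" "nedge_z r 1 (- g) = 0"
    unfolding edge_x_def edge_y_def edge_z_def power_one mult_1_left mult_1_right mult_zero_left mult_zero_right
      power_zero_numeral add_0_left add_0_right pow rg
    using gg by (algebra | simp)+
  have E0: "nedge_z r (- g) 0 = 0" "nedge_x r (- g) 0 1 = 0" "nedge_y r 0 1 (- g) = 0" "nedge_z r 0 1 = 0"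
    by (simp_all add: edge_x_def edge_y_def edge_z_def)
  have jf: "jf N ?p a w = a$1 * w$3 * (- 1 + 2 * g) + a$2 * w$3 * (1 - g) + a$3 * w$1 * (1 - 2 * g) + a$3 * w$2 * (- 1 + g)" for a w
    unfolding jf_nform vector_3 E E0 by algebra
  have "jf N ?p u u = 0" for u unfolding jf by algebra
  then have "3 \<le> kap N ?p" using kap_ge_3[OF p F0] by blast
  moreover have "kap N ?p \<le> 3"
  proof (rule kap_le[OF p])
    let ?u = "vector [0, 1, 1] :: complex^3"
    have "lpoly (pair N ?p) ?p ?u = [:0, 0, 0, (8 - 4 * g), 0, (- 6 - 2 * g), 0:]"
    proof (rule lpoly_eqI)
      fix s
      have v: "(?p + s *s ?u) $ 1 = 1" "(?p + s *s ?u) $ 2 = (- g) + s" "(?p + s *s ?u) $ 3 = s" by simp_all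
      have "poly [:0, 0, 0, (8 - 4 * g), 0, (- 6 - 2 * g), 0:] s = s^3 * ((8 - 4 * g) + (- 6 - 2 * g) * s^2)" by (simp add: power_numeral_reduce algebra_simps)
      also have "\<dots> = pair N ?p (?p + s *s ?u)"
        unfolding dot_3 N_nth v vector_3 unfolding rg using gg by algebra
      finally show "poly [:0, 0, 0, (8 - 4 * g), 0, (- 6 - 2 * g), 0:] s = pair N ?p (?p + s *s ?u)" .
    qed
    moreover have "(8 - 4 * g) \<noteq> 0"
    proof
      assume "(8 - 4 * g) = 0"
      then have "(80::complex) = 0" using gg by algebra
      then show False by simp
    qed
    ultimately show "coeff (lpoly (pair N ?p) ?p ?u) 3 \<noteq> 0" by (simp add: numeral_3_eq_3)
  qed
  moreover have "jf N ?p (axis 1 1) (axis 3 1) \<noteq> 0"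
  proof -
    have "- 1 + 2 * g \<noteq> 0"
    proof
      assume "- 1 + 2 * g = 0"
      then have "(1::complex) = 0" using gg by algebra
      then show False by simp
    qed
    then show ?thesis unfolding jf by (simp add: axis_def)
  qed
  ultimately show ?thesis unfolding radial_iff[OF p] using F0 by auto
qed

lemma radial_singularity_minus_1_minus_g: "radial_singularity N (vec.span {vector [1, (- 1 - g), 0]}) 1"
proof -
  let ?p = "vector [1, (- 1 - g), 0] :: complex^3"
  have p: "?p \<noteq> 0" by (simp add: vec3_eq_iff)
  have "(1 + g * (- 1 - g)) * (1 + (1 + g) * (- 1 - g)) = 0" using gg by algebra
  then have F0: "N ?p = 0" unfolding vec3_eq_iff N_nth by simp
  have pow: "(- 1 - g)^2 = 2 + g" "(- 1 - g)^3 = - 3 - 2 * g" "(- 1 - g)^4 = 5 + 3 * g"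
    using gg by algebra+
  have E: "nedge_y r (- 1 - g) 0 1 = 3 + 2 * g" "nedge_x r 0 1 (- 1 - g) = 2 + g" "nedge_x r 1 (- 1 - g) 0 = - 3 - 2 * g" "nedge_y r 1 (- 1 - g) 0 = - 2 - g" "nedge_z r 1 (- 1 - g) = 0"
    unfolding edge_x_def edge_y_def edge_z_def power_one mult_1_left mult_1_right mult_zero_left mult_zero_right
      power_zero_numeral add_0_left add_0_right pow rg
    using gg by (algebra | simp)+
  have E0: "nedge_z r (- 1 - g) 0 = 0" "nedge_x r (- 1 - g) 0 1 = 0" "nedge_y r 0 1 (- 1 - g) = 0" "nedge_z r 0 1 = 0"
    by (simp_all add: edge_x_def edge_y_def edge_z_def)
  have jf: "jf N ?p a w = a$1 * w$3 * (3 + 2 * g) + a$2 * w$3 * (2 + g) + a$3 * w$1 * (- 3 - 2 * g) + a$3 * w$2 * (- 2 - g)" for a w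
    unfolding jf_nform vector_3 E E0 by algebra
  have "jf N ?p u u = 0" for u unfolding jf by algebra
  then have "3 \<le> kap N ?p" using kap_ge_3[OF p F0] by blast
  moreover have "kap N ?p \<le> 3"
  proof (rule kap_le[OF p])
    let ?u = "vector [0, 1, 1] :: complex^3"
    have "lpoly (pair N ?p) ?p ?u = [:0, 0, 0, (- 14 - 8 * g), (28 + 16 * g), (- 14 - 8 * g), 0:]"
    proof (rule lpoly_eqI)
      fix s
      have v: "(?p + s *s ?u) $ 1 = 1" "(?p + s *s ?u) $ 2 = (- 1 - g) + s" "(?p + s *s ?u) $ 3 = s" by simp_all
      have "poly [:0, 0, 0, (- 14 - 8 * g), (28 + 16 * g), (- 14 - 8 * g), 0:] s = s^3 * ((- 14 - 8 * g) + (28 + 16 * g) * s + (- 14 - 8 * g) * s^2)" by (simp add: power_numeral_reduce algebra_simps)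
      also have "\<dots> = pair N ?p (?p + s *s ?u)"
        unfolding dot_3 N_nth v vector_3 unfolding rg using gg by algebra
      finally show "poly [:0, 0, 0, (- 14 - 8 * g), (28 + 16 * g), (- 14 - 8 * g), 0:] s = pair N ?p (?p + s *s ?u)" .
    qed
    moreover have "(- 14 - 8 * g) \<noteq> 0"
    proof
      assume "(- 14 - 8 * g) = 0"
      then have "(20::complex) = 0" using gg by algebra
      then show False by simp
    qed
    ultimately show "coeff (lpoly (pair N ?p) ?p ?u) 3 \<noteq> 0" by (simp add: numeral_3_eq_3)
  qed
  moreover have "jf N ?p (axis 1 1) (axis 3 1) \<noteq> 0"
  proof -
    have "3 + 2 * g \<noteq> 0"
    proof
      assume "3 + 2 * g = 0"
      then have "(1::complex) = 0" using gg by algebra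
      then show False by simp
    qed
    then show ?thesis unfolding jf by (simp add: axis_def)
  qed
  ultimately show ?thesis unfolding radial_iff[OF p] using F0 by auto
qed

end

section \<open>Transport of radial singularities along linear maps\<close>

lemma line_through_image: "(*v) M ` line_through p q = line_through ((*v) M ` p) ((*v) M ` q)"
  unfolding line_through_def by (metis image_Un matrix_vector_mul_linear_gen vec.linear_span_image)

text \<open>Takes the form as an argument, unlike \<open>three_radial\<close>, so that it can be
  compared across pullbacks.\<close>

definition two_radial :: "(complex^3 \<Rightarrow> complex^3) \<Rightarrow> (complex^3) set \<Rightarrow> (complex^3) set \<Rightarrow> bool" where
  "two_radial F p q \<longleftrightarrow> (\<exists>r1 r2. r1 \<noteq> r2 \<and> r1 \<subseteq> line_through p q \<and> r2 \<subseteq> line_through p q \<and>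
     radial_singularity F r1 1 \<and> radial_singularity F r2 1)"

lemma two_radial_image:
  assumes "invertible M" "two_radial (pullback M F) p q"
  shows "two_radial F ((*v) M ` p) ((*v) M ` q)"
proof -
  obtain r1 r2 where r: "r1 \<noteq> r2" "r1 \<subseteq> line_through p q" "r2 \<subseteq> line_through p q"
    "radial_singularity (pullback M F) r1 1" "radial_singularity (pullback M F) r2 1"
    using assms(2) unfolding two_radial_def by blast
  have inj: "inj ((*v) M)" using assms(1) by (metis inj_onI invertible_inv)
  have "(*v) M ` r1 \<noteq> (*v) M ` r2" using r(1) inj by (simp add: inj_image_eq_iff)
  then show ?thesis
    unfolding two_radial_def line_through_image[symmetric]
    using r radial_singularity_image[OF assms(1)] by (meson image_mono)
qed

context normal_form_foliation
begin

lemma two_radial_N: "two_radial N (vec.span {axis 1 1}) (vec.span {axis 2 1})"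
proof -
  have "vec.span {vector [1, t, 0]} \<subseteq> line_through (vec.span {axis 1 1}) (vec.span {axis 2 1 :: complex^3})" for t
  proof -
    have "vector [1, t, 0] = 1 *s axis 1 1 + t *s (axis 2 1 :: complex^3)" by (simp add: vec3_eq_iff axis_def)
    then show ?thesis unfolding line_through_span span1_subset in_span2 by blast
  qed
  moreover have "vec.span {vector [1, - g, 0]} \<noteq> vec.span {vector [1, - 1 - g, 0] :: complex^3}"
    by (subst span1_eq_iff) (simp_all add: vec3_eq_iff)
  ultimately show ?thesis unfolding two_radial_def using radial_singularity_minus_g radial_singularity_minus_1_minus_g by blast
qed

lemma three_radial_N:
  defines "m k \<equiv> vec.span {axis k 1 :: complex^3}"
  shows "distinct [m 1, m 2, m 3]" "\<forall>k. radial_singularity N (m k) 3"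
    "two_radial N (m 1) (m 2)" "two_radial N (m 1) (m 3)" "two_radial N (m 2) (m 3)"
proof -
  have c: "(*v) cyc ` m 1 = m 2" "(*v) cyc ` m 2 = m 3" "(*v) cyc ` m 3 = m 1"
    unfolding m_def image_span1 by (rule arg_cong[where f = "\<lambda>v. vec.span {v}"], simp add: cyc_mult vec3_eq_iff axis_def)+
  show "distinct [m 1, m 2, m 3]"
    unfolding m_def by (simp add: span1_eq_iff vec3_eq_iff axis_def)
  note rot = radial_singularity_image[OF invertible_cyc, of N, unfolded pullback_cyc_nform]
  have 3: "radial_singularity N (m 3) 3" unfolding m_def by (rule radial_singularity_axis_3)
  have 1: "radial_singularity N (m 1) 3" using rot[OF 3] unfolding c .
  have 2: "radial_singularity N (m 2) 3" using rot[OF 1] unfolding c .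
  show "\<forall>k. radial_singularity N (m k) 3" using 1 2 3 by (simp add: forall_3)
  note rot2 = two_radial_image[OF invertible_cyc, of N, unfolded pullback_cyc_nform]
  show 12: "two_radial N (m 1) (m 2)" unfolding m_def by (rule two_radial_N)
  show 23: "two_radial N (m 2) (m 3)" using rot2[OF 12] unfolding c .
  have "two_radial N (m 3) (m 1)" using rot2[OF 23] unfolding c .
  then show "two_radial N (m 1) (m 3)" unfolding two_radial_def line_through_def by (simp add: Un_commute)
qed

end

section \<open>Foliations conjugate to the Hilbert modular foliation\<close>

context quintic_foliation
begin

lemma conjugated_hilbert_imp:
  assumes "linearly_conjugated F hilbert_modular5"
  shows "card {l. invariant_line F l} = 15" "CS_set F = {c. c^2 + 3 * c + 1 = 0}" "\<exists>m1 m2 m3. three_radial m1 m2 m3"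
proof -
  define r where "r = complex_of_real (sqrt 5)"
  have r: "r^2 = 5" unfolding r_def by (simp flip: of_real_power)
  define g where "g = (r - 1) / 2"
  have rg: "r = 2 * g + 1" by (simp add: g_def field_simps)
  have "4 * (g^2 + g - 1) = (2 * g + 1)^2 - 5" by algebra
  also have "\<dots> = 0" using r rg by simp
  finally have gg: "g^2 + g = 1" by (simp only: mult_eq_0_iff) simp
  obtain M where M: "invertible M" "F = pullback M (hmod r)"
    using assms linearly_conjugated_iff[OF hf hmod_nform(1)[OF r]] unfolding hilbert_modular5_hmod r_def by blast
  obtain L where L: "invertible L" "hmod r = pullback L (nform r)" using hmod_nform(2)[OF r] by blast
  define K where "K = L ** M"
  have K: "invertible K" "F = pullback K (nform r)"
    using invertible_mult[OF L(1) M(1)] M(2) L(2) by (simp_all add: K_def pullback_pullback)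
  obtain K' where K': "invertible K'" "nform r = pullback K' F" using pullback_inverse[OF K(1), of "nform r"] K(2) by metis
  \<comment> \<open>The locale of the normal form asks for a finite singular set; injectivity of
    \<open>K'\<close> on points lets it be inherited from \<open>F\<close>.\<close>
  have inj: "inj ((*v) K')" using K'(1) by (metis inj_onI invertible_inv)
  have "(`) ((*v) K') ` {s. singular_point (nform r) s} \<subseteq> {s. singular_point F s}"
    using singular_point_image[OF K'(1), of F] K'(2) by auto
  then have "finite ((`) ((*v) K') ` {s. singular_point (nform r) s})" using fin finite_subset by blast
  moreover have "inj_on ((`) ((*v) K')) {s. singular_point (nform r) s}"
    using inj by (simp add: inj_on_def inj_image_eq_iff)
  ultimately have "finite {s. singular_point (nform r) s}" using finite_imageD by blast
  then interpret N: normal_form_foliation r g by unfold_locales (use gg rg hform_nform in auto)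
  show "card {l. invariant_line F l} = 15"
    using bij_betw_same_card[OF invariant_lines_pullback[OF K(1), of "nform r"]] N.card_invariant_lines K(2) by simp
  show "CS_set F = {c. c^2 + 3 * c + 1 = 0}"
    using CS_set_pullback[OF K(1), of "nform r"] N.CS_set_N K(2) by simp
  define m where "m k = (*v) K' ` vec.span {axis k 1 :: complex^3}" for k
  have "distinct [m 1, m 2, m 3]" using N.three_radial_N(1) inj by (simp add: m_def inj_image_eq_iff)
  moreover have "radial_singularity F (m k) 3" for k
    using radial_singularity_image[OF K'(1)] N.three_radial_N(2) K'(2) unfolding m_def by metis
  moreover note two_radial_image[OF K'(1), of F, folded K'(2), folded m_def]
  have "two_radial F (m 1) (m 2)" "two_radial F (m 1) (m 3)" "two_radial F (m 2) (m 3)"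
    unfolding m_def using two_radial_image[OF K'(1), of F, folded K'(2)] N.three_radial_N(3-5) by blast+
  ultimately have "three_radial (m 1) (m 2) (m 3)" unfolding three_radial_def two_radial_def by simp
  then show "\<exists>m1 m2 m3. three_radial m1 m2 m3" by blast
qed

end

lemma quadratic_roots:
  "{c. c^2 + 3 * c + 1 = 0} = {complex_of_real (- 3/2 + sqrt 5 / 2), complex_of_real (- 3/2 - sqrt 5 / 2)}"
proof -
  have "complex_of_real (sqrt 5)^2 = 5" by (simp flip: of_real_power)
  then have "c^2 + 3 * c + 1 = (c - complex_of_real (- 3/2 + sqrt 5 / 2)) * (c - complex_of_real (- 3/2 - sqrt 5 / 2))" for c
    by (simp add: algebra_simps power2_eq_square)
  then show ?thesis by auto
qed

theorem theoremF:
  fixes F :: "complex^3 \<Rightarrow> complex^3"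
  assumes "foliation F" and "has_degree F 5"
  shows
    "(linearly_conjugated F hilbert_modular5 \<longleftrightarrow>
        reduced_convex F \<and>
        CS_set F = {complex_of_real (- 3/2 + sqrt 5 / 2), complex_of_real (- 3/2 - sqrt 5 / 2)}) \<and>
     (linearly_conjugated F hilbert_modular5 \<longleftrightarrow>
        (\<exists>m1 m2 m3. distinct [m1, m2, m3] \<and>
           (\<forall>m\<in>{m1, m2, m3}. radial_singularity F m 3) \<and>
           (\<forall>(p, q)\<in>{(m1, m2), (m1, m3), (m2, m3)}.
              \<exists>r1 r2. r1 \<noteq> r2 \<and> r1 \<subseteq> line_through p q \<and> r2 \<subseteq> line_through p q \<and>
                radial_singularity F r1 1 \<and> radial_singularity F r2 1))) \<and>
     (\<forall>m1 m2 m3. distinct [m1, m2, m3] \<longrightarrow>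
        (\<forall>m\<in>{m1, m2, m3}. radial_singularity F m 3) \<longrightarrow>
        \<not> (\<exists>l. proj_line l \<and> m1 \<subseteq> l \<and> m2 \<subseteq> l \<and> m3 \<subseteq> l) \<and>
        invariant_line F (line_through m1 m2) \<and>
        invariant_line F (line_through m1 m3) \<and>
        invariant_line F (line_through m2 m3))"
proof -
  obtain n where n: "n \<ge> 1" "hform n F" and fin: "finite {s. singular_point F s}"
    using assms(1) unfolding foliation_hform by blast
  interpret p: projective_form F n by unfold_locales (use n in auto)
  \<comment> \<open>The coefficients have one degree more than the foliation.\<close>
  have n6: "n = 6" using p.has_degree_eq[OF assms(2)] by simp
  interpret quintic_foliation F by unfold_locales (use n fin n6 in auto)
  have d5: "d = 5" if "has_degree F d" for d using has_degree_eq[OF that] by simp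
  have rc: "reduced_convex F \<longleftrightarrow> card {l. invariant_line F l} = 15"
  proof
    assume "reduced_convex F"
    then obtain d where "has_degree F d" "card {l. invariant_line F l} = 3 * d" unfolding reduced_convex_def by blast
    then show "card {l. invariant_line F l} = 15" using d5 by simp
  next
    assume "card {l. invariant_line F l} = 15"
    then show "reduced_convex F" unfolding reduced_convex_def using assms(2) by (intro exI[of _ 5]) simp
  qed
  have 31: "linearly_conjugated F hilbert_modular5" if hyp: "three_radial m1 m2 m3" for m1 m2 m3
  proof -
    obtain r where r: "r^2 = 5" "linearly_conjugated F (nform r)" using three_radial_conjugated[OF hyp] by blast
    obtain M where M: "invertible M" "F = pullback M (nform r)" using r(2) linearly_conjugated_iff[OF hf hform_nform] by blast
    obtain K where K: "invertible K" "nform r = pullback K hilbert_modular5" using nform_hilbert[OF r(1)] by blast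
    have "complex_of_real (sqrt 5)^2 = 5" by (simp flip: of_real_power)
    then have h: "hform 6 hilbert_modular5" unfolding hilbert_modular5_hmod by (rule hmod_nform(1))
    show ?thesis unfolding linearly_conjugated_iff[OF hf h]
      using invertible_mult[OF K(1) M(1)] M(2) K(2) by (metis pullback_pullback)
  qed
  have "linearly_conjugated F hilbert_modular5 \<longleftrightarrow> (\<exists>m1 m2 m3. three_radial m1 m2 m3)"
    using 31 conjugated_hilbert_imp(3) by blast
  moreover have "linearly_conjugated F hilbert_modular5 \<longleftrightarrow>
        reduced_convex F \<and> CS_set F = {complex_of_real (- 3/2 + sqrt 5 / 2), complex_of_real (- 3/2 - sqrt 5 / 2)}"
    unfolding rc using 31 reduced_convex_imp_three_radial conjugated_hilbert_imp(1,2) quadratic_roots by metis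
  ultimately show ?thesis unfolding three_radial_def using three_radial_triangle by blast
qed

end
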